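(* Let $G$ be a finite group, $\Bbbk$ a field, $\Gamma\in\mathcal{RK}$ a Kitaev graph, $g$ the genus of the closed surface $\Sigma_\Gamma^{\mathrm{cl}}$, and $\varpi_1(\Sigma_\Gamma^{\mathrm{cl}})$ the canonical central extension of $\pi_1(\Sigma_\Gamma^{\mathrm{cl}})$ by $\mathbb Z$, with $x\in\varpi_1(\Sigma_\Gamma^{\mathrm{cl}})$ the image of $1\in\mathbb Z$. (i) The space $\Omega=\mathrm{span}_\Bbbk\mathrm{Hom}_{\mathrm{Grp}}(\varpi_1(\Sigma_\Gamma^{\mathrm{cl}}),G)$ is a left-left Yetter--Drinfeld module over $\Bbbk G$ via $\delta(f)=f(x)\otimes f$ and $(h\bullet f)(y)=hf(y)h^{-1}$, for $f\in\mathrm{Hom}_{\mathrm{Grp}}(\varpi_1(\Sigma_\Gamma^{\mathrm{cl}}),G)$, $h\in G$, $y\in\varpi_1(\Sigma_\Gamma^{\mathrm{cl}})$. (ii) If $M$ is an involutive Hopf bimodule over $\Bbbk G$ with $M^{\mathrm{coinv}}\cong\Bbbk^p_{\chi^{-1}}$ for a pair in involution $(p,\chi)$, then there is a linear isomorphism $$\mathrm{Prot}_{\Bbbk G}^M(\Gamma,\Bbbk_\varepsilon^1)\cong{}^{p^{2g}}\Omega\big/\big((\ker\chi^{-2g})\bullet{}^{p^{2g}}\Omega\big).$$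
   Context: **Notation.** $H:=\Bbbk G$, $\otimes=\otimes_\Bbbk$. $\mathrm{Gr}(H)=G$ and $\mathrm{Gr}(H^* )$ is the group of characters (algebra maps $H\to\Bbbk$) under convolution; powers $\chi^n$ are in this group; $\ker\chi^{-2g}\subset\Bbbk G$ is the kernel of the algebra map $\chi^{-2g}:\Bbbk G\to\Bbbk$. For a left-left Yetter--Drinfeld module $N$ (a left module and comodule with $(h\bullet n)_{|-1|}\otimes(h\bullet n)_{|0|}=h_{(1)}n_{|-1|}S(h_{(3)})\otimes h_{(2)}\bullet n_{|0|}$) and $q\in G$, ${}^qN=\{n\in N\mid\delta(n)=q\otimes n\}$. A pair in involution is $(p,\chi)\in\mathrm{Gr}(H)\times\mathrm{Gr}(H^* )$ with $S^2(h)=\chi^{-1}(h_{(1)})\chi(h_{(3)})ph_{(2)}p^{-1}$ for all $h$ (for $\Bbbk G$ this means $p$ is central). **Central extension.** If $g=0$, $\varpi_1:=\mathbb Z$ (and $x=1$). If $g\ge1$, $\varpi_1$ is the group with generators $\alpha_1,\beta_1,\dots,\alpha_g,\beta_g,x$ and relations $[\beta_g,\alpha_g^{-1}]\cdots[\beta_1,\alpha_1^{-1}]=x$ and $x$ commutes with all $\alpha_i,\beta_i$; here $[a,b]=aba^{-1}b^{-1}$. **Involutive Hopf bimodules.** An $H$-bimodule and $H$-bicomodule $M$ (coactions $m_{[-1]}\otimes m_{[0]}$, $m_{[0]}\otimes m_{[1]}$) with $$(h\triangleright m\triangleleft k)_{[-1]}\otimes(h\triangleright m\triangleleft k)_{[0]}\otimes(h\triangleright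 m\triangleleft k)_{[1]}=h_{(1)}m_{[-1]}k_{(1)}\otimes h_{(2)}\triangleright m_{[0]}\triangleleft k_{(2)}\otimes h_{(3)}m_{[1]}S^{-2}(k_{(3)}),$$ together with a linear involution $\psi:M\to M$ with $\psi(h\triangleright m)=\psi(m)\triangleleft S(h)$ and $\psi(m)_{[-1]}\otimes\psi(m)_{[0]}=S(m_{[1]})\otimes\psi(m_{[0]})$. $M^{\mathrm{coinv}}=\{m\mid m_{[-1]}\otimes m_{[0]}=1\otimes m\}$ is a right module via $m\bullet h=S(h_{(1)})\triangleright m\triangleleft h_{(2)}$ and a right comodule via restriction of the right coaction. **Kitaev graphs.** A ribbon graph $(\Gamma,\iota,\rho)$ is a finite set $\Gamma$ of half-edges with a fixed-point free involution $\iota$ and a permutation $\rho$. Vertices $V_\Gamma$, edges $E_\Gamma$, faces $F_\Gamma$ are the cycles (including those of length one) of $\rho$, $\iota$, $\rho^{-1}\iota$; $v_h,e_h,f_h$ are the ones containing $h\in\Gamma$. It is connected if $\langle\iota,\rho\rangle$ acts transitively. A Kitaev graph is a connected ribbon graph with a subset $C_\Gamma\subset\Gamma$ of cilia such that $C_\Gamma\to V_\Gamma$, $c\mapsto v_c$, and $C_\Gamma\to F_\Gamma$, $c\mapsto f_{\rho^{-1}(c)}$, are bijective, a distinguished cilium $\mathrm{pt}\in C_\Gamma$, and a total order on $\Gamma$ such that for $e_h\ne e_k$: $h<k$ iff $\iota(h)<\iota(k)$. The source of an edge $\{h,\iota(h)\}$ is $s=\min\{h,\iota(h)\}$, its target is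 $\iota(s)$. $\mathcal{RK}$ is the set of Kitaev graphs whose half-edges form a finite subset of $\mathbb N=\{1,2,\dots\}$ stable under $\kappa_\infty=(1\,2)(3\,4)\cdots$, with $\iota$ the restriction of $\kappa_\infty$ and order inherited from $\mathbb N$. $\Sigma_\Gamma$ is the compact oriented surface obtained from oriented discs (one per vertex, with disjoint boundary intervals labelled counterclockwise by its half-edges in cyclic order) by gluing a rectangle along its short sides to the intervals $h,\iota(h)$ for each edge, compatibly with orientations; $\Sigma_\Gamma^{\mathrm{cl}}$ is obtained by gluing a disc to each boundary component. Its genus is $1-\tfrac12(|V_\Gamma|-|E_\Gamma|+|F_\Gamma|)$. **Extended Hilbert space.** $\mathbb M_\Gamma=\bigotimes_{e\in E_\Gamma}M$. For a half-edge $h$, $a\in H$, $\alpha\in H^*$, $L_h(a),T_h(\alpha)$ are the identity on all factors except that of $e_h$, where $L_h(a)m=a\triangleright m$ if $h$ is a target, $m\triangleleft S(a)$ if $h$ is a source; $T_h(\alpha)m=\alpha(m_{[-1]})m_{[0]}$ if $h$ is a source, $\alpha(S(m_{[1]}))m_{[0]}$ if $h$ is a target. For a cilium $c$ let $v_c=[h_1,\dots,h_i]$ with $h_1=c$, $h_{r+1}=\rho(h_r)$, and $f_{\rho^{-1}(c)}=[k_1,\dots,k_j]$ with $k_1=\rho^{-1}(c)$, $k_{r+1}=\rho^{-1}\iota(k_r)$. $H_c=H$ acts by $a\bullet_cm=L_{h_i}(a_{(i)})\cdots L_{h_1}(a_{(1)})m$ and coacts by $\delta_c$ with $(\alpha\otimes\mathrm{id})\delta_c(m)=T_{k_j}(\alpha_{(1)})\cdots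 T_{k_1}(\alpha_{(j)})m$. These commute for different cilia and make $\mathbb M_\Gamma$ a left-left Yetter--Drinfeld module over $\mathbb H_\Gamma=\bigotimes_{c\in C_\Gamma}H_c$. **Protected space.** For a right-right module-comodule $X$ and left-left module-comodule $N$ over an algebra $A$ and coalgebra $C$ (no compatibility), $\mathrm{Bit}_A^C(X,N)$ is the image of $X\square_CN\hookrightarrow X\otimes N\twoheadrightarrow X\otimes_AN$. $\Bbbk^q_\zeta$ is $\Bbbk$ with right action $\lambda h=\zeta(h)\lambda$ and right coaction $\lambda\mapsto\lambda\otimes q$. $\mathrm{Prot}_H^M(\Gamma,X)=\mathrm{Bit}_{\mathbb H_\Gamma}^{\mathbb H_\Gamma}(\mathbb X_\Gamma,\mathbb M_\Gamma)$ with $\mathbb X_\Gamma=\bigotimes_{c\in C_\Gamma}Z_c$, $Z_{\mathrm{pt}}=X$, $Z_c=\Bbbk^{p^{-2}}_{\chi^2}$ for $c\ne\mathrm{pt}$, with factorwise structure. *)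

theory Defs
  imports
    HOL.Vector_Spaces
    "HOL-Algebra.Group"
    "HOL-Combinatorics.Orbits"
    "HOL-Combinatorics.Permutations"
    "HOL-Library.Function_Algebras"
    "HOL-Library.FuncSet"
begin

section \<open>Vector spaces and linear maps\<close>

text \<open>
  A vector space is a subspace \<open>carr V\<close> of a type that is a vector space as a whole under
  \<open>scl V\<close>.
\<close>

record ('k, 'v) vspace =
  carr :: "'v set"
  scl :: "'k \<Rightarrow> 'v \<Rightarrow> 'v"

definition vspace :: "('k::field, 'v::ab_group_add, 'z) vspace_scheme \<Rightarrow> bool" where
  "vspace V \<longleftrightarrow> vector_space (scl V) \<and> module.subspace (scl V) (carr V)"

definition lin ::
  "('k::field, 'v::ab_group_add, 'y) vspace_scheme \<Rightarrow>
   ('k, 'w::ab_group_add, 'z) vspace_scheme \<Rightarrow> ('v \<Rightarrow> 'w) \<Rightarrow> bool" where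
  "lin V W f \<longleftrightarrow> f \<in> carr V \<rightarrow> carr W \<and>
     (\<forall>x\<in>carr V. \<forall>y\<in>carr V. f (x + y) = f x + f y) \<and>
     (\<forall>c. \<forall>x\<in>carr V. f (scl V c x) = scl W c (f x))"

definition bilin ::
  "('k::field, 'u::ab_group_add, 'x) vspace_scheme \<Rightarrow>
   ('k, 'v::ab_group_add, 'y) vspace_scheme \<Rightarrow>
   ('k, 'w::ab_group_add, 'z) vspace_scheme \<Rightarrow> ('u \<Rightarrow> 'v \<Rightarrow> 'w) \<Rightarrow> bool" where
  "bilin U V W b \<longleftrightarrow>
     (\<forall>x\<in>carr U. lin V W (b x)) \<and> (\<forall>y\<in>carr V. lin U W (\<lambda>x. b x y))"

definition fscl :: "'k::times \<Rightarrow> ('a \<Rightarrow> 'k) \<Rightarrow> 'a \<Rightarrow> 'k" where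
  "fscl c f = (\<lambda>x. c * f x)"

definition ground :: "('k::field, 'k) vspace" where
  "ground = \<lparr>carr = UNIV, scl = (*)\<rparr>"

definition basis_fun :: "'a \<Rightarrow> 'a \<Rightarrow> 'k::zero_neq_one" where
  "basis_fun a = (\<lambda>x. if x = a then 1 else 0)"


section \<open>Tensor products\<close>

text \<open>
  The pure tensor \<open>x \<otimes> y\<close> is realised as evaluation at \<open>(x, y)\<close> on bilinear forms. Over a field,
  the span of these evaluations is the algebraic tensor product, also for infinite-dimensional
  factors. The forms are defined on the ambient types, which makes the tensor product of subspaces
  a subspace of the tensor product.
\<close>

type_synonym ('k, 'v, 'w) ten = "('v \<Rightarrow> 'w \<Rightarrow> 'k) \<Rightarrow> 'k"

definition bilinear_form ::
  "('k::field, 'v::ab_group_add, 'y) vspace_scheme \<Rightarrow>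
   ('k, 'w::ab_group_add, 'z) vspace_scheme \<Rightarrow> ('v \<Rightarrow> 'w \<Rightarrow> 'k) \<Rightarrow> bool" where
  "bilinear_form V W \<phi> \<longleftrightarrow>
     (\<forall>x x' y. \<phi> (x + x') y = \<phi> x y + \<phi> x' y) \<and>
     (\<forall>x y y'. \<phi> x (y + y') = \<phi> x y + \<phi> x y') \<and>
     (\<forall>c x y. \<phi> (scl V c x) y = c * \<phi> x y) \<and>
     (\<forall>c x y. \<phi> x (scl W c y) = c * \<phi> x y)"

definition tens ::
  "('k::field, 'v::ab_group_add, 'y) vspace_scheme \<Rightarrow>
   ('k, 'w::ab_group_add, 'z) vspace_scheme \<Rightarrow> 'v \<Rightarrow> 'w \<Rightarrow> ('k, 'v, 'w) ten" where
  "tens V W x y = (\<lambda>\<phi>. if bilinear_form V W \<phi> then \<phi> x y else 0)"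

definition tensor ::
  "('k::field, 'v::ab_group_add, 'y) vspace_scheme \<Rightarrow>
   ('k, 'w::ab_group_add, 'z) vspace_scheme \<Rightarrow> ('k, ('k, 'v, 'w) ten) vspace"
  (infixr \<open>\<boxtimes>\<close> 72) where
  "V \<boxtimes> W =
     \<lparr>carr = module.span fscl {tens V W x y | x y. x \<in> carr V \<and> y \<in> carr W}, scl = fscl\<rparr>"

text \<open>
  The linear map on \<open>V \<boxtimes> W\<close> induced by a bilinear map \<open>b\<close>; it is uniquely determined on the
  carrier of \<open>V \<boxtimes> W\<close>.
\<close>

definition tlift ::
  "('k::field, 'v::ab_group_add, 'x) vspace_scheme \<Rightarrow>
   ('k, 'w::ab_group_add, 'y) vspace_scheme \<Rightarrow>
   ('k, 'u::ab_group_add, 'z) vspace_scheme \<Rightarrow>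
   ('v \<Rightarrow> 'w \<Rightarrow> 'u) \<Rightarrow> ('k, 'v, 'w) ten \<Rightarrow> 'u" where
  "tlift V W U b = (SOME F. lin (V \<boxtimes> W) U F \<and>
     (\<forall>x\<in>carr V. \<forall>y\<in>carr W. F (tens V W x y) = b x y))"

definition tens3 ::
  "('k::field, 'u::ab_group_add, 'x) vspace_scheme \<Rightarrow>
   ('k, 'v::ab_group_add, 'y) vspace_scheme \<Rightarrow>
   ('k, 'w::ab_group_add, 'z) vspace_scheme \<Rightarrow>
   'u \<Rightarrow> 'v \<Rightarrow> 'w \<Rightarrow> ('k, 'u, ('k, 'v, 'w) ten) ten" where
  "tens3 U V W u v w = tens U (V \<boxtimes> W) u (tens V W v w)"

definition tlift3 ::
  "('k::field, 'u::ab_group_add, 'x) vspace_scheme \<Rightarrow>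
   ('k, 'v::ab_group_add, 'y) vspace_scheme \<Rightarrow>
   ('k, 'w::ab_group_add, 'z) vspace_scheme \<Rightarrow>
   ('k, 't::ab_group_add, 'r) vspace_scheme \<Rightarrow>
   ('u \<Rightarrow> 'v \<Rightarrow> 'w \<Rightarrow> 't) \<Rightarrow> ('k, 'u, ('k, 'v, 'w) ten) ten \<Rightarrow> 't" where
  "tlift3 U V W T b = tlift U (V \<boxtimes> W) T (\<lambda>u s. tlift V W T (b u) s)"

text \<open>Tensor products of finite families, with the same double-dual realisation.\<close>

type_synonym ('k, 'i, 'v) mten = "(('i \<Rightarrow> 'v) \<Rightarrow> 'k) \<Rightarrow> 'k"

definition multilinear_form ::
  "'i set \<Rightarrow> ('i \<Rightarrow> ('k::field, 'v::ab_group_add, 'z) vspace_scheme) \<Rightarrow>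
   (('i \<Rightarrow> 'v) \<Rightarrow> 'k) \<Rightarrow> bool" where
  "multilinear_form I V \<phi> \<longleftrightarrow>
     (\<forall>i\<in>I. \<forall>m x y. \<phi> (m(i := x + y)) = \<phi> (m(i := x)) + \<phi> (m(i := y))) \<and>
     (\<forall>i\<in>I. \<forall>m c x. \<phi> (m(i := scl (V i) c x)) = c * \<phi> (m(i := x)))"

definition mtens ::
  "'i set \<Rightarrow> ('i \<Rightarrow> ('k::field, 'v::ab_group_add, 'z) vspace_scheme) \<Rightarrow>
   ('i \<Rightarrow> 'v) \<Rightarrow> ('k, 'i, 'v) mten" where
  "mtens I V m = (\<lambda>\<phi>. if multilinear_form I V \<phi> then \<phi> (restrict m I) else 0)"

definition mtensor ::
  "'i set \<Rightarrow> ('i \<Rightarrow> ('k::field, 'v::ab_group_add, 'z) vspace_scheme) \<Rightarrow>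
   ('k, ('k, 'i, 'v) mten) vspace" where
  "mtensor I V =
     \<lparr>carr = module.span fscl (mtens I V ` (\<Pi>\<^sub>E i\<in>I. carr (V i))), scl = fscl\<rparr>"

definition mlift ::
  "'i set \<Rightarrow> ('i \<Rightarrow> ('k::field, 'v::ab_group_add, 'y) vspace_scheme) \<Rightarrow>
   ('k, 'u::ab_group_add, 'z) vspace_scheme \<Rightarrow>
   (('i \<Rightarrow> 'v) \<Rightarrow> 'u) \<Rightarrow> ('k, 'i, 'v) mten \<Rightarrow> 'u" where
  "mlift I V U b = (SOME F. lin (mtensor I V) U F \<and>
     (\<forall>m \<in> (\<Pi>\<^sub>E i\<in>I. carr (V i)). F (mtens I V m) = b m))"


section \<open>Hopf algebras and group algebras\<close>

record ('k, 'h) hopf = "('k, 'h) vspace" +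
  hmul :: "'h \<Rightarrow> 'h \<Rightarrow> 'h"
  hone :: "'h"
  hcomul :: "'h \<Rightarrow> ('k, 'h, 'h) ten"
  hcounit :: "'h \<Rightarrow> 'k"
  hanti :: "'h \<Rightarrow> 'h"

definition group_space :: "('g, 'b) monoid_scheme \<Rightarrow> ('k::field, 'g \<Rightarrow> 'k) vspace" where
  "group_space G = \<lparr>carr = {a. \<forall>x. x \<notin> carrier G \<longrightarrow> a x = 0}, scl = fscl\<rparr>"

text \<open>Only meaningful for finite \<open>G\<close>: elements are arbitrary functions on the carrier.\<close>

definition group_algebra :: "('g, 'b) monoid_scheme \<Rightarrow> ('k::field, 'g \<Rightarrow> 'k) hopf" where
  "group_algebra G =
     \<lparr>carr = carr (group_space G :: ('k, 'g \<Rightarrow> 'k) vspace), scl = fscl,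
      hmul = (\<lambda>a b x. if x \<in> carrier G
                then \<Sum>y\<in>carrier G. a y * b (inv\<^bsub>G\<^esub> y \<otimes>\<^bsub>G\<^esub> x) else 0),
      hone = basis_fun \<one>\<^bsub>G\<^esub>,
      hcomul = (\<lambda>a. \<Sum>x\<in>carrier G. fscl (a x)
                  (tens (group_space G) (group_space G) (basis_fun x) (basis_fun x))),
      hcounit = (\<lambda>a. \<Sum>x\<in>carrier G. a x),
      hanti = (\<lambda>a x. if x \<in> carrier G then a (inv\<^bsub>G\<^esub> x) else 0)\<rparr>"

text \<open>
  Sweedler notation: \<open>sw2 H V a (\<lambda>x y. b x y)\<close> is \<open>b(a\<^sub>(\<^sub>1\<^sub>), a\<^sub>(\<^sub>2\<^sub>))\<close>, with values in \<open>V\<close>, and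
  similarly \<open>sw3\<close>.
\<close>

definition sw2 ::
  "('k::field, 'h::ab_group_add) hopf \<Rightarrow> ('k, 'v::ab_group_add, 'z) vspace_scheme \<Rightarrow>
   'h \<Rightarrow> ('h \<Rightarrow> 'h \<Rightarrow> 'v) \<Rightarrow> 'v" where
  "sw2 H V a b = tlift H H V b (hcomul H a)"

definition sw3 ::
  "('k::field, 'h::ab_group_add) hopf \<Rightarrow> ('k, 'v::ab_group_add, 'z) vspace_scheme \<Rightarrow>
   'h \<Rightarrow> ('h \<Rightarrow> 'h \<Rightarrow> 'h \<Rightarrow> 'v) \<Rightarrow> 'v" where
  "sw3 H V a b = tlift3 H H H V b
     (sw2 H (H \<boxtimes> H \<boxtimes> H) a (\<lambda>x y. tens H (H \<boxtimes> H) x (hcomul H y)))"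

definition dual ::
  "('k::field, 'h::ab_group_add, 'z) vspace_scheme \<Rightarrow> ('k, 'h \<Rightarrow> 'k) vspace" where
  "dual H = \<lparr>carr = {\<alpha>. lin H ground \<alpha> \<and> (\<forall>x. x \<notin> carr H \<longrightarrow> \<alpha> x = 0)}, scl = fscl\<rparr>"

text \<open>
  The comultiplication of \<open>H\<^sup>*\<close>, for finite-dimensional \<open>H\<close>, is dual to the multiplication of
  \<open>H\<close>: \<open>\<alpha>\<^sub>(\<^sub>1\<^sub>)(h) \<alpha>\<^sub>(\<^sub>2\<^sub>)(k) = \<alpha>(hk)\<close>.
\<close>

definition dual_comul ::
  "('k::field, 'h::ab_group_add) hopf \<Rightarrow> ('h \<Rightarrow> 'k) \<Rightarrow> ('k, 'h \<Rightarrow> 'k, 'h \<Rightarrow> 'k) ten" where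
  "dual_comul H \<alpha> = (THE t. t \<in> carr (dual H \<boxtimes> dual H) \<and>
     (\<forall>h\<in>carr H. \<forall>k\<in>carr H.
        tlift (dual H) (dual H) ground (\<lambda>\<beta> \<gamma>. \<beta> h * \<gamma> k) t = \<alpha> (hmul H h k)))"

definition grouplikes :: "('k::field, 'h::ab_group_add) hopf \<Rightarrow> 'h monoid" where
  "grouplikes H =
     \<lparr>carrier = {a \<in> carr H. hcomul H a = tens H H a a \<and> hcounit H a = 1},
      monoid.mult = hmul H, one = hone H\<rparr>"

definition characters :: "('k::field, 'h::ab_group_add) hopf \<Rightarrow> ('h \<Rightarrow> 'k) monoid" where
  "characters H =
     \<lparr>carrier = {\<chi> \<in> carr (dual H). \<chi> (hone H) = 1 \<and>
                  (\<forall>a\<in>carr H. \<forall>b\<in>carr H. \<chi> (hmul H a b) = \<chi> a * \<chi> b)},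
      monoid.mult = (\<lambda>\<chi> \<eta> a. if a \<in> carr H then sw2 H ground a (\<lambda>x y. \<chi> x * \<eta> y) else 0),
      one = (\<lambda>a. if a \<in> carr H then hcounit H a else 0)\<rparr>"

definition pair_in_involution ::
  "('k::field, 'h::ab_group_add) hopf \<Rightarrow> 'h \<Rightarrow> ('h \<Rightarrow> 'k) \<Rightarrow> bool" where
  "pair_in_involution H p \<chi> \<longleftrightarrow>
     p \<in> carrier (grouplikes H) \<and> \<chi> \<in> carrier (characters H) \<and>
     (\<forall>h\<in>carr H. hanti H (hanti H h) =
        sw3 H H h (\<lambda>h1 h2 h3.
          scl H ((inv\<^bsub>characters H\<^esub> \<chi>) h1 * \<chi> h3)
            (hmul H (hmul H p h2) (inv\<^bsub>grouplikes H\<^esub> p))))"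


section \<open>Modules, comodules and Hopf bimodules\<close>

definition left_module ::
  "('k::field, 'h::ab_group_add) hopf \<Rightarrow> ('k, 'v::ab_group_add, 'z) vspace_scheme \<Rightarrow>
   ('h \<Rightarrow> 'v \<Rightarrow> 'v) \<Rightarrow> bool" where
  "left_module H V act \<longleftrightarrow> bilin H V V act \<and>
     (\<forall>v\<in>carr V. act (hone H) v = v) \<and>
     (\<forall>a\<in>carr H. \<forall>b\<in>carr H. \<forall>v\<in>carr V. act (hmul H a b) v = act a (act b v))"

definition right_module ::
  "('k::field, 'h::ab_group_add) hopf \<Rightarrow> ('k, 'v::ab_group_add, 'z) vspace_scheme \<Rightarrow>
   ('v \<Rightarrow> 'h \<Rightarrow> 'v) \<Rightarrow> bool" where
  "right_module H V act \<longleftrightarrow> bilin V H V act \<and>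
     (\<forall>v\<in>carr V. act v (hone H) = v) \<and>
     (\<forall>a\<in>carr H. \<forall>b\<in>carr H. \<forall>v\<in>carr V. act v (hmul H a b) = act (act v a) b)"

definition left_comodule ::
  "('k::field, 'h::ab_group_add) hopf \<Rightarrow> ('k, 'v::ab_group_add, 'z) vspace_scheme \<Rightarrow>
   ('v \<Rightarrow> ('k, 'h, 'v) ten) \<Rightarrow> bool" where
  "left_comodule H V \<delta> \<longleftrightarrow> lin V (H \<boxtimes> V) \<delta> \<and>
     (\<forall>v\<in>carr V.
        tlift H V (H \<boxtimes> H \<boxtimes> V) (\<lambda>a w. tens H (H \<boxtimes> V) a (\<delta> w)) (\<delta> v) =
        tlift H V (H \<boxtimes> H \<boxtimes> V)
          (\<lambda>a w. sw2 H (H \<boxtimes> H \<boxtimes> V) a (\<lambda>a1 a2. tens3 H H V a1 a2 w)) (\<delta> v) \<and>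
        tlift H V V (\<lambda>a w. scl V (hcounit H a) w) (\<delta> v) = v)"

definition right_comodule ::
  "('k::field, 'h::ab_group_add) hopf \<Rightarrow> ('k, 'v::ab_group_add, 'z) vspace_scheme \<Rightarrow>
   ('v \<Rightarrow> ('k, 'v, 'h) ten) \<Rightarrow> bool" where
  "right_comodule H V \<delta> \<longleftrightarrow> lin V (V \<boxtimes> H) \<delta> \<and>
     (\<forall>v\<in>carr V.
        tlift V H (V \<boxtimes> H \<boxtimes> H)
          (\<lambda>w b. tlift V H (V \<boxtimes> H \<boxtimes> H) (\<lambda>u a. tens3 V H H u a b) (\<delta> w)) (\<delta> v) =
        tlift V H (V \<boxtimes> H \<boxtimes> H) (\<lambda>w b. tens V (H \<boxtimes> H) w (hcomul H b)) (\<delta> v) \<and>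
        tlift V H V (\<lambda>w b. scl V (hcounit H b) w) (\<delta> v) = v)"

definition left_yetter_drinfeld ::
  "('k::field, 'h::ab_group_add) hopf \<Rightarrow> ('k, 'v::ab_group_add, 'z) vspace_scheme \<Rightarrow>
   ('h \<Rightarrow> 'v \<Rightarrow> 'v) \<Rightarrow> ('v \<Rightarrow> ('k, 'h, 'v) ten) \<Rightarrow> bool" where
  "left_yetter_drinfeld H V act \<delta> \<longleftrightarrow>
     vspace V \<and> left_module H V act \<and> left_comodule H V \<delta> \<and>
     (\<forall>h\<in>carr H. \<forall>v\<in>carr V. \<delta> (act h v) =
        sw3 H (H \<boxtimes> V) h (\<lambda>h1 h2 h3.
          tlift H V (H \<boxtimes> V)
            (\<lambda>a w. tens H V (hmul H (hmul H h1 a) (hanti H h3)) (act h2 w)) (\<delta> v)))"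

text \<open>The subspace \<open>\<^sup>qN = {n. \<delta>(n) = q \<otimes> n}\<close> of a left comodule.\<close>

definition homogeneous ::
  "('k::field, 'h::ab_group_add) hopf \<Rightarrow> ('k, 'v::ab_group_add, 'z) vspace_scheme \<Rightarrow>
   ('v \<Rightarrow> ('k, 'h, 'v) ten) \<Rightarrow> 'h \<Rightarrow> ('k, 'v) vspace" where
  "homogeneous H V \<delta> q = \<lparr>carr = {v \<in> carr V. \<delta> v = tens H V q v}, scl = scl V\<rparr>"

record ('k, 'h, 'm) bimod = "('k, 'm) vspace" +
  lact :: "'h \<Rightarrow> 'm \<Rightarrow> 'm"
  ract :: "'m \<Rightarrow> 'h \<Rightarrow> 'm"
  lcoact :: "'m \<Rightarrow> ('k, 'h, 'm) ten"
  rcoact :: "'m \<Rightarrow> ('k, 'm, 'h) ten"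

text \<open>\<open>m\<^sub>[\<^sub>-\<^sub>1\<^sub>] \<otimes> m\<^sub>[\<^sub>0\<^sub>] \<otimes> m\<^sub>[\<^sub>1\<^sub>]\<close> in \<open>H \<otimes> (M \<otimes> H)\<close>.\<close>

definition bicoact ::
  "('k::field, 'h::ab_group_add) hopf \<Rightarrow> ('k, 'h, 'm::ab_group_add) bimod \<Rightarrow>
   'm \<Rightarrow> ('k, 'h, ('k, 'm, 'h) ten) ten" where
  "bicoact H M m =
     tlift H M (H \<boxtimes> M \<boxtimes> H) (\<lambda>a n. tens H (M \<boxtimes> H) a (rcoact M n)) (lcoact M m)"

definition hopf_bimodule ::
  "('k::field, 'h::ab_group_add) hopf \<Rightarrow> ('k, 'h, 'm::ab_group_add) bimod \<Rightarrow> bool" where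
  "hopf_bimodule H M \<longleftrightarrow>
     vspace M \<and>
     left_module H M (lact M) \<and> right_module H M (ract M) \<and>
     (\<forall>a\<in>carr H. \<forall>b\<in>carr H. \<forall>m\<in>carr M.
        ract M (lact M a m) b = lact M a (ract M m b)) \<and>
     left_comodule H M (lcoact M) \<and> right_comodule H M (rcoact M) \<and>
     (\<forall>m\<in>carr M. bicoact H M m =
        tlift M H (H \<boxtimes> M \<boxtimes> H)
          (\<lambda>n b. tlift H M (H \<boxtimes> M \<boxtimes> H) (\<lambda>a n'. tens3 H M H a n' b) (lcoact M n))
          (rcoact M m)) \<and>
     (let S_inv = inv_into (carr H) (hanti H) in
      \<forall>h\<in>carr H. \<forall>k\<in>carr H. \<forall>m\<in>carr M.
        bicoact H M (ract M (lact M h m) k) =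
        sw3 H (H \<boxtimes> M \<boxtimes> H) h (\<lambda>h1 h2 h3.
        sw3 H (H \<boxtimes> M \<boxtimes> H) k (\<lambda>k1 k2 k3.
          tlift3 H M H (H \<boxtimes> M \<boxtimes> H)
            (\<lambda>a n b. tens3 H M H
               (hmul H (hmul H h1 a) k1)
               (ract M (lact M h2 n) k2)
               (hmul H (hmul H h3 b) (S_inv (S_inv k3))))
            (bicoact H M m))))"

definition involutive_hopf_bimodule ::
  "('k::field, 'h::ab_group_add) hopf \<Rightarrow> ('k, 'h, 'm::ab_group_add) bimod \<Rightarrow>
   ('m \<Rightarrow> 'm) \<Rightarrow> bool" where
  "involutive_hopf_bimodule H M \<psi> \<longleftrightarrow>
     hopf_bimodule H M \<and> lin M M \<psi> \<and>
     (\<forall>m\<in>carr M. \<psi> (\<psi> m) = m) \<and>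
     (\<forall>h\<in>carr H. \<forall>m\<in>carr M. \<psi> (lact M h m) = ract M (\<psi> m) (hanti H h)) \<and>
     (\<forall>m\<in>carr M. lcoact M (\<psi> m) =
        tlift M H (H \<boxtimes> M) (\<lambda>n b. tens H M (hanti H b) (\<psi> n)) (rcoact M m))"

text \<open>
  Right-right and left-left module-comodules over an algebra with elements of type \<open>'a\<close> and a
  coalgebra with elements of type \<open>'c\<close>.
\<close>

record ('k, 'a, 'c, 'v) rmc = "('k, 'v) vspace" +
  rmc_act :: "'v \<Rightarrow> 'a \<Rightarrow> 'v"
  rmc_coact :: "'v \<Rightarrow> ('k, 'v, 'c) ten"

record ('k, 'a, 'c, 'v) lmc = "('k, 'v) vspace" +
  lmc_act :: "'a \<Rightarrow> 'v \<Rightarrow> 'v"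
  lmc_coact :: "'v \<Rightarrow> ('k, 'c, 'v) ten"

definition rmc_isomorphic ::
  "('k::field, 'h::ab_group_add) hopf \<Rightarrow> ('k, 'h, 'h, 'v::ab_group_add) rmc \<Rightarrow>
   ('k, 'h, 'h, 'w::ab_group_add) rmc \<Rightarrow> bool" where
  "rmc_isomorphic H X Y \<longleftrightarrow>
     (\<exists>\<theta>. lin X Y \<theta> \<and> bij_betw \<theta> (carr X) (carr Y) \<and>
        (\<forall>x\<in>carr X. \<forall>h\<in>carr H. \<theta> (rmc_act X x h) = rmc_act Y (\<theta> x) h) \<and>
        (\<forall>x\<in>carr X. rmc_coact Y (\<theta> x) =
           tlift X H (Y \<boxtimes> H) (\<lambda>x' h. tens Y H (\<theta> x') h) (rmc_coact X x)))"

definition coinvariants ::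
  "('k::field, 'h::ab_group_add) hopf \<Rightarrow> ('k, 'h, 'm::ab_group_add) bimod \<Rightarrow>
   ('k, 'h, 'h, 'm) rmc" where
  "coinvariants H M =
     \<lparr>carr = {m \<in> carr M. lcoact M m = tens H M (hone H) m}, scl = scl M,
      rmc_act = (\<lambda>m h. sw2 H M h (\<lambda>h1 h2. ract M (lact M (hanti H h1) m) h2)),
      rmc_coact = rcoact M\<rparr>"

text \<open>\<open>\<k>\<^sup>q\<^sub>\<zeta>\<close>: the ground field with action \<open>\<lambda>h = \<zeta>(h)\<lambda>\<close> and coaction \<open>\<lambda> \<mapsto> \<lambda> \<otimes> q\<close>.\<close>

definition line ::
  "('k::field, 'h::ab_group_add) hopf \<Rightarrow> 'h \<Rightarrow> ('h \<Rightarrow> 'k) \<Rightarrow> ('k, 'h, 'h, 'k) rmc" where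
  "line H q \<zeta> =
     \<lparr>carr = UNIV, scl = (*), rmc_act = (\<lambda>l h. \<zeta> h * l),
      rmc_coact = (\<lambda>l. tens ground H l q)\<rparr>"


section \<open>Quotient spaces and bitensor products\<close>

record ('k, 'q) lin_space =
  ls_carr :: "'q set"
  ls_add :: "'q \<Rightarrow> 'q \<Rightarrow> 'q"
  ls_scl :: "'k \<Rightarrow> 'q \<Rightarrow> 'q"

text \<open>
  The image of \<open>V\<close> in the quotient of the ambient space by its subspace \<open>U\<close>, as a space of cosets
  of \<open>U\<close>; this is \<open>V/U\<close> if \<open>U\<close> is contained in \<open>V\<close>.
\<close>

definition quotient_image ::
  "('k::field, 'v::ab_group_add, 'z) vspace_scheme \<Rightarrow> 'v set \<Rightarrow> ('k, 'v set) lin_space" where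
  "quotient_image V U =
     \<lparr>ls_carr = (\<lambda>v. {v + u | u. u \<in> U}) ` carr V,
      ls_add = (\<lambda>A B. {a + b | a b. a \<in> A \<and> b \<in> B}),
      ls_scl = (\<lambda>c A. {scl V c a + u | a u. a \<in> A \<and> u \<in> U})\<rparr>"

definition lin_isomorphic :: "('k, 'p) lin_space \<Rightarrow> ('k, 'q) lin_space \<Rightarrow> bool" where
  "lin_isomorphic P Q \<longleftrightarrow>
     (\<exists>\<Phi>. bij_betw \<Phi> (ls_carr P) (ls_carr Q) \<and>
        (\<forall>x\<in>ls_carr P. \<forall>y\<in>ls_carr P. \<Phi> (ls_add P x y) = ls_add Q (\<Phi> x) (\<Phi> y)) \<and>
        (\<forall>c. \<forall>x\<in>ls_carr P. \<Phi> (ls_scl P c x) = ls_scl Q c (\<Phi> x)))"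

definition cotensor ::
  "('k::field, 'c::ab_group_add, 'z) vspace_scheme \<Rightarrow>
   ('k, 'a::ab_group_add, 'c, 'x::ab_group_add) rmc \<Rightarrow>
   ('k, 'a, 'c, 'n::ab_group_add) lmc \<Rightarrow> ('k, ('k, 'x, 'n) ten) vspace" where
  "cotensor C X N =
     \<lparr>carr = {t \<in> carr (X \<boxtimes> N).
        tlift X N (X \<boxtimes> C \<boxtimes> N)
          (\<lambda>x n. tlift X C (X \<boxtimes> C \<boxtimes> N) (\<lambda>x' c. tens3 X C N x' c n) (rmc_coact X x)) t =
        tlift X N (X \<boxtimes> C \<boxtimes> N) (\<lambda>x n. tens X (C \<boxtimes> N) x (lmc_coact N n)) t},
      scl = fscl\<rparr>"

text \<open>The kernel of \<open>X \<otimes> N \<rightarrow> X \<otimes>\<^sub>A N\<close>.\<close>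

definition balancing ::
  "('k::field, 'a::ab_group_add, 'z) vspace_scheme \<Rightarrow>
   ('k, 'a, 'c::ab_group_add, 'x::ab_group_add) rmc \<Rightarrow>
   ('k, 'a, 'c, 'n::ab_group_add) lmc \<Rightarrow> ('k, 'x, 'n) ten set" where
  "balancing A X N = module.span fscl
     {tens X N (rmc_act X x a) n - tens X N x (lmc_act N a n) | x a n.
        x \<in> carr X \<and> a \<in> carr A \<and> n \<in> carr N}"

definition bitensor ::
  "('k::field, 'a::ab_group_add, 'y) vspace_scheme \<Rightarrow>
   ('k, 'c::ab_group_add, 'z) vspace_scheme \<Rightarrow>
   ('k, 'a, 'c, 'x::ab_group_add) rmc \<Rightarrow>
   ('k, 'a, 'c, 'n::ab_group_add) lmc \<Rightarrow> ('k, ('k, 'x, 'n) ten set) lin_space" where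
  "bitensor A C X N = quotient_image (cotensor C X N) (balancing A X N)"


section \<open>Kitaev graphs\<close>

record 'h ribbon =
  half_edges :: "'h set"
  iota :: "'h \<Rightarrow> 'h"
  rho :: "'h \<Rightarrow> 'h"

record 'h kitaev = "'h ribbon" +
  cilia :: "'h set"
  pt :: "'h"

definition ribbon_graph :: "('h, 'z) ribbon_scheme \<Rightarrow> bool" where
  "ribbon_graph \<Gamma> \<longleftrightarrow>
     finite (half_edges \<Gamma>) \<and>
     iota \<Gamma> permutes half_edges \<Gamma> \<and>
     (\<forall>h\<in>half_edges \<Gamma>. iota \<Gamma> (iota \<Gamma> h) = h \<and> iota \<Gamma> h \<noteq> h) \<and>
     rho \<Gamma> permutes half_edges \<Gamma>"

definition rho_inv :: "('h, 'z) ribbon_scheme \<Rightarrow> 'h \<Rightarrow> 'h" where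
  "rho_inv \<Gamma> = inv_into UNIV (rho \<Gamma>)"

definition face_perm :: "('h, 'z) ribbon_scheme \<Rightarrow> 'h \<Rightarrow> 'h" where
  "face_perm \<Gamma> = rho_inv \<Gamma> \<circ> iota \<Gamma>"

definition vertex_of :: "('h, 'z) ribbon_scheme \<Rightarrow> 'h \<Rightarrow> 'h set" where
  "vertex_of \<Gamma> h = orbit (rho \<Gamma>) h"

definition edge_of :: "('h, 'z) ribbon_scheme \<Rightarrow> 'h \<Rightarrow> 'h set" where
  "edge_of \<Gamma> h = orbit (iota \<Gamma>) h"

definition face_of :: "('h, 'z) ribbon_scheme \<Rightarrow> 'h \<Rightarrow> 'h set" where
  "face_of \<Gamma> h = orbit (face_perm \<Gamma>) h"

definition vertices :: "('h, 'z) ribbon_scheme \<Rightarrow> 'h set set" where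
  "vertices \<Gamma> = vertex_of \<Gamma> ` half_edges \<Gamma>"

definition edges :: "('h, 'z) ribbon_scheme \<Rightarrow> 'h set set" where
  "edges \<Gamma> = edge_of \<Gamma> ` half_edges \<Gamma>"

definition faces :: "('h, 'z) ribbon_scheme \<Rightarrow> 'h set set" where
  "faces \<Gamma> = face_of \<Gamma> ` half_edges \<Gamma>"

text \<open>
  Transitivity of the group generated by \<open>\<iota>\<close> and \<open>\<rho>\<close>: any two half-edges are related by a word in
  \<open>\<iota>\<close>, \<open>\<rho>\<close> and their inverses.
\<close>

definition connected_ribbon :: "('h, 'z) ribbon_scheme \<Rightarrow> bool" where
  "connected_ribbon \<Gamma> \<longleftrightarrow>
     (let R = {(h, iota \<Gamma> h) | h. h \<in> half_edges \<Gamma>} \<union> {(h, rho \<Gamma> h) | h. h \<in> half_edges \<Gamma>}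
      in \<forall>h\<in>half_edges \<Gamma>. \<forall>k\<in>half_edges \<Gamma>. (h, k) \<in> (R \<union> R\<inverse>)\<^sup>*)"

text \<open>The total order on the half-edges is the one of the type \<open>'h\<close>.\<close>

definition kitaev_graph :: "('h::linorder) kitaev \<Rightarrow> bool" where
  "kitaev_graph \<Gamma> \<longleftrightarrow>
     ribbon_graph \<Gamma> \<and> connected_ribbon \<Gamma> \<and>
     cilia \<Gamma> \<subseteq> half_edges \<Gamma> \<and>
     bij_betw (vertex_of \<Gamma>) (cilia \<Gamma>) (vertices \<Gamma>) \<and>
     bij_betw (\<lambda>c. face_of \<Gamma> (rho_inv \<Gamma> c)) (cilia \<Gamma>) (faces \<Gamma>) \<and>
     pt \<Gamma> \<in> cilia \<Gamma> \<and>
     (\<forall>h\<in>half_edges \<Gamma>. \<forall>k\<in>half_edges \<Gamma>. edge_of \<Gamma> h \<noteq> edge_of \<Gamma> k \<longrightarrow>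
        (h < k \<longleftrightarrow> iota \<Gamma> h < iota \<Gamma> k))"

text \<open>\<open>(1 2)(3 4)\<dots>\<close>; the value at \<open>0\<close> is irrelevant, half-edges being positive.\<close>

definition kappa_inf :: "nat \<Rightarrow> nat" where
  "kappa_inf h = (if odd h then h + 1 else h - 1)"

definition RK :: "nat kitaev set" where
  "RK = {\<Gamma>. kitaev_graph \<Gamma> \<and> half_edges \<Gamma> \<subseteq> {1..} \<and>
     kappa_inf ` half_edges \<Gamma> \<subseteq> half_edges \<Gamma> \<and>
     (\<forall>h\<in>half_edges \<Gamma>. iota \<Gamma> h = kappa_inf h)}"

text \<open>
  \<open>g = 1 - (|V| - |E| + |F|)/2\<close>; for a connected ribbon graph this is a nonnegative integer, so that
  neither the division nor the conversion truncates.
\<close>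

definition genus :: "('h, 'z) ribbon_scheme \<Rightarrow> nat" where
  "genus \<Gamma> = nat (1 - (int (card (vertices \<Gamma>)) - int (card (edges \<Gamma>)) + int (card (faces \<Gamma>))) div 2)"

definition cycle_list :: "('a \<Rightarrow> 'a) \<Rightarrow> 'a \<Rightarrow> 'a list" where
  "cycle_list f a = map (\<lambda>r. (f ^^ r) a) [0..<card (orbit f a)]"


section \<open>Extended Hilbert space and protected space\<close>

definition ext_space ::
  "('h, 'z) ribbon_scheme \<Rightarrow> ('k::field, 'a, 'm::ab_group_add) bimod \<Rightarrow>
   ('k, ('k, 'h set, 'm) mten) vspace" where
  "ext_space \<Gamma> M = mtensor (edges \<Gamma>) (\<lambda>_. M)"

definition on_factor ::
  "('h, 'z) ribbon_scheme \<Rightarrow> ('k::field, 'a, 'm::ab_group_add) bimod \<Rightarrow>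
   'h set \<Rightarrow> ('m \<Rightarrow> 'm) \<Rightarrow> ('k, 'h set, 'm) mten \<Rightarrow> ('k, 'h set, 'm) mten" where
  "on_factor \<Gamma> M e T = mlift (edges \<Gamma>) (\<lambda>_. M) (ext_space \<Gamma> M)
     (\<lambda>m. mtens (edges \<Gamma>) (\<lambda>_. M) (m(e := T (m e))))"

definition is_source :: "('h::linorder, 'z) ribbon_scheme \<Rightarrow> 'h \<Rightarrow> bool" where
  "is_source \<Gamma> h \<longleftrightarrow> h = min h (iota \<Gamma> h)"

definition L_op ::
  "('k::field, 'a::ab_group_add) hopf \<Rightarrow> ('k, 'a, 'm::ab_group_add) bimod \<Rightarrow>
   ('h::linorder, 'z) ribbon_scheme \<Rightarrow> 'h \<Rightarrow> 'a \<Rightarrow>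
   ('k, 'h set, 'm) mten \<Rightarrow> ('k, 'h set, 'm) mten" where
  "L_op H M \<Gamma> h a = on_factor \<Gamma> M (edge_of \<Gamma> h)
     (\<lambda>m. if is_source \<Gamma> h then ract M m (hanti H a) else lact M a m)"

definition T_op ::
  "('k::field, 'a::ab_group_add) hopf \<Rightarrow> ('k, 'a, 'm::ab_group_add) bimod \<Rightarrow>
   ('h::linorder, 'z) ribbon_scheme \<Rightarrow> 'h \<Rightarrow> ('a \<Rightarrow> 'k) \<Rightarrow>
   ('k, 'h set, 'm) mten \<Rightarrow> ('k, 'h set, 'm) mten" where
  "T_op H M \<Gamma> h \<alpha> = on_factor \<Gamma> M (edge_of \<Gamma> h)
     (\<lambda>m. if is_source \<Gamma> h
        then tlift H M M (\<lambda>a n. scl M (\<alpha> a) n) (lcoact M m)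
        else tlift M H M (\<lambda>n b. scl M (\<alpha> (hanti H b)) n) (rcoact M m))"

text \<open>\<open>L_list H W L [h\<^sub>1,\<dots>,h\<^sub>i] a = L\<^sub>h\<^sub>i(a\<^sub>(\<^sub>i\<^sub>)) \<dots> L\<^sub>h\<^sub>1(a\<^sub>(\<^sub>1\<^sub>))\<close> as operator on \<open>W\<close>.\<close>

fun L_list ::
  "('k::field, 'a::ab_group_add) hopf \<Rightarrow> ('k, 'w::ab_group_add) vspace \<Rightarrow>
   ('h \<Rightarrow> 'a \<Rightarrow> 'w \<Rightarrow> 'w) \<Rightarrow> 'h list \<Rightarrow> 'a \<Rightarrow> 'w \<Rightarrow> 'w" where
  "L_list H W L [] a w = scl W (hcounit H a) w"
| "L_list H W L (h # hs) a w = sw2 H W a (\<lambda>a1 a2. L_list H W L hs a2 (L h a1 w))"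

text \<open>\<open>T_list H W T [k\<^sub>1,\<dots>,k\<^sub>j] \<alpha> = T\<^sub>k\<^sub>j(\<alpha>\<^sub>(\<^sub>1\<^sub>)) \<dots> T\<^sub>k\<^sub>1(\<alpha>\<^sub>(\<^sub>j\<^sub>))\<close> as operator on \<open>W\<close>.\<close>

fun T_list ::
  "('k::field, 'a::ab_group_add) hopf \<Rightarrow> ('k, 'w::ab_group_add) vspace \<Rightarrow>
   ('h \<Rightarrow> ('a \<Rightarrow> 'k) \<Rightarrow> 'w \<Rightarrow> 'w) \<Rightarrow> 'h list \<Rightarrow> ('a \<Rightarrow> 'k) \<Rightarrow> 'w \<Rightarrow> 'w" where
  "T_list H W T [] \<alpha> w = scl W (\<alpha> (hone H)) w"
| "T_list H W T (k # ks) \<alpha> w =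
     tlift (dual H) (dual H) W (\<lambda>\<beta> \<gamma>. T_list H W T ks \<beta> (T k \<gamma> w)) (dual_comul H \<alpha>)"

definition cilium_act ::
  "('k::field, 'a::ab_group_add) hopf \<Rightarrow> ('k, 'a, 'm::ab_group_add) bimod \<Rightarrow>
   ('h::linorder) kitaev \<Rightarrow> 'h \<Rightarrow> 'a \<Rightarrow> ('k, 'h set, 'm) mten \<Rightarrow> ('k, 'h set, 'm) mten" where
  "cilium_act H M \<Gamma> c = L_list H (ext_space \<Gamma> M) (L_op H M \<Gamma>) (cycle_list (rho \<Gamma>) c)"

text \<open>\<open>(\<alpha> \<otimes> id) \<circ> \<delta>\<^sub>c\<close>.\<close>

definition cilium_coact ::
  "('k::field, 'a::ab_group_add) hopf \<Rightarrow> ('k, 'a, 'm::ab_group_add) bimod \<Rightarrow>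
   ('h::linorder) kitaev \<Rightarrow> 'h \<Rightarrow> ('a \<Rightarrow> 'k) \<Rightarrow>
   ('k, 'h set, 'm) mten \<Rightarrow> ('k, 'h set, 'm) mten" where
  "cilium_coact H M \<Gamma> c = T_list H (ext_space \<Gamma> M) (T_op H M \<Gamma>)
     (cycle_list (face_perm \<Gamma>) (rho_inv \<Gamma> c))"

definition graph_hopf ::
  "('k::field, 'a::ab_group_add) hopf \<Rightarrow> 'h kitaev \<Rightarrow> ('k, ('k, 'h, 'a) mten) vspace" where
  "graph_hopf H \<Gamma> = mtensor (cilia \<Gamma>) (\<lambda>_. H)"

text \<open>
  The joint module and comodule structure of \<open>ext_space \<Gamma> M\<close> over \<open>graph_hopf H \<Gamma>\<close>. Operators for
  different cilia commute; they are composed in the order of the half-edges. The coaction \<open>\<delta>\<close> is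
  characterised by \<open>((\<Otimes>\<^sub>c \<alpha>\<^sub>c) \<otimes> id) \<circ> \<delta> = \<Prod>\<^sub>c (\<alpha>\<^sub>c \<otimes> id) \<circ> \<delta>\<^sub>c\<close> for all families \<open>\<alpha>\<^sub>c\<close> in \<open>H\<^sup>*\<close>.
\<close>

definition graph_lmc ::
  "('k::field, 'a::ab_group_add) hopf \<Rightarrow> ('k, 'a, 'm::ab_group_add) bimod \<Rightarrow>
   ('h::linorder) kitaev \<Rightarrow>
   ('k, ('k, 'h, 'a) mten, ('k, 'h, 'a) mten, ('k, 'h set, 'm) mten) lmc" where
  "graph_lmc H M \<Gamma> =
     (let C = cilia \<Gamma>; W = ext_space \<Gamma> M; HG = graph_hopf H \<Gamma> in
      \<lparr>carr = carr W, scl = scl W,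
       lmc_act = (\<lambda>A w. mlift C (\<lambda>_. H) W
          (\<lambda>a. foldr (\<lambda>c. cilium_act H M \<Gamma> c (a c)) (sorted_list_of_set C) w) A),
       lmc_coact = (\<lambda>w. THE t. t \<in> carr (HG \<boxtimes> W) \<and>
          (\<forall>\<alpha> \<in> (\<Pi>\<^sub>E c\<in>C. carr (dual H)).
             tlift HG W W
               (\<lambda>A w'. scl W (mlift C (\<lambda>_. H) ground (\<lambda>a. \<Prod>c\<in>C. \<alpha> c (a c)) A) w') t =
             foldr (\<lambda>c. cilium_coact H M \<Gamma> c (\<alpha> c)) (sorted_list_of_set C) w))\<rparr>)"

text \<open>The canonical map \<open>\<Otimes>\<^sub>c (X\<^sub>c \<otimes> H) \<rightarrow> (\<Otimes>\<^sub>c X\<^sub>c) \<otimes> (\<Otimes>\<^sub>c H)\<close>.\<close>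

definition shuffle ::
  "'i set \<Rightarrow> ('k::field, 'a::ab_group_add) hopf \<Rightarrow>
   ('i \<Rightarrow> ('k, 'a, 'a, 'x::ab_group_add) rmc) \<Rightarrow>
   ('k, 'i, ('k, 'x, 'a) ten) mten \<Rightarrow> ('k, ('k, 'i, 'x) mten, ('k, 'i, 'a) mten) ten" where
  "shuffle C H X = (SOME F.
     lin (mtensor C (\<lambda>c. X c \<boxtimes> H)) (mtensor C X \<boxtimes> mtensor C (\<lambda>_. H)) F \<and>
     (\<forall>x \<in> (\<Pi>\<^sub>E c\<in>C. carr (X c)). \<forall>h \<in> (\<Pi>\<^sub>E c\<in>C. carr H).
        F (mtens C (\<lambda>c. X c \<boxtimes> H) (\<lambda>c. tens (X c) H (x c) (h c))) =
        tens (mtensor C X) (mtensor C (\<lambda>_. H)) (mtens C X x) (mtens C (\<lambda>_. H) h)))"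

definition rmc_tensor ::
  "'i set \<Rightarrow> ('k::field, 'a::ab_group_add) hopf \<Rightarrow>
   ('i \<Rightarrow> ('k, 'a, 'a, 'x::ab_group_add) rmc) \<Rightarrow>
   ('k, ('k, 'i, 'a) mten, ('k, 'i, 'a) mten, ('k, 'i, 'x) mten) rmc" where
  "rmc_tensor C H X =
     \<lparr>carr = carr (mtensor C X), scl = scl (mtensor C X),
      rmc_act = (\<lambda>t A.
        mlift C X (mtensor C X)
          (\<lambda>x. mlift C (\<lambda>_. H) (mtensor C X)
             (\<lambda>a. mtens C X (\<lambda>c. rmc_act (X c) (x c) (a c))) A) t),
      rmc_coact =
        mlift C X (mtensor C X \<boxtimes> mtensor C (\<lambda>_. H))
          (\<lambda>x. shuffle C H X (mtens C (\<lambda>c. X c \<boxtimes> H) (\<lambda>c. rmc_coact (X c) (x c))))\<rparr>"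

definition protected_space ::
  "('k::field, 'a::ab_group_add) hopf \<Rightarrow> ('k, 'a, 'm::ab_group_add) bimod \<Rightarrow>
   'a \<Rightarrow> ('a \<Rightarrow> 'k) \<Rightarrow> ('h::linorder) kitaev \<Rightarrow> ('k, 'a, 'a, 'k) rmc \<Rightarrow>
   ('k, ('k, ('k, 'h, 'k) mten, ('k, 'h set, 'm) mten) ten set) lin_space" where
  "protected_space H M p \<chi> \<Gamma> X =
     bitensor (graph_hopf H \<Gamma>) (graph_hopf H \<Gamma>)
       (rmc_tensor (cilia \<Gamma>) H
          (\<lambda>c. if c = pt \<Gamma> then X
               else line H (p [^]\<^bsub>grouplikes H\<^esub> (- 2 :: int)) (\<chi> [^]\<^bsub>characters H\<^esub> (2 :: int))))
       (graph_lmc H M \<Gamma>)"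


section \<open>The central extension of the surface group\<close>

text \<open>
  Groups given by generators and relators: words in letters \<open>(s, True)\<close> for \<open>s\<close> and
  \<open>(s, False)\<close> for the inverse of \<open>s\<close>, modulo the congruence generated by free cancellation
  and the relators.
\<close>

type_synonym 's word = "('s \<times> bool) list"

definition words :: "'s set \<Rightarrow> 's word set" where
  "words S = lists (S \<times> UNIV)"

inductive word_eq :: "'s set \<Rightarrow> 's word set \<Rightarrow> 's word \<Rightarrow> 's word \<Rightarrow> bool"
  for S :: "'s set" and R :: "'s word set" where
  refl: "u \<in> words S \<Longrightarrow> word_eq S R u u"
| sym: "word_eq S R u v \<Longrightarrow> word_eq S R v u"
| trans: "word_eq S R u v \<Longrightarrow> word_eq S R v w \<Longrightarrow> word_eq S R u w"
| cancel: "u \<in> words S \<Longrightarrow> v \<in> words S \<Longrightarrow> s \<in> S \<Longrightarrow>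
    word_eq S R (u @ [(s, b), (s, \<not> b)] @ v) (u @ v)"
| relator: "u \<in> words S \<Longrightarrow> v \<in> words S \<Longrightarrow> r \<in> R \<Longrightarrow> r \<in> words S \<Longrightarrow>
    word_eq S R (u @ r @ v) (u @ v)"

definition word_class :: "'s set \<Rightarrow> 's word set \<Rightarrow> 's word \<Rightarrow> 's word set" where
  "word_class S R u = {v. word_eq S R u v}"

definition presented_group :: "'s set \<Rightarrow> 's word set \<Rightarrow> 's word set monoid" where
  "presented_group S R =
     \<lparr>carrier = word_class S R ` words S,
      monoid.mult = (\<lambda>A B. \<Union>u\<in>A. \<Union>v\<in>B. word_class S R (u @ v)),
      one = word_class S R []\<rparr>"

datatype surface_gen = Alpha nat | Beta nat | Central

definition surface_gens :: "nat \<Rightarrow> surface_gen set" where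
  "surface_gens g = Alpha ` {1..g} \<union> Beta ` {1..g} \<union> {Central}"

definition word_commutator :: "'s \<times> bool \<Rightarrow> 's \<times> bool \<Rightarrow> 's word" where
  "word_commutator a b = [a, b, apsnd Not a, apsnd Not b]"

text \<open>
  For \<open>g = 0\<close> the group is \<open>\<int>\<close>, the free group on the central generator; the surface relation,
  whose left hand side would be empty, is then not imposed.
\<close>

definition surface_relators :: "nat \<Rightarrow> surface_gen word set" where
  "surface_relators g =
     (if g = 0 then {}
      else {concat (map (\<lambda>i. word_commutator (Beta i, True) (Alpha i, False)) (rev [1..<Suc g]))
              @ [(Central, False)]} \<union>
           {word_commutator (Central, True) (s, True) | s. s \<in> Alpha ` {1..g} \<union> Beta ` {1..g}})"

definition surface_ext :: "nat \<Rightarrow> surface_gen word set monoid" where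
  "surface_ext g = presented_group (surface_gens g) (surface_relators g)"

definition surface_ext_central :: "nat \<Rightarrow> surface_gen word set" where
  "surface_ext_central g = word_class (surface_gens g) (surface_relators g) [(Central, True)]"


section \<open>The Yetter--Drinfeld module of homomorphisms\<close>

text \<open>Homomorphisms are made extensional, so that they are determined by their values.\<close>

definition Hom_grp :: "('w, 'y) monoid_scheme \<Rightarrow> ('g, 'z) monoid_scheme \<Rightarrow> ('w \<Rightarrow> 'g) set" where
  "Hom_grp P G = hom P G \<inter> extensional (carrier P)"

definition hom_conj ::
  "('w, 'y) monoid_scheme \<Rightarrow> ('g, 'z) monoid_scheme \<Rightarrow> 'g \<Rightarrow> ('w \<Rightarrow> 'g) \<Rightarrow> 'w \<Rightarrow> 'g" where
  "hom_conj P G h f = (\<lambda>y\<in>carrier P. h \<otimes>\<^bsub>G\<^esub> f y \<otimes>\<^bsub>G\<^esub> inv\<^bsub>G\<^esub> h)"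

text \<open>
  \<open>omega\<close> is the space of formal linear combinations of homomorphisms; \<open>omega_act\<close> and
  \<open>omega_coact x\<close> are the linear extensions of \<open>h \<bullet> f = h f h\<^sup>-\<^sup>1\<close> and \<open>\<delta>(f) = f(x) \<otimes> f\<close>.
\<close>

definition omega ::
  "('w, 'y) monoid_scheme \<Rightarrow> ('g, 'z) monoid_scheme \<Rightarrow> ('k::field, ('w \<Rightarrow> 'g) \<Rightarrow> 'k) vspace" where
  "omega P G =
     \<lparr>carr = {w. finite {f. w f \<noteq> 0} \<and> {f. w f \<noteq> 0} \<subseteq> Hom_grp P G}, scl = fscl\<rparr>"

definition omega_act ::
  "('w, 'y) monoid_scheme \<Rightarrow> ('g, 'z) monoid_scheme \<Rightarrow> ('g \<Rightarrow> 'k::field) \<Rightarrow>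
   (('w \<Rightarrow> 'g) \<Rightarrow> 'k) \<Rightarrow> ('w \<Rightarrow> 'g) \<Rightarrow> 'k" where
  "omega_act P G a w =
     (\<Sum>h\<in>carrier G. \<Sum>f | w f \<noteq> 0. fscl (a h * w f) (basis_fun (hom_conj P G h f)))"

definition omega_coact ::
  "('w, 'y) monoid_scheme \<Rightarrow> ('g, 'z) monoid_scheme \<Rightarrow> 'w \<Rightarrow>
   (('w \<Rightarrow> 'g) \<Rightarrow> 'k::field) \<Rightarrow> ('k, 'g \<Rightarrow> 'k, ('w \<Rightarrow> 'g) \<Rightarrow> 'k) ten" where
  "omega_coact P G x w =
     (\<Sum>f | w f \<noteq> 0. fscl (w f)
        (tens (group_algebra G) (omega P G) (basis_fun (f x)) (basis_fun f)))"

text \<open>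
  For a left comodule and module \<open>(V, act, \<delta>)\<close>, the quotient \<open>\<^sup>qV / ((ker \<eta>) \<bullet> \<^sup>qV)\<close>.
\<close>

definition twisted_coinvariants ::
  "('k::field, 'h::ab_group_add) hopf \<Rightarrow> ('k, 'v::ab_group_add, 'z) vspace_scheme \<Rightarrow>
   ('h \<Rightarrow> 'v \<Rightarrow> 'v) \<Rightarrow> ('v \<Rightarrow> ('k, 'h, 'v) ten) \<Rightarrow> 'h \<Rightarrow> ('h \<Rightarrow> 'k) \<Rightarrow>
   ('k, 'v set) lin_space" where
  "twisted_coinvariants H V act \<delta> q \<eta> =
     quotient_image (homogeneous H V \<delta> q)
       (module.span (scl V)
          {act a v | a v. a \<in> carr H \<and> \<eta> a = 0 \<and> v \<in> carr (homogeneous H V \<delta> q)})"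

end

theory Submission
  imports Defs
begin

text \<open>
  The coinvariants of \<open>M\<close> being one-dimensional, \<open>M\<close> has a basis indexed by \<open>G\<close> on which all structure
  maps are monomial. Hence the extended Hilbert space has a basis of \<open>G\<close>-valued configurations on the
  half-edges, inverse on opposite half-edges; the module structure is a gauge transformation at each
  vertex up to a character, and the coaction records the holonomy around each face up to a power of the
  central element \<open>p\<close>. In the cotensor product all face holonomies are prescribed central elements.
  Merging faces across a shared edge and normalising the boundary word of the remaining disc writes such
  a configuration uniquely as a list of \<open>g\<close> pairs in \<open>G\<close> with product of commutators \<open>p\<^sup>2\<^sup>g\<close>, that is a
  homomorphism on the central extension with value \<open>p\<^sup>2\<^sup>g\<close> at \<open>x\<close>, together with a gauge at the vertices
  other than the base point. Balancing at these vertices removes the gauge, and the base point acts by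
  conjugation; the characters contributed by the edges and vertices multiply to \<open>\<chi>\<^sup>-\<^sup>2\<^sup>g\<close>.
\<close>


section \<open>Holonomies along words of half-edges\<close>

text \<open>Both exponents 2g come from one Euler count. Cilia biject with vertices and with faces,
  so |V| = |F| and |E| = 2(|V| - 1) + 2g. The coaction degree of a face is its holonomy times one
  inverse of \<open>p\<close> per target, hence |E| inverses over all faces, while each of the |V| -
  1 cilia other than \<open>pt\<close> prescribes the degree p^(-2); what remains is p^(2g).
  Likewise every source contributes one factor \<chi>, against \<chi>^2 per other cilium. The
  reduction of words does not know the genus: it carries an Euler count along, and comparison with
  the graph identifies the number of handles. Orbits cannot simply be counted. A stabiliser may act
  by a nontrivial scalar and then kills its basis vector, so the isomorphism is given by linear maps
  in both directions that are inverse modulo the relations. Lifts from tensor products are choices,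
  made separately for each multilinear map. They can be evaluated only after multilinearity has been
  shown, and they say nothing about parameters; expansions in finite bases supply both, which
  explains the extent of the linear algebra.\<close>

primrec walk :: "('h => 'h) => ('h => 'v) => 'v => 'h list => 'v => bool" where
 "walk io t a [] b \<longleftrightarrow> a = b"
| "walk io t a (w # W) b \<longleftrightarrow> t (io w) = a \<and> walk io t (t w) W b"

lemma walk_append: "walk io t a (A @ B) b \<longleftrightarrow> (\<exists>m. walk io t a A m \<and> walk io t m B b)"
 by (induction A arbitrary: a) auto

lemma walk_cong:
 assumes "!!w. w : set W ==> c w = c' w" "!!w. w : set W ==> c (io w) = c' (io w)"
 shows "walk io c a W b \<longleftrightarrow> walk io c' a W b" using assms by (induction W arbitrary: a) auto

lemma walk_end: "walk io t a W b ==> b : insert a (t ` set W)" by (induction W arbitrary: a) auto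

primrec hol :: "('g, 'b) monoid_scheme => ('h => 'g) => 'h list => 'g" where
 "hol G cf [] = \<one>\<^bsub>G\<^esub>"
| "hol G cf (w # W) = cf w \<otimes>\<^bsub>G\<^esub> hol G cf W"

lemma hol_cong: "(!!w. w : set W ==> cf w = cf' w) ==> hol G cf W = hol G cf' W" by (induction W) auto

definition cfg ::
 "('g, 'b) monoid_scheme => ('h => 'h) => 'h set => ('h list \<times> 'g) list => ('h => 'g) set" where
 "cfg G io L Fs = {cf : L \<rightarrow>\<^sub>E carrier G. (\<forall>u\<in>L. cf (io u) = inv\<^bsub>G\<^esub> cf u) \<and>
  (\<forall>(F, z)\<in>set Fs. hol G cf F = z)}"

lemma cfgD:
 assumes "cf : cfg G io L Fs"
 shows "u : L ==> cf u : carrier G" "u : L ==> cf (io u) = inv\<^bsub>G\<^esub> cf u"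
  "u \<notin> L ==> cf u = undefined" "(F, z) : set Fs ==> hol G cf F = z"
 using assms unfolding cfg_def by (auto dest: PiE_arb)

text \<open>The letter \<open>u\<close> runs from \<open>t (io u)\<close> to \<open>t u\<close>, as
  in \<open>walk\<close>. The gauge is multiplied in at the start of the letter and inversely at its
  end, so it telescopes along walks.\<close>

definition gauge ::
 "('g, 'b) monoid_scheme => ('h => 'h) => ('h => 'v) => 'h set => ('v => 'g) => ('h => 'g) => 'h => 'g"
 where "gauge G io t L a cf = (\<lambda>u\<in>L. a (t (io u)) \<otimes>\<^bsub>G\<^esub> cf u \<otimes>\<^bsub>G\<^esub> inv\<^bsub>G\<^esub> a (t u))"

text \<open>The head of the list stands rightmost because the surface relator is written with
  decreasing index; entry \<open>i\<close> of the list then serves the handle of index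
  \<open>Suc i\<close>.\<close>

primrec comm_prod :: "('g, 'b) monoid_scheme => ('g \<times> 'g) list => 'g" where
 "comm_prod G [] = \<one>\<^bsub>G\<^esub>"
| "comm_prod G (q # qs) = comm_prod G qs \<otimes>\<^bsub>G\<^esub>
  (fst q \<otimes>\<^bsub>G\<^esub> snd q \<otimes>\<^bsub>G\<^esub> inv\<^bsub>G\<^esub> fst q \<otimes>\<^bsub>G\<^esub> inv\<^bsub>G\<^esub> snd q)"

definition conj_by :: "('g, 'b) monoid_scheme => 'g => 'g => 'g" where
 "conj_by G h x = h \<otimes>\<^bsub>G\<^esub> x \<otimes>\<^bsub>G\<^esub> inv\<^bsub>G\<^esub> h"

definition pair_lists :: "('g, 'b) monoid_scheme => nat => ('g \<times> 'g) list set" where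
 "pair_lists G n = {qs. set qs \<subseteq> carrier G \<times> carrier G \<and> length qs = n}"

definition based_maps :: "('g, 'b) monoid_scheme => 'v set => 'v => ('v => 'g) set" where
 "based_maps G V v0 = {\<tau> : V \<rightarrow>\<^sub>E carrier G. \<tau> v0 = \<one>\<^bsub>G\<^esub>}"

definition all_letters :: "'h list => ('h list \<times> 'g) list => 'h set" where
 "all_letters W Fs = set (W @ concat (map fst Fs))"

definition central :: "('g, 'b) monoid_scheme => 'g => bool" where
 "central G z \<longleftrightarrow> z : carrier G \<and> (\<forall>h\<in>carrier G. z \<otimes>\<^bsub>G\<^esub> h = h \<otimes>\<^bsub>G\<^esub> z)"

text \<open>
 The condition on \<open>c\<close> says that the corners around a vertex form a single cycle: a function on
 half-edges that is compatible with all corners factors through the vertex map \<open>t\<close>. In this form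
 it passes to smaller words by extending \<open>c\<close> to the removed letters. Connectedness is phrased
 similarly.
\<close>

definition surface_words ::
 "('h => 'h) => ('h => 'v) => 'v => 'h list => ('h list \<times> 'g) list => bool" where
 "surface_words io t v0 W Fs \<longleftrightarrow>
  distinct (W @ concat (map fst Fs)) \<and>
  (\<forall>u\<in>all_letters W Fs. io u : all_letters W Fs \<and> io (io u) = u \<and> io u ~= u) \<and>
  walk io t v0 W v0 \<and> (\<forall>(F, z)\<in>set Fs. F ~= [] \<and> (\<exists>a. walk io t a F a)) \<and>
  (\<forall>(c :: 'h => bool) a. walk io c a W a \<longrightarrow> (\<forall>(F, z)\<in>set Fs. \<exists>b. walk io c b F b) \<longrightarrow>
    (\<exists>k. k v0 = a \<and> (\<forall>u\<in>all_letters W Fs. c u = k (t u)))) \<and>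
  (\<forall>d :: 'h => bool. (\<forall>u\<in>all_letters W Fs. d (io u) = d u) \<longrightarrow>
    (\<forall>F\<in>set (W # map fst Fs). \<forall>u\<in>set F. \<forall>w\<in>set F. d u = d w) \<longrightarrow>
    (\<forall>u\<in>all_letters W Fs. \<forall>w\<in>all_letters W Fs. d u = d w)) \<and>
  (W = [] \<longrightarrow> Fs = [])"

text \<open>\<Theta> holds the handle holonomies, taken as loops at \<open>v0\<close>, and \<tau> a
  transport from \<open>v0\<close> to each vertex; hence the two transformation rules, in which
  \<Theta> feels only \<open>a v0\<close>. Since an edge has two letters and there are
  \<open>length Fs + 1\<close> faces, the last equation is Euler's formula |V| - |E| + |F| = 2 - 2n,
  kept so that \<open>n\<close> can be recognised as the genus.\<close>

definition solves ::
 "('g, 'b) monoid_scheme => ('h => 'h) => ('h => 'v) => 'v => 'h list => ('h list \<times> 'g) list =>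
 nat => (('h => 'g) => ('g \<times> 'g) list) => (('h => 'g) => 'v => 'g) => bool" where
 "solves G io t v0 W Fs n \<Theta> \<tau> \<longleftrightarrow>
  (let L = all_letters W Fs; V = insert v0 (t ` L); X = cfg G io L Fs in
   bij_betw (%cf. (\<Theta> cf, \<tau> cf)) X (pair_lists G n \<times> based_maps G V v0) \<and>
   (\<forall>cf\<in>X. hol G cf W \<otimes>\<^bsub>G\<^esub> foldr (%q. (\<otimes>\<^bsub>G\<^esub>) (snd q)) Fs \<one>\<^bsub>G\<^esub> = comm_prod G (\<Theta> cf)) \<and>
   (\<forall>cf\<in>X. \<forall>a\<in>V \<rightarrow> carrier G.
    \<Theta> (gauge G io t L a cf) = map (map_prod (conj_by G (a v0)) (conj_by G (a v0))) (\<Theta> cf) \<and>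
    (\<forall>v\<in>V. \<tau> (gauge G io t L a cf) v = a v0 \<otimes>\<^bsub>G\<^esub> \<tau> cf v \<otimes>\<^bsub>G\<^esub> inv\<^bsub>G\<^esub> a v)) \<and>
   2 * card V + 2 * length Fs + 4 * n = card L + 2)"

text \<open>Take a letter whose inverse follows at minimal distance. If nothing lies between them,
  the pair cancels. Otherwise the letter next to it has its inverse outside the enclosed segment by
  minimality, and the two pairs interlock.\<close>

lemma distinct_closed_cases:
 assumes "distinct W" "W ~= []" and io: "!!u. u : set W ==> io u : set W \<and> io (io u) = u \<and> io u ~= u"
 shows "(\<exists>A x B. W = A @ x # io x # B) \<or>
  (\<exists>A x B y C D E. W = A @ x # B @ y # C @ io x # D @ io y # E)"
proof -
 define P where "P = (%n. \<exists>A x B C. W = A @ x # B @ io x # C \<and> length B = n)"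
 have "\<exists>n. P n"
 proof -
  obtain w W' where W: "W = w # W'" using assms(2) by (cases W) auto
  then have "io w : set W'" using io[of w] by auto
  then obtain B C where "W' = B @ io w # C" by (meson split_list)
  then have "W = [] @ w # B @ io w # C" using W by simp
  then show ?thesis unfolding P_def by blast
 qed
 then obtain n where n: "P n" "!!m. m < n ==> \<not> P m" by (metis exists_least_iff)
 then obtain A x B C where W: "W = A @ x # B @ io x # C" and B: "length B = n" unfolding P_def by blast
 show ?thesis
 proof (cases B)
  case Nil
  then show ?thesis using W by auto
 next
  case (Cons y B')
  have y: "y : set W" using W Cons by auto
  have yB: "io y \<notin> set B'"
  proof
   assume "io y : set B'"
   then obtain Q R where "B' = Q @ io y # R" by (meson split_list)
   then have "W = (A @ [x]) @ y # Q @ io y # (R @ io x # C)" "length Q < n" using W Cons B by auto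
   then show False using n(2)[of "length Q"] unfolding P_def by blast
  qed
  have ne: "io y ~= y" "io y ~= x" "io y ~= io x"
   using io[OF y] io[of x] W Cons \<open>distinct W\<close> by auto
  have "io y : set W" using io[OF y] by auto
  then have "io y : set A \<or> io y : set C" using yB ne W Cons by auto
  then show ?thesis
  proof
   \<comment> \<open>Now \<open>io y\<close> is the first of the four letters and takes the part of
     \<open>x\<close> in the conclusion, with \<open>x\<close> in the part of
     \<open>y\<close>.\<close>
   assume "io y : set A"
   then obtain Q R where "A = Q @ io y # R" by (meson split_list)
   then have "W = Q @ io y # R @ x # [] @ io (io y) # B' @ io x # C" using W Cons io[OF y] by simp
   then show ?thesis by blast
  next
   assume "io y : set C"
   then obtain Q R where "C = Q @ io y # R" by (meson split_list)
   then have "W = A @ x # [] @ y # B' @ io x # Q @ io y # R" using W Cons by simp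
   then show ?thesis by blast
  qed
 qed
qed

context group
begin

lemma inv_cancel_left [simp]:
 "x : carrier G ==> y : carrier G ==> x \<otimes> (inv x \<otimes> y) = y"
 "x : carrier G ==> y : carrier G ==> inv x \<otimes> (x \<otimes> y) = y" by (simp_all flip: m_assoc)

lemmas group_word_simps = m_assoc inv_mult_group

lemma hol_closed [simp]: "(!!w. w : set W ==> cf w : carrier G) ==> hol G cf W : carrier G"
 by (induction W) auto

lemma hol_append:
 "(!!w. w : set (A @ B) ==> cf w : carrier G) ==> hol G cf (A @ B) = hol G cf A \<otimes> hol G cf B"
 by (induction A) (auto simp: m_assoc)

lemma hol_gauge:
 assumes "walk io t p W q" "set W \<subseteq> L" "!!u. u : L ==> cf u : carrier G"
  "!!u. u : L ==> a (t u) : carrier G" "a p : carrier G" "a q : carrier G"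
 shows "hol G (gauge G io t L a cf) W = a p \<otimes> hol G cf W \<otimes> inv a q" using assms
proof (induction W arbitrary: p)
 case Nil
 then show ?case by auto
next
 case (Cons w W)
 have "hol G (gauge G io t L a cf) W = a (t w) \<otimes> hol G cf W \<otimes> inv a q" using Cons by auto
 moreover have "hol G cf W : carrier G" using Cons.prems by (auto intro!: hol_closed)
 moreover have "gauge G io t L a cf w = a p \<otimes> cf w \<otimes> inv a (t w)" "w : L"
  using Cons.prems by (auto simp: gauge_def)
 ultimately show ?case using Cons.prems by (simp add: group_word_simps)
qed

text \<open>In the absence of face constraints an edge is a free coordinate in the group: the
  opposite half-edge adds nothing, as its value is the inverse.\<close>

lemma cfg_insert:
 assumes "x \<notin> L'" "io x \<notin> L'" "io x ~= x" "io (io x) = x" "L = insert x (insert (io x) L')"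
  "!!u. u : L' ==> io u : L'"
 shows "bij_betw (%cf. (restrict cf L', cf x)) (cfg G io L []) (cfg G io L' [] \<times> carrier G)"
proof (rule bij_betw_byWitness[where f' = "%(cf, g). cf(x := g, io x := inv g)"])
 show "\<forall>cf\<in>cfg G io L []. (%(cf, g). cf(x := g, io x := inv g)) (restrict cf L', cf x) = cf"
 proof
  fix cf assume cf: "cf : cfg G io L []"
  have "((restrict cf L')(x := cf x, io x := inv cf x)) u = cf u" for u
  proof -
   have 1: "cf (io x) = inv cf x" using cfgD(2)[OF cf, of x] assms(5) by blast
   have 2: "cf u = undefined" if "u \<notin> L" using cfgD(3)[OF cf that] .
   consider "u = x" | "u = io x" | "u : L'" | "u \<notin> L" using assms(5) by blast
   then show ?thesis
   proof cases
    case 4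
    then show ?thesis using 2 assms(5) by simp
   qed (use 1 assms(1-3) in auto)
  qed
  then show "(%(cf, g). cf(x := g, io x := inv g)) (restrict cf L', cf x) = cf" by auto
 qed
 show "\<forall>q\<in>cfg G io L' [] \<times> carrier G.
   (%cf. (restrict cf L', cf x)) ((%(cf, g). cf(x := g, io x := inv g)) q) = q"
 proof
  fix q assume q: "q : cfg G io L' [] \<times> carrier G"
  obtain cf g where [simp]: "q = (cf, g)" by (cases q)
  have "restrict (cf(x := g, io x := inv g)) L' u = cf u" for u
   using cfgD(3)[of cf G io L' "[]" u] q assms(1,2) by auto
  then show "(%cf. (restrict cf L', cf x)) ((%(cf, g). cf(x := g, io x := inv g)) q) = q"
   using assms(3) by auto
 qed
 show "(%cf. (restrict cf L', cf x)) ` cfg G io L [] \<subseteq> cfg G io L' [] \<times> carrier G"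
 proof clarify
  fix cf assume cf: "cf : cfg G io L []"
  have "!!u. u : L ==> cf u : carrier G" "!!u. u : L ==> cf (io u) = inv cf u" using cfgD[OF cf] by blast+
  then show "restrict cf L' : cfg G io L' [] \<and> cf x : carrier G"
   using assms(6) unfolding cfg_def assms(5) by simp
 qed
 show "(%(cf, g). cf(x := g, io x := inv g)) ` (cfg G io L' [] \<times> carrier G) \<subseteq> cfg G io L []"
 proof clarify
  fix cf g assume cf: "cf : cfg G io L' []" and g: "g : carrier G"
  let ?cf = "cf(x := g, io x := inv g)"
  have "?cf : L \<rightarrow>\<^sub>E carrier G"
   using cf g unfolding assms(5) cfg_def by (auto simp: PiE_def Pi_def extensional_def)
  moreover have "?cf (io u) = inv ?cf u" if u: "u : L" for u
  proof -
   consider "u = x" | "u = io x" | "u : L'" "u ~= x" "u ~= io x" using u assms(5) by auto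
   then show ?thesis
   proof cases
    case 3
    then have "io u ~= x" "io u ~= io x" using assms(1,2,6) by metis+
    then show ?thesis using 3 cf by (simp add: cfg_def)
   qed (use assms(3,4) g in auto)
  qed
  ultimately show "?cf : cfg G io L []" by (simp add: cfg_def)
 qed
qed

end

text \<open>The bijection of the fibres may vary with the base element. This is what the handle move
  requires, where the new coordinates are obtained by multiplying with holonomies of the remaining
  configuration.\<close>

lemma bij_betw_fibred:
 assumes "bij_betw f A B" "!!a. a : A ==> bij_betw (g a) C D"
 shows "bij_betw (%(a, c). (f a, g a c)) (A \<times> C) (B \<times> D)"
proof (rule bij_betw_imageI)
 show "inj_on (%(a, c). (f a, g a c)) (A \<times> C)" using assms by (auto simp: bij_betw_def inj_on_def)
 show "(%(a, c). (f a, g a c)) ` (A \<times> C) = B \<times> D"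
 proof
  show "(%(a, c). (f a, g a c)) ` (A \<times> C) \<subseteq> B \<times> D"
   using assms by (auto simp: bij_betw_def)
  show "B \<times> D \<subseteq> (%(a, c). (f a, g a c)) ` (A \<times> C)"
  proof clarify
   fix b d assume "b : B" "d : D"
   then obtain a where a: "a : A" "b = f a" using assms(1) by (auto simp: bij_betw_def)
   then obtain c where "c : C" "d = g a c"
    using assms(2)[OF a(1)] \<open>d : D\<close> by (auto simp: bij_betw_def)
   then show "(b, d) : (%(a, c). (f a, g a c)) ` (A \<times> C)" using a by force
  qed
 qed
qed

lemma gauge_restrict:
 "L' \<subseteq> L ==> restrict (gauge G io t L a cf) L' = gauge G io t L' a (restrict cf L')"
 by (auto simp: gauge_def restrict_def fun_eq_iff)

section \<open>Moves on a single boundary word: handles and cancellations\<close>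

lemma surface_words_Nil:
 "surface_words io t v0 W [] \<longleftrightarrow> distinct W \<and>
  (\<forall>u\<in>set W. io u : set W \<and> io (io u) = u \<and> io u ~= u) \<and> walk io t v0 W v0 \<and>
  (\<forall>(c :: 'h => bool) a. walk io c a W a \<longrightarrow> (\<exists>k. k v0 = a \<and> (\<forall>u\<in>set W. c u = k (t u))))"
 unfolding surface_words_def all_letters_def
 by (simp only: list.map concat.simps append_Nil2 list.set ball_simps prod.case simp_thms)

lemma surface_words_NilD:
 assumes "surface_words io t v0 W []"
 shows "distinct W" "u : set W ==> io u : set W" "u : set W ==> io (io u) = u"
  "u : set W ==> io u ~= u" "walk io t v0 W v0"
  "walk io c a W a ==> \<exists>k. k v0 = a \<and> (\<forall>u\<in>set W. c u = (k (t u) :: bool))"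
 using assms unfolding surface_words_Nil by blast+

text \<open>Deleting two interlocking pairs and reordering the enclosed segments cuts out a handle.
  No vertex is lost: the ends of \<open>x\<close> and \<open>y\<close> are junctions of the reduced
  word, hence ends of its letters, or \<open>v0\<close> if all segments up to the junction are
  empty.\<close>

lemma surface_words_handle:
 fixes W :: "'h list"
 assumes S: "surface_words io t v0 W ([] :: ('h list \<times> 'g) list)"
  and W: "W = A @ x # B @ y # C @ io x # D @ io y # E"
 shows "surface_words io t v0 (A @ D @ C @ B @ E) ([] :: ('h list \<times> 'g) list)"
  and "insert v0 (t ` set W) = insert v0 (t ` set (A @ D @ C @ B @ E))"
  and "walk io t v0 (A @ D @ C @ B) (t (io y))" "walk io t (t (io y)) E v0"
  and "walk io t v0 A (t (io x))" "walk io t (t x) B (t (io y))" "walk io t (t y) C (t x)"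
proof -
 let ?W' = "A @ D @ C @ B @ E"
 have dist: "distinct W" and inv: "!!u. u : set W ==> io u : set W \<and> io (io u) = u \<and> io u ~= u"
  and wlk: "walk io t v0 W v0"
  and link: "!!c a. walk io c a W a ==> \<exists>k. k v0 = a \<and> (\<forall>u\<in>set W. c u = (k (t u) :: bool))"
  using surface_words_NilD[OF S] by blast+
 have xy: "io (io x) = x" "io (io y) = y" using inv W by auto
 have "walk io t v0 A (t (io x)) \<and> walk io t (t x) B (t (io y)) \<and> walk io t (t y) C (t x) \<and>
  walk io t (t (io x)) D (t y) \<and> walk io t (t (io y)) E v0"
  using wlk unfolding W walk_append walk.simps xy by blast
 note wk = this
 show "walk io t v0 (A @ D @ C @ B) (t (io y))" "walk io t (t (io y)) E v0"
  "walk io t v0 A (t (io x))" "walk io t (t x) B (t (io y))" "walk io t (t y) C (t x)"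
  using wk by (auto simp: walk_append)
 have wk': "walk io t v0 ?W' v0" using wk by (auto simp: walk_append)
 have "t (io x) : insert v0 (t ` set ?W')" "t x : insert v0 (t ` set ?W')"
  "t y : insert v0 (t ` set ?W')" "t (io y) : insert v0 (t ` set ?W')"
  using walk_end[of io t v0 A "t (io x)"] walk_end[of io t v0 "A @ D @ C" "t x"]
   walk_end[of io t v0 "A @ D" "t y"] walk_end[of io t v0 "A @ D @ C @ B" "t (io y)"] wk by (auto simp: walk_append)
 then show "insert v0 (t ` set W) = insert v0 (t ` set ?W')" unfolding W
  by (simp only: set_append list.set image_Un image_insert) blast
 have set: "set ?W' = set W - {x, y, io x, io y}" using dist unfolding W by auto
 have inv': "io u : set ?W'" if "u : set ?W'" for u
  using inv[of u] that xy unfolding set by (metis Diff_iff insertE insertI1 insertI2 singletonD)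
 have link': "\<exists>k. k v0 = a \<and> (\<forall>u\<in>set ?W'. c u = (k (t u) :: bool))" if c: "walk io c a ?W' a" for c a
 proof -
  obtain p1 p4 p2 p3 where p: "walk io c a A p1" "walk io c p1 D p4" "walk io c p4 C p2"
   "walk io c p2 B p3" "walk io c p3 E a" using c by (auto simp: walk_append)
  \<comment> \<open>The removed letters receive the values at the junctions of the reduced word. The
    walk around \<open>W\<close> passes the same junctions in another order and therefore
    closes.\<close>
  define c' where "c' = c(x := p2, io x := p1, y := p4, io y := p3)"
  have ne: "x ~= io x" "y ~= io y" "x ~= y" "io x ~= io y" "x ~= io y" "io x ~= y"
   using dist inv W by auto
  have eq: "c' u = c u" "c' (io u) = c (io u)" if "u : set ?W'" for u
   using that inv'[OF that] unfolding set c'_def by auto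
  have wc: "walk io c' p Z q \<longleftrightarrow> walk io c p Z q" if "set Z \<subseteq> set ?W'" for p q Z
   by (intro walk_cong eq) (use that in auto)
  have "walk io c' p Z q \<longleftrightarrow> walk io c p Z q" if "Z : {A, B, C, D, E}" for p q Z
   by (rule wc) (use that in auto)
  then have "walk io c' a W a" using p unfolding W by (auto simp: walk_append xy c'_def ne ne[symmetric])
  from link[OF this] obtain k where k: "k v0 = a" "\<forall>u\<in>set W. c' u = k (t u)" by blast
  have "c u = k (t u)" if "u : set ?W'" for u
   using k(2)[rule_format, of u] eq(1)[OF that] that unfolding set by simp
  then show ?thesis using k(1) by blast
 qed
 show "surface_words io t v0 ?W' ([] :: ('h list \<times> 'g) list)" unfolding surface_words_Nil
 proof (intro conjI ballI allI impI)
  show "distinct ?W'" using dist unfolding W by auto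
  show "io u : set ?W'" "io (io u) = u" "io u ~= u" if "u : set ?W'" for u
   using that inv[of u] inv'[of u] set by blast+
 qed (use wk' link' in blast)+
qed

text \<open>A letter followed by its inverse is an edge with a dangling end. The only corner at
  \<open>t x\<close> is the one between the two letters, so this vertex disappears with them, while
  the other end stays in the rest of the word or is \<open>v0\<close>.\<close>

lemma surface_words_cancel:
 fixes W :: "'h list"
 assumes S: "surface_words io t v0 W ([] :: ('h list \<times> 'g) list)"
  and W: "W = A @ x # io x # B"
 shows "surface_words io t v0 (A @ B) ([] :: ('h list \<times> 'g) list)"
  and "insert v0 (t ` set W) = insert (t x) (insert v0 (t ` set (A @ B)))"
  and "t x \<notin> insert v0 (t ` set (A @ B))" "t (io x) : insert v0 (t ` set (A @ B))"
proof -
 let ?W' = "A @ B"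
 have dist: "distinct W" and inv: "!!u. u : set W ==> io u : set W \<and> io (io u) = u \<and> io u ~= u"
  and wlk: "walk io t v0 W v0"
  and link: "!!c a. walk io c a W a ==> \<exists>k. k v0 = a \<and> (\<forall>u\<in>set W. c u = (k (t u) :: bool))"
  using surface_words_NilD[OF S] by blast+
 have x: "io (io x) = x" "io x ~= x" using inv W by auto
 have wk: "walk io t v0 A (t (io x))" "walk io t (t (io x)) B v0"
  using wlk unfolding W walk_append walk.simps x by blast+
 have wk': "walk io t v0 ?W' v0" using wk by (auto simp: walk_append)
 show m: "t (io x) : insert v0 (t ` set ?W')" using walk_end[OF wk(1)] by auto
 then show "insert v0 (t ` set W) = insert (t x) (insert v0 (t ` set ?W'))" unfolding W
  by (simp only: set_append list.set image_Un image_insert) blast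
 have set: "set ?W' = set W - {x, io x}" using dist unfolding W by auto
 have inv': "io u : set ?W'" if "u : set ?W'" for u
  using inv[of u] that x unfolding set by (metis Diff_iff insertE insertI1 insertI2 singletonD)
 \<comment> \<open>The value \<open>b\<close> at \<open>x\<close> is arbitrary, since only the
   corner between \<open>x\<close> and \<open>io x\<close> involves it.\<close>
 have ext: "walk io (c(x := b, io x := m)) a W a"
  if c: "walk io c a A m" "walk io c m B a" for c a m and b :: bool
 proof -
  define c' where "c' = c(x := b, io x := m)"
  have eq: "c' u = c u" "c' (io u) = c (io u)" if "u : set ?W'" for u
   using that inv'[OF that] unfolding set c'_def by auto
  have "walk io c' p Z q \<longleftrightarrow> walk io c p Z q" if "Z : {A, B}" for p q Z
   by (intro walk_cong eq) (use that in auto)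
  then have "walk io c' a W a" using c unfolding W by (auto simp: walk_append x c'_def x(2)[symmetric])
  then show ?thesis unfolding c'_def .
 qed
 have link': "\<exists>k. k v0 = a \<and> (\<forall>u\<in>set ?W'. c u = (k (t u) :: bool))" if c: "walk io c a ?W' a" for c a
 proof -
  obtain m where "walk io c a A m" "walk io c m B a" using c by (auto simp: walk_append)
  from link[OF ext[OF this, of True]] obtain k
   where k: "k v0 = a" "\<forall>u\<in>set W. (c(x := True, io x := m)) u = k (t u)" by blast
  have "c u = k (t u)" if "u : set ?W'" for u using k(2)[rule_format, of u] that unfolding set by simp
  then show ?thesis using k(1) by blast
 qed
 show "surface_words io t v0 ?W' ([] :: ('h list \<times> 'g) list)" unfolding surface_words_Nil
 proof (intro conjI ballI allI impI)
  show "distinct ?W'" using dist unfolding W by auto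
  show "io u : set ?W'" "io (io u) = u" "io u ~= u" if "u : set ?W'" for u
   using that inv[of u] inv'[of u] set by blast+
 qed (use wk' link' in blast)+
 \<comment> \<open>The function that is true at \<open>x\<close> only is compatible with all
   corners. Factoring it through \<open>t\<close> separates \<open>t x\<close> from
   \<open>v0\<close> and from all vertices of the remaining word.\<close>
 have "walk io (%_. False) False Z False" for Z :: "'h list" by (induction Z) auto
 from link[OF ext[OF this this, of True]] obtain k
  where "k v0 = False" "!!u. u : set W ==> ((%_. False)(x := True, io x := False)) u = k (t u)" by blast
 note k = this
 have "k (t x)" using k(2)[of x] x(2) W by auto
 moreover have "\<not> k (t u)" if "u : set ?W'" for u using k(2)[of u] that unfolding set by auto
 ultimately show "t x \<notin> insert v0 (t ` set ?W')" using k(1) by auto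
qed

context group
begin

lemma bij_betw_pair_lists_Suc:
 "bij_betw (%(((qs, \<tau>), v), u). ((u, v) # qs, \<tau>))
  (((pair_lists G n \<times> T) \<times> carrier G) \<times> carrier G) (pair_lists G (Suc n) \<times> T)"
proof (rule bij_betw_byWitness[where
   f' = "%(qs, \<tau>). (((tl qs, \<tau>), snd (hd qs)), fst (hd qs))"])
qed (auto simp: pair_lists_def length_Suc_conv)

lemma bij_betw_sandwich:
 assumes "p : carrier G" "q : carrier G"
 shows "bij_betw (%g. p \<otimes> g \<otimes> q) (carrier G) (carrier G)"
 by (rule bij_betw_byWitness[where f' = "%g. inv p \<otimes> g \<otimes> inv q"])
  (use assms in \<open>auto simp: group_word_simps\<close>)

text \<open>With letters standing for holonomies, A x B y C x^-1 D y^-1 E equals (A D C B E) [u, v]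
  for two loops u and v at \<open>v0\<close>. Here x occurs once in u and y once in v, so given the
  rest, (x, y) and (u, v) determine each other, and the handle contributes exactly one
  commutator.\<close>

lemma solves_handle:
 assumes S: "surface_words io t v0 W ([] :: ('h list \<times> 'a) list)"
  and W: "W = A @ x # B @ y # C @ io x # D @ io y # E"
  and sol: "solves G io t v0 (A @ D @ C @ B @ E) [] n \<Theta>' \<tau>'"
 shows "\<exists>\<Theta> \<tau>. solves G io t v0 W [] (Suc n) \<Theta> \<tau>"
proof -
 let ?W' = "A @ D @ C @ B @ E"
 define L where "L = set W"
 define L' where "L' = set ?W'"
 define V where "V = insert v0 (t ` L')"
 have V: "V = insert v0 (t ` L)" unfolding V_def L_def L'_def using surface_words_handle(2)[OF S W] by simp
 note wk = surface_words_handle(3-)[OF S W]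
 have dist: "distinct W" and inv: "!!u. u : L ==> io u : L \<and> io (io u) = u \<and> io u ~= u"
  using surface_words_NilD[OF S] unfolding L_def by blast+
 have inv': "!!u. u : L' ==> io u : L'"
  using surface_words_NilD(2)[OF surface_words_handle(1)[OF S W]] unfolding L'_def .
 have xyL: "x : L" "y : L" "io x : L" "io y : L" unfolding L_def W by auto
 have xy: "io (io x) = x" "io (io y) = y" "io x ~= x" "io y ~= y" using inv xyL by auto
 define L1 where "L1 = insert y (insert (io y) L')"
 have L: "L = insert x (insert (io x) L1)" unfolding L_def L1_def L'_def W by auto
 have notin: "x \<notin> L1" "io x \<notin> L1" "y \<notin> L'" "io y \<notin> L'"
  using dist xy unfolding L1_def L'_def W by auto
 have sub: "set A \<subseteq> L'" "set B \<subseteq> L'" "set C \<subseteq> L'" "set D \<subseteq> L'" "set E \<subseteq> L'" "L' \<subseteq> L"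
  unfolding L L1_def by (auto simp: L'_def)
 define X where "X = cfg G io L []"
 define X' where "X' = cfg G io L' []"
 define K where "K = (%cf. hol G cf (A @ D @ C @ B))"
 \<comment> \<open>The loop \<open>fy\<close> is y C B conjugated by E. The loop \<open>fx\<close>
   is A x B E preceded by the inverse of the reduced word A D C B E. Both start and end at
   \<open>v0\<close>, so a gauge transformation conjugates them by its value there.\<close>
 define fy where "fy = (%cf g. inv (hol G cf E) \<otimes> g \<otimes> (hol G cf C \<otimes> hol G cf B \<otimes> hol G cf E))"
 define fx where "fx = (%cf g. (inv (hol G cf E) \<otimes> inv (K cf) \<otimes> hol G cf A) \<otimes> g \<otimes>
  (hol G cf B \<otimes> hol G cf E))"
 define \<Theta> where "\<Theta> = (%cf. (fx cf (cf x), fy cf (cf y)) # \<Theta>' (restrict cf L'))"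
 define \<tau> where "\<tau> = (%cf. \<tau>' (restrict cf L'))"
 have carr: "cf u : carrier G" if "cf : X" "u : L" for cf u using that by (auto simp: X_def cfg_def)
 have carr': "cf u : carrier G" if "cf : X'" "u : L'" for cf u using that by (auto simp: X'_def cfg_def)
 have hc: "hol G cf Z : carrier G" if "cf : X" "set Z \<subseteq> L" for cf Z
  using that carr by (intro hol_closed) auto
 have hc': "hol G cf Z : carrier G" if "cf : X'" "set Z \<subseteq> L'" for cf Z
  using that carr' by (intro hol_closed) auto
 have sol': "bij_betw (%cf. (\<Theta>' cf, \<tau>' cf)) X' (pair_lists G n \<times> based_maps G V v0)"
  "!!cf. cf : X' ==> hol G cf ?W' = comm_prod G (\<Theta>' cf)"
  "!!cf a. cf : X' ==> a : V \<rightarrow> carrier G ==>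
   \<Theta>' (gauge G io t L' a cf) = map (map_prod (conj_by G (a v0)) (conj_by G (a v0))) (\<Theta>' cf)"
  "!!cf a v. cf : X' ==> a : V \<rightarrow> carrier G ==> v : V ==>
   \<tau>' (gauge G io t L' a cf) v = a v0 \<otimes> \<tau>' cf v \<otimes> inv a v"
  "2 * card V + 4 * n = card L' + 2" using sol hc'[of _ ?W'] unfolding solves_def Let_def
  by (auto simp: all_letters_def L'_def V_def X'_def)
 have F0: "bij_betw (%cf. ((restrict cf L', cf y), cf x)) X ((X' \<times> carrier G) \<times> carrier G)"
 proof -
  have 1: "bij_betw (%cf. (restrict cf L1, cf x)) X (cfg G io L1 [] \<times> carrier G)"
   unfolding X_def using notin xy L inv' by (intro cfg_insert) (auto simp: L1_def)
  have 2: "bij_betw (%cf. (restrict cf L', cf y)) (cfg G io L1 []) (X' \<times> carrier G)"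
   unfolding X'_def using notin xy inv' by (intro cfg_insert) (auto simp: L1_def)
  have 3: "bij_betw (%(cf, g). ((restrict cf L', cf y), id g)) (cfg G io L1 [] \<times> carrier G)
   ((X' \<times> carrier G) \<times> carrier G)"
   by (rule bij_betw_fibred[OF 2, where g = "%_. id"]) auto
  have L1': "L1 \<inter> L' = L'" "y : L1" unfolding L1_def by auto
  show ?thesis using bij_betw_trans[OF 1 3] by (simp add: comp_def L1')
 qed
 have F1: "bij_betw (%((cf, g), h). (((\<Theta>' cf, \<tau>' cf), fy cf g), fx cf h))
  ((X' \<times> carrier G) \<times> carrier G)
  (((pair_lists G n \<times> based_maps G V v0) \<times> carrier G) \<times> carrier G)"
 proof -
  have 1: "bij_betw (%(cf, g). ((\<Theta>' cf, \<tau>' cf), fy cf g)) (X' \<times> carrier G)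
   ((pair_lists G n \<times> based_maps G V v0) \<times> carrier G)"
   by (rule bij_betw_fibred[OF sol'(1)], unfold fy_def, rule bij_betw_sandwich)
    (auto intro!: hc' sub)
  have 2: "bij_betw (fx (fst q)) (carrier G) (carrier G)" if "q : X' \<times> carrier G" for q
   unfolding fx_def K_def by (intro bij_betw_sandwich m_closed inv_closed hc') (use that sub in auto)
  show ?thesis using bij_betw_fibred[OF 1 2] by (simp add: case_prod_unfold)
 qed
 have hr: "hol G (restrict cf L') Z = hol G cf Z" if "set Z \<subseteq> L'" for cf Z
  using that by (intro hol_cong) auto
 have bij: "bij_betw (%cf. (\<Theta> cf, \<tau> cf)) X (pair_lists G (Suc n) \<times> based_maps G V v0)"
  using bij_betw_trans[OF F0 bij_betw_trans[OF F1 bij_betw_pair_lists_Suc]]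
  by (simp add: comp_def \<Theta>_def \<tau>_def fx_def fy_def K_def hr sub)
 have rX: "restrict cf L' : X'" if "cf : X" for cf using that sub(6) inv' by (auto simp: X_def X'_def cfg_def)
 have hol: "hol G cf W = comm_prod G (\<Theta> cf)" if cf: "cf : X" for cf
 proof -
  have c: "hol G cf Z : carrier G" if "Z : {A, B, C, D, E}" for Z using that sub by (intro hc cf) auto
  have i: "cf (io x) = inv cf x" "cf (io y) = inv cf y" "cf x : carrier G" "cf y : carrier G"
   using cf xyL carr[OF cf] by (auto simp: X_def cfg_def)
  have h: "hol G cf (P @ Q) = hol G cf P \<otimes> hol G cf Q" if "set P \<subseteq> L" "set Q \<subseteq> L" for P Q
   using that carr[OF cf] by (intro hol_append) auto
  have sl: "set Z \<subseteq> L" if "Z : {A, B, C, D, E}" for Z using that sub by auto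
  have 1: "comm_prod G (\<Theta>' (restrict cf L')) = hol G cf ?W'"
   using sol'(2)[OF rX[OF cf]] hr[of ?W' cf] L'_def by simp
  have "hol G cf W = hol G cf A \<otimes> (cf x \<otimes> (hol G cf B \<otimes> (cf y \<otimes> (hol G cf C \<otimes> (inv cf x \<otimes>
   (hol G cf D \<otimes> (inv cf y \<otimes> hol G cf E)))))))"
   unfolding W using xyL sl by (simp add: h i)
  then show ?thesis unfolding \<Theta>_def fx_def fy_def K_def using xyL sl i(3,4) c
   by (simp add: 1 h group_word_simps)
 qed
 have gau: "\<Theta> (gauge G io t L a cf) = map (map_prod (conj_by G (a v0)) (conj_by G (a v0))) (\<Theta> cf)"
  if cf: "cf : X" and a: "a : V \<rightarrow> carrier G" for cf a
 proof -
  let ?g = "gauge G io t L a cf"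
  have av: "a v0 : carrier G" "!!u. u : L ==> a (t u) : carrier G" using a unfolding V by auto
  have hg: "hol G ?g Z = a p \<otimes> hol G cf Z \<otimes> inv a q"
   if "walk io t p Z q" "set Z \<subseteq> L" "a p : carrier G" "a q : carrier G" for p q Z
   using that carr[OF cf] av by (intro hol_gauge) auto
  have at: "a (t x) : carrier G" "a (t y) : carrier G" "a (t (io x)) : carrier G"
   "a (t (io y)) : carrier G" using av xyL by auto
  have sl: "set Z \<subseteq> L" if "Z : {A, B, C, D, E, A @ D @ C @ B}" for Z
  proof -
   have "set Z \<subseteq> L'" using that sub(1-5) by auto
   then show ?thesis using sub(6) by blast
  qed
  have c: "hol G cf Z : carrier G" if "Z : {A, B, C, D, E, A @ D @ C @ B}" for Z
   by (rule hc[OF cf sl[OF that]])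
  have i: "cf x : carrier G" "cf y : carrier G" using xyL carr[OF cf] by auto
  have holg: "hol G ?g (A @ D @ C @ B) = a v0 \<otimes> hol G cf (A @ D @ C @ B) \<otimes> inv a (t (io y))"
   "hol G ?g E = a (t (io y)) \<otimes> hol G cf E \<otimes> inv a v0"
   "hol G ?g A = a v0 \<otimes> hol G cf A \<otimes> inv a (t (io x))"
   "hol G ?g B = a (t x) \<otimes> hol G cf B \<otimes> inv a (t (io y))"
   "hol G ?g C = a (t y) \<otimes> hol G cf C \<otimes> inv a (t x)" by (rule hg; use wk at av sl in simp)+
  have gxy: "?g x = a (t (io x)) \<otimes> cf x \<otimes> inv a (t x)" "?g y = a (t (io y)) \<otimes> cf y \<otimes> inv a (t y)"
   using xyL by (auto simp: gauge_def)
  have "fx ?g (?g x) = conj_by G (a v0) (fx cf (cf x))" "fy ?g (?g y) = conj_by G (a v0) (fy cf (cf y))"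
   unfolding fx_def fy_def K_def conj_by_def holg gxy using c i at av(1) by (simp_all add: group_word_simps)
  then show ?thesis unfolding \<Theta>_def using sol'(3)[OF rX[OF cf] a] by (simp add: gauge_restrict[OF sub(6)])
 qed
 have gau': "\<tau> (gauge G io t L a cf) v = a v0 \<otimes> \<tau> cf v \<otimes> inv a v"
  if cf: "cf : X" and a: "a : V \<rightarrow> carrier G" "v : V" for cf a v
  unfolding \<tau>_def using sol'(4)[OF rX[OF cf] a] by (simp add: gauge_restrict[OF sub(6)])
 \<comment> \<open>Two edges disappear and no vertex, which the count balances by one
   handle.\<close>
 have card: "card L = card L' + 4"
 proof -
  have "finite L'" unfolding L'_def by simp
  then show ?thesis unfolding L L1_def using notin xy by (auto simp: L1_def card_insert_if)
 qed
 have compc: "comm_prod G (\<Theta> cf) : carrier G" if "cf : X" for cf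
  using hol[OF that] hc[OF that, of W] L_def by auto
 have "solves G io t v0 W [] (Suc n) \<Theta> \<tau>" unfolding solves_def Let_def
  using bij hol gau gau' card sol'(5) compc by (auto simp: all_letters_def X_def L_def[symmetric] V[symmetric])
 then show ?thesis by blast
qed

end

lemma cfg_iff: "cf : cfg G io L Fs \<longleftrightarrow> cf : cfg G io L [] \<and> (\<forall>(F, z)\<in>set Fs. hol G cf F = z)"
 by (simp add: cfg_def)

lemma cfg_restrict:
 "cf : cfg G io L [] ==> L' \<subseteq> L ==> (!!u. u : L' ==> io u : L') ==> restrict cf L' : cfg G io L' []"
 unfolding cfg_def by auto

lemma based_mapsD:
 assumes "\<tau> : based_maps G V v0"
 shows "v \<notin> V ==> \<tau> v = undefined" "v : V ==> \<tau> v : carrier G" "\<tau> v0 = \<one>\<^bsub>G\<^esub>"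
 using assms unfolding based_maps_def by (auto dest: PiE_arb)

context group
begin

lemma bij_betw_based_maps_insert:
 assumes "v' \<notin> V" "v0 : V" "m : V"
 shows "bij_betw (%(\<tau>, g). \<tau>(v' := \<tau> m \<otimes> g)) (based_maps G V v0 \<times> carrier G)
  (based_maps G (insert v' V) v0)"
proof (rule bij_betw_byWitness[where f' = "%\<sigma>. (restrict \<sigma> V, inv \<sigma> m \<otimes> \<sigma> v')"])
 have ne: "v' ~= m" "v' ~= v0" "m ~= v'" using assms by auto
 show "\<forall>q\<in>based_maps G V v0 \<times> carrier G. (%\<sigma>. (restrict \<sigma> V, inv \<sigma> m \<otimes> \<sigma> v'))
   ((%(\<tau>, g). \<tau>(v' := \<tau> m \<otimes> g)) q) = q"
 proof
  fix q assume "q : based_maps G V v0 \<times> carrier G"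
  then obtain \<tau> g where q: "q = (\<tau>, g)" and \<tau>: "\<tau> : based_maps G V v0" and g: "g : carrier G"
   by blast
  have e: "restrict (\<tau>(v' := \<tau> m \<otimes> g)) V = \<tau>"
  proof
   fix v show "restrict (\<tau>(v' := \<tau> m \<otimes> g)) V v = \<tau> v"
    using based_mapsD(1)[OF \<tau>, of v] assms(1) by (cases "v : V") auto
  qed
  have "\<tau> m : carrier G" using based_mapsD(2)[OF \<tau>] assms by blast
  then show "(%\<sigma>. (restrict \<sigma> V, inv \<sigma> m \<otimes> \<sigma> v')) ((%(\<tau>, g). \<tau>(v' := \<tau> m \<otimes> g)) q) = q"
   unfolding q prod.case e using g ne by simp
 qed
 show "\<forall>\<sigma>\<in>based_maps G (insert v' V) v0.
   (%(\<tau>, g). \<tau>(v' := \<tau> m \<otimes> g)) (restrict \<sigma> V, inv \<sigma> m \<otimes> \<sigma> v') = \<sigma>"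
 proof
  fix \<sigma> assume \<sigma>: "\<sigma> : based_maps G (insert v' V) v0"
  have "\<sigma> m : carrier G" "\<sigma> v' : carrier G" using based_mapsD(2)[OF \<sigma>] assms by blast+
  then have "((restrict \<sigma> V)(v' := \<sigma> m \<otimes> (inv \<sigma> m \<otimes> \<sigma> v'))) v = \<sigma> v" for v
   using based_mapsD(1)[OF \<sigma>, of v] by (cases "v = v'"; cases "v : V") auto
  then show "(%(\<tau>, g). \<tau>(v' := \<tau> m \<otimes> g)) (restrict \<sigma> V, inv \<sigma> m \<otimes> \<sigma> v') = \<sigma>"
   using assms by auto
 qed
 show "(%(\<tau>, g). \<tau>(v' := \<tau> m \<otimes> g)) ` (based_maps G V v0 \<times> carrier G)
   \<subseteq> based_maps G (insert v' V) v0"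
  using assms ne by (auto simp: based_maps_def PiE_iff extensional_def)
 show "(%\<sigma>. (restrict \<sigma> V, inv \<sigma> m \<otimes> \<sigma> v')) ` based_maps G (insert v' V) v0
   \<subseteq> based_maps G V v0 \<times> carrier G"
  using assms by (auto simp: based_maps_def PiE_iff)
qed

text \<open>The holonomy of the word is unchanged, and so are the handle data. The free value at
  \<open>x\<close> becomes the transport to the dangling vertex: \<tau> is continued from
  \<open>t (io x)\<close> along \<open>x\<close>. One vertex and two letters fewer leave the count
  intact.\<close>

lemma solves_cancel:
 assumes S: "surface_words io t v0 W ([] :: ('h list \<times> 'a) list)"
  and W: "W = A @ x # io x # B"
  and sol: "solves G io t v0 (A @ B) [] n \<Theta>' \<tau>'"
 shows "\<exists>\<Theta> \<tau>. solves G io t v0 W [] n \<Theta> \<tau>"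
proof -
 define L where "L = set W"
 define L' where "L' = set (A @ B)"
 define V' where "V' = insert v0 (t ` L')"
 define V where "V = insert v0 (t ` L)"
 have V: "V = insert (t x) V'" and tx: "t x \<notin> V'" "t (io x) : V'" "v0 : V'"
  unfolding V_def V'_def L_def L'_def using surface_words_cancel(2-)[OF S W] by blast+
 note S' = surface_words_NilD[OF S, folded L_def]
 have inv': "!!u. u : L' ==> io u : L'"
  using surface_words_NilD(2)[OF surface_words_cancel(1)[OF S W]] unfolding L'_def .
 have xL: "x : L" "io x : L" unfolding L_def W by auto
 have x: "io (io x) = x" "io x ~= x" using S' xL by auto
 have L: "L = insert x (insert (io x) L')" unfolding L_def L'_def W by auto
 have notin: "x \<notin> L'" "io x \<notin> L'" using S'(1) unfolding L'_def W by auto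
 have sub: "L' \<subseteq> L" unfolding L by auto
 define X where "X = cfg G io L []"
 define X' where "X' = cfg G io L' []"
 define \<Theta> where "\<Theta> = (%cf. \<Theta>' (restrict cf L'))"
 define \<tau> where "\<tau> = (%cf. (\<tau>' (restrict cf L'))(t x := \<tau>' (restrict cf L') (t (io x)) \<otimes> cf x))"
 have carr: "cf u : carrier G" if "cf : X" "u : L" for cf u
  using cfgD(1)[of cf G io L] that unfolding X_def by blast
 have rX: "restrict cf L' : X'" if "cf : X" for cf
  using that cfg_restrict[OF _ sub] inv' unfolding X_def X'_def by blast
 have hc: "hol G cf Z : carrier G" if "cf : X" "set Z \<subseteq> L" for cf Z
  using that carr by (intro hol_closed) auto
 have hc': "hol G cf Z : carrier G" if "cf : X'" "set Z \<subseteq> L'" for cf Z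
  using that cfgD(1)[of cf G io L'] unfolding X'_def by (intro hol_closed) auto
 have sol': "bij_betw (%cf. (\<Theta>' cf, \<tau>' cf)) X' (pair_lists G n \<times> based_maps G V' v0)"
  "!!cf. cf : X' ==> hol G cf (A @ B) = comm_prod G (\<Theta>' cf)"
  "!!cf a. cf : X' ==> a : V' \<rightarrow> carrier G ==>
   \<Theta>' (gauge G io t L' a cf) = map (map_prod (conj_by G (a v0)) (conj_by G (a v0))) (\<Theta>' cf)"
  "!!cf a v. cf : X' ==> a : V' \<rightarrow> carrier G ==> v : V' ==>
   \<tau>' (gauge G io t L' a cf) v = a v0 \<otimes> \<tau>' cf v \<otimes> inv a v"
  "2 * card V' + 4 * n = card L' + 2" using sol hc'[of _ "A @ B"] unfolding solves_def Let_def
  by (auto simp: all_letters_def L'_def V'_def X'_def)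
 have \<tau>T: "\<tau>' cf : based_maps G V' v0" if "cf : X'" for cf
  using sol'(1) that by (auto simp: bij_betw_def)
 have bij: "bij_betw (%cf. (\<Theta> cf, \<tau> cf)) X (pair_lists G n \<times> based_maps G V v0)"
 proof -
  have 1: "bij_betw (%cf. (restrict cf L', cf x)) X (X' \<times> carrier G)"
   unfolding X_def X'_def by (rule cfg_insert[OF notin x(2,1) L inv'])
  have 2: "bij_betw (%(cf, g). ((\<Theta>' cf, \<tau>' cf), id g)) (X' \<times> carrier G)
   ((pair_lists G n \<times> based_maps G V' v0) \<times> carrier G)"
   by (rule bij_betw_fibred[OF sol'(1), where g = "%_. id"]) auto
  have 3: "bij_betw (%((q, \<tau>), g). (q, (\<tau>, g)))
   ((pair_lists G n \<times> based_maps G V' v0) \<times> carrier G)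
   (pair_lists G n \<times> (based_maps G V' v0 \<times> carrier G))"
   by (rule bij_betw_byWitness[where f' = "%(q, (\<tau>, g)). ((q, \<tau>), g)"]) auto
  have 0: "bij_betw id (pair_lists G n) (pair_lists G n)" by simp
  have 4: "bij_betw (%(q, r). (id q, (%(\<tau>, g). \<tau>(t x := \<tau> (t (io x)) \<otimes> g)) r))
   (pair_lists G n \<times> (based_maps G V' v0 \<times> carrier G))
   (pair_lists G n \<times> based_maps G V v0)"
   unfolding V by (rule bij_betw_fibred[OF 0 bij_betw_based_maps_insert[OF tx(1,3,2)]])
  show ?thesis using bij_betw_trans[OF 1 bij_betw_trans[OF 2 bij_betw_trans[OF 3 4]]]
   by (simp add: comp_def \<Theta>_def \<tau>_def)
 qed
 have hol: "hol G cf W = comm_prod G (\<Theta> cf)" if cf: "cf : X" for cf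
 proof -
  have i: "cf (io x) = inv cf x" using cfgD(2)[of cf G io L "[]" x] cf xL unfolding X_def by blast
  have sl: "set A \<subseteq> L" "set B \<subseteq> L" unfolding L_def W by auto
  have h: "hol G cf (P @ Q) = hol G cf P \<otimes> hol G cf Q" if "set P \<subseteq> L" "set Q \<subseteq> L" for P Q
   using that carr[OF cf] by (intro hol_append) auto
  have "hol G cf W = hol G cf (A @ B)"
   unfolding W using sl xL carr[OF cf xL(1)] hc[OF cf sl(1)] hc[OF cf sl(2)] by (simp add: h i)
  also have "... = hol G (restrict cf L') (A @ B)" by (rule hol_cong) (simp add: L'_def)
  finally show ?thesis unfolding \<Theta>_def using sol'(2)[OF rX[OF cf]] by simp
 qed
 have gau: "\<Theta> (gauge G io t L a cf) = map (map_prod (conj_by G (a v0)) (conj_by G (a v0))) (\<Theta> cf)"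
  if cf: "cf : X" and a: "a : V \<rightarrow> carrier G" for cf a
  unfolding \<Theta>_def gauge_restrict[OF sub] by (rule sol'(3)[OF rX[OF cf]]) (use a V in auto)
 have gau': "\<tau> (gauge G io t L a cf) v = a v0 \<otimes> \<tau> cf v \<otimes> inv a v"
  if cf: "cf : X" and a: "a : V \<rightarrow> carrier G" and v: "v : V" for cf a v
 proof -
  have a': "a : V' \<rightarrow> carrier G" using a V by auto
  note g = sol'(4)[OF rX[OF cf] a']
  have c: "\<tau>' (restrict cf L') v : carrier G" if "v : V'" for v
   using based_mapsD(2)[OF \<tau>T[OF rX[OF cf]] that] .
  have ac: "a v0 : carrier G" "a (t x) : carrier G" "a (t (io x)) : carrier G" using a tx V by auto
  show ?thesis
  proof (cases "v = t x")
   case False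
   then have "v : V'" using v V by auto
   then show ?thesis using False g[of v] unfolding \<tau>_def gauge_restrict[OF sub] by simp
  next
   case True
   have "gauge G io t L a cf x = a (t (io x)) \<otimes> cf x \<otimes> inv a (t x)"
    using xL unfolding gauge_def by simp
   then show ?thesis using True g[OF tx(2)] c[OF tx(2)] carr[OF cf xL(1)] ac
    unfolding \<tau>_def gauge_restrict[OF sub] by (simp add: group_word_simps)
  qed
 qed
 have card: "card L = card L' + 2" "card V = card V' + 1"
 proof -
  have "finite L'" "finite V'" unfolding L'_def V'_def by auto
  then show "card L = card L' + 2" "card V = card V' + 1" unfolding L V using notin x tx by auto
 qed
 have compc: "comm_prod G (\<Theta> cf) : carrier G" if "cf : X" for cf
  using hol[OF that] hc[OF that, of W] L_def by auto
 have "solves G io t v0 W [] n \<Theta> \<tau>" unfolding solves_def Let_def using bij hol gau gau' card sol'(5) compc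
  by (auto simp: all_letters_def X_def L_def[symmetric] V_def[symmetric])
 then show ?thesis by blast
qed

text \<open>This is the sphere with one vertex. There is exactly one configuration, because elements
  of \<open>cfg\<close> are \<open>undefined\<close> off the letters.\<close>

lemma solves_empty: "solves G io t v0 [] [] 0 (%_. []) (%_. \<lambda>v\<in>{v0}. \<one>)"
proof -
 have "cfg G io {} [] = {%_. undefined}" unfolding cfg_def by auto
 moreover have "pair_lists G 0 = {[]}" unfolding pair_lists_def by auto
 moreover have "based_maps G {v0} v0 = {\<lambda>v\<in>{v0}. \<one>}"
 proof
  show "based_maps G {v0} v0 \<subseteq> {\<lambda>v\<in>{v0}. \<one>}"
  proof
   fix \<tau> assume "\<tau> : based_maps G {v0} v0"
   then have "\<tau> v = (\<lambda>v\<in>{v0}. \<one>) v" for v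
    using based_mapsD(1,3)[of \<tau> G "{v0}" v0] by (cases "v = v0") auto
   then show "\<tau> : {\<lambda>v\<in>{v0}. \<one>}" by auto
  qed
 qed (auto simp: based_maps_def)
 ultimately show ?thesis unfolding solves_def Let_def all_letters_def by (auto simp: bij_betw_def)
qed

lemma one_face_solution:
 assumes "surface_words io t v0 W ([] :: ('h list \<times> 'a) list)"
 shows "\<exists>n \<Theta> \<tau>. solves G io t v0 W [] n \<Theta> \<tau>" using assms
proof (induction W rule: length_induct)
 case (1 W)
 note S = \<open>surface_words io t v0 W []\<close>
 show ?case
 proof (cases "W = []")
  case True
  show ?thesis unfolding True by (intro exI) (rule solves_empty)
 next
  case False
  have "io u : set W \<and> io (io u) = u \<and> io u ~= u" if "u : set W" for u
   using surface_words_NilD(2-4)[OF S that] by blast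
  from distinct_closed_cases[OF surface_words_NilD(1)[OF S] False, of io, OF this]
  consider A x B where "W = A @ x # io x # B"
   | A x B y C D E where "W = A @ x # B @ y # C @ io x # D @ io y # E" by blast
  then show ?thesis
  proof cases
   case 1
   have "length (A @ B) < length W" using 1 by simp
   then obtain n \<Theta> \<tau> where "solves G io t v0 (A @ B) [] n \<Theta> \<tau>"
    using "1.IH" surface_words_cancel(1)[OF S 1] by blast
   then show ?thesis using solves_cancel[OF S 1] by blast
  next
   case 2
   have "length (A @ D @ C @ B @ E) < length W" using 2 by simp
   then obtain n \<Theta> \<tau> where "solves G io t v0 (A @ D @ C @ B @ E) [] n \<Theta> \<tau>"
    using "1.IH" surface_words_handle(1)[OF S 2] by blast
   then show ?thesis using solves_handle[OF S 2] by blast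
  qed
 qed
qed

end

section \<open>Several faces: merging across a shared edge\<close>

lemma surface_wordsD:
 assumes "surface_words io t v0 W Fs"
 shows "distinct (W @ concat (map fst Fs))"
  "u : all_letters W Fs ==> io u : all_letters W Fs"
  "u : all_letters W Fs ==> io (io u) = u" "u : all_letters W Fs ==> io u ~= u"
  "walk io t v0 W v0" "(F, z) : set Fs ==> F ~= []" "(F, z) : set Fs ==> \<exists>a. walk io t a F a"
  "walk io c a W a ==> (!!F z. (F, z) : set Fs ==> \<exists>b. walk io c b F b) ==>
   \<exists>k. k v0 = a \<and> (\<forall>u\<in>all_letters W Fs. c u = (k (t u) :: bool))"
  "(!!u. u : all_letters W Fs ==> d (io u) = (d u :: bool)) ==>
   (!!F u w. F : set (W # map fst Fs) ==> u : set F ==> w : set F ==> d u = d w) ==>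
   u : all_letters W Fs ==> w : all_letters W Fs ==> d u = d w"
  "W = [] ==> Fs = []"
proof -
 note a1 = assms[unfolded surface_words_def, THEN conjunct1]
 note b1 = assms[unfolded surface_words_def, THEN conjunct2]
 note a2 = b1[THEN conjunct1] note b2 = b1[THEN conjunct2]
 note a3 = b2[THEN conjunct1] note b3 = b2[THEN conjunct2]
 note a4 = b3[THEN conjunct1] note b4 = b3[THEN conjunct2]
 note a5 = b4[THEN conjunct1] note b5 = b4[THEN conjunct2]
 note a6 = b5[THEN conjunct1] note a7 = b5[THEN conjunct2]
 show "distinct (W @ concat (map fst Fs))" by (rule a1)
 show "u : all_letters W Fs ==> io u : all_letters W Fs" using a2 by blast
 show "u : all_letters W Fs ==> io (io u) = u" using a2 by blast
 show "u : all_letters W Fs ==> io u ~= u" using a2 by blast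
 show "walk io t v0 W v0" by (rule a3)
 show "(F, z) : set Fs ==> F ~= []" using a4 by blast
 show "(F, z) : set Fs ==> \<exists>a. walk io t a F a" using a4 by blast
 show "walk io c a W a ==> (!!F z. (F, z) : set Fs ==> \<exists>b. walk io c b F b) ==>
   \<exists>k. k v0 = a \<and> (\<forall>u\<in>all_letters W Fs. c u = (k (t u) :: bool))"
  by (rule a5[rule_format]) auto
 show "(!!u. u : all_letters W Fs ==> d (io u) = d u) ==>
   (!!F u w. F : set (W # map fst Fs) ==> u : set F ==> w : set F ==> d u = d w) ==>
   u : all_letters W Fs ==> w : all_letters W Fs ==> d u = d w"
  by (rule a6[rule_format]) blast+
 show "W = [] ==> Fs = []" using a7 by blast
qed

text \<open>Otherwise the letters of \<open>W\<close> are closed under \<open>io\<close>, and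
  membership in them is constant on edges and on faces. Connectedness then makes it constant
  altogether, although a second face exists and faces are nonempty.\<close>

lemma exists_shared_edge:
 assumes S: "surface_words io t v0 W Fs" and "Fs ~= []"
 shows "\<exists>A x C P Q z Fs1 Fs2. W = A @ x # C \<and> Fs = Fs1 @ (P @ io x # Q, z) # Fs2"
proof -
 note D = surface_wordsD[OF S]
 have "W ~= []" using D(10) assms(2) by blast
 have disj: "set F \<inter> set W = {}" if "(F, z) : set Fs" for F z using D(1) that by fastforce
 have "\<exists>x\<in>set W. io x \<notin> set W"
 proof (rule ccontr)
  assume "\<not> ?thesis"
  then have cl: "!!u. u : set W ==> io u : set W" by blast
  obtain F z where F: "(F, z) : set Fs" using assms(2) by (cases Fs) auto
  have u: "hd F : set F" "hd W : set W" using D(6)[OF F] \<open>W ~= []\<close> by auto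
  have uL: "hd F : all_letters W Fs" "hd W : all_letters W Fs" using u F unfolding all_letters_def by force+
  have "(hd F : set W) = (hd W : set W)"
  proof (rule D(9)[of "%u. u : set W", OF _ _ uL])
   show "(io u : set W) = (u : set W)" if "u : all_letters W Fs" for u
    using cl[of u] cl[of "io u"] D(3)[OF that] by metis
   show "(u : set W) = (w : set W)"
    if "F : set (W # map fst Fs)" "u : set F" "w : set F" for F u w using that disj by fastforce
  qed
  then show False using u disj[OF F] by blast
 qed
 then obtain x where x: "x : set W" "io x \<notin> set W" by blast
 then have "io x : all_letters W Fs" using D(2)[of x] unfolding all_letters_def by auto
 then obtain F z where F: "(F, z) : set Fs" "io x : set F" using x(2) unfolding all_letters_def by auto
 obtain A C where "W = A @ x # C" using x(1) by (meson split_list)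
 moreover obtain P Q where "F = P @ io x # Q" using F(2) by (meson split_list)
 moreover obtain Fs1 Fs2 where "Fs = Fs1 @ (F, z) # Fs2" using F(1) by (meson split_list)
 ultimately show ?thesis by blast
qed

text \<open>Deleting an edge between two different discs joins them to one disc. Its boundary is the
  first word with the second one, cut open at the edge, inserted in place of the letter. Both ends
  of the edge remain as junctions of the new word, so the vertices survive.\<close>

lemma surface_words_merge:
 assumes S: "surface_words io t v0 W Fs"
  and W: "W = A @ x # C" and Fs: "Fs = Fs1 @ (P @ io x # Q, z) # Fs2"
 shows "surface_words io t v0 (A @ Q @ P @ C) (Fs1 @ Fs2)"
  and "insert v0 (t ` all_letters W Fs) = insert v0 (t ` all_letters (A @ Q @ P @ C) (Fs1 @ Fs2))"
proof -
 let ?W = "A @ Q @ P @ C" let ?Fs = "Fs1 @ Fs2"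
 define L where "L = all_letters W Fs"
 define L' where "L' = all_letters ?W ?Fs"
 note D = surface_wordsD[OF S, folded L_def]
 have Fin: "(P @ io x # Q, z) : set Fs" unfolding Fs by simp
 have xL: "x : L" "io x : L" unfolding L_def all_letters_def W Fs by auto
 have x: "io (io x) = x" "io x ~= x" "x ~= io x" using D(3,4)[OF xL(1)] by auto
 have LL: "L = insert x (insert (io x) L')" unfolding L_def L'_def all_letters_def W Fs by auto
 have dist': "distinct (?W @ concat (map fst ?Fs))" and notin: "x \<notin> L'" "io x \<notin> L'"
  using D(1) unfolding W Fs L'_def all_letters_def by auto
 have L': "u : L' \<longleftrightarrow> u : L \<and> u ~= x \<and> u ~= io x" for u
  unfolding LL using notin by blast
 have inv': "io u : L'" if "u : L'" for u
 proof -
  have u: "u : L" "u ~= x" "u ~= io x" using that L' by auto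
  then have "io u : L" "io (io u) = u" using D(2,3) by auto
  then show ?thesis using u x unfolding L' by metis
 qed
 have sub: "set A \<subseteq> L'" "set C \<subseteq> L'" "set P \<subseteq> L'" "set Q \<subseteq> L'" unfolding L'_def all_letters_def by auto
 have walks: "walk io t v0 A (t (io x)) \<and> walk io t (t (io x)) Q r \<and> walk io t r P (t x) \<and>
   walk io t (t x) C v0" if "walk io t r (P @ io x # Q) r" for r
  using D(5) that unfolding W walk_append walk.simps x by blast
 then obtain r where r: "walk io t v0 A (t (io x))" "walk io t (t (io x)) Q r" "walk io t r P (t x)"
   "walk io t (t x) C v0" using D(7)[OF Fin] by blast
 have wk': "walk io t v0 ?W v0" unfolding walk_append using r by blast
 have "t (io x) : insert v0 (t ` set A)" using walk_end[OF r(1)] .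
 moreover have "walk io t v0 (A @ Q @ P) (t x)" unfolding walk_append using r by blast
 from walk_end[OF this] have "t x : insert v0 (t ` set (A @ Q @ P))" .
 moreover have "set (A @ Q @ P) \<subseteq> L'" using sub by simp
 ultimately have "t x : insert v0 (t ` L')" "t (io x) : insert v0 (t ` L')" using sub(1) by blast+
 then show "insert v0 (t ` all_letters W Fs) = insert v0 (t ` all_letters ?W ?Fs)"
  unfolding L_def[symmetric] L'_def[symmetric] LL image_insert by blast
 have link': "\<exists>k. k v0 = a \<and> (\<forall>u\<in>L'. c u = (k (t u) :: bool))"
  if c: "walk io c a ?W a" and cF: "!!F z. (F, z) : set ?Fs ==> \<exists>b. walk io c b F b" for c a
 proof -
  obtain p r q where w: "walk io c a A p" "walk io c p Q r" "walk io c r P q" "walk io c q C a"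
   using c unfolding walk_append by blast
  \<comment> \<open>The deleted letters take the values at the two cuts, before \<open>Q\<close> and
    after \<open>P\<close>.\<close>
  define c' where "c' = c(x := q, io x := p)"
  have eq: "c' u = c u" "c' (io u) = c (io u)" if "u : L'" for u
  proof -
   show "c' u = c u" using that unfolding L' c'_def by simp
   show "c' (io u) = c (io u)" using inv'[OF that] unfolding L' c'_def by simp
  qed
  have wc: "walk io c' p Z q \<longleftrightarrow> walk io c p Z q" if "set Z \<subseteq> L'" for p q Z
   by (intro walk_cong eq) (use that in auto)
  have c'x: "c' x = q" "c' (io x) = p" unfolding c'_def using x by auto
  have "walk io c' a W a" unfolding W walk_append walk.simps c'x wc[OF sub(1)] wc[OF sub(2)] using w by blast
  moreover have "\<exists>b. walk io c' b F b" if "(F, z') : set Fs" for F z'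
  proof -
   have "(F, z') = (P @ io x # Q, z) \<or> (F, z') : set ?Fs" using that unfolding Fs by auto
   then show ?thesis
   proof
    assume "(F, z') = (P @ io x # Q, z)"
    then have F: "F = P @ io x # Q" by simp
    have "walk io c' r F r" unfolding F walk_append walk.simps x c'x wc[OF sub(3)] wc[OF sub(4)] using w by blast
    then show ?thesis by blast
   next
    assume F: "(F, z') : set ?Fs"
    have "set F \<subseteq> L'" using F unfolding L'_def all_letters_def by force
    then show ?thesis using cF[OF F] wc by blast
   qed
  qed
  ultimately obtain k where k: "k v0 = a" "\<forall>u\<in>L. c' u = k (t u)" using D(8) by blast
  have "c u = k (t u)" if "u : L'" for u using k(2) eq(1)[OF that] that L' by metis
  then show ?thesis using k(1) by blast
 qed
 have con': "d u = (d w :: bool)"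
  if d: "!!u. u : L' ==> d (io u) = d u"
   and dF: "!!F u w. F : set (?W # map fst ?Fs) ==> u : set F ==> w : set F ==> d u = d w"
   and uw: "u : L'" "w : L'" for d u w
 proof -
  \<comment> \<open>If the merged word is empty, then \<open>W\<close> and the merged face consist
    of the two deleted letters alone, and any constant may be given to them.\<close>
  obtain e where e: "!!u. u : set ?W ==> d u = e"
  proof (cases "?W = []")
   case False
   then have "hd ?W : set ?W" by (rule hd_in_set)
   then show ?thesis using dF[of ?W] that[of "d (hd ?W)"] by (meson list.set_intros(1))
  qed (use that in auto)
  define d' where "d' = d(x := e, io x := e)"
  have d'x: "d' x = e" "d' (io x) = e" unfolding d'_def by auto
  have d': "d' u = d u" if "u : L'" for u using that unfolding L' d'_def by simp
  have "d' u = d' w"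
  proof (rule D(9))
   show "d' (io u) = d' u" if "u : L" for u
   proof (cases "u : L'")
    case True
    then show ?thesis using d inv' d' by simp
   next
    case False
    then have "u = x \<or> u = io x" using that LL by blast
    then show ?thesis using d'x x by auto
   qed
   show "u : L" "w : L" using uw L' by auto
   fix F u w assume F: "F : set (W # map fst Fs)" and u: "u : set F" and w: "w : set F"
   consider "F = W" | "F = P @ io x # Q" | "F : set (map fst ?Fs)" using F unfolding Fs by auto
   then show "d' u = d' w"
   proof cases
    case 3
    then have "set F \<subseteq> L'" unfolding L'_def all_letters_def by auto
    then show ?thesis using d' dF[of F u w] 3 u w by auto
   next
    case 1
    have "d' v = e" if "v : set F" for v using that e[of v] d'[of v] d'x sub unfolding 1 W by auto
    then show ?thesis using u w by blast
   next
    case 2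
    have "d' v = e" if "v : set F" for v using that e[of v] d'[of v] d'x sub unfolding 2 by auto
    then show ?thesis using u w by blast
   qed
  qed
  then show ?thesis using d' uw by simp
 qed
 \<comment> \<open>An empty merged word means \<open>W = [x]\<close> and a face
   \<open>[io x]\<close>. These already form a connected component, so no further face can
   exist.\<close>
 have ne': "?Fs = []" if "?W = []"
 proof (rule ccontr)
  assume "?Fs ~= []"
  then obtain F z' where F: "(F, z') : set ?Fs" by (cases ?Fs) auto
  have FL: "set F \<subseteq> L'" using F unfolding L'_def all_letters_def by force
  have h: "hd F : set F" using F D(6)[of F z'] unfolding Fs by auto
  have "(hd F : {x, io x}) = (x : {x, io x})"
  proof (rule D(9)[of "%u. u : {x, io x}"])
   show "(io u : {x, io x}) = (u : {x, io x})" if "u : L" for u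
    using x D(3)[OF that] by (metis insertE insertI1 insertI2 singletonD)
   show "hd F : L" "x : L" using h FL LL by auto
   fix F u w assume F: "F : set (W # map fst Fs)" and u: "u : set F" and w: "w : set F"
   have "A = []" "C = []" "P = []" "Q = []" using \<open>?W = []\<close> by auto
   then have "set F \<subseteq> {x, io x} \<or> F : set (map fst ?Fs)" using F unfolding W Fs by auto
   moreover have "set F \<subseteq> L'" if "F : set (map fst ?Fs)"
    using that unfolding L'_def all_letters_def by auto
   ultimately show "(u : {x, io x}) = (w : {x, io x})" using u w notin by blast
  qed
  moreover have "hd F ~= x" "hd F ~= io x" using subsetD[OF FL h] notin by metis+
  ultimately show False by simp
 qed
 show "surface_words io t v0 ?W ?Fs" unfolding surface_words_def L'_def[symmetric]
 proof (intro conjI ballI allI impI)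
  show "io u : L'" "io (io u) = u" "io u ~= u" if "u : L'" for u
   using inv'[OF that] D(3,4)[of u] that L' by auto
  show "case q of (F, z) => F ~= [] \<and> (\<exists>a. walk io t a F a)" if "q : set ?Fs" for q
  proof -
   obtain F z' where q: "q = (F, z')" by (cases q)
   have "(F, z') : set Fs" using that unfolding q Fs by auto
   then show ?thesis using D(6,7) unfolding q by blast
  qed
  show "\<exists>k. k v0 = a \<and> (\<forall>u\<in>L'. c u = (k (t u) :: bool))"
   if "walk io c a ?W a" "\<forall>(F, z)\<in>set ?Fs. \<exists>b. walk io c b F b" for c a
   by (rule link'[OF that(1)]) (use that(2) in blast)
  show "d u = (d w :: bool)" if "\<forall>u\<in>L'. d (io u) = d u"
   "\<forall>F\<in>set (?W # map fst ?Fs). \<forall>u\<in>set F. \<forall>w\<in>set F. d u = d w" "u : L'" "w : L'" for d u w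
   using con'[of d u w] that by blast
 qed (use dist' wk' ne' in blast)+
qed

context group
begin

lemma central_mult_left_commute:
 "central G z ==> x : carrier G ==> y : carrier G ==> x \<otimes> (z \<otimes> y) = z \<otimes> (x \<otimes> y)"
 "central G z ==> x : carrier G ==> x \<otimes> z = z \<otimes> x"
proof -
 show 1: "central G z ==> x : carrier G ==> x \<otimes> z = z \<otimes> x" by (simp add: central_def)
 show "central G z ==> x : carrier G ==> y : carrier G ==> x \<otimes> (z \<otimes> y) = z \<otimes> (x \<otimes> y)"
  using m_assoc[of x z y] m_assoc[of z x y] 1 unfolding central_def by metis
qed

lemma prod_central_faces:
 fixes Fs1 :: "('h list \<times> 'a) list"
 assumes "\<forall>(F, z)\<in>set (Fs1 @ (F, z) # Fs2). central G z"
 shows "foldr (%q. (\<otimes>) (snd q)) (Fs1 @ (F, z) # Fs2) \<one> =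
   z \<otimes> foldr (%q. (\<otimes>) (snd q)) (Fs1 @ Fs2) \<one>"
  and "foldr (%q. (\<otimes>) (snd q)) (Fs1 @ Fs2) \<one> : carrier G"
proof -
 have cl: "foldr (%q. (\<otimes>) (snd q)) Fs \<one> : carrier G" if "\<forall>(F, z)\<in>set Fs. central G z" for Fs :: "('h list \<times> 'a) list"
  using that by (induction Fs) (auto simp: central_def)
 show "foldr (%q. (\<otimes>) (snd q)) (Fs1 @ Fs2) \<one> : carrier G" by (rule cl) (use assms in auto)
 show "foldr (%q. (\<otimes>) (snd q)) (Fs1 @ (F, z) # Fs2) \<one> = z \<otimes> foldr (%q. (\<otimes>) (snd q)) (Fs1 @ Fs2) \<one>"
  using assms
 proof (induction Fs1)
  case (Cons q Fs1)
  have "central G z" "central G (snd q)" using Cons.prems by (auto simp: case_prod_unfold)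
  moreover have "foldr (%q. (\<otimes>) (snd q)) (Fs1 @ Fs2) \<one> : carrier G"
   by (rule cl) (use Cons.prems in auto)
  moreover have "foldr (%q. (\<otimes>) (snd q)) (Fs1 @ (F, z) # Fs2) \<one> =
    z \<otimes> foldr (%q. (\<otimes>) (snd q)) (Fs1 @ Fs2) \<one>"
   by (rule Cons.IH) (use Cons.prems in auto)
  ultimately show ?case
   using central_mult_left_commute(1)[of z "snd q" "foldr (%q. (\<otimes>) (snd q)) (Fs1 @ Fs2) \<one>"]
   unfolding central_def by simp
 qed simp
qed

lemma central_inv: "central G z ==> central G (inv z)"
 unfolding central_def by (metis inv_closed inv_comm inv_mult_group inv_inv)

text \<open>The condition P x^-1 Q = z can be solved for x, so the constraint of the face and the
  coordinate of the shared edge cancel each other.\<close>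

lemma cfg_merge:
 assumes L: "L = insert x (insert (io x) L')" and notin: "x \<notin> L'" "io x \<notin> L'"
  and x: "io x ~= x" "io (io x) = x" and inv': "!!u. u : L' ==> io u : L'"
  and z: "central G z" and sub: "set P \<subseteq> L'" "set Q \<subseteq> L'"
  and sub': "!!F z. (F, z) : set (Fs1 @ Fs2) ==> set F \<subseteq> L'"
 shows "bij_betw (%cf. restrict cf L') (cfg G io L (Fs1 @ (P @ io x # Q, z) # Fs2))
   (cfg G io L' (Fs1 @ Fs2))"
  and "cf : cfg G io L (Fs1 @ (P @ io x # Q, z) # Fs2) ==>
   cf x = hol G cf Q \<otimes> (inv z \<otimes> hol G cf P)"
proof -
 let ?Fs = "Fs1 @ (P @ io x # Q, z) # Fs2" let ?Fs' = "Fs1 @ Fs2"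
 have zc: "z : carrier G" "central G (inv z)" using z central_inv by (auto simp: central_def)
 have b: "bij_betw (%cf. (restrict cf L', cf x)) (cfg G io L []) (cfg G io L' [] \<times> carrier G)"
  by (rule cfg_insert[OF notin x L inv'])
 have hr: "hol G (restrict cf L') F = hol G cf F" if "set F \<subseteq> L'" for cf F
  using that by (intro hol_cong) auto
 have face: "hol G cf (P @ io x # Q) = z \<longleftrightarrow> cf x = hol G cf Q \<otimes> (inv z \<otimes> hol G cf P)"
  if cf: "cf : cfg G io L []" for cf
 proof -
  note c = cfgD(1)[OF cf]
  have "!!u. u : L' ==> u : L" unfolding L by blast
  then have pq: "hol G cf P : carrier G" "hol G cf Q : carrier G" using sub c by (intro hol_closed; blast)+
  have g: "cf x : carrier G" "cf (io x) = inv cf x" using c[of x] cfgD(2)[OF cf, of x] L by auto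
  have "hol G cf (P @ io x # Q) = hol G cf P \<otimes> (inv cf x \<otimes> hol G cf Q)"
   using c sub g unfolding L by (subst hol_append) auto
  moreover have "hol G cf P \<otimes> (inv cf x \<otimes> hol G cf Q) = z \<longleftrightarrow>
   cf x = hol G cf Q \<otimes> (inv z \<otimes> hol G cf P)"
  proof
   assume "hol G cf P \<otimes> (inv cf x \<otimes> hol G cf Q) = z"
   from this[symmetric] show "cf x = hol G cf Q \<otimes> (inv z \<otimes> hol G cf P)"
    using pq g by (simp add: group_word_simps)
  next
   assume e: "cf x = hol G cf Q \<otimes> (inv z \<otimes> hol G cf P)"
   have "hol G cf P \<otimes> (inv (hol G cf Q \<otimes> (inv z \<otimes> hol G cf P)) \<otimes> hol G cf Q) = z"
    using pq g zc z by (simp add: group_word_simps)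
   then show "hol G cf P \<otimes> (inv cf x \<otimes> hol G cf Q) = z" unfolding e .
  qed
  ultimately show ?thesis by simp
 qed
 show val: "cf x = hol G cf Q \<otimes> (inv z \<otimes> hol G cf P)" if "cf : cfg G io L ?Fs" for cf
  using that face[of cf] cfg_iff[of cf G io L ?Fs] by auto
 show "bij_betw (%cf. restrict cf L') (cfg G io L ?Fs) (cfg G io L' ?Fs')"
 proof (rule bij_betw_imageI)
  show "inj_on (%cf. restrict cf L') (cfg G io L ?Fs)"
  proof (rule inj_onI)
   fix cf cf' assume g: "cf : cfg G io L ?Fs" "cf' : cfg G io L ?Fs" and e: "restrict cf L' = restrict cf' L'"
   have "cf x = cf' x" unfolding val[OF g(1)] val[OF g(2)]
    using hr[OF sub(1), of cf] hr[OF sub(1), of cf'] hr[OF sub(2), of cf] hr[OF sub(2), of cf'] e by simp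
   moreover have "cf : cfg G io L []" "cf' : cfg G io L []" using g cfg_iff[of _ G io L ?Fs] by blast+
   ultimately show "cf = cf'" using b e unfolding bij_betw_def inj_on_def by blast
  qed
  show "(%cf. restrict cf L') ` cfg G io L ?Fs = cfg G io L' ?Fs'"
  proof
   show "(%cf. restrict cf L') ` cfg G io L ?Fs \<subseteq> cfg G io L' ?Fs'"
   proof
    fix cf' assume "cf' : (%cf. restrict cf L') ` cfg G io L ?Fs"
    then obtain cf where cf: "cf : cfg G io L ?Fs" "cf' = restrict cf L'" by blast
    have "cf : cfg G io L []" using cf(1) cfg_iff[of cf G io L ?Fs] by blast
    then have "restrict cf L' : cfg G io L' []" by (rule cfg_restrict) (use L inv' in auto)
    moreover have "hol G (restrict cf L') F = z'" if "(F, z') : set ?Fs'" for F z'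
     using hr[OF sub'[OF that]] cfgD(4)[OF cf(1), of F z'] that by auto
    ultimately show "cf' : cfg G io L' ?Fs'" using cf(2) cfg_iff[of cf' G io L' ?Fs'] by blast
   qed
   show "cfg G io L' ?Fs' \<subseteq> (%cf. restrict cf L') ` cfg G io L ?Fs"
   proof
    fix cf' assume cf': "cf' : cfg G io L' ?Fs'"
    let ?g = "hol G cf' Q \<otimes> (inv z \<otimes> hol G cf' P)"
    have "hol G cf' P : carrier G" "hol G cf' Q : carrier G"
     using sub cfgD(1)[OF cf'] by (intro hol_closed; blast)+
    then have "?g : carrier G" using zc by simp
    moreover have "cf' : cfg G io L' []" using cf' cfg_iff[of cf' G io L' ?Fs'] by blast
    ultimately have "(cf', ?g) : (%cf. (restrict cf L', cf x)) ` cfg G io L []"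
     using b unfolding bij_betw_def by blast
    then obtain cf where cf0: "(cf', ?g) = (restrict cf L', cf x)" "cf : cfg G io L []" by (rule imageE)
    then have cf: "cf : cfg G io L []" "restrict cf L' = cf'" "cf x = ?g" by (auto simp only: prod.inject)
    have "hol G cf (P @ io x # Q) = z"
     unfolding face[OF cf(1)] cf(3) cf(2)[symmetric] hr[OF sub(1)] hr[OF sub(2)] ..
    moreover have "hol G cf F = z'" if "(F, z') : set ?Fs'" for F z'
     using hr[OF sub'[OF that], of cf] cfgD(4)[OF cf' that] cf(2) by simp
    ultimately have "cf : cfg G io L ?Fs" using cf(1) cfg_iff[of cf G io L ?Fs] by auto
    then show "cf' : (%cf. restrict cf L') ` cfg G io L ?Fs" using cf(2) by blast
   qed
  qed
 qed
qed

text \<open>Substituting x = Q z^-1 P turns A x C into z^-1 (A Q P C), as \<open>z\<close> is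
  central. The factor z^-1 is compensated by the additional \<open>z\<close> in the product of the
  face values, so handle data and transports of the merged word can be taken over unchanged.\<close>

lemma solves_merge:
 assumes S: "surface_words io t v0 W Fs"
  and W: "W = A @ x # C" and Fs: "Fs = Fs1 @ (P @ io x # Q, z) # Fs2"
  and zs: "\<forall>(F, z)\<in>set Fs. central G z"
  and sol: "solves G io t v0 (A @ Q @ P @ C) (Fs1 @ Fs2) n \<Theta>' \<tau>'"
 shows "\<exists>\<Theta> \<tau>. solves G io t v0 W Fs n \<Theta> \<tau>"
proof -
 let ?W' = "A @ Q @ P @ C" let ?Fs' = "Fs1 @ Fs2"
 define L where "L = all_letters W Fs"
 define L' where "L' = all_letters ?W' ?Fs'"
 define V where "V = insert v0 (t ` L')"
 have V: "V = insert v0 (t ` L)" unfolding V_def L_def L'_def using surface_words_merge(2)[OF S W Fs] by simp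
 note D = surface_wordsD[OF S, folded L_def]
 have inv': "!!u. u : L' ==> io u : L'"
  using surface_wordsD(2)[OF surface_words_merge(1)[OF S W Fs]] unfolding L'_def .
 have xL: "x : L" "io x : L" unfolding L_def all_letters_def W Fs by auto
 have x: "io x ~= x" "io (io x) = x" using D(3,4)[OF xL(1)] by auto
 have L: "L = insert x (insert (io x) L')" unfolding L_def L'_def all_letters_def W Fs by auto
 have notin: "x \<notin> L'" "io x \<notin> L'" using D(1) unfolding W Fs L'_def all_letters_def by auto
 have sub: "set A \<subseteq> L'" "set C \<subseteq> L'" "set P \<subseteq> L'" "set Q \<subseteq> L'" unfolding L'_def all_letters_def by auto
 have sub': "set F \<subseteq> L'" if "(F, z') : set ?Fs'" for F z'
  using that unfolding L'_def all_letters_def by force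
 have z: "central G z" using zs unfolding Fs by simp
 have zc: "z : carrier G" "central G (inv z)" using z central_inv by (auto simp: central_def)
 define X where "X = cfg G io L Fs"
 define X' where "X' = cfg G io L' ?Fs'"
 have bij: "bij_betw (%cf. restrict cf L') X X'"
  unfolding X_def X'_def Fs by (rule cfg_merge(1)[OF L notin x inv' z sub(3,4) sub'])
 have val: "cf x = hol G cf Q \<otimes> (inv z \<otimes> hol G cf P)" if "cf : X" for cf
  by (rule cfg_merge(2)[OF L notin x inv' z sub(3,4) sub' that[unfolded X_def Fs]])
 have rX: "restrict cf L' : X'" if "cf : X" for cf using bij that by (auto simp: bij_betw_def)
 have sub2: "L' \<subseteq> L" unfolding L by blast
 define \<Theta> where "\<Theta> = (%cf. \<Theta>' (restrict cf L'))"
 define \<tau> where "\<tau> = (%cf. \<tau>' (restrict cf L'))"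
 let ?z' = "foldr (%q. (\<otimes>) (snd q)) ?Fs' \<one>"
 note sol' = sol[unfolded solves_def Let_def, folded L'_def, folded V_def X'_def]
 have "bij_betw (%cf. (\<Theta> cf, \<tau> cf)) X (pair_lists G n \<times> based_maps G V v0)"
  using bij_betw_trans[OF bij conjunct1[OF sol']] by (simp add: comp_def \<Theta>_def \<tau>_def)
 moreover have "hol G cf W \<otimes> foldr (%q. (\<otimes>) (snd q)) Fs \<one> = comm_prod G (\<Theta> cf)" if cf: "cf : X" for cf
 proof -
  note pz = prod_central_faces[OF zs[unfolded Fs]]
  have c: "cf u : carrier G" if "u : L" for u using cfgD(1)[of cf G io L Fs] that cf unfolding X_def by blast
  have hc: "hol G cf Z : carrier G" if "Z : {A, C, P, Q}" for Z
   using that sub c sub2 by (intro hol_closed) blast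
  have h: "hol G cf (Y @ Z) = hol G cf Y \<otimes> hol G cf Z" if "set Y \<subseteq> L" "set Z \<subseteq> L" for Y Z
   using that c by (intro hol_append) auto
  have s: "set Z \<subseteq> L" if "Z : {A, C, P, Q}" for Z using that sub sub2 by blast
  have "hol G cf W = hol G cf A \<otimes> (cf x \<otimes> hol G cf C)" unfolding W using s xL by (simp add: h)
  also have "... = inv z \<otimes> hol G cf ?W'" unfolding val[OF cf] using s hc zc(1)
   by (simp add: h m_assoc central_mult_left_commute[OF zc(2)])
  finally have "hol G cf W \<otimes> (z \<otimes> ?z') = hol G cf ?W' \<otimes> ?z'"
   using s hc zc(1) pz(2) by (simp add: h m_assoc central_mult_left_commute(1)[OF z])
  also have "... = hol G (restrict cf L') ?W' \<otimes> ?z'"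
   using sub by (subst hol_cong[of ?W' cf "restrict cf L'" G]) auto
  also have "... = comm_prod G (\<Theta> cf)" using sol' rX[OF cf] unfolding \<Theta>_def by blast
  finally show ?thesis unfolding Fs pz(1) .
 qed
 moreover have "\<Theta> (gauge G io t L a cf) = map (map_prod (conj_by G (a v0)) (conj_by G (a v0))) (\<Theta> cf)"
  "\<forall>v\<in>V. \<tau> (gauge G io t L a cf) v = a v0 \<otimes> \<tau> cf v \<otimes> inv a v"
  if cf: "cf : X" and a: "a : V \<rightarrow> carrier G" for cf a
  using sol' rX[OF cf] a unfolding \<Theta>_def \<tau>_def gauge_restrict[OF sub2] by blast+
 moreover have "2 * card V + 2 * length Fs + 4 * n = card L + 2"
 proof -
  have "finite L'" unfolding L'_def all_letters_def by simp
  then have "card L = card L' + 2" unfolding L using notin x by auto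
  moreover have "2 * card V + 2 * length ?Fs' + 4 * n = card L' + 2" using sol' by blast
  ultimately show ?thesis unfolding Fs by simp
 qed
 ultimately have "solves G io t v0 W Fs n \<Theta> \<tau>"
  unfolding solves_def Let_def L_def[symmetric] V[symmetric] X_def[symmetric] by blast
 then show ?thesis by blast
qed

theorem surface_solution:
 assumes "surface_words io t v0 W Fs" "\<forall>(F, z)\<in>set Fs. central G z"
 shows "\<exists>n \<Theta> \<tau>. solves G io t v0 W Fs n \<Theta> \<tau>" using assms
proof (induction Fs arbitrary: W rule: length_induct)
 case (1 Fs)
 show ?case
 proof (cases "Fs = []")
  case True
  then show ?thesis using one_face_solution[of io t v0 W] 1(2) by simp
 next
  case False
  then obtain A x C P Q z Fs1 Fs2
   where *: "W = A @ x # C" "Fs = Fs1 @ (P @ io x # Q, z) # Fs2" using exists_shared_edge[OF 1(2)] by blast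
  have "length (Fs1 @ Fs2) < length Fs" "\<forall>(F, z)\<in>set (Fs1 @ Fs2). central G z" using 1(3) * by auto
  then obtain n \<Theta> \<tau> where "solves G io t v0 (A @ Q @ P @ C) (Fs1 @ Fs2) n \<Theta> \<tau>"
   using 1(1) surface_words_merge(1)[OF 1(2) *] by blast
  then show ?thesis using solves_merge[OF 1(2) * 1(3)] by blast
 qed
qed

end

section \<open>Homomorphisms from the central extension\<close>

lemma words_append: "u @ v : words S \<longleftrightarrow> u : words S \<and> v : words S"
 unfolding words_def by auto

lemma words_Cons: "(s, b) # u : words S \<longleftrightarrow> s : S \<and> u : words S"
 unfolding words_def by auto

lemma words_Nil: "[] : words S" unfolding words_def by auto

lemma word_eq_words: "word_eq S R u v ==> u : words S \<and> v : words S"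
 by (induction rule: word_eq.induct) (auto simp: words_append words_Cons words_Nil)

lemma word_eq_append_left: "word_eq S R u v ==> w : words S ==> word_eq S R (w @ u) (w @ v)"
proof (induction rule: word_eq.induct)
 case (cancel u v s b)
 then show ?case using word_eq.cancel[of "w @ u" S v s R b] by (simp add: words_append)
next
 case (relator u v r)
 then show ?case using word_eq.relator[of "w @ u" S v r R] by (simp add: words_append)
qed (auto intro: word_eq.refl word_eq.sym word_eq.trans simp: words_append)

lemma word_eq_append_right: "word_eq S R u v ==> w : words S ==> word_eq S R (u @ w) (v @ w)"
proof (induction rule: word_eq.induct)
 case (cancel u v s b)
 then show ?case using word_eq.cancel[of u S "v @ w" s R b] by (simp add: words_append)
next
 case (relator u v r)
 then show ?case using word_eq.relator[of u S "v @ w" r R] by (simp add: words_append)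
qed (auto intro: word_eq.refl word_eq.sym word_eq.trans simp: words_append)

lemma word_class_eq: "word_eq S R u v ==> word_class S R u = word_class S R v"
 unfolding word_class_def using word_eq.sym word_eq.trans by blast

lemma word_class_self: "u : words S ==> u : word_class S R u"
 unfolding word_class_def using word_eq.refl by blast

text \<open>The product is a union over all representatives; since \<open>word_eq\<close> is a
  congruence, all members of this union coincide.\<close>

lemma presented_group_mult:
 assumes "u : words S" "v : words S"
 shows "word_class S R u \<otimes>\<^bsub>presented_group S R\<^esub> word_class S R v = word_class S R (u @ v)"
proof -
 have "word_class S R (u' @ v') = word_class S R (u @ v)"
  if "u' : word_class S R u" "v' : word_class S R v" for u' v'
 proof -
  have e: "word_eq S R u u'" "word_eq S R v v'" using that unfolding word_class_def by auto
  then have "word_eq S R (u @ v) (u' @ v')"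
   using word_eq_append_right[OF e(1) assms(2)] word_eq_append_left[OF e(2)] word_eq_words[OF e(1)]
   by (blast intro: word_eq.trans)
  then show ?thesis using word_class_eq by metis
 qed
 then have "(\<Union>u'\<in>word_class S R u. \<Union>v'\<in>word_class S R v. word_class S R (u' @ v')) =
   (\<Union>u'\<in>word_class S R u. \<Union>v'\<in>word_class S R v. word_class S R (u @ v))" by simp
 also have "... = word_class S R (u @ v)" using word_class_self[OF assms(1)] word_class_self[OF assms(2)] by blast
 finally show ?thesis unfolding presented_group_def by simp
qed

lemma carrier_presented_group: "carrier (presented_group S R) = word_class S R ` words S"
 unfolding presented_group_def by simp

definition letter_val :: "('g, 'b) monoid_scheme => ('s => 'g) => 's \<times> bool => 'g" where
 "letter_val G \<sigma> = (%(s, b). if b then \<sigma> s else inv\<^bsub>G\<^esub> \<sigma> s)"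

definition hom_of ::
 "('g, 'b) monoid_scheme => 's set => 's word set => ('s => 'g) => 's word set => 'g" where
 "hom_of G S R \<sigma> = (\<lambda>A\<in>carrier (presented_group S R). hol G (letter_val G \<sigma>) (SOME u. u : A))"

text \<open>The pair for the handle \<open>i\<close> consists of the values of \<beta>_i and of
  \<alpha>_i^-1, because the relator uses the commutators [\<beta>_i, \<alpha>_i^-1] whereas
  \<open>comm_prod\<close> takes the commutators of the pairs themselves.\<close>

definition pair_gens :: "('g, 'b) monoid_scheme => 'g => ('g \<times> 'g) list => surface_gen => 'g" where
 "pair_gens G z qs = (%s. case s of Alpha i => inv\<^bsub>G\<^esub> snd (qs ! (i - 1)) | Beta i => fst (qs ! (i - 1))
  | Central => z)"

definition hom_of_pairs ::
 "('g, 'b) monoid_scheme => nat => 'g => ('g \<times> 'g) list => surface_gen word set => 'g" where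
 "hom_of_pairs G g z qs = hom_of G (surface_gens g) (surface_relators g) (pair_gens G z qs)"

definition pairs_with_product ::
 "('g, 'b) monoid_scheme => nat => 'g => ('g \<times> 'g) list set" where
 "pairs_with_product G g z = {qs : pair_lists G g. comm_prod G qs = z}"

definition homs_with_value ::
 "('g, 'b) monoid_scheme => nat => 'g => (surface_gen word set => 'g) set" where
 "homs_with_value G g z = {f : Hom_grp (surface_ext g) G. f (surface_ext_central g) = z}"

lemma surface_ext_central_carrier: "surface_ext_central g : carrier (surface_ext g)"
 unfolding surface_ext_central_def surface_ext_def carrier_presented_group
 by (rule imageI) (simp add: words_def surface_gens_def)

context group
begin

lemma letter_val_closed:
 "\<sigma> : S \<rightarrow> carrier G ==> u : words S ==> w : set u ==> letter_val G \<sigma> w : carrier G"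
 unfolding letter_val_def words_def by fastforce

lemma hol_word_append:
 "\<sigma> : S \<rightarrow> carrier G ==> u : words S ==> v : words S ==>
  hol G (letter_val G \<sigma>) (u @ v) = hol G (letter_val G \<sigma>) u \<otimes> hol G (letter_val G \<sigma>) v"
 by (rule hol_append) (auto intro: letter_val_closed)

lemma hol_word_closed:
 "\<sigma> : S \<rightarrow> carrier G ==> u : words S ==> hol G (letter_val G \<sigma>) u : carrier G"
 by (rule hol_closed) (rule letter_val_closed)

text \<open>Von Dyck's criterion: evaluation of words always respects free cancellation, so it
  descends to the presented group once the relators evaluate to one.\<close>

lemma word_eq_hol:
 assumes \<sigma>: "\<sigma> : S \<rightarrow> carrier G"
  and R: "!!r. r : R ==> r : words S ==> hol G (letter_val G \<sigma>) r = \<one>"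
 shows "word_eq S R u v ==> hol G (letter_val G \<sigma>) u = hol G (letter_val G \<sigma>) v"
proof (induction rule: word_eq.induct)
 case (cancel u v s b)
 have w: "[(s, b), (s, \<not> b)] : words S" using cancel by (auto simp: words_def)
 have "\<sigma> s : carrier G" using \<sigma> cancel by auto
 then have "hol G (letter_val G \<sigma>) [(s, b), (s, \<not> b)] = \<one>" unfolding letter_val_def by (cases b) auto
 moreover have "[(s, b), (s, \<not> b)] @ v : words S" using w cancel words_append by blast
 note hol_word_append[OF \<sigma> cancel(1) this]
 ultimately show ?case using hol_word_append[OF \<sigma> w cancel(2)]
   hol_word_append[OF \<sigma> cancel(1,2)] hol_word_closed[OF \<sigma> cancel(2)] by (metis l_one)
next
 case (relator u v r)
 then show ?case using hol_word_append[OF \<sigma> relator(1), of "r @ v"] hol_word_append[OF \<sigma> relator(4,2)]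
   hol_word_append[OF \<sigma> relator(1,2)] hol_word_closed[OF \<sigma> relator(2)] R[of r]
  by (simp add: words_append)
qed auto

lemma hom_of_class:
 assumes \<sigma>: "\<sigma> : S \<rightarrow> carrier G"
  and R: "!!r. r : R ==> r : words S ==> hol G (letter_val G \<sigma>) r = \<one>"
  and u: "u : words S"
 shows "hom_of G S R \<sigma> (word_class S R u) = hol G (letter_val G \<sigma>) u"
proof -
 have "(SOME v. v : word_class S R u) : word_class S R u" using word_class_self[OF u] by (rule someI)
 then have "word_eq S R u (SOME v. v : word_class S R u)" unfolding word_class_def by simp
 from word_eq_hol[OF \<sigma> R this] show ?thesis unfolding hom_of_def carrier_presented_group using u by simp
qed

lemma hom_of_hom:
 assumes \<sigma>: "\<sigma> : S \<rightarrow> carrier G"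
  and R: "!!r. r : R ==> r : words S ==> hol G (letter_val G \<sigma>) r = \<one>"
 shows "hom_of G S R \<sigma> : Hom_grp (presented_group S R) G"
proof -
 have c: "hom_of G S R \<sigma> (word_class S R u) = hol G (letter_val G \<sigma>) u" if "u : words S" for u
  by (rule hom_of_class[OF \<sigma> R that])
 have "hom_of G S R \<sigma> : hom (presented_group S R) G"
 proof (rule homI)
  fix A assume "A : carrier (presented_group S R)"
  then obtain u where u: "u : words S" "A = word_class S R u" unfolding carrier_presented_group by auto
  then show "hom_of G S R \<sigma> A : carrier G" using c[OF u(1)] hol_word_closed[OF \<sigma> u(1)] by simp
  fix B assume "B : carrier (presented_group S R)"
  then obtain v where v: "v : words S" "B = word_class S R v" unfolding carrier_presented_group by auto
  have uv: "u @ v : words S" using u v by (simp add: words_append)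
  show "hom_of G S R \<sigma> (A \<otimes>\<^bsub>presented_group S R\<^esub> B) = hom_of G S R \<sigma> A \<otimes> hom_of G S R \<sigma> B"
   unfolding u(2) v(2) presented_group_mult[OF u(1) v(1)]
    c[OF u(1)] c[OF v(1)] c[OF uv] by (rule hol_word_append[OF \<sigma> u(1) v(1)])
 qed
 then show ?thesis unfolding Hom_grp_def hom_of_def by auto
qed

text \<open>The converse of \<open>hom_of_class\<close>. It gives surjectivity of the
  parametrisation by pairs, and later the finiteness of the set of homomorphisms.\<close>

lemma hom_class:
 assumes f: "f : hom (presented_group S R) G"
 defines "\<sigma> \<equiv> %s. f (word_class S R [(s, True)])"
 shows "u : words S ==> f (word_class S R u) = hol G (letter_val G \<sigma>) u"
  and "\<sigma> : S \<rightarrow> carrier G"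
proof -
 have cl: "f (word_class S R u) : carrier G" if "u : words S" for u
  using f that unfolding hom_def carrier_presented_group by auto
 have mult: "f (word_class S R (u @ v)) = f (word_class S R u) \<otimes> f (word_class S R v)"
  if "u : words S" "v : words S" for u v using hom_mult[OF f, of "word_class S R u" "word_class S R v"] that
  unfolding carrier_presented_group by (simp add: presented_group_mult)
 \<comment> \<open>The group axioms are not established for the presented group, only its product.
   The class of the empty word is idempotent, hence so is its image, and in \<open>G\<close> this
   forces \<one>.\<close>
 have "f (word_class S R []) \<otimes> f (word_class S R []) = f (word_class S R [])"
  using mult[OF words_Nil words_Nil] by simp
 then have one: "f (word_class S R []) = \<one>" using cl[OF words_Nil] by (simp add: l_cancel_one)
 show \<sigma>: "\<sigma> : S \<rightarrow> carrier G" unfolding \<sigma>_def using cl by (auto simp: words_def)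
 have letter: "f (word_class S R [(s, b)]) = letter_val G \<sigma> (s, b)" if s: "s : S" for s b
 proof (cases b)
  case False
  have w: "[(s, True)] : words S" "[(s, False)] : words S" using s by (auto simp: words_def)
  have "word_eq S R ([] @ [(s, False), (s, \<not> False)] @ []) ([] @ [])"
   by (rule word_eq.cancel) (auto simp: words_Nil s)
  then have "word_class S R [(s, False), (s, True)] = word_class S R []" by (simp add: word_class_eq)
  then have "f (word_class S R [(s, False)]) \<otimes> \<sigma> s = \<one>"
   using mult[OF w(2,1)] one unfolding \<sigma>_def by simp
  then have "f (word_class S R [(s, False)]) = inv \<sigma> s"
   using cl[OF w(2)] cl[OF w(1)] unfolding \<sigma>_def by (intro inv_equality[symmetric])
  then show ?thesis using False unfolding letter_val_def by simp
 qed (simp add: letter_val_def \<sigma>_def)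
 show "u : words S ==> f (word_class S R u) = hol G (letter_val G \<sigma>) u"
 proof (induction u)
  case (Cons w u)
  obtain s b where w: "w = (s, b)" by (cases w)
  have s: "s : S" "u : words S" using Cons.prems unfolding w words_Cons by auto
  have "[(s, b)] : words S" using s by (auto simp: words_def)
  from mult[OF this s(2)] show ?case using letter[OF s(1), of b] Cons.IH s(2) unfolding w by simp
 qed (simp add: one)
qed

text \<open>The offset \<open>k\<close> is what the induction on the list runs on: the tail
  satisfies the same statement with offset \<open>Suc k\<close>.\<close>

lemma hol_commutators:
 assumes "!!i. i < length qs ==> fst (qs ! i) : carrier G \<and> snd (qs ! i) : carrier G \<and>
   \<sigma> (Beta (Suc (k + i))) = fst (qs ! i) \<and> \<sigma> (Alpha (Suc (k + i))) = inv snd (qs ! i)"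
 shows "hol G (letter_val G \<sigma>) (concat (map (%i. word_commutator (Beta i, True) (Alpha i, False))
   (rev [Suc k..<Suc k + length qs]))) = comm_prod G qs"
 using assms
proof (induction qs arbitrary: k)
 case (Cons q qs)
 let ?c = "%i. word_commutator (Beta i, True) (Alpha i, False)"
 let ?u = "concat (map ?c (rev [Suc (Suc k)..<Suc (Suc k) + length qs]))"
 have IH: "hol G (letter_val G \<sigma>) ?u = comm_prod G qs"
 proof (rule Cons.IH)
  fix i assume "i < length qs"
  then show "fst (qs ! i) : carrier G \<and> snd (qs ! i) : carrier G \<and>
   \<sigma> (Beta (Suc (Suc k + i))) = fst (qs ! i) \<and> \<sigma> (Alpha (Suc (Suc k + i))) = inv snd (qs ! i)"
   using Cons.prems[of "Suc i"] by simp
 qed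
 have q: "fst q : carrier G" "snd q : carrier G" "\<sigma> (Beta (Suc k)) = fst q"
  "\<sigma> (Alpha (Suc k)) = inv snd q" using Cons.prems[of 0] by auto
 have cq: "hol G (letter_val G \<sigma>) (?c (Suc k)) = fst q \<otimes> snd q \<otimes> inv fst q \<otimes> inv snd q"
  using q by (simp add: word_commutator_def letter_val_def m_assoc)
 have vals: "letter_val G \<sigma> w : carrier G" if w: "w : set (?c (Suc k)) \<union> set ?u" for w
 proof -
  have "\<exists>i\<in>{Suc k..<Suc k + Suc (length qs)}. w : set (?c i)" using w
  proof
   assume "w : set (?c (Suc k))"
   then show ?thesis by (rule bexI) simp
  next
   assume "w : set ?u"
   then obtain i where "i : {Suc (Suc k)..<Suc (Suc k) + length qs}" "w : set (?c i)"
    by (auto simp del: upt_Suc)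
   then show ?thesis by (intro bexI[of _ i]) auto
  qed
  then obtain i where i: "i : {Suc k..<Suc k + Suc (length qs)}" "w : set (?c i)" by blast
  have "i - Suc k < length (q # qs)" "i = Suc (k + (i - Suc k))" using i(1) by auto
  then have "\<sigma> (Alpha i) : carrier G" "\<sigma> (Beta i) : carrier G"
   using Cons.prems[of "i - Suc k"] by auto
  then show ?thesis using i(2) by (auto simp: word_commutator_def letter_val_def)
 qed
 have "[Suc k..<Suc k + length (q # qs)] = Suc k # [Suc (Suc k)..<Suc (Suc k) + length qs]"
  by (subst upt_conv_Cons) (simp_all del: upt_Suc)
 then have "concat (map ?c (rev [Suc k..<Suc k + length (q # qs)])) = ?u @ ?c (Suc k)"
  by (simp only: rev.simps map_append concat_append list.map concat.simps append_Nil2)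
 moreover have "hol G (letter_val G \<sigma>) (?u @ ?c (Suc k)) =
   hol G (letter_val G \<sigma>) ?u \<otimes> hol G (letter_val G \<sigma>) (?c (Suc k))"
  by (rule hol_append) (rule vals, simp only: set_append Un_iff, blast)
 ultimately show ?case unfolding IH cq by simp
qed simp

lemma comm_prod_closed: "set qs \<subseteq> carrier G \<times> carrier G ==> comm_prod G qs : carrier G"
 by (induction qs) auto

lemma pair_gens_closed:
 "qs : pair_lists G g ==> z : carrier G ==> pair_gens G z qs : surface_gens g \<rightarrow> carrier G"
proof
 fix s assume qs: "qs : pair_lists G g" and z: "z : carrier G" and s: "s : surface_gens g"
 have "fst (qs ! i) : carrier G \<and> snd (qs ! i) : carrier G" if "i < g" for i
  using qs nth_mem[of i qs] that unfolding pair_lists_def by fastforce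
 from this[of "i - 1" for i] show "pair_gens G z qs s : carrier G"
  using s z unfolding surface_gens_def pair_gens_def by auto
qed

lemma hol_surface_relator:
 assumes "qs : pair_lists G g"
 shows "hol G (letter_val G (pair_gens G z qs))
  (concat (map (%i. word_commutator (Beta i, True) (Alpha i, False)) (rev [1..<Suc g]))) = comm_prod G qs"
proof -
 have "fst (qs ! i) : carrier G \<and> snd (qs ! i) : carrier G" if "i < g" for i
  using assms nth_mem[of i qs] that unfolding pair_lists_def by fastforce
 then have "hol G (letter_val G (pair_gens G z qs))
  (concat (map (%i. word_commutator (Beta i, True) (Alpha i, False)) (rev [Suc 0..<Suc 0 + length qs]))) =
   comm_prod G qs"
  using assms by (intro hol_commutators) (auto simp: pair_gens_def pair_lists_def)
 then show ?thesis using assms by (simp add: pair_lists_def del: upt_Suc)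
qed

lemma surface_relators_words: "r : surface_relators g ==> r : words (surface_gens g)"
 unfolding surface_relators_def words_def surface_gens_def by (auto simp: word_commutator_def split: if_splits)

lemma surface_relators_hol:
 assumes qs: "qs : pairs_with_product G g z" and z: "central G z" and r: "r : surface_relators g"
 shows "hol G (letter_val G (pair_gens G z qs)) r = \<one>"
proof -
 let ?w = "concat (map (%i. word_commutator (Beta i, True) (Alpha i, False)) (rev [1..<Suc g]))"
 have q: "qs : pair_lists G g" "comm_prod G qs = z" using qs unfolding pairs_with_product_def by auto
 have zc: "z : carrier G" using z by (simp add: central_def)
 note \<sigma> = pair_gens_closed[OF q(1) zc]
 from r consider "r = ?w @ [(Central, False)]"
  | s where "r = word_commutator (Central, True) (s, True)" "s : surface_gens g"
  unfolding surface_relators_def surface_gens_def by (auto split: if_splits)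
 then show ?thesis
 proof cases
  case 1
  have "?w @ [(Central, False)] : words (surface_gens g)" using surface_relators_words[OF r] 1 by simp
  then have "hol G (letter_val G (pair_gens G z qs)) r =
    hol G (letter_val G (pair_gens G z qs)) ?w \<otimes> hol G (letter_val G (pair_gens G z qs)) [(Central, False)]"
   unfolding 1 words_append by (intro hol_word_append[OF \<sigma>]) auto
  then show ?thesis unfolding hol_surface_relator[OF q(1)] q(2) using zc by (simp add: letter_val_def pair_gens_def)
 next
  case 2
  have s: "pair_gens G z qs s : carrier G" using \<sigma> 2(2) by auto
  have "z \<otimes> (pair_gens G z qs s \<otimes> (inv z \<otimes> inv pair_gens G z qs s)) = \<one>"
   using s zc by (simp add: central_mult_left_commute(1)[OF central_inv[OF z]])
  then show ?thesis unfolding 2 word_commutator_def using s zc by (simp add: letter_val_def pair_gens_def)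
 qed
qed

lemma hom_of_pairs_class:
 assumes "qs : pairs_with_product G g z" "central G z" "u : words (surface_gens g)"
 shows "hom_of_pairs G g z qs (word_class (surface_gens g) (surface_relators g) u) =
  hol G (letter_val G (pair_gens G z qs)) u"
 unfolding hom_of_pairs_def using assms surface_relators_hol pair_gens_closed
 by (intro hom_of_class) (auto simp: pairs_with_product_def central_def)

lemma hom_of_pairs_hom:
 assumes "qs : pairs_with_product G g z" "central G z"
 shows "hom_of_pairs G g z qs : homs_with_value G g z"
proof -
 have "hom_of_pairs G g z qs : Hom_grp (surface_ext g) G" unfolding hom_of_pairs_def surface_ext_def
  using assms surface_relators_hol pair_gens_closed
  by (intro hom_of_hom) (auto simp: pairs_with_product_def central_def)
 moreover have "hom_of_pairs G g z qs (surface_ext_central g) = z" unfolding surface_ext_central_def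
  by (subst hom_of_pairs_class[OF assms])
   (use assms(2) in \<open>auto simp: words_def surface_gens_def letter_val_def pair_gens_def central_def\<close>)
 ultimately show ?thesis unfolding homs_with_value_def by simp
qed

text \<open>Homomorphisms correspond to their values on the generators, and the long relator says
  that the product of commutators is the value at x. For g = 0 that relator is not imposed; there
  the empty product equals \<open>z\<close> by the second assumption.\<close>

lemma bij_betw_hom_of_pairs:
 assumes z: "central G z" and z0: "g = 0 ==> z = \<one>"
 shows "bij_betw (hom_of_pairs G g z) (pairs_with_product G g z) (homs_with_value G g z)"
proof (rule bij_betw_imageI)
 let ?cl = "%s. word_class (surface_gens g) (surface_relators g) [(s, True)]"
 have w: "[(s, True)] : words (surface_gens g)" if "s : surface_gens g" for s
  using that by (simp add: words_def)
 show "inj_on (hom_of_pairs G g z) (pairs_with_product G g z)"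
 proof (rule inj_onI)
  fix qs rs assume qs: "qs : pairs_with_product G g z" and rs: "rs : pairs_with_product G g z"
   and e: "hom_of_pairs G g z qs = hom_of_pairs G g z rs"
  have len: "length qs = g" "length rs = g" using qs rs by (auto simp: pairs_with_product_def pair_lists_def)
  have cl: "pair_gens G z ps : surface_gens g \<rightarrow> carrier G" if "ps : {qs, rs}" for ps
   using that qs rs z pair_gens_closed by (auto simp: pairs_with_product_def central_def)
  have gens: "pair_gens G z qs s = pair_gens G z rs s" if "s : surface_gens g" for s
  proof -
   have "pair_gens G z qs s : carrier G" "pair_gens G z rs s : carrier G" using cl that by blast+
   then show ?thesis using hom_of_pairs_class[OF qs z w[OF that]] hom_of_pairs_class[OF rs z w[OF that]] e
    by (simp add: letter_val_def)
  qed
  have "qs ! i = rs ! i" if i: "i < g" for i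
  proof -
   have s: "Alpha (Suc i) : surface_gens g" "Beta (Suc i) : surface_gens g"
    using i unfolding surface_gens_def by auto
   have sub: "set qs \<subseteq> carrier G \<times> carrier G" "set rs \<subseteq> carrier G \<times> carrier G"
    using qs rs unfolding pairs_with_product_def pair_lists_def by auto
   have "qs ! i : set qs" "rs ! i : set rs" using i len by auto
   then have "qs ! i : carrier G \<times> carrier G" "rs ! i : carrier G \<times> carrier G"
    using subsetD[OF sub(1)] subsetD[OF sub(2)] by simp_all
   then have "snd (qs ! i) : carrier G" "snd (rs ! i) : carrier G" by auto
   moreover have "inv snd (qs ! i) = inv snd (rs ! i)" "fst (qs ! i) = fst (rs ! i)"
    using gens[OF s(1)] gens[OF s(2)] by (simp_all add: pair_gens_def)
   ultimately show ?thesis by (metis inv_inv prod_eqI)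
  qed
  then show "qs = rs" using len by (intro nth_equalityI) auto
 qed
 show "hom_of_pairs G g z ` pairs_with_product G g z = homs_with_value G g z"
 proof
  show "hom_of_pairs G g z ` pairs_with_product G g z \<subseteq> homs_with_value G g z"
   using hom_of_pairs_hom[OF _ z] by blast
  show "homs_with_value G g z \<subseteq> hom_of_pairs G g z ` pairs_with_product G g z"
  proof
   fix f assume f: "f : homs_with_value G g z"
   have fh: "f : hom (presented_group (surface_gens g) (surface_relators g)) G"
    and fe: "f : extensional (carrier (presented_group (surface_gens g) (surface_relators g)))"
    and fx: "f (?cl Central) = z"
    using f unfolding homs_with_value_def Hom_grp_def surface_ext_def surface_ext_central_def by auto
   let ?\<sigma> = "%s. f (?cl s)"
   note hc = hom_class[OF fh]
   define qs where "qs = map (%i. (f (?cl (Beta i)), inv f (?cl (Alpha i)))) [1..<Suc g]"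
   have in_gens: "Beta i : surface_gens g" "Alpha i : surface_gens g" if "i : {1..g}" for i
    using that unfolding surface_gens_def by auto
   have cl: "?\<sigma> s : carrier G" if "s : surface_gens g" for s using hc(2) that by blast
   have qs: "qs : pair_lists G g" unfolding pair_lists_def qs_def using cl in_gens by (auto simp del: upt_Suc)
   have nth: "qs ! (i - 1) = (?\<sigma> (Beta i), inv ?\<sigma> (Alpha i))" if "i : {1..g}" for i
    using that unfolding qs_def by (subst nth_map) (auto simp del: upt_Suc)
   have gens: "pair_gens G z qs s = ?\<sigma> s" if s: "s : surface_gens g" for s
   proof (cases s)
    case (Alpha i)
    then have "i : {1..g}" using s unfolding surface_gens_def by auto
    then show ?thesis using nth cl[OF s] unfolding Alpha pair_gens_def by simp
   next
    case (Beta i)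
    then have "i : {1..g}" using s unfolding surface_gens_def by auto
    then show ?thesis using nth unfolding Beta pair_gens_def by simp
   qed (simp add: pair_gens_def fx)
   have hol_eq: "hol G (letter_val G (pair_gens G z qs)) u = hol G (letter_val G ?\<sigma>) u"
    if "u : words (surface_gens g)" for u
    using that gens by (intro hol_cong) (auto simp: words_def letter_val_def split: prod.splits)
   have "comm_prod G qs = z"
   proof (cases "g = 0")
    case True
    then have "qs = []" using qs unfolding pair_lists_def by simp
    then show ?thesis using z0[OF True] by simp
   next
    case False
    let ?w = "concat (map (%i. word_commutator (Beta i, True) (Alpha i, False)) (rev [1..<Suc g]))"
    let ?r = "?w @ [(Central, False)]"
    have r: "?r : surface_relators g" using False unfolding surface_relators_def by simp
    note rw = surface_relators_words[OF r]
    have w2: "?w : words (surface_gens g)" "[(Central, False)] : words (surface_gens g)"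
     using rw unfolding words_append by auto
    have "word_eq (surface_gens g) (surface_relators g) ([] @ ?r @ []) ([] @ [])"
     by (rule word_eq.relator[OF words_Nil words_Nil r rw])
    then have "f (word_class (surface_gens g) (surface_relators g) ?r) =
      f (word_class (surface_gens g) (surface_relators g) [])"
     using word_class_eq by fastforce
    then have "hol G (letter_val G ?\<sigma>) ?r = \<one>" using hc(1)[OF rw] hc(1)[OF words_Nil] by simp
    then have "hol G (letter_val G ?\<sigma>) ?w \<otimes> inv z = \<one>"
     unfolding hol_word_append[OF hc(2) w2] using fx cl[of Central] by (simp add: letter_val_def surface_gens_def)
    then have "comm_prod G qs \<otimes> inv z = \<one>"
     using hol_surface_relator[OF qs, of z] hol_eq[OF w2(1)] by simp
    then show ?thesis using qs z comm_prod_closed[of qs] unfolding pair_lists_def central_def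
     by (metis (mono_tags, lifting) inv_closed inv_equality inv_inv mem_Collect_eq)
   qed
   then have qsz: "qs : pairs_with_product G g z" using qs unfolding pairs_with_product_def by simp
   have "hom_of_pairs G g z qs A = f A" for A
   proof (cases "A : carrier (presented_group (surface_gens g) (surface_relators g))")
    case True
    then obtain u where u: "u : words (surface_gens g)"
     "A = word_class (surface_gens g) (surface_relators g) u" unfolding carrier_presented_group by auto
    show ?thesis unfolding u(2) hom_of_pairs_class[OF qsz z u(1)] hol_eq[OF u(1)] hc(1)[OF u(1)] ..
   next
    case False
    then show ?thesis using fe unfolding hom_of_pairs_def hom_of_def extensional_def by simp
   qed
   then have "f = hom_of_pairs G g z qs" by (intro ext) simp
   then show "f : hom_of_pairs G g z ` pairs_with_product G g z" using qsz by (rule image_eqI)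
  qed
 qed
qed

section \<open>Compatibility with conjugation\<close>

lemma conj_by_mult:
 "h : carrier G ==> x : carrier G ==> y : carrier G ==>
  conj_by G h (x \<otimes> y) = conj_by G h x \<otimes> conj_by G h y"
 "h : carrier G ==> x : carrier G ==> conj_by G h (inv x) = inv conj_by G h x"
 "h : carrier G ==> conj_by G h \<one> = \<one>"
 "h : carrier G ==> x : carrier G ==> conj_by G h x : carrier G"
 unfolding conj_by_def by (simp_all add: group_word_simps)

lemma conj_by_central: "h : carrier G ==> central G z ==> conj_by G h z = z"
 unfolding conj_by_def central_def by (metis inv_closed inv_cancel_left(1) m_assoc r_inv r_one)

lemma comm_prod_conj:
 assumes "h : carrier G"
 shows "set qs \<subseteq> carrier G \<times> carrier G ==>
  comm_prod G (map (map_prod (conj_by G h) (conj_by G h)) qs) = conj_by G h (comm_prod G qs)"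
 using assms by (induction qs) (auto simp: conj_by_mult comm_prod_closed)

lemma hol_conj:
 assumes "h : carrier G"
 shows "(!!w. w : set u ==> cf w : carrier G \<and> cf' w = conj_by G h (cf w)) ==>
  hol G cf' u = conj_by G h (hol G cf u)"
 by (induction u) (auto simp: conj_by_mult assms)

lemma pairs_with_product_conj:
 assumes "qs : pairs_with_product G g z" "central G z" "h : carrier G"
 shows "map (map_prod (conj_by G h) (conj_by G h)) qs : pairs_with_product G g z"
proof -
 have qs: "set qs \<subseteq> carrier G \<times> carrier G" "length qs = g" "comm_prod G qs = z"
  using assms(1) unfolding pairs_with_product_def pair_lists_def by auto
 then have "map (map_prod (conj_by G h) (conj_by G h)) qs : pair_lists G g"
  using assms(3) conj_by_mult(4) unfolding pair_lists_def by auto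
 then show ?thesis
  unfolding pairs_with_product_def using comm_prod_conj[OF assms(3) qs(1)] qs(3) conj_by_central assms by simp
qed

text \<open>Both sides evaluate words, so it suffices to compare generators. The central generator
  keeps its value since \<open>z\<close> is central.\<close>

lemma hom_of_pairs_conj:
 assumes qs: "qs : pairs_with_product G g z" and z: "central G z" and h: "h : carrier G"
 shows "hom_of_pairs G g z (map (map_prod (conj_by G h) (conj_by G h)) qs) =
  hom_conj (surface_ext g) G h (hom_of_pairs G g z qs)"
proof
 fix A
 let ?qs = "map (map_prod (conj_by G h) (conj_by G h)) qs"
 show "hom_of_pairs G g z ?qs A = hom_conj (surface_ext g) G h (hom_of_pairs G g z qs) A"
 proof (cases "A : carrier (surface_ext g)")
  case True
  then obtain u where u: "u : words (surface_gens g)"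
   "A = word_class (surface_gens g) (surface_relators g) u" unfolding surface_ext_def carrier_presented_group by auto
  have qsl: "qs : pair_lists G g" using qs unfolding pairs_with_product_def by simp
  have zc: "z : carrier G" using z unfolding central_def by simp
  note cl = pair_gens_closed[OF qsl zc]
  have nth: "fst (qs ! i) : carrier G" "snd (qs ! i) : carrier G" if "i < g" for i
   using qsl nth_mem[of i qs] that unfolding pair_lists_def by fastforce+
  have gens: "pair_gens G z ?qs s = conj_by G h (pair_gens G z qs s)" if "s : surface_gens g" for s
   using that qsl h nth conj_by_central[OF h z] unfolding surface_gens_def pair_gens_def pair_lists_def
   by (auto simp: conj_by_mult)
  have "hol G (letter_val G (pair_gens G z ?qs)) u = conj_by G h (hol G (letter_val G (pair_gens G z qs)) u)"
  proof (rule hol_conj[OF h])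
   fix w assume w: "w : set u"
   obtain s b where sb: "w = (s, b)" by (cases w)
   have s: "s : surface_gens g" using u(1) w unfolding sb words_def by auto
   then have "pair_gens G z qs s : carrier G" using cl by blast
   then show "letter_val G (pair_gens G z qs) w : carrier G \<and>
     letter_val G (pair_gens G z ?qs) w = conj_by G h (letter_val G (pair_gens G z qs) w)"
    unfolding sb letter_val_def using gens[OF s] h by (simp add: conj_by_mult)
  qed
  then show ?thesis using True unfolding u(2) hom_of_pairs_class[OF pairs_with_product_conj[OF assms] z u(1)]
    hom_conj_def restrict_def hom_of_pairs_class[OF qs z u(1)] conj_by_def by simp
 next
  case False
  then show ?thesis unfolding hom_conj_def hom_of_pairs_def hom_of_def surface_ext_def by simp
 qed
qed

end

section \<open>Linear and multilinear maps\<close>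

lemma vector_space_fscl: "vector_space (fscl :: 'k::field => ('a => 'k) => 'a => 'k)"
 by unfold_locales (auto simp: fscl_def fun_eq_iff algebra_simps)

lemma vector_space_times: "vector_space ((*) :: 'k::field => 'k => 'k)" by unfold_locales (auto simp: algebra_simps)

lemma vspaceD:
 assumes "vspace V"
 shows "0 : carr V" "x : carr V ==> y : carr V ==> x + y : carr V"
  "x : carr V ==> y : carr V ==> x - y : carr V"
  "x : carr V ==> scl V c x : carr V" "(!!i. i : I ==> f i : carr V) ==> sum f I : carr V"
  "scl V c (x + y) = scl V c x + scl V c y" "scl V (c + d) x = scl V c x + scl V d x"
  "scl V c (scl V d x) = scl V (c * d) x" "scl V 1 x = x" "scl V 0 x = 0" "scl V c 0 = 0"
  "scl V c (sum f I) = (\<Sum>i\<in>I. scl V c (f i))" "scl V (sum h I) x = (\<Sum>i\<in>I. scl V (h i) x)"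
  "vector_space (scl V)" "module.subspace (scl V) (carr V)"
proof -
 interpret vector_space "scl V" using assms by (simp add: vspace_def)
 have s: "subspace (carr V)" using assms by (simp add: vspace_def)
 show "0 : carr V" "x : carr V ==> y : carr V ==> x + y : carr V"
  "x : carr V ==> y : carr V ==> x - y : carr V"
  "x : carr V ==> scl V c x : carr V" "(!!i. i : I ==> f i : carr V) ==> sum f I : carr V"
  using s subspace_0 subspace_add subspace_diff subspace_scale subspace_sum by blast+
 show "scl V c (x + y) = scl V c x + scl V c y" "scl V (c + d) x = scl V c x + scl V d x"
  "scl V c (scl V d x) = scl V (c * d) x" "scl V 1 x = x" "scl V 0 x = 0" "scl V c 0 = 0"
  "scl V c (sum f I) = (\<Sum>i\<in>I. scl V c (f i))" "scl V (sum h I) x = (\<Sum>i\<in>I. scl V (h i) x)"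
  by (simp_all add: algebra_simps scale_sum_right scale_sum_left)
 show "vector_space (scl V)" "subspace (carr V)" by (unfold_locales, rule s)
qed

lemma vspace_ground [simp]: "vspace ground"
proof -
 interpret vector_space "(*) :: 'a => 'a => 'a" by (rule vector_space_times)
 show ?thesis unfolding vspace_def ground_def using vector_space_times by simp
qed

lemma ground_simps [simp]: "carr ground = UNIV" "scl ground = (*)" by (simp_all add: ground_def)

lemma vspace_span: "vspace \<lparr>carr = module.span fscl S, scl = fscl\<rparr>"
proof -
 interpret vector_space fscl by (rule vector_space_fscl)
 show ?thesis unfolding vspace_def using vector_space_fscl by simp
qed

lemma linD:
 assumes "lin V W f"
 shows "x : carr V ==> f x : carr W" "x : carr V ==> y : carr V ==> f (x + y) = f x + f y"
  "x : carr V ==> f (scl V c x) = scl W c (f x)" using assms unfolding lin_def by auto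

lemma linI:
 assumes "!!x. x : carr V ==> f x : carr W"
  "!!x y. x : carr V ==> y : carr V ==> f (x + y) = f x + f y"
  "!!c x. x : carr V ==> f (scl V c x) = scl W c (f x)"
 shows "lin V W f" using assms unfolding lin_def by auto

lemma lin_cong: "(!!x. x : carr V ==> f x = g x) ==> vspace V ==> lin V W f \<longleftrightarrow> lin V W g"
 unfolding lin_def by (auto simp: vspaceD Pi_def)

lemma lin_0: "lin V W f ==> vspace V ==> vspace W ==> f 0 = 0" using linD(3)[of V W f 0 0] by (simp add: vspaceD)

lemma lin_sum:
 assumes "lin V W f" "vspace V" "vspace W" "!!i. i : I ==> x i : carr V"
 shows "f (\<Sum>i\<in>I. x i) = (\<Sum>i\<in>I. f (x i))" using assms(4) by (induction I rule: infinite_finite_induct)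
  (auto simp: lin_0[OF assms(1-3)] linD[OF assms(1)] vspaceD[OF assms(2)])

lemma lin_diff:
 assumes "lin V W f" "vspace V" "vspace W" "x : carr V" "y : carr V"
 shows "f (x - y) = f x - f y"
proof -
 have "f (x - y) + f y = f (x - y + y)" using assms by (simp only: linD(2) vspaceD(3))
 then show ?thesis by (simp add: algebra_simps)
qed

lemma lin_id: "lin V V (%x. x)" by (rule linI) auto

lemma lin_comp: "lin V W g ==> lin U V f ==> lin U W (%x. g (f x))"
 by (rule linI) (simp_all add: linD[of V W g] linD[of U V f])

lemma lin_scl: "lin V W f ==> vspace W ==> lin V W (%x. scl W c (f x))"
 by (rule linI) (auto simp: linD vspaceD mult.commute)

lemma lin_scl_left: "lin V ground k ==> vspace W ==> w : carr W ==> lin V W (%x. scl W (k x) w)"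
 by (rule linI) (auto simp: linD vspaceD)

lemma lin_add: "lin V W f ==> lin V W g ==> vspace W ==> lin V W (%x. f x + g x)"
 by (rule linI) (auto simp: linD vspaceD algebra_simps)

lemma lin_zero: "vspace W ==> lin V W (%x. 0)" by (rule linI) (auto simp: vspaceD)

lemma lin_sum_fun: "(!!i. i : I ==> lin V W (f i)) ==> vspace W ==> lin V W (%x. \<Sum>i\<in>I. f i x)"
 by (induction I rule: infinite_finite_induct) (auto intro: lin_zero lin_add)

lemma bilinD:
 assumes "bilin U V W b"
 shows "x : carr U ==> lin V W (b x)" "y : carr V ==> lin U W (%x. b x y)"
  "x : carr U ==> y : carr V ==> b x y : carr W" using assms unfolding bilin_def lin_def by auto

lemma bilinI:
 "(!!x. x : carr U ==> lin V W (b x)) ==> (!!y. y : carr V ==> lin U W (%x. b x y)) ==> bilin U V W b"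
 unfolding bilin_def by auto

lemma bilin_comp: "lin W Z f ==> bilin U V W b ==> bilin U V Z (%x y. f (b x y))"
 by (rule bilinI) (auto intro: lin_comp bilinD)

lemma bilin_comp2: "bilin U V W b ==> lin U' U f ==> lin V' V g ==> bilin U' V' W (%x y. b (f x) (g y))"
proof (rule bilinI)
 assume b: "bilin U V W b" and f: "lin U' U f" and g: "lin V' V g"
 show "lin V' W (%y. b (f x) (g y))" if "x : carr U'" for x
  by (rule lin_comp[OF bilinD(1)[OF b linD(1)[OF f that]] g])
 show "lin U' W (%x. b (f x) (g y))" if "y : carr V'" for y
  by (rule lin_comp[OF bilinD(2)[OF b linD(1)[OF g that]] f])
qed

lemma bilin_scl_left: "lin U ground k ==> lin V W f ==> vspace W ==> bilin U V W (%x y. scl W (k x) (f y))"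
 by (rule bilinI) (auto intro: lin_scl lin_scl_left linD)

lemma bilin_scl_right: "lin U W f ==> lin V ground k ==> vspace W ==> bilin U V W (%x y. scl W (k y) (f x))"
 by (rule bilinI) (auto intro: lin_scl lin_scl_left linD)

lemma bilin_sum: "(!!i. i : I ==> bilin U V W (b i)) ==> vspace W ==> bilin U V W (%x y. \<Sum>i\<in>I. b i x y)"
 by (rule bilinI) (auto intro!: lin_sum_fun intro: bilinD)

text \<open>Tensors are functions on forms. A failing identity between vectors has to be turned into
  a form that detects the failure, and such a functional does this.\<close>

lemma linear_functional_separates:
 assumes "vector_space s" "v ~= 0"
 shows "\<exists>\<phi>. Vector_Spaces.linear s (*) \<phi> \<and> \<phi> v ~= (0 :: 'k::field)"
proof -
 interpret vector_space_pair s "(*) :: 'k => 'k => 'k"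
  using assms(1) vector_space_times by (simp add: vector_space_pair_def)
 have "vs1.independent {v}" using assms(2) by simp
 from linear_independent_extend[OF this, of "%_. 1"] show ?thesis by fastforce
qed

text \<open>The forms that define tensors live on the ambient types, while bilinear maps are
  controlled on carriers only. Composition with a projection onto the carrier bridges this
  gap.\<close>

lemma subspace_projection:
 assumes "vspace V"
 shows "\<exists>\<pi>. Vector_Spaces.linear (scl V) (scl V) \<pi> \<and> (\<forall>x. \<pi> x : carr V) \<and> (\<forall>x\<in>carr V. \<pi> x = x)"
proof -
 interpret vector_space "scl V" using assms by (rule vspaceD)
 interpret p: vector_space_pair "scl V" "scl V" by unfold_locales
 have sub: "subspace (carr V)" using assms by (rule vspaceD)
 obtain B where B: "B \<subseteq> carr V" "independent B" "carr V \<subseteq> span B" "card B = dim (carr V)"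
  using basis_exists[of "carr V"] by blast
 have sB: "span B = carr V" using B span_minimal[OF B(1) sub] by blast
 let ?\<pi> = "p.construct B (%x. x)"
 have lin: "Vector_Spaces.linear (scl V) (scl V) ?\<pi>" by (rule p.linear_construct[OF B(2)])
 have "range ?\<pi> = span ((%x. x) ` B)" by (rule p.range_construct_eq_span[OF B(2)])
 then have r: "?\<pi> x : carr V" for x using sB by auto
 have "?\<pi> x = x" if "x : carr V" for x
 proof -
  have id: "Vector_Spaces.linear (scl V) (scl V) (%x. x)" by (rule linear_ident)
  have "x : span B" using that sB by simp
  then show ?thesis using p.linear_eq_on[OF lin id, of x B] p.construct_basis[OF B(2)] by blast
 qed
 then show ?thesis using lin r by blast
qed

text \<open>It is enough to respect relations that express one member of the family by finitely many
  members: the map is defined on a maximal independent subfamily, and every member is then compared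
  with its expansion there.\<close>

lemma lin_extension:
 fixes s :: "'i => 'v::ab_group_add" and U :: "('k::field, 'u::ab_group_add, 'z) vspace_scheme"
 assumes V: "vector_space sc" and U: "vspace U" and b: "!!i. i : I ==> b i : carr U"
  and rel: "!!i J c. i : I ==> finite J ==> J \<subseteq> I ==> s i = (\<Sum>j\<in>J. sc (c j) (s j)) ==>
   b i = (\<Sum>j\<in>J. scl U (c j) (b j))"
 shows "\<exists>F. lin \<lparr>carr = module.span sc (s ` I), scl = sc\<rparr> U F \<and> (\<forall>i\<in>I. F (s i) = b i)"
proof -
 interpret V: vector_space sc by (rule V)
 interpret U: vector_space "scl U" using U by (rule vspaceD)
 interpret p: vector_space_pair sc "scl U" by unfold_locales
 obtain B where B: "B \<subseteq> s ` I" "V.independent B" "s ` I \<subseteq> V.span B"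
  using V.maximal_independent_subset[of "s ` I"] by blast
 \<comment> \<open>Different indices may give the same vector, so one index is chosen for each
   vector of the independent subfamily.\<close>
 define ix where "ix = (%e. SOME i. i : I \<and> s i = e)"
 have ix: "ix e : I" "s (ix e) = e" if "e : B" for e
  using someI_ex[of "%i. i : I \<and> s i = e"] B(1) that unfolding ix_def by blast+
 obtain F where F: "Vector_Spaces.linear sc (scl U) F" "\<forall>e\<in>B. F e = b (ix e)"
  using p.linear_independent_extend[OF B(2), of "%e. b (ix e)"] by blast
 interpret F: Vector_Spaces.linear sc "scl U" F by (rule F(1))
 have Fs: "F (s i) = b i" if i: "i : I" for i
 proof -
  have "s i : V.span B" using B(3) i by blast
  then obtain T c where T: "finite T" "T \<subseteq> B" "s i = (\<Sum>e\<in>T. sc (c e) e)"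
   unfolding V.span_explicit by blast
  have inj: "inj_on ix T" by (rule inj_onI) (use ix T(2) in \<open>metis subsetD\<close>)
  have "s i = (\<Sum>j\<in>ix ` T. sc (c (s j)) (s j))"
   unfolding T(3) sum.reindex[OF inj] by (rule sum.cong) (use ix T(2) in auto)
  then have "b i = (\<Sum>j\<in>ix ` T. scl U (c (s j)) (b j))" by (intro rel[OF i]) (use T ix in auto)
  also have "... = (\<Sum>e\<in>T. scl U (c e) (F e))"
   unfolding sum.reindex[OF inj] by (rule sum.cong) (use ix T(2) F(2) in auto)
  also have "... = F (s i)" unfolding T(3) by (simp add: F.sum F.scale)
  finally show ?thesis by simp
 qed
 have "F x : carr U" if "x : V.span (s ` I)" for x
 proof -
  have "U.subspace (carr U)" using U by (rule vspaceD)
  moreover have "F ` s ` I \<subseteq> carr U" using Fs b by auto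
  ultimately have "U.span (F ` s ` I) \<subseteq> carr U" by (intro U.span_minimal)
  then show ?thesis using that F.span_image by blast
 qed
 then have "lin \<lparr>carr = V.span (s ` I), scl = sc\<rparr> U F" by (intro linI) (auto simp: F.add F.scale)
 then show ?thesis using Fs by blast
qed

lemma lin_eq_on_span:
 assumes F: "lin V U F" and F': "lin V U F'" and V: "vspace V" and U: "vspace U"
  and S: "carr V = module.span (scl V) S" "!!x. x : S ==> F x = F' x" and x: "x : carr V"
 shows "F x = F' x"
proof -
 interpret vector_space "scl V" using V by (rule vspaceD)
 have sub: "S \<subseteq> carr V" unfolding S(1) by (rule span_superset)
 have "x : span S" using x S(1) by simp
 then have "x : carr V \<and> F x = F' x"
 proof (induction rule: span_induct_alt)
  case base
  then show ?case using lin_0[OF F V U] lin_0[OF F' V U] V by (simp add: vspaceD)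
 next
  case (step c x y)
  then have "x : carr V" using sub by blast
  then show ?case using step V by (simp add: vspaceD linD[OF F] linD[OF F'] S(2))
 qed
 then show ?thesis by simp
qed

section \<open>Universal properties of tensor products\<close>

lemma tensor_simps [simp]: "scl (V \<boxtimes> W) = fscl"
 "carr (V \<boxtimes> W) = module.span fscl {tens V W x y | x y. x : carr V \<and> y : carr W}"
 unfolding tensor_def by simp_all

lemmas carr_tensor = tensor_simps(2)
declare tensor_simps(2) [simp del]

lemma vspace_tensor [simp]: "vspace (V \<boxtimes> W)" unfolding tensor_def by (rule vspace_span)

lemma tens_add_left: "tens V W (x + x') y = tens V W x y + tens V W x' y"
 and tens_add_right: "tens V W x (y + y') = tens V W x y + tens V W x y'"
 and tens_scl_left: "tens V W (scl V c x) y = fscl c (tens V W x y)"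
 and tens_scl_right: "tens V W x (scl W c y) = fscl c (tens V W x y)"
 by (auto simp: tens_def fun_eq_iff bilinear_form_def fscl_def)

lemma tens_carr: "x : carr V ==> y : carr W ==> tens V W x y : carr (V \<boxtimes> W)" unfolding carr_tensor
 by (rule module.span_base) (use vector_space_fscl in \<open>auto simp: module_iff_vector_space\<close>)

lemma bilin_tens: "bilin V W (V \<boxtimes> W) (tens V W)" by (intro bilinI linI)
  (auto simp: tens_carr tens_add_left tens_add_right tens_scl_left tens_scl_right)

text \<open>If \<open>b\<close> violated a relation between pure tensors, a functional on
  \<open>U\<close> would see the defect. Composed with \<open>b\<close> and the projections onto the
  carriers it is a bilinear form on the ambient types, and evaluating the relation at this form
  gives a contradiction.\<close>

lemma tlift_exists:
 assumes V: "vspace V" and W: "vspace W" and U: "vspace U" and b: "bilin V W U b"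
 shows "\<exists>F. lin (V \<boxtimes> W) U F \<and> (\<forall>x\<in>carr V. \<forall>y\<in>carr W. F (tens V W x y) = b x y)"
proof -
 interpret U: vector_space "scl U" using U by (rule vspaceD)
 obtain \<pi> where \<pi>: "Vector_Spaces.linear (scl V) (scl V) \<pi>" "!!x. \<pi> x : carr V" "!!x. x : carr V ==> \<pi> x = x"
  using subspace_projection[OF V] by blast
 obtain \<rho> where \<rho>: "Vector_Spaces.linear (scl W) (scl W) \<rho>" "!!x. \<rho> x : carr W" "!!x. x : carr W ==> \<rho> x = x"
  using subspace_projection[OF W] by blast
 interpret \<pi>: Vector_Spaces.linear "scl V" "scl V" \<pi> by (rule \<pi>(1))
 interpret \<rho>: Vector_Spaces.linear "scl W" "scl W" \<rho> by (rule \<rho>(1))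
 let ?I = "carr V \<times> carr W"
 have S: "{tens V W x y | x y. x : carr V \<and> y : carr W} = (%(x, y). tens V W x y) ` ?I" by auto
 have "\<exists>F. lin \<lparr>carr = module.span fscl ((%(x, y). tens V W x y) ` ?I), scl = fscl\<rparr> U F \<and>
  (\<forall>i\<in>?I. F ((%(x, y). tens V W x y) i) = (%(x, y). b x y) i)"
 proof (rule lin_extension[OF vector_space_fscl U])
  show "(%(x, y). b x y) i : carr U" if "i : ?I" for i using that b by (auto intro: bilinD)
  fix i J c assume i: "i : ?I" and J: "finite J" "J \<subseteq> ?I"
   and e: "(%(x, y). tens V W x y) i = (\<Sum>j\<in>J. fscl (c j) ((%(x, y). tens V W x y) j))"
  show "(%(x, y). b x y) i = (\<Sum>j\<in>J. scl U (c j) ((%(x, y). b x y) j))"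
  proof (rule ccontr)
   assume "\<not> ?thesis"
   then have "(%(x, y). b x y) i - (\<Sum>j\<in>J. scl U (c j) ((%(x, y). b x y) j)) ~= 0" by simp
   from linear_functional_separates[OF U.vector_space_axioms this] obtain \<phi>
    where \<phi>: "Vector_Spaces.linear (scl U) (*) \<phi>"
     "\<phi> ((%(x, y). b x y) i - (\<Sum>j\<in>J. scl U (c j) ((%(x, y). b x y) j))) ~= 0" by blast
   interpret \<phi>: Vector_Spaces.linear "scl U" "(*)" \<phi> by (rule \<phi>(1))
   let ?\<beta> = "%x y. \<phi> (b (\<pi> x) (\<rho> y))"
   have bl: "bilinear_form V W ?\<beta>" unfolding bilinear_form_def
    using linD(2,3)[OF bilinD(1)[OF b]] linD(2,3)[OF bilinD(2)[OF b]] \<pi>(2) \<rho>(2)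
    by (simp add: \<pi>.add \<pi>.scale \<rho>.add \<rho>.scale \<phi>.add \<phi>.scale)
   have ev: "((%(x, y). tens V W x y) j) ?\<beta> = \<phi> ((%(x, y). b x y) j)" if "j : ?I" for j
    using that bl \<pi>(3) \<rho>(3) by (auto simp: tens_def)
   have "\<phi> ((%(x, y). b x y) i) = (\<Sum>j\<in>J. fscl (c j) ((%(x, y). tens V W x y) j)) ?\<beta>"
    using ev[OF i] e by simp
   also have "... = (\<Sum>j\<in>J. c j * ((%(x, y). tens V W x y) j) ?\<beta>)"
    using J(1) by (induction J rule: finite_induct) (auto simp: fscl_def)
   also have "... = (\<Sum>j\<in>J. c j * \<phi> ((%(x, y). b x y) j))"
    by (rule sum.cong) (use ev J(2) in auto)
   also have "... = \<phi> (\<Sum>j\<in>J. scl U (c j) ((%(x, y). b x y) j))"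
    by (simp add: \<phi>.sum \<phi>.scale)
   finally show False using \<phi>(2) by (simp add: \<phi>.diff)
  qed
 qed
 then show ?thesis unfolding tensor_def S by auto
qed

lemma tlift:
 assumes "vspace V" "vspace W" "vspace U" "bilin V W U b"
 shows "lin (V \<boxtimes> W) U (tlift V W U b)"
  and "x : carr V ==> y : carr W ==> tlift V W U b (tens V W x y) = b x y"
 using someI_ex[OF tlift_exists[OF assms], folded tlift_def] by blast+

lemma lin_eq_tensor:
 assumes "lin (V \<boxtimes> W) U F" "lin (V \<boxtimes> W) U F'" "vspace U"
  and "!!x y. x : carr V ==> y : carr W ==> F (tens V W x y) = F' (tens V W x y)"
  and "t : carr (V \<boxtimes> W)"
 shows "F t = F' t" by (rule lin_eq_on_span[OF assms(1,2) vspace_tensor assms(3) _ _ assms(5)])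
  (use assms(4) in \<open>auto simp: carr_tensor\<close>)

definition multilin ::
 "'i set => ('i => ('k::field, 'v::ab_group_add, 'y) vspace_scheme) =>
 ('k, 'u::ab_group_add, 'z) vspace_scheme => (('i => 'v) => 'u) => bool" where
 "multilin I V U b \<longleftrightarrow> (\<forall>m\<in>(\<Pi>\<^sub>E i\<in>I. carr (V i)). b m : carr U \<and>
  (\<forall>i\<in>I. lin (V i) U (%x. b (m(i := x)))))"

lemma mtensor_simps [simp]: "scl (mtensor I V) = fscl" unfolding mtensor_def by simp

lemma carr_mtensor: "carr (mtensor I V) = module.span fscl (mtens I V ` (\<Pi>\<^sub>E i\<in>I. carr (V i)))"
 unfolding mtensor_def by simp

lemma vspace_mtensor [simp]: "vspace (mtensor I V)" unfolding mtensor_def by (rule vspace_span)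

lemma mtens_carr: "m : (\<Pi>\<^sub>E i\<in>I. carr (V i)) ==> mtens I V m : carr (mtensor I V)"
 unfolding carr_mtensor
 by (rule module.span_base) (use vector_space_fscl in \<open>auto simp: module_iff_vector_space\<close>)

lemma restrict_fun_upd_in: "i : I ==> restrict (m(i := x)) I = (restrict m I)(i := x)"
 by (auto simp: restrict_def fun_eq_iff)

lemma multilin_mtens:
 "multilin I V (mtensor I V) (mtens I V)" unfolding multilin_def
proof (intro ballI conjI)
 fix m i assume m: "m : (\<Pi>\<^sub>E i\<in>I. carr (V i))"
 show "mtens I V m : carr (mtensor I V)" using m by (rule mtens_carr)
 assume i: "i : I"
 show "lin (V i) (mtensor I V) (%x. mtens I V (m(i := x)))"
 proof (rule linI)
  show "mtens I V (m(i := x)) : carr (mtensor I V)" if "x : carr (V i)" for x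
   using m i that by (intro mtens_carr) (auto simp: PiE_iff extensional_def)
  show "mtens I V (m(i := x + y)) = mtens I V (m(i := x)) + mtens I V (m(i := y))" for x y
   using i unfolding mtens_def restrict_fun_upd_in[OF i] multilinear_form_def by (auto simp: fun_eq_iff)
  show "mtens I V (m(i := scl (V i) c x)) = scl (mtensor I V) c (mtens I V (m(i := x)))" for c x
   using i unfolding mtens_def restrict_fun_upd_in[OF i] multilinear_form_def by (auto simp: fun_eq_iff fscl_def)
 qed
qed

text \<open>The argument of \<open>tlift_exists\<close> with a projection in every slot. The map
  \<open>pr\<close> also restricts a family to the index set, so that the composite is defined on
  all families.\<close>

lemma mlift_exists:
 assumes V: "!!i. i : I ==> vspace (V i)" and U: "vspace U" and b: "multilin I V U b"
 shows "\<exists>F. lin (mtensor I V) U F \<and> (\<forall>m\<in>(\<Pi>\<^sub>E i\<in>I. carr (V i)). F (mtens I V m) = b m)"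
proof -
 interpret U: vector_space "scl U" using U by (rule vspaceD)
 have "\<forall>i\<in>I. \<exists>\<pi>. Vector_Spaces.linear (scl (V i)) (scl (V i)) \<pi> \<and> (\<forall>x. \<pi> x : carr (V i)) \<and>
   (\<forall>x\<in>carr (V i). \<pi> x = x)"
  using subspace_projection V by blast
 then obtain \<pi> where "\<forall>i\<in>I. Vector_Spaces.linear (scl (V i)) (scl (V i)) (\<pi> i) \<and>
   (\<forall>x. \<pi> i x : carr (V i)) \<and> (\<forall>x\<in>carr (V i). \<pi> i x = x)" by metis
 then have \<pi>: "!!i. i : I ==> Vector_Spaces.linear (scl (V i)) (scl (V i)) (\<pi> i)"
  "!!i x. i : I ==> \<pi> i x : carr (V i)" "!!i x. i : I ==> x : carr (V i) ==> \<pi> i x = x"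
  by blast+
 let ?I = "\<Pi>\<^sub>E i\<in>I. carr (V i)"
 define pr where "pr = (%m. \<lambda>i\<in>I. \<pi> i (m i))"
 have pr: "pr m : ?I" for m unfolding pr_def using \<pi>(2) by auto
 have "\<exists>F. lin \<lparr>carr = module.span fscl (mtens I V ` ?I), scl = fscl\<rparr> U F \<and>
  (\<forall>m\<in>?I. F (mtens I V m) = b m)"
 proof (rule lin_extension[OF vector_space_fscl U])
  show "b m : carr U" if "m : ?I" for m using that b unfolding multilin_def by blast
  fix m J c assume m: "m : ?I" and J: "finite J" "J \<subseteq> ?I"
   and e: "mtens I V m = (\<Sum>j\<in>J. fscl (c j) (mtens I V j))"
  show "b m = (\<Sum>j\<in>J. scl U (c j) (b j))"
  proof (rule ccontr)
   assume "\<not> ?thesis"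
   then have "b m - (\<Sum>j\<in>J. scl U (c j) (b j)) ~= 0" by simp
   from linear_functional_separates[OF U.vector_space_axioms this] obtain \<phi>
    where \<phi>: "Vector_Spaces.linear (scl U) (*) \<phi>"
     "\<phi> (b m - (\<Sum>j\<in>J. scl U (c j) (b j))) ~= 0" by blast
   interpret \<phi>: Vector_Spaces.linear "scl U" "(*)" \<phi> by (rule \<phi>(1))
   let ?\<beta> = "%m. \<phi> (b (pr m))"
   have bl: "multilinear_form I V ?\<beta>" unfolding multilinear_form_def
   proof (intro conjI ballI allI)
    fix i m assume i: "i : I"
    interpret \<pi>: Vector_Spaces.linear "scl (V i)" "scl (V i)" "\<pi> i" by (rule \<pi>(1)[OF i])
    have u: "pr (m(i := x)) = (pr m)(i := \<pi> i x)" for x unfolding pr_def using i by (auto simp: fun_eq_iff)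
    have l: "lin (V i) U (%x. b ((pr m)(i := x)))" using b pr i unfolding multilin_def by blast
    show "?\<beta> (m(i := x + y)) = ?\<beta> (m(i := x)) + ?\<beta> (m(i := y))" for x y
     unfolding u \<pi>.add linD(2)[OF l \<pi>(2)[OF i] \<pi>(2)[OF i]] \<phi>.add ..
    show "?\<beta> (m(i := scl (V i) c x)) = c * ?\<beta> (m(i := x))" for c x
     unfolding u \<pi>.scale linD(3)[OF l \<pi>(2)[OF i]] \<phi>.scale ..
   qed
   have ev: "mtens I V j ?\<beta> = \<phi> (b j)" if "j : ?I" for j
   proof -
    have "pr (restrict j I) = j"
    proof
     fix i show "pr (restrict j I) i = j i"
      unfolding pr_def using \<pi>(3) that by (cases "i : I") (auto dest: PiE_mem PiE_arb)
    qed
    then show ?thesis using bl by (simp add: mtens_def)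
   qed
   have "\<phi> (b m) = (\<Sum>j\<in>J. fscl (c j) (mtens I V j)) ?\<beta>" using ev[OF m] e by simp
   also have "... = (\<Sum>j\<in>J. c j * mtens I V j ?\<beta>)"
    using J(1) by (induction J rule: finite_induct) (auto simp: fscl_def)
   also have "... = (\<Sum>j\<in>J. c j * \<phi> (b j))" by (rule sum.cong) (use ev J(2) in auto)
   also have "... = \<phi> (\<Sum>j\<in>J. scl U (c j) (b j))" by (simp add: \<phi>.sum \<phi>.scale)
   finally show False using \<phi>(2) by (simp add: \<phi>.diff)
  qed
 qed
 then show ?thesis unfolding mtensor_def by auto
qed

lemma mlift:
 assumes "!!i. i : I ==> vspace (V i)" "vspace U" "multilin I V U b"
 shows "lin (mtensor I V) U (mlift I V U b)"
  and "m : (\<Pi>\<^sub>E i\<in>I. carr (V i)) ==> mlift I V U b (mtens I V m) = b m"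
 using someI_ex[OF mlift_exists[OF assms], folded mlift_def] by blast+

lemma mlift_cong:
 assumes "!!m. m : (\<Pi>\<^sub>E i\<in>I. carr (V i)) ==> b m = b' m"
 shows "mlift I V U b = mlift I V U b'"
proof -
 have "(\<forall>m\<in>(\<Pi>\<^sub>E i\<in>I. carr (V i)). F (mtens I V m) = b m) \<longleftrightarrow>
   (\<forall>m\<in>(\<Pi>\<^sub>E i\<in>I. carr (V i)). F (mtens I V m) = b' m)" for F
  using assms by simp
 then show ?thesis unfolding mlift_def by simp
qed

lemma multilin_cong:
 assumes "!!m. m : (\<Pi>\<^sub>E i\<in>I. carr (V i)) ==> b m = b' m" "!!i. i : I ==> vspace (V i)"
  "multilin I V U b"
 shows "multilin I V U b'" unfolding multilin_def
proof (intro ballI conjI)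
 fix m i assume m: "m : (\<Pi>\<^sub>E i\<in>I. carr (V i))"
 show "b' m : carr U" using assms(1)[OF m] assms(3) m unfolding multilin_def by metis
 assume i: "i : I"
 have "lin (V i) U (%x. b (m(i := x)))" using assms(3) m i unfolding multilin_def by blast
 moreover have "b (m(i := x)) = b' (m(i := x))" if "x : carr (V i)" for x
  by (rule assms(1)) (use m i that in \<open>auto simp: PiE_iff extensional_def\<close>)
 ultimately show "lin (V i) U (%x. b' (m(i := x)))"
  using lin_cong[OF _ assms(2)[OF i], of "%x. b (m(i := x))" "%x. b' (m(i := x))" U] by blast
qed

lemma multilin_lin_comp: "lin U Z f ==> multilin I V U b ==> multilin I V Z (%m. f (b m))"
 unfolding multilin_def by (auto intro: lin_comp linD)

lemma multilin_prod:
 assumes "finite I" "!!i. i : I ==> lin (V i) ground (k i)"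
 shows "multilin I V ground (%m. \<Prod>i\<in>I. k i (m i))" unfolding multilin_def
proof (intro ballI conjI)
 fix m i assume i: "i : I"
 have "(\<Prod>j\<in>I. k j ((m(i := x)) j)) = k i x * (\<Prod>j\<in>I - {i}. k j (m j))" for x
  by (subst prod.remove[OF assms(1) i]) (auto intro!: prod.cong)
 then show "lin (V i) ground (%x. \<Prod>j\<in>I. k j ((m(i := x)) j))"
  using assms(2)[OF i] by (intro linI) (auto simp: linD algebra_simps)
qed auto

lemma multilin_map:
 assumes "multilin I V U b" "!!i. i : I ==> lin (V' i) (V i) (f i)"
 shows "multilin I V' U (%m. b (\<lambda>i\<in>I. f i (m i)))" unfolding multilin_def
proof (intro ballI conjI)
 fix m i assume m: "m : (\<Pi>\<^sub>E i\<in>I. carr (V' i))"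
 have fm: "(\<lambda>i\<in>I. f i (m i)) : (\<Pi>\<^sub>E i\<in>I. carr (V i))"
  using linD(1)[OF assms(2)] PiE_mem[OF m] by simp
 then show "b (\<lambda>i\<in>I. f i (m i)) : carr U" using assms(1) unfolding multilin_def by blast
 assume i: "i : I"
 have "(\<lambda>j\<in>I. f j ((m(i := x)) j)) = (\<lambda>j\<in>I. f j (m j))(i := f i x)" for x
  using i by (auto simp: fun_eq_iff)
 moreover have "lin (V i) U (%x. b ((\<lambda>j\<in>I. f j (m j))(i := x)))"
  using assms(1) fm i unfolding multilin_def by blast
 ultimately show "lin (V' i) U (%x. b (\<lambda>j\<in>I. f j ((m(i := x)) j)))"
  using lin_comp[OF _ assms(2)[OF i]] by simp
qed

section \<open>Finite bases\<close>

text \<open>The coordinates are part of the datum: they are functions on the ambient type that are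
  linear, and dual to \<open>e\<close>, on the carrier. This keeps all later expansions
  explicit.\<close>

definition has_basis ::
 "('k::field, 'v::ab_group_add, 'z) vspace_scheme => 'a set => ('a => 'v) => ('a => 'v => 'k) => bool"
 where
 "has_basis V A e co \<longleftrightarrow> vspace V \<and> finite A \<and> (\<forall>a\<in>A. e a : carr V \<and> lin V ground (co a)) \<and>
  (\<forall>a\<in>A. \<forall>b\<in>A. co a (e b) = (if a = b then 1 else 0)) \<and>
  (\<forall>v\<in>carr V. v = (\<Sum>a\<in>A. scl V (co a v) (e a)))"

lemma has_basisD:
 assumes "has_basis V A e co"
 shows "vspace V" "finite A" "a : A ==> e a : carr V" "a : A ==> lin V ground (co a)"
  "a : A ==> b : A ==> co a (e b) = (if a = b then 1 else 0)"
  "v : carr V ==> v = (\<Sum>a\<in>A. scl V (co a v) (e a))" using assms unfolding has_basis_def by blast+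

lemma lin_basis_expand:
 assumes B: "has_basis V A e co" and F: "lin V U F" and U: "vspace U" and v: "v : carr V"
 shows "F v = (\<Sum>a\<in>A. scl U (co a v) (F (e a)))"
proof -
 note b = has_basisD[OF B]
 have "F v = F (\<Sum>a\<in>A. scl V (co a v) (e a))" using b(6)[OF v] by simp
 also have "... = (\<Sum>a\<in>A. F (scl V (co a v) (e a)))"
  by (rule lin_sum[OF F b(1) U]) (use b in \<open>auto simp: vspaceD\<close>)
 also have "... = (\<Sum>a\<in>A. scl U (co a v) (F (e a)))" by (rule sum.cong) (use b linD(3)[OF F] in auto)
 finally show ?thesis .
qed

lemma lin_eq_basis:
 assumes "has_basis V A e co" "lin V U F" "lin V U F'" "vspace U"
  "!!a. a : A ==> F (e a) = F' (e a)" "v : carr V"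
 shows "F v = F' v" using lin_basis_expand[OF assms(1,2,4,6)] lin_basis_expand[OF assms(1,3,4,6)] assms(5) by simp

lemma lin_from_basis:
 assumes B: "has_basis V A e co" and U: "vspace U" and f: "!!a. a : A ==> f a : carr U"
 shows "lin V U (%v. \<Sum>a\<in>A. scl U (co a v) (f a))"
  and "b : A ==> (\<Sum>a\<in>A. scl U (co a (e b)) (f a)) = f b"
proof -
 note b = has_basisD[OF B]
 show "lin V U (%v. \<Sum>a\<in>A. scl U (co a v) (f a))"
  by (intro lin_sum_fun lin_scl_left) (use b U f in auto)
 assume "b : A"
 then have "(\<Sum>a\<in>A. scl U (co a (e b)) (f a)) = (\<Sum>a\<in>A. if a = b then f a else 0)"
  by (intro sum.cong) (use b(5) U in \<open>auto simp: vspaceD\<close>)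
 then show "(\<Sum>a\<in>A. scl U (co a (e b)) (f a)) = f b" using b(2) \<open>b : A\<close> by simp
qed

lemma bilin_eq_basis:
 assumes "has_basis V A e co" "has_basis W A' e' co'" "bilin V W U b" "bilin V W U b'" "vspace U"
  "!!a a'. a : A ==> a' : A' ==> b (e a) (e' a') = b' (e a) (e' a')" "v : carr V" "w : carr W"
 shows "b v w = b' v w"
proof (rule lin_eq_basis[OF assms(1) bilinD(2)[OF assms(3,8)] bilinD(2)[OF assms(4,8)] assms(5) _ assms(7)])
 fix a assume a: "a : A"
 then have "e a : carr V" by (rule has_basisD(3)[OF assms(1)])
 then show "b (e a) w = b' (e a) w"
  by (intro lin_eq_basis[OF assms(2) bilinD(1)[OF assms(3)] bilinD(1)[OF assms(4)] assms(5) _ assms(8)])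
   (use assms(6) a in auto)
qed

text \<open>The slots are expanded one at a time; the induction is over the set \<open>J\<close> of
  slots already filled with basis vectors.\<close>

lemma multilin_expand:
 assumes I: "finite I" and B: "!!i. i : I ==> has_basis (V i) (A i) (e i) (co i)"
  and b: "multilin I V U b" and U: "vspace U" and m: "m : (\<Pi>\<^sub>E i\<in>I. carr (V i))"
 shows "b m = (\<Sum>cf\<in>(\<Pi>\<^sub>E i\<in>I. A i). scl U (\<Prod>i\<in>I. co i (cf i) (m i)) (b (\<lambda>i\<in>I. e i (cf i))))"
proof -
 have fin: "finite (A i)" if "i : I" for i using has_basisD(2)[OF B[OF that]] .
 have "J \<subseteq> I ==> b m = (\<Sum>cf\<in>(\<Pi>\<^sub>E i\<in>J. A i). scl U (\<Prod>i\<in>J. co i (cf i) (m i))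
   (b (\<lambda>i\<in>I. if i : J then e i (cf i) else m i)))" if "finite J" for J
  using that
 proof (induction J rule: finite_induct)
  case empty
  have "(\<lambda>i\<in>I. m i) = m" using m by (intro ext) (auto dest: PiE_arb simp: restrict_def)
  then show ?case using U by (simp add: vspaceD restrict_def)
 next
  case (insert j J)
  have j: "j : I" using insert by auto
  let ?P = "%cf. \<lambda>i\<in>I. if i : J then e i (cf i) else m i"
  have P: "?P cf : (\<Pi>\<^sub>E i\<in>I. carr (V i))" if "cf : (\<Pi>\<^sub>E i\<in>J. A i)" for cf
  proof -
   have "e i (cf i) : carr (V i)" if "i : J" for i
    using has_basisD(3)[OF B, of i "cf i"] that \<open>cf : _\<close> insert.prems by auto
   then show ?thesis using m by (auto dest: PiE_mem)
  qed
  have Q: "b (?P cf) = (\<Sum>a\<in>A j. scl U (co j a (m j)) (b ((?P cf)(j := e j a))))"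
   if "cf : (\<Pi>\<^sub>E i\<in>J. A i)" for cf
  proof -
   have l: "lin (V j) U (%x. b ((?P cf)(j := x)))" using b P[OF that] j unfolding multilin_def by blast
   have "(?P cf)(j := m j) = ?P cf" using insert.hyps j by (auto simp: fun_eq_iff)
   moreover have "m j : carr (V j)" using m j by auto
   ultimately show ?thesis using lin_basis_expand[OF B[OF j] l U, of "m j"] by simp
  qed
  have "b m = (\<Sum>cf\<in>(\<Pi>\<^sub>E i\<in>J. A i). scl U (\<Prod>i\<in>J. co i (cf i) (m i)) (b (?P cf)))"
   by (rule insert.IH) (use insert.prems in auto)
  also have "... = (\<Sum>cf\<in>(\<Pi>\<^sub>E i\<in>J. A i). \<Sum>a\<in>A j. scl U ((\<Prod>i\<in>J. co i (cf i) (m i)) * co j a (m j))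
    (b ((?P cf)(j := e j a))))"
   by (rule sum.cong) (use Q U in \<open>auto simp: vspaceD\<close>)
  also have "... = (\<Sum>(cf, a)\<in>(\<Pi>\<^sub>E i\<in>J. A i) \<times> A j. scl U ((\<Prod>i\<in>J. co i (cf i) (m i)) * co j a (m j))
    (b ((?P cf)(j := e j a))))"
   by (rule sum.cartesian_product)
  also have "... = (\<Sum>cf\<in>(\<Pi>\<^sub>E i\<in>insert j J. A i). scl U (\<Prod>i\<in>insert j J. co i (cf i) (m i))
   (b (\<lambda>i\<in>I. if i : insert j J then e i (cf i) else m i)))"
  proof (rule sum.reindex_bij_witness[where i = "%cf. (cf(j := undefined), cf j)" and j = "%(cf, a). cf(j := a)"])
   fix q assume q: "q : (\<Pi>\<^sub>E i\<in>J. A i) \<times> A j"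
   obtain cf a where qe: "q = (cf, a)" by (cases q)
   have "cf j = undefined" using q insert.hyps(2) unfolding qe by (auto dest: PiE_arb)
   then show "((case q of (cf, a) => cf(j := a))(j := undefined), (case q of (cf, a) => cf(j := a)) j) = q"
    unfolding qe by auto
   show "(case q of (cf, a) => cf(j := a)) : (\<Pi>\<^sub>E i\<in>insert j J. A i)"
    using q unfolding qe by (auto simp: PiE_iff extensional_def)
   have "(\<Prod>i\<in>insert j J. co i ((cf(j := a)) i) (m i)) = co j a (m j) * (\<Prod>i\<in>J. co i (cf i) (m i))"
    using insert.hyps by (subst prod.insert) (auto intro!: prod.cong)
   moreover have "(\<lambda>i\<in>I. if i : insert j J then e i ((cf(j := a)) i) else m i) = (?P cf)(j := e j a)"
    using j insert.hyps by (auto simp: fun_eq_iff)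
   ultimately show "scl U (\<Prod>i\<in>insert j J. co i ((case q of (cf, a) => cf(j := a)) i) (m i))
    (b (\<lambda>i\<in>I. if i : insert j J then e i ((case q of (cf, a) => cf(j := a)) i) else m i)) =
    (case q of (cf, a) => scl U ((\<Prod>i\<in>J. co i (cf i) (m i)) * co j a (m j)) (b ((?P cf)(j := e j a))))"
    unfolding qe prod.case by (simp only: mult.commute)
  next
   fix cf assume cf: "cf : (\<Pi>\<^sub>E i\<in>insert j J. A i)"
   show "(case (cf(j := undefined), cf j) of (cf, a) => cf(j := a)) = cf" by simp
   show "(cf(j := undefined), cf j) : (\<Pi>\<^sub>E i\<in>J. A i) \<times> A j"
    using cf insert.hyps by (auto simp: PiE_iff extensional_def)
  qed
  finally show ?case .
 qed
 from this[OF I subset_refl]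
 have "b m = (\<Sum>cf\<in>(\<Pi>\<^sub>E i\<in>I. A i). scl U (\<Prod>i\<in>I. co i (cf i) (m i))
   (b (\<lambda>i\<in>I. if i : I then e i (cf i) else m i)))" .
 moreover have "(\<lambda>i\<in>I. if i : I then e i (cf i) else m i) = (\<lambda>i\<in>I. e i (cf i))" for cf
  by (auto simp: fun_eq_iff)
 ultimately show ?thesis by simp
qed

lemma has_basis_mtensor:
 assumes I: "finite I" and B: "!!i. i : I ==> has_basis (V i) (A i) (e i) (co i)"
 shows "has_basis (mtensor I V) (\<Pi>\<^sub>E i\<in>I. A i) (%cf. mtens I V (\<lambda>i\<in>I. e i (cf i)))
  (%cf. mlift I V ground (%m. \<Prod>i\<in>I. co i (cf i) (m i)))"
proof -
 note b = has_basisD[OF B]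
 let ?e = "%cf. mtens I V (\<lambda>i\<in>I. e i (cf i))"
 let ?c = "%cf. mlift I V ground (%m. \<Prod>i\<in>I. co i (cf i) (m i))"
 have eP: "(\<lambda>i\<in>I. e i (cf i)) : (\<Pi>\<^sub>E i\<in>I. carr (V i))" if "cf : (\<Pi>\<^sub>E i\<in>I. A i)" for cf
  using that b(3) by auto
 have ml: "multilin I V ground (%m. \<Prod>i\<in>I. co i (cf i) (m i))" if "cf : (\<Pi>\<^sub>E i\<in>I. A i)" for cf
  using that b(4) by (intro multilin_prod[OF I]) auto
 note ll = mlift[OF b(1) vspace_ground ml]
 have fin: "finite (\<Pi>\<^sub>E i\<in>I. A i)" using I b(2) by (intro finite_PiE) auto
 show ?thesis unfolding has_basis_def
 proof (intro conjI ballI)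
  show "vspace (mtensor I V)" by simp
  show "finite (\<Pi>\<^sub>E i\<in>I. A i)" by (rule fin)
  show "?e cf : carr (mtensor I V)" if "cf : (\<Pi>\<^sub>E i\<in>I. A i)" for cf by (rule mtens_carr[OF eP[OF that]])
  show "lin (mtensor I V) ground (?c cf)" if "cf : (\<Pi>\<^sub>E i\<in>I. A i)" for cf by (rule ll(1)[OF _ that])
  show "?c cf (?e cf') = (if cf = cf' then 1 else 0)"
   if g: "cf : (\<Pi>\<^sub>E i\<in>I. A i)" "cf' : (\<Pi>\<^sub>E i\<in>I. A i)" for cf cf'
  proof -
   have "?c cf (?e cf') = (\<Prod>i\<in>I. co i (cf i) ((\<lambda>i\<in>I. e i (cf' i)) i))"
    by (rule ll(2)[OF _ g(1) eP[OF g(2)]])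
   also have "... = (\<Prod>i\<in>I. if cf i = cf' i then 1 else 0)"
    by (rule prod.cong) (use b(5) PiE_mem[OF g(1)] PiE_mem[OF g(2)] in simp_all)
   also have "... = (if cf = cf' then 1 else 0)"
   proof (cases "cf = cf'")
    case False
    then obtain i where "i : I" "cf i ~= cf' i" using g PiE_ext by metis
    then show ?thesis using I False by (auto intro: prod_zero)
   qed simp
   finally show ?thesis .
  qed
  show "v = (\<Sum>cf\<in>(\<Pi>\<^sub>E i\<in>I. A i). scl (mtensor I V) (?c cf v) (?e cf))" if "v : carr (mtensor I V)" for v
  proof (rule lin_eq_on_span[where F = "%v. v", OF lin_id _ vspace_mtensor vspace_mtensor _ _ that])
   show "lin (mtensor I V) (mtensor I V) (%v. \<Sum>cf\<in>(\<Pi>\<^sub>E i\<in>I. A i). scl (mtensor I V) (?c cf v) (?e cf))"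
    by (intro lin_sum_fun lin_scl_left ll(1) mtens_carr eP) auto
   show "carr (mtensor I V) = module.span (scl (mtensor I V)) (mtens I V ` (\<Pi>\<^sub>E i\<in>I. carr (V i)))"
    by (simp add: carr_mtensor)
   fix v assume "v : mtens I V ` (\<Pi>\<^sub>E i\<in>I. carr (V i))"
   then obtain m where m: "m : (\<Pi>\<^sub>E i\<in>I. carr (V i))" "v = mtens I V m" by auto
   have "v = (\<Sum>cf\<in>(\<Pi>\<^sub>E i\<in>I. A i). scl (mtensor I V) (\<Prod>i\<in>I. co i (cf i) (m i)) (?e cf))"
    unfolding m(2) by (rule multilin_expand[OF I B multilin_mtens vspace_mtensor m(1)])
   also have "... = (\<Sum>cf\<in>(\<Pi>\<^sub>E i\<in>I. A i). scl (mtensor I V) (?c cf v) (?e cf))"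
    by (rule sum.cong) (use ll(2)[OF _ _ m(1)] m(2) in auto)
   finally show "v = ..." .
  qed
 qed
qed

text \<open>The coordinates of a tensor with respect to a basis of one factor.\<close>

definition lcomp ::
 "('k::field, 'h::ab_group_add, 'y) vspace_scheme => ('k, 'v::ab_group_add, 'z) vspace_scheme =>
 ('a => 'h => 'k) => 'a => ('k, 'h, 'v) ten => 'v" where
 "lcomp H V co a = tlift H V V (%h v. scl V (co a h) v)"

definition rcomp ::
 "('k::field, 'v::ab_group_add, 'z) vspace_scheme => ('k, 'h::ab_group_add, 'y) vspace_scheme =>
 ('a => 'h => 'k) => 'a => ('k, 'v, 'h) ten => 'v" where
 "rcomp V H co a = tlift V H V (%v h. scl V (co a h) v)"

lemma lcomp:
 assumes B: "has_basis H A e co" and V: "vspace V" and a: "a : A"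
 shows "lin (H \<boxtimes> V) V (lcomp H V co a)"
  and "h : carr H ==> v : carr V ==> lcomp H V co a (tens H V h v) = scl V (co a h) v"
proof -
 note b = has_basisD[OF B]
 have "bilin H V V (%h v. scl V (co a h) v)" by (rule bilin_scl_left[OF b(4)[OF a] lin_id V])
 note t = tlift[OF b(1) V V this]
 show "lin (H \<boxtimes> V) V (lcomp H V co a)"
  and "h : carr H ==> v : carr V ==> lcomp H V co a (tens H V h v) = scl V (co a h) v"
  unfolding lcomp_def using t by blast+
qed

lemma rcomp:
 assumes B: "has_basis H A e co" and V: "vspace V" and a: "a : A"
 shows "lin (V \<boxtimes> H) V (rcomp V H co a)"
  and "h : carr H ==> v : carr V ==> rcomp V H co a (tens V H v h) = scl V (co a h) v"
proof -
 note b = has_basisD[OF B]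
 have "bilin V H V (%v h. scl V (co a h) v)" by (rule bilin_scl_right[OF lin_id b(4)[OF a] V])
 note t = tlift[OF V b(1) V this]
 show "lin (V \<boxtimes> H) V (rcomp V H co a)"
  and "h : carr H ==> v : carr V ==> rcomp V H co a (tens V H v h) = scl V (co a h) v"
  unfolding rcomp_def using t by blast+
qed

text \<open>Only the factor \<open>H\<close> is expanded, so the other factor may have any
  dimension.\<close>

lemma lcomp_expand:
 assumes B: "has_basis H A e co" and V: "vspace V" and t: "t : carr (H \<boxtimes> V)"
 shows "t = (\<Sum>a\<in>A. tens H V (e a) (lcomp H V co a t))"
proof (rule lin_eq_tensor[where F = "%t. t", OF lin_id _ vspace_tensor _ t])
 note b = has_basisD[OF B]
 note l = lcomp[OF B V]
 show "lin (H \<boxtimes> V) (H \<boxtimes> V) (%t. \<Sum>a\<in>A. tens H V (e a) (lcomp H V co a t))"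
  by (intro lin_sum_fun vspace_tensor lin_comp[OF bilinD(1)[OF bilin_tens] l(1)] b(3))
 fix h v assume h: "h : carr H" and v: "v : carr V"
 have "tens H V h v = (\<Sum>a\<in>A. scl (H \<boxtimes> V) (co a h) (tens H V (e a) v))"
  by (rule lin_basis_expand[OF B bilinD(2)[OF bilin_tens v] vspace_tensor h])
 also have "... = (\<Sum>a\<in>A. tens H V (e a) (lcomp H V co a (tens H V h v)))"
  by (rule sum.cong) (use l(2) h v in \<open>simp_all add: tens_scl_right\<close>)
 finally show "tens H V h v = ..." .
qed

lemma rcomp_expand:
 assumes B: "has_basis H A e co" and V: "vspace V" and t: "t : carr (V \<boxtimes> H)"
 shows "t = (\<Sum>a\<in>A. tens V H (rcomp V H co a t) (e a))"
proof (rule lin_eq_tensor[where F = "%t. t", OF lin_id _ vspace_tensor _ t])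
 note b = has_basisD[OF B]
 note l = rcomp[OF B V]
 show "lin (V \<boxtimes> H) (V \<boxtimes> H) (%t. \<Sum>a\<in>A. tens V H (rcomp V H co a t) (e a))"
  by (intro lin_sum_fun vspace_tensor lin_comp[OF bilinD(2)[OF bilin_tens] l(1)] b(3))
 fix v h assume h: "h : carr H" and v: "v : carr V"
 have "tens V H v h = (\<Sum>a\<in>A. scl (V \<boxtimes> H) (co a h) (tens V H v (e a)))"
  by (rule lin_basis_expand[OF B bilinD(1)[OF bilin_tens v] vspace_tensor h])
 also have "... = (\<Sum>a\<in>A. tens V H (rcomp V H co a (tens V H v h)) (e a))"
  by (rule sum.cong) (use l(2) h v in \<open>simp_all add: tens_scl_left\<close>)
 finally show "tens V H v h = ..." .
qed

text \<open>This replaces the choice in \<open>tlift\<close> by a finite sum, from which the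
  dependence on parameters inside \<open>b\<close> or \<open>t\<close> can be read off.\<close>

lemma tlift_lcomp:
 assumes B: "has_basis H A e co" and V: "vspace V" and U: "vspace U" and b: "bilin H V U b"
  and t: "t : carr (H \<boxtimes> V)"
 shows "tlift H V U b t = (\<Sum>a\<in>A. b (e a) (lcomp H V co a t))"
proof -
 note B' = has_basisD[OF B]
 note l = tlift[OF B'(1) V U b]
 have c: "lcomp H V co a t : carr V" if "a : A" for a using linD(1)[OF lcomp(1)[OF B V that] t] .
 have "tlift H V U b t = tlift H V U b (\<Sum>a\<in>A. tens H V (e a) (lcomp H V co a t))"
  using lcomp_expand[OF B V t] by simp
 also have "... = (\<Sum>a\<in>A. tlift H V U b (tens H V (e a) (lcomp H V co a t)))"
  by (rule lin_sum[OF l(1) vspace_tensor U]) (use B' c in \<open>auto intro: tens_carr\<close>)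
 also have "... = (\<Sum>a\<in>A. b (e a) (lcomp H V co a t))" by (rule sum.cong) (use l(2) B' c in auto)
 finally show ?thesis .
qed

lemma tlift_rcomp:
 assumes B: "has_basis H A e co" and V: "vspace V" and U: "vspace U" and b: "bilin V H U b"
  and t: "t : carr (V \<boxtimes> H)"
 shows "tlift V H U b t = (\<Sum>a\<in>A. b (rcomp V H co a t) (e a))"
proof -
 note B' = has_basisD[OF B]
 note l = tlift[OF V B'(1) U b]
 have c: "rcomp V H co a t : carr V" if "a : A" for a using linD(1)[OF rcomp(1)[OF B V that] t] .
 have "tlift V H U b t = tlift V H U b (\<Sum>a\<in>A. tens V H (rcomp V H co a t) (e a))"
  using rcomp_expand[OF B V t] by simp
 also have "... = (\<Sum>a\<in>A. tlift V H U b (tens V H (rcomp V H co a t) (e a)))"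
  by (rule lin_sum[OF l(1) vspace_tensor U]) (use B' c in \<open>auto intro: tens_carr\<close>)
 also have "... = (\<Sum>a\<in>A. b (rcomp V H co a t) (e a))" by (rule sum.cong) (use l(2) B' c in auto)
 finally show ?thesis .
qed

lemma lcomp_basis:
 assumes B: "has_basis H A e co" and V: "vspace V" and "a : A" "b : A" "v : carr V"
 shows "lcomp H V co a (tens H V (e b) v) = (if a = b then v else 0)"
 using lcomp(2)[OF B V assms(3)] has_basisD[OF B] assms by (simp add: vspaceD)

lemma rcomp_basis:
 assumes B: "has_basis H A e co" and V: "vspace V" and "a : A" "b : A" "v : carr V"
 shows "rcomp V H co a (tens V H v (e b)) = (if a = b then v else 0)"
 using rcomp(2)[OF B V assms(3)] has_basisD[OF B] assms by (simp add: vspaceD)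

lemma has_basis_tensor:
 assumes B: "has_basis V A e co" and B': "has_basis W A' e' co'"
 shows "has_basis (V \<boxtimes> W) (A \<times> A') (%(a, a'). tens V W (e a) (e' a'))
  (%(a, a') t. co' a' (lcomp V W co a t))"
proof -
 note b = has_basisD[OF B] and b' = has_basisD[OF B']
 note l = lcomp[OF B b'(1)]
 show ?thesis unfolding has_basis_def
 proof (intro conjI ballI)
  show "vspace (V \<boxtimes> W)" by simp
  show "finite (A \<times> A')" using b b' by simp
  fix q assume q: "q : A \<times> A'"
  obtain a a' where qe: "q = (a, a')" by (cases q)
  show "(case q of (a, a') => tens V W (e a) (e' a')) : carr (V \<boxtimes> W)"
   using q b b' by (auto intro: tens_carr)
  show "lin (V \<boxtimes> W) ground (case q of (a, a') => %t. co' a' (lcomp V W co a t))"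
   using q lin_comp[OF b'(4) l(1)] by auto
  fix r assume r: "r : A \<times> A'"
  obtain b c where re: "r = (b, c)" by (cases r)
  have in_A: "a : A" "a' : A'" "b : A" "c : A'" using q r unfolding qe re by auto
  show "(case q of (a, a') => %t. co' a' (lcomp V W co a t))
    (case r of (a, a') => tens V W (e a) (e' a')) = (if q = r then 1 else 0)"
   unfolding qe re using lcomp_basis[OF B b'(1) in_A(1,3) b'(3)[OF in_A(4)]] b'(5)[OF in_A(2,4)]
    lin_0[OF b'(4)[OF in_A(2)] b'(1) vspace_ground] by (cases "a' = c") simp_all
 next
  fix t assume t: "t : carr (V \<boxtimes> W)"
  have c: "lcomp V W co a t : carr W" if "a : A" for a using linD(1)[OF l(1)[OF that] t] .
  have "t = (\<Sum>a\<in>A. tens V W (e a) (lcomp V W co a t))" by (rule lcomp_expand[OF B b'(1) t])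
  also have "... = (\<Sum>a\<in>A. \<Sum>a'\<in>A'. fscl (co' a' (lcomp V W co a t)) (tens V W (e a) (e' a')))"
  proof (rule sum.cong[OF HOL.refl])
   fix a assume a: "a : A"
   show "tens V W (e a) (lcomp V W co a t) =
     (\<Sum>a'\<in>A'. fscl (co' a' (lcomp V W co a t)) (tens V W (e a) (e' a')))"
    using lin_basis_expand[OF B' bilinD(1)[OF bilin_tens b(3)[OF a]] vspace_tensor c[OF a]] by simp
  qed
  also have "... = (\<Sum>(a, a')\<in>A \<times> A'. fscl (co' a' (lcomp V W co a t)) (tens V W (e a) (e' a')))"
   by (rule sum.cartesian_product)
  finally show "t = (\<Sum>q\<in>A \<times> A'. scl (V \<boxtimes> W) ((case q of (a, a') => %t. co' a' (lcomp V W co a t)) t)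
    (case q of (a, a') => tens V W (e a) (e' a')))"
   by (simp add: case_prod_unfold)
 qed
qed

section \<open>The group algebra\<close>

definition trilin ::
 "('k::field, 'u::ab_group_add, 'x) vspace_scheme => ('k, 'v::ab_group_add, 'y) vspace_scheme =>
 ('k, 'w::ab_group_add, 'z) vspace_scheme => ('k, 't::ab_group_add, 'r) vspace_scheme =>
 ('u => 'v => 'w => 't) => bool" where
 "trilin U V W T b \<longleftrightarrow> (\<forall>u\<in>carr U. bilin V W T (b u)) \<and>
  (\<forall>v\<in>carr V. \<forall>w\<in>carr W. lin U T (%u. b u v w))"

lemma trilinD:
 assumes "trilin U V W T b"
 shows "u : carr U ==> bilin V W T (b u)"
  "v : carr V ==> w : carr W ==> lin U T (%u. b u v w)"
  "u : carr U ==> v : carr V ==> w : carr W ==> b u v w : carr T"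
 using assms unfolding trilin_def by (auto intro: bilinD)

lemma bilin_cong:
 assumes "!!x y. x : carr U ==> y : carr V ==> b x y = b' x y" "vspace U" "vspace V" "bilin U V W b"
 shows "bilin U V W b'"
proof (rule bilinI)
 show "lin V W (b' x)" if "x : carr U" for x
  using lin_cong[OF _ assms(3), of "b x" "b' x"] assms(1) that bilinD(1)[OF assms(4)] by blast
 show "lin U W (%x. b' x y)" if "y : carr V" for y
  using lin_cong[OF _ assms(2), of "%x. b x y" "%x. b' x y"] assms(1) that bilinD(2)[OF assms(4)] by blast
qed

lemma trilin_cong:
 assumes "!!x y z. x : carr U ==> y : carr V ==> z : carr W ==> b x y z = b' x y z"
  "vspace U" "vspace V" "vspace W" "trilin U V W T b"
 shows "trilin U V W T b'" unfolding trilin_def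
proof (intro conjI ballI)
 show "bilin V W T (b' u)" if "u : carr U" for u
  by (rule bilin_cong[OF assms(1)[OF that] assms(3,4) trilinD(1)[OF assms(5) that]])
 show "lin U T (%u. b' u v w)" if "v : carr V" "w : carr W" for v w
  using lin_cong[OF _ assms(2), of "%u. b u v w" "%u. b' u v w"] assms(1) that trilinD(2)[OF assms(5)]
  by blast
qed

text \<open>Made for Sweedler expressions in which the outer legs meet in one place and the middle
  leg occurs in another.\<close>

lemma trilin_outer:
 assumes b: "bilin A B T b" and f: "bilin U W A f" and g: "lin V B g"
 shows "trilin U V W T (%u v w. b (f u w) (g v))" unfolding trilin_def
proof (intro conjI ballI bilinI)
 show "lin W T (%w. b (f u w) (g v))" if "u : carr U" "v : carr V" for u v
  by (rule lin_comp[OF bilinD(2)[OF b linD(1)[OF g that(2)]] bilinD(1)[OF f that(1)]])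
 show "lin V T (%v. b (f u w) (g v))" if "u : carr U" "w : carr W" for u w
  by (rule lin_comp[OF bilinD(1)[OF b bilinD(3)[OF f that]] g])
 show "lin U T (%u. b (f u w) (g v))" if "v : carr V" "w : carr W" for v w
  by (rule lin_comp[OF bilinD(2)[OF b linD(1)[OF g that(1)]] bilinD(2)[OF f that(2)]])
qed

lemma trilin_sum:
 "(!!i. i : I ==> trilin U V W T (b i)) ==> vspace T ==> trilin U V W T (%u v w. \<Sum>i\<in>I. b i u v w)"
 unfolding trilin_def by (auto intro!: lin_sum_fun bilin_sum)

text \<open>Linearity in \<open>u\<close> does not follow from the universal property, since a lift
  is chosen for each \<open>u\<close> separately. It is visible after expansion in the basis of
  \<open>W\<close>.\<close>

lemma bilin_tlift:
 assumes V: "vspace V" and U: "vspace U" and T: "vspace T" and B: "has_basis W A e co"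
  and b: "trilin U V W T b"
 shows "bilin U (V \<boxtimes> W) T (%u s. tlift V W T (b u) s)"
proof (rule bilinI)
 note W = has_basisD[OF B]
 show "lin (V \<boxtimes> W) T (%s. tlift V W T (b u) s)" if "u : carr U" for u
  by (rule tlift(1)[OF V W(1) T trilinD(1)[OF b that]])
 fix s assume s: "s : carr (V \<boxtimes> W)"
 have c: "rcomp V W co a s : carr V" if "a : A" for a using linD(1)[OF rcomp(1)[OF B V that] s] .
 have "lin U T (%u. \<Sum>a\<in>A. b u (rcomp V W co a s) (e a))"
  by (intro lin_sum_fun T trilinD(2)[OF b] c W(3))
 moreover have "tlift V W T (b u) s = (\<Sum>a\<in>A. b u (rcomp V W co a s) (e a))" if "u : carr U" for u
  by (rule tlift_rcomp[OF B V T trilinD(1)[OF b that] s])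
 ultimately show "lin U T (%u. tlift V W T (b u) s)"
  using lin_cong[OF _ U, of "%u. tlift V W T (b u) s" "%u. \<Sum>a\<in>A. b u (rcomp V W co a s) (e a)"] by blast
qed

lemma tlift3:
 assumes V: "vspace V" and U: "vspace U" and T: "vspace T" and B: "has_basis W A e co"
  and b: "trilin U V W T b"
 shows "lin (U \<boxtimes> V \<boxtimes> W) T (tlift3 U V W T b)"
  and "u : carr U ==> s : carr (V \<boxtimes> W) ==> tlift3 U V W T b (tens U (V \<boxtimes> W) u s) = tlift V W T (b u) s"
  and "u : carr U ==> v : carr V ==> w : carr W ==> tlift3 U V W T b (tens3 U V W u v w) = b u v w"
proof -
 note t = tlift[OF U vspace_tensor T bilin_tlift[OF assms]]
 show "lin (U \<boxtimes> V \<boxtimes> W) T (tlift3 U V W T b)" unfolding tlift3_def by (rule t(1))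
 show 2: "u : carr U ==> s : carr (V \<boxtimes> W) ==> tlift3 U V W T b (tens U (V \<boxtimes> W) u s) = tlift V W T (b u) s"
  for u s unfolding tlift3_def by (rule t(2))
 show "u : carr U ==> v : carr V ==> w : carr W ==> tlift3 U V W T b (tens3 U V W u v w) = b u v w"
  unfolding tens3_def using 2[of u "tens V W v w"] tens_carr[of v V w W]
   tlift(2)[OF V has_basisD(1)[OF B] T trilinD(1)[OF b]] by simp
qed

lemma basis_fun_simps [simp]: "basis_fun a a = 1" "b ~= a ==> basis_fun a b = 0" by (auto simp: basis_fun_def)

lemma basis_fun_inject: "basis_fun a = (basis_fun b :: 'a => 'k::field) \<longleftrightarrow> a = b"
 by (metis basis_fun_simps zero_neq_one)

lemma has_basis_functions:
 assumes "finite A"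
 shows "has_basis \<lparr>carr = {w. \<forall>x. x \<notin> A \<longrightarrow> w x = 0}, scl = fscl\<rparr> A (basis_fun :: 'a => 'a => 'k::field) (%x w. w x)"
proof -
 interpret vector_space "fscl :: 'k => ('a => 'k) => 'a => 'k" by (rule vector_space_fscl)
 have "subspace {w :: 'a => 'k. \<forall>x. x \<notin> A \<longrightarrow> w x = 0}"
  by (rule subspaceI) (auto simp: fscl_def)
 then have v: "vspace \<lparr>carr = {w :: 'a => 'k. \<forall>x. x \<notin> A \<longrightarrow> w x = 0}, scl = fscl\<rparr>"
  unfolding vspace_def using vector_space_fscl by simp
 have ev: "(\<Sum>a\<in>A. fscl (w a) (basis_fun a)) x = (\<Sum>a\<in>A. w a * basis_fun a x)" for w :: "'a => 'k" and x
  using assms by (induction A rule: finite_induct) (auto simp: fscl_def)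
 have "w = (\<Sum>a\<in>A. fscl (w a) (basis_fun a))" if "\<forall>x. x \<notin> A \<longrightarrow> w x = 0" for w :: "'a => 'k"
 proof
  fix x
  have "(\<Sum>a\<in>A. w a * basis_fun a x) = (\<Sum>a\<in>A. if a = x then w a else 0)"
   by (rule sum.cong) (auto simp: basis_fun_def)
  then show "w x = (\<Sum>a\<in>A. fscl (w a) (basis_fun a)) x" unfolding ev using that assms by auto
 qed
 then show ?thesis unfolding has_basis_def using v assms
  by (auto simp: basis_fun_def fscl_def intro!: linI split: if_splits)
qed

lemma has_basis_cong:
 assumes "has_basis V A e co" "carr V = carr W" "scl V = scl W"
 shows "has_basis W A e co" using assms unfolding has_basis_def vspace_def lin_def by auto

lemma sum_apply: "(\<Sum>i\<in>I. f i) x = (\<Sum>i\<in>I. f i x)" by (induction I rule: infinite_finite_induct) auto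

lemma fscl_tensor: "t : carr (V \<boxtimes> W) ==> fscl c t : carr (V \<boxtimes> W)"
 using vspaceD(4)[OF vspace_tensor, of t V W c] by simp

lemma tens_cong: "scl V = scl V' ==> scl W = scl W' ==> tens V W = tens V' W'"
 unfolding tens_def bilinear_form_def by simp

section \<open>Basis computations in the group algebra\<close>

locale finite_group = group G for G :: "('g, 'b) monoid_scheme" (structure) +
 assumes fin: "finite (carrier G)"
begin

abbreviation kG :: "('k::field, 'g => 'k) hopf" where "kG \<equiv> group_algebra G"
abbreviation bf :: "'g => 'g => 'k::field" where "bf \<equiv> basis_fun"

lemma has_basis_kG: "has_basis (kG :: ('k::field, 'g => 'k) hopf) (carrier G) bf (%x a. a x)"
 by (rule has_basis_cong[OF has_basis_functions[OF fin]])
  (auto simp: group_algebra_def group_space_def)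

lemmas kG_basis = has_basisD[OF has_basis_kG]

lemma vspace_kG [simp]: "vspace kG" by (rule kG_basis)
lemma bf_kG [simp]: "x : carrier G ==> bf x : carr kG" by (rule kG_basis)

lemma scl_kG [simp]: "scl kG = fscl" by (simp add: group_algebra_def)

lemma hmul_bf [simp]:
 assumes "x : carrier G" "y : carrier G"
 shows "hmul kG (bf x) (bf y) = bf (x \<otimes> y)"
proof
 fix z
 have "(\<Sum>u\<in>carrier G. bf x u * bf y (inv u \<otimes> z)) = (\<Sum>u\<in>carrier G. if u = x then bf y (inv x \<otimes> z) else 0)"
  by (rule sum.cong) (auto simp: basis_fun_def)
 then have "(\<Sum>u\<in>carrier G. bf x u * bf y (inv u \<otimes> z)) = bf y (inv x \<otimes> z)" using fin assms by simp
 moreover have "inv x \<otimes> z = y \<longleftrightarrow> z = x \<otimes> y" if "z : carrier G"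
  using assms that by (metis inv_cancel_left)
 ultimately show "hmul kG (bf x) (bf y) z = bf (x \<otimes> y) z"
  using assms by (auto simp: group_algebra_def basis_fun_def)
qed

lemma bilin_hmul: "bilin kG kG kG (hmul kG)"
proof -
 have c: "hmul kG a b : carr kG" for a b :: "'g => 'k::field" by (simp add: group_algebra_def group_space_def)
 show ?thesis by (intro bilinI linI c)
   (auto simp: group_algebra_def fun_eq_iff fscl_def algebra_simps sum.distrib sum_distrib_left)
qed

lemma hone_kG [simp]: "hone kG = bf \<one>" by (simp add: group_algebra_def)

lemma hcomul_kG: "hcomul (kG :: ('k::field, 'g => 'k) hopf) a = (\<Sum>x\<in>carrier G. fscl (a x) (tens kG kG (bf x) (bf x)))"
proof -
 have e: "tens (group_space G) (group_space G) =
   tens (kG :: ('k, 'g => 'k) hopf) (kG :: ('k, 'g => 'k) hopf)"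
  by (rule tens_cong) (simp_all add: group_space_def)
 show ?thesis unfolding e[symmetric] by (simp add: group_algebra_def)
qed

lemma lin_hcomul: "lin kG (kG \<boxtimes> kG) (hcomul kG)"
proof -
 have "lin kG (kG \<boxtimes> kG) (%a. \<Sum>x\<in>carrier G. scl (kG \<boxtimes> kG) (a x) (tens kG kG (bf x) (bf x)))"
  by (rule lin_from_basis(1)[OF has_basis_kG vspace_tensor]) (simp add: tens_carr)
 then show ?thesis unfolding hcomul_kG by simp
qed

lemma hcomul_bf: "x : carrier G ==> hcomul kG (bf x) = tens kG kG (bf x) (bf x)"
proof -
 assume x: "x : carrier G"
 have "(\<Sum>y\<in>carrier G. scl (kG \<boxtimes> kG) (bf x y) (tens kG kG (bf y) (bf y))) = tens kG kG (bf x) (bf x)"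
  by (rule lin_from_basis(2)[OF has_basis_kG vspace_tensor _ x]) (simp add: tens_carr)
 then show ?thesis unfolding hcomul_kG by simp
qed

lemma lin_hcounit: "lin kG ground (hcounit kG)"
 by (rule linI) (auto simp: group_algebra_def fscl_def sum.distrib sum_distrib_left)

lemma hcounit_bf [simp]: "x : carrier G ==> hcounit kG (bf x) = 1"
proof -
 assume x: "x : carrier G"
 have "(\<Sum>y\<in>carrier G. bf x y) = (\<Sum>y\<in>carrier G. if y = x then 1 else 0)"
  by (rule sum.cong) (auto simp: basis_fun_def)
 then show ?thesis using x fin by (simp add: group_algebra_def)
qed

lemma lin_hanti: "lin kG kG (hanti kG)"
proof (rule linI)
 show "hanti kG a : carr kG" for a :: "'g => 'k::field" by (auto simp: group_algebra_def group_space_def)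
qed (auto simp: group_algebra_def fun_eq_iff fscl_def)

lemma hanti_bf [simp]: "x : carrier G ==> hanti kG (bf x) = bf (inv x)"
 by (auto simp: group_algebra_def basis_fun_def fun_eq_iff)

lemma hanti_hanti: "a : carr kG ==> hanti kG (hanti kG a) = a"
 by (rule lin_eq_basis[OF has_basis_kG lin_comp[OF lin_hanti lin_hanti] lin_id]) auto

text \<open>The coproduct of the group algebra is diagonal on the basis of group elements, so both
  legs of each summand carry the same group element.\<close>

lemma sw2_expand:
 assumes "bilin kG kG V b" "vspace V" "a : carr kG"
 shows "sw2 kG V a b = (\<Sum>x\<in>carrier G. scl V (a x) (b (bf x) (bf x)))"
proof -
 note t = tlift[OF vspace_kG vspace_kG assms(2,1)]
 have "sw2 kG V a b = (\<Sum>x\<in>carrier G. tlift kG kG V b (fscl (a x) (tens kG kG (bf x) (bf x))))"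
  unfolding sw2_def hcomul_kG by (rule lin_sum[OF t(1) vspace_tensor assms(2)])
   (intro fscl_tensor tens_carr bf_kG)
 also have "... = (\<Sum>x\<in>carrier G. scl V (a x) (b (bf x) (bf x)))"
  by (rule sum.cong) (use linD(3)[OF t(1)] t(2) in \<open>auto simp: tens_carr\<close>)
 finally show ?thesis .
qed

lemma sw2_bf:
 assumes "bilin kG kG V b" "vspace V" "x : carrier G"
 shows "sw2 kG V (bf x) b = b (bf x) (bf x)" using sw2_expand[OF assms(1,2) bf_kG[OF assms(3)]]
  lin_from_basis(2)[OF has_basis_kG assms(2), of "%x. b (bf x) (bf x)" x] assms by (simp add: bilinD)

lemma sw3_expand:
 assumes "trilin kG kG kG V b" "vspace V" "a : carr kG"
 shows "sw3 kG V a b = (\<Sum>x\<in>carrier G. scl V (a x) (b (bf x) (bf x) (bf x)))"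
proof -
 note t = tlift3[OF vspace_kG vspace_kG assms(2) has_basis_kG assms(1)]
 have "bilin kG kG (kG \<boxtimes> kG \<boxtimes> kG) (%x y. tens kG (kG \<boxtimes> kG) x (hcomul kG y))"
  by (rule bilin_comp2[OF bilin_tens lin_id lin_hcomul])
 from sw2_expand[OF this vspace_tensor assms(3)]
 have "sw3 kG V a b = tlift3 kG kG kG V b
   (\<Sum>x\<in>carrier G. fscl (a x) (tens3 kG kG kG (bf x) (bf x) (bf x)))"
  unfolding sw3_def by (simp add: hcomul_bf tens3_def)
 also have "... = (\<Sum>x\<in>carrier G. tlift3 kG kG kG V b (fscl (a x) (tens3 kG kG kG (bf x) (bf x) (bf x))))"
  by (rule lin_sum[OF t(1) vspace_tensor assms(2)])
   (unfold tens3_def, intro fscl_tensor tens_carr bf_kG)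
 also have "... = (\<Sum>x\<in>carrier G. scl V (a x) (b (bf x) (bf x) (bf x)))"
  by (rule sum.cong) (use linD(3)[OF t(1)] t(3) in \<open>auto simp: tens_carr tens3_def\<close>)
 finally show ?thesis .
qed

lemma sw3_bf:
 assumes "trilin kG kG kG V b" "vspace V" "x : carrier G"
 shows "sw3 kG V (bf x) b = b (bf x) (bf x) (bf x)" using sw3_expand[OF assms(1,2) bf_kG[OF assms(3)]]
  lin_from_basis(2)[OF has_basis_kG assms(2), of "%x. b (bf x) (bf x) (bf x)" x] assms by (simp add: trilinD)

section \<open>The dual and its comultiplication\<close>

definition dual_basis :: "'g => ('g => 'k::field) => 'k" where
 "dual_basis x = (%a. if a : carr (kG :: ('k, 'g => 'k) hopf) then a x else 0)"

lemma dual_simps [simp]: "scl (dual V) = fscl" "al : carr (dual V) \<longleftrightarrow> lin V ground al \<and> (\<forall>x. x \<notin> carr V \<longrightarrow> al x = 0)"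
 by (simp_all add: dual_def)

lemma vspace_dual: "vspace (dual (kG :: ('k::field, 'g => 'k) hopf))"
proof -
 interpret vector_space "fscl :: 'k => (('g => 'k) => 'k) => ('g => 'k) => 'k" by (rule vector_space_fscl)
 have "subspace (carr (dual (kG :: ('k::field, 'g => 'k) hopf)))"
 proof (rule subspaceI)
  show "0 : carr (dual (kG :: ('k::field, 'g => 'k) hopf))"
   using lin_zero[OF vspace_ground] by (simp add: zero_fun_def)
  show "al + \<beta> : carr (dual kG)" if "al : carr (dual kG)" "\<beta> : carr (dual kG)" for al \<beta> :: "('g => 'k) => 'k"
   using that lin_add[OF _ _ vspace_ground, of kG al \<beta>] by (simp add: plus_fun_def)
  show "fscl c al : carr (dual kG)" if "al : carr (dual kG)" for c and al :: "('g => 'k) => 'k"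
   using that lin_scl[OF _ vspace_ground, of kG al c] by (simp add: fscl_def)
 qed
 then show ?thesis unfolding vspace_def using vector_space_fscl by simp
qed

lemma has_basis_dual:
 "has_basis (dual (kG :: ('k::field, 'g => 'k) hopf)) (carrier G) dual_basis (%x al. al (bf x))"
 unfolding has_basis_def
proof (intro conjI ballI)
 show "finite (carrier G)" by (rule fin)
 show "vspace (dual (kG :: ('k::field, 'g => 'k) hopf))" by (rule vspace_dual)
 show "dual_basis x : carr (dual (kG :: ('k::field, 'g => 'k) hopf))" if "x : carrier G" for x
  using kG_basis(4)[OF that] unfolding dual_basis_def
  by (auto simp: vspaceD[OF vspace_kG] vspaceD(4)[OF vspace_kG, unfolded scl_kG] lin_def)
 show "lin (dual (kG :: ('k::field, 'g => 'k) hopf)) ground (%al. al (bf x))" for x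
  by (rule linI) (auto simp: fscl_def)
 show "dual_basis y (bf x :: 'g => 'k) = (if x = y then 1 else 0)" if "x : carrier G" "y : carrier G" for x y
  using that by (auto simp: dual_basis_def)
 show "al = (\<Sum>x\<in>carrier G. scl (dual kG) (al (bf x)) (dual_basis x))"
  if al: "al : carr (dual kG)" for al :: "('g => 'k) => 'k"
 proof
  fix a
  have ev: "(\<Sum>x\<in>carrier G. scl (dual kG) (al (bf x)) (dual_basis x)) a =
    (\<Sum>x\<in>carrier G. al (bf x) * dual_basis x a)"
   by (simp add: sum_apply fscl_def)
  show "al a = (\<Sum>x\<in>carrier G. scl (dual kG) (al (bf x)) (dual_basis x)) a"
  proof (cases "a : carr (kG :: ('k, 'g => 'k) hopf)")
   case True
   then show ?thesis unfolding ev using lin_basis_expand[OF has_basis_kG _ vspace_ground True, of al] al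
    by (simp add: dual_basis_def mult.commute)
  next
   case False
   then show ?thesis unfolding ev using al by (simp add: dual_basis_def)
  qed
 qed
qed

lemma bilin_pairing:
 assumes "h : carr kG" "k : carr kG"
 shows "bilin (dual kG) (dual kG) ground (%\<beta> cf. \<beta> h * cf k)"
 by (intro bilinI linI) (auto simp: fscl_def algebra_simps)

text \<open>The comultiplication is given by a description. The explicit double sum shows existence;
  uniqueness holds because the pairings with pairs of group elements are the coordinates of a tensor
  in the dual basis.\<close>

lemma dual_comul_spec:
 fixes al :: "('g => 'k::field) => 'k"
 assumes al: "al : carr (dual kG)"
 shows "dual_comul kG al : carr (dual kG \<boxtimes> dual kG)"
  and "h : carr kG ==> k : carr kG ==>
   tlift (dual kG) (dual kG) ground (%\<beta> cf. \<beta> h * cf k) (dual_comul kG al) = al (hmul kG h k)"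
  and "dual_comul kG al = (\<Sum>x\<in>carrier G. \<Sum>y\<in>carrier G. scl (dual kG \<boxtimes> dual kG)
   (al (bf (x \<otimes> y))) (tens (dual kG) (dual kG) (dual_basis x) (dual_basis y)))"
proof -
 let ?D = "dual (kG :: ('k, 'g => 'k) hopf)"
 let ?P = "%t. t : carr (?D \<boxtimes> ?D) \<and> (\<forall>h\<in>carr kG. \<forall>k\<in>carr kG.
    tlift ?D ?D ground (%\<beta> cf. \<beta> h * cf k) t = al (hmul kG h k))"
 let ?t = "\<Sum>x\<in>carrier G. \<Sum>y\<in>carrier G. scl (?D \<boxtimes> ?D) (al (bf (x \<otimes> y))) (tens ?D ?D (dual_basis x) (dual_basis y))"
 note dD = has_basisD[OF has_basis_dual]
 note l = tlift[OF vspace_dual vspace_dual vspace_ground bilin_pairing]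
 have all: "lin kG ground al" using al by simp
 have tc: "scl (?D \<boxtimes> ?D) (al (bf (x \<otimes> y))) (tens ?D ?D (dual_basis x) (dual_basis y)) : carr (?D \<boxtimes> ?D)"
  if "x : carrier G" "y : carrier G" for x y
  using that by (intro vspaceD(4)[OF vspace_tensor] tens_carr dD(3))
 have t: "?t : carr (?D \<boxtimes> ?D)" by (intro vspaceD(5)[OF vspace_tensor] tc)
 have val: "tlift ?D ?D ground (%\<beta> cf. \<beta> h * cf k) ?t = al (hmul kG h k)"
  if h: "h : carr kG" and k: "k : carr kG" for h k
 proof -
  have "tlift ?D ?D ground (%\<beta> cf. \<beta> h * cf k) ?t = (\<Sum>x\<in>carrier G. \<Sum>y\<in>carrier G. al (bf (x \<otimes> y)) * (h x * k y))"
  proof -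
   have "tlift ?D ?D ground (%\<beta> cf. \<beta> h * cf k) ?t = (\<Sum>x\<in>carrier G. tlift ?D ?D ground (%\<beta> cf. \<beta> h * cf k)
     (\<Sum>y\<in>carrier G. scl (?D \<boxtimes> ?D) (al (bf (x \<otimes> y))) (tens ?D ?D (dual_basis x) (dual_basis y))))"
    by (rule lin_sum[OF l(1)[OF h k] vspace_tensor vspace_ground]) (intro vspaceD(5)[OF vspace_tensor] tc)
   also have "... = (\<Sum>x\<in>carrier G. \<Sum>y\<in>carrier G. tlift ?D ?D ground (%\<beta> cf. \<beta> h * cf k)
     (scl (?D \<boxtimes> ?D) (al (bf (x \<otimes> y))) (tens ?D ?D (dual_basis x) (dual_basis y))))"
    by (intro sum.cong HOL.refl lin_sum[OF l(1)[OF h k] vspace_tensor vspace_ground] tc)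
   also have "... = (\<Sum>x\<in>carrier G. \<Sum>y\<in>carrier G. al (bf (x \<otimes> y)) * (h x * k y))"
   proof (intro sum.cong HOL.refl)
    fix x y assume xy: "x : carrier G" "y : carrier G"
    show "tlift ?D ?D ground (%\<beta> cf. \<beta> h * cf k)
     (scl (?D \<boxtimes> ?D) (al (bf (x \<otimes> y))) (tens ?D ?D (dual_basis x) (dual_basis y))) = al (bf (x \<otimes> y)) * (h x * k y)"
     unfolding linD(3)[OF l(1)[OF h k] tens_carr[OF dD(3)[OF xy(1)] dD(3)[OF xy(2)]]]
      l(2)[OF h k dD(3)[OF xy(1)] dD(3)[OF xy(2)]] using h k by (simp add: dual_basis_def)
   qed
   finally show ?thesis .
  qed
  also have "... = al (hmul kG h k)"
  proof (rule bilin_eq_basis[OF has_basis_kG has_basis_kG _ bilin_comp[OF all bilin_hmul] vspace_ground _ h k,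
     where b = "%h k. (\<Sum>x\<in>carrier G. \<Sum>y\<in>carrier G. al (bf (x \<otimes> y)) * (h x * k y))"])
   show "bilin kG kG ground (%h k. \<Sum>x\<in>carrier G. \<Sum>y\<in>carrier G. al (bf (x \<otimes> y)) * (h x * k y))"
    by (intro bilin_sum bilinI linI) (auto simp: fscl_def algebra_simps)
   fix x y assume xy: "x : carrier G" "y : carrier G"
   have "(\<Sum>x'\<in>carrier G. \<Sum>y'\<in>carrier G. al (bf (x' \<otimes> y')) * (bf x x' * bf y y')) =
     (\<Sum>x'\<in>carrier G. \<Sum>y'\<in>carrier G. if y' = y then (if x' = x then al (bf (x \<otimes> y)) else 0) else 0)"
    by (intro sum.cong HOL.refl) (auto simp: basis_fun_def)
   also have "... = (\<Sum>x'\<in>carrier G. if x' = x then al (bf (x \<otimes> y)) else 0)"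
    by (intro sum.cong HOL.refl) (use xy fin in \<open>simp add: sum.delta\<close>)
   also have "... = al (bf (x \<otimes> y))" using xy fin by (simp add: sum.delta)
   finally show "(\<Sum>x'\<in>carrier G. \<Sum>y'\<in>carrier G. al (bf (x' \<otimes> y')) * (bf x x' * bf y y')) = al (hmul kG (bf x) (bf y))"
    using xy by simp
  qed
  finally show ?thesis .
 qed
 have uniq: "t = t'" if t: "?P t" "?P t'" for t t'
 proof -
  note B = has_basis_tensor[OF has_basis_dual has_basis_dual]
  have co: "(case q of (x, y) => %t. lcomp ?D ?D (%x al. al (bf x)) x t (bf y)) t = al (hmul kG (bf (fst q)) (bf (snd q)))"
   if "q : carrier G \<times> carrier G" "?P t" for q t
  proof -
   obtain x y where q: "q = (x, y)" by (cases q)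
   have xy: "x : carrier G" "y : carrier G" using that q by auto
   have "(%t. lcomp ?D ?D (%x al. al (bf x)) x t (bf y)) t = tlift ?D ?D ground (%\<beta> cf. \<beta> (bf x) * cf (bf y)) t"
   proof (rule lin_eq_tensor[OF _ l(1)[OF bf_kG[OF xy(1)] bf_kG[OF xy(2)]] vspace_ground])
    show "lin (?D \<boxtimes> ?D) ground (%t. lcomp ?D ?D (%x al. al (bf x)) x t (bf y))"
     by (rule lin_comp[OF dD(4)[OF xy(2)] lcomp(1)[OF has_basis_dual vspace_dual xy(1)]])
    show "t : carr (?D \<boxtimes> ?D)" using that by blast
    fix \<beta> cf assume "\<beta> : carr ?D" "cf : carr ?D"
    then show "lcomp ?D ?D (%x al. al (bf x)) x (tens ?D ?D \<beta> cf) (bf y) =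
      tlift ?D ?D ground (%\<beta> cf. \<beta> (bf x) * cf (bf y)) (tens ?D ?D \<beta> cf)"
     using lcomp(2)[OF has_basis_dual vspace_dual xy(1), of \<beta> cf] l(2)[OF bf_kG[OF xy(1)] bf_kG[OF xy(2)], of \<beta> cf]
     by (simp add: fscl_def)
   qed
   then show ?thesis using that(2) xy unfolding q by simp
  qed
  have "t = (\<Sum>q\<in>carrier G \<times> carrier G. scl (?D \<boxtimes> ?D) (al (hmul kG (bf (fst q)) (bf (snd q))))
    (case q of (x, y) => tens ?D ?D (dual_basis x) (dual_basis y)))" if "?P t" for t
  proof -
   have "t : carr (?D \<boxtimes> ?D)" using that by blast
   from has_basisD(6)[OF B this] show ?thesis using co[OF _ that] by (simp cong: sum.cong)
  qed
  from this[OF t(1)] this[OF t(2)] show ?thesis by simp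
 qed
 have P: "?P (dual_comul kG al)" unfolding dual_comul_def by (rule theI[of ?P ?t]) (use t val uniq in blast)+
 have "?P ?t" using t val by blast
 from uniq[OF P this] show "dual_comul kG al = ?t" .
 show "dual_comul kG al : carr (?D \<boxtimes> ?D)" using P by blast
 show "h : carr kG ==> k : carr kG ==>
   tlift ?D ?D ground (%\<beta> cf. \<beta> h * cf k) (dual_comul kG al) = al (hmul kG h k)"
  using P by blast
qed

end

section \<open>Group-likes, characters and pairs in involution\<close>

context finite_group
begin

text \<open>Coefficients of \<Delta>(a) = a \<otimes> a give a(x) a(y) = 0 for x \<noteq> y and
  a(x)^2 = a(x). The counit excludes a = 0, so exactly one coefficient is nonzero, and it is
  1.\<close>

lemma carrier_grouplikes: "carrier (grouplikes kG) = bf ` carrier G"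
proof
 show "bf ` carrier G \<subseteq> carrier (grouplikes kG)" by (auto simp: grouplikes_def hcomul_bf)
 show "carrier (grouplikes kG) \<subseteq> bf ` carrier G"
 proof
  fix a :: "'g => 'k::field" assume "a : carrier (grouplikes kG)"
  then have a: "a : carr kG" "hcomul kG a = tens kG kG a a" "hcounit kG a = 1" by (auto simp: grouplikes_def)
  have co: "a x * a y = (if x = y then a x else 0)" if xy: "x : carrier G" "y : carrier G" for x y
  proof -
   have l: "lin kG kG (%a. lcomp kG kG (%x a. a x) x (hcomul kG a))"
    by (rule lin_comp[OF lcomp(1)[OF has_basis_kG vspace_kG xy(1)] lin_hcomul])
   have "lcomp kG kG (%x a. a x) x (hcomul kG a) = fscl (a x) (bf x)"
   proof (rule lin_eq_basis[OF has_basis_kG l _ vspace_kG _ a(1)])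
    show "lin kG kG (%a. fscl (a x) (bf x))"
     using lin_scl_left[OF kG_basis(4)[OF xy(1)] vspace_kG bf_kG[OF xy(1)]] by simp
    fix z assume z: "z : carrier G"
    show "lcomp kG kG (%x a. a x) x (hcomul kG (bf z)) = fscl (bf z x) (bf x)"
     unfolding hcomul_bf[OF z] lcomp_basis[OF has_basis_kG vspace_kG xy(1) z bf_kG[OF z]]
     by (auto simp: fscl_def basis_fun_def fun_eq_iff)
   qed
   moreover have "lcomp kG kG (%x a. a x) x (tens kG kG a a) = fscl (a x) a"
    using lcomp(2)[OF has_basis_kG vspace_kG xy(1) a(1) a(1)] by simp
   ultimately have "fscl (a x) (bf x) y = fscl (a x) a y" using a(2) by simp
   then show ?thesis by (auto simp: fscl_def basis_fun_def)
  qed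
  have "(\<Sum>x\<in>carrier G. a x) = 1" using a(3) by (simp add: group_algebra_def)
  then obtain x where x: "x : carrier G" "a x ~= 0" by (metis sum.neutral zero_neq_one)
  have "a y = bf x y" for y
  proof (cases "y : carrier G")
   case True
   then show ?thesis using co[OF x(1) True] co[OF x(1) x(1)] x(2) by (auto simp: basis_fun_def split: if_splits)
  next
   case False
   then have "y ~= x" using x by auto
   then show ?thesis using False a(1) by (simp add: group_algebra_def group_space_def)
  qed
  then have "a = bf x" by (rule ext)
  then show "a : bf ` carrier G" using x by blast
 qed
qed

lemma grouplikes_simps:
 "\<one>\<^bsub>grouplikes kG\<^esub> = bf \<one>"
 "x : carrier G ==> y : carrier G ==> bf x \<otimes>\<^bsub>grouplikes kG\<^esub> bf y = bf (x \<otimes> y)"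
 by (simp_all add: grouplikes_def)

lemma group_grouplikes: "group (grouplikes kG)"
 by (rule groupI) (auto simp: carrier_grouplikes grouplikes_simps m_assoc intro!: bexI[of _ "inv x" for x])

lemma grouplikes_inv: "x : carrier G ==> inv\<^bsub>grouplikes kG\<^esub> bf x = bf (inv x)"
 by (rule group.inv_equality[OF group_grouplikes]) (auto simp: carrier_grouplikes grouplikes_simps)

lemma grouplikes_pow:
 assumes "x : carrier G"
 shows "bf x [^]\<^bsub>grouplikes (kG :: ('k::field, 'g => 'k) hopf)\<^esub> (n :: nat) = bf (x [^] n)"
proof -
 interpret gl: group "grouplikes (kG :: ('k, 'g => 'k) hopf)" by (rule group_grouplikes)
 show ?thesis by (induction n) (simp_all add: grouplikes_simps assms)
qed

lemma grouplikes_int_pow: "x : carrier G ==> bf x [^]\<^bsub>grouplikes kG\<^esub> (n :: int) = bf (x [^] n)"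
 by (cases "n < 0")
  (simp_all only: int_pow_def2 if_True if_False grouplikes_pow grouplikes_inv nat_pow_closed)

definition char_of :: "('g => 'k::field) => ('g => 'k) => 'k" where
 "char_of f = (%a. if a : carr kG then \<Sum>x\<in>carrier G. a x * f x else 0)"

lemma char_of_dual: "char_of f : carr (dual kG)"
proof -
 have "lin kG ground (%a. \<Sum>x\<in>carrier G. scl ground (a x) (f x))"
  by (rule lin_from_basis(1)[OF has_basis_kG vspace_ground]) simp
 then have "lin kG ground (char_of f)"
  using lin_cong[OF _ vspace_kG, of "char_of f" "%a. \<Sum>x\<in>carrier G. scl ground (a x) (f x)" ground]
  by (simp add: char_of_def)
 then show ?thesis by (simp add: char_of_def)
qed

lemma char_of_bf: "x : carrier G ==> char_of f (bf x) = f x"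
 using lin_from_basis(2)[OF has_basis_kG vspace_ground, of f x] by (simp add: char_of_def)

lemma dual_eqI:
 assumes "al : carr (dual kG)" "\<beta> : carr (dual kG)" "!!x. x : carrier G ==> al (bf x) = \<beta> (bf x)"
 shows "al = \<beta>"
proof
 fix a show "al a = \<beta> a"
 proof (cases "a : carr kG")
  case True
  show ?thesis
   by (rule lin_eq_basis[where F = al and F' = \<beta>, OF has_basis_kG _ _ vspace_ground assms(3) True])
    (use assms in auto)
 qed (use assms in auto)
qed

lemma charactersD:
 assumes "\<chi> : carrier (characters kG)"
 shows "\<chi> : carr (dual kG)" "lin kG ground \<chi>" "\<chi> (bf \<one>) = 1"
  "x : carrier G ==> y : carrier G ==> \<chi> (bf (x \<otimes> y)) = \<chi> (bf x) * \<chi> (bf y)"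
  "x : carrier G ==> \<chi> (bf x) ~= 0" "x : carrier G ==> \<chi> (bf (inv x)) = inverse (\<chi> (bf x))"
proof -
 have m: "\<chi> (hmul kG (bf x) (bf y)) = \<chi> (bf x) * \<chi> (bf y)" if "x : carrier G" "y : carrier G" for x y
 proof -
  have "\<forall>a\<in>carr kG. \<forall>b\<in>carr kG. \<chi> (hmul kG a b) = \<chi> a * \<chi> b"
   using assms unfolding characters_def by simp
  then show ?thesis using bf_kG that by blast
 qed
 show "\<chi> : carr (dual kG)" "lin kG ground \<chi>" and one: "\<chi> (bf \<one>) = 1"
  using assms unfolding characters_def by auto
 show mult: "x : carrier G ==> y : carrier G ==> \<chi> (bf (x \<otimes> y)) = \<chi> (bf x) * \<chi> (bf y)" for x y
  using m[of x y] by simp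
 have "\<chi> (bf x) * \<chi> (bf (inv x)) = 1" if "x : carrier G" for x using mult[of x "inv x"] that one by simp
 then show "x : carrier G ==> \<chi> (bf x) ~= 0" "x : carrier G ==> \<chi> (bf (inv x)) = inverse (\<chi> (bf x))"
  by (force, metis inverse_unique)
qed

lemma char_of_characters:
 assumes "f \<one> = 1" "!!x y. x : carrier G ==> y : carrier G ==> f (x \<otimes> y) = f x * f y"
 shows "char_of f : carrier (characters kG)"
proof -
 have l: "lin kG ground (char_of f)" using char_of_dual[of f] by simp
 have "char_of f (hmul kG a b) = char_of f a * char_of f b" if ab: "a : carr kG" "b : carr kG" for a b
 proof (rule bilin_eq_basis[OF has_basis_kG has_basis_kG bilin_comp[OF l bilin_hmul] _ vspace_ground _ ab])
  show "bilin kG kG ground (%a b. char_of f a * char_of f b)"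
   using bilin_scl_left[OF l l vspace_ground] by simp
 qed (simp add: char_of_bf assms)
 then show ?thesis unfolding characters_def using char_of_dual assms(1) by (simp add: char_of_bf)
qed

lemma characters_mult:
 assumes "\<chi> : carrier (characters kG)" "\<eta> : carrier (characters kG)"
 shows "\<chi> \<otimes>\<^bsub>characters kG\<^esub> \<eta> = char_of (%x. \<chi> (bf x) * \<eta> (bf x))"
proof -
 have "bilin kG kG ground (%x y. \<chi> x * \<eta> y)"
  using bilin_scl_left[OF charactersD(2)[OF assms(1)] charactersD(2)[OF assms(2)] vspace_ground] by simp
 from sw2_expand[OF this vspace_ground] show ?thesis unfolding characters_def char_of_def by (simp add: fun_eq_iff)
qed

lemma characters_one: "\<one>\<^bsub>characters kG\<^esub> = char_of (%_. 1)"
 unfolding characters_def char_of_def by (simp add: fun_eq_iff group_algebra_def)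

lemma characters_mult_closed:
 "\<chi> : carrier (characters kG) ==> \<eta> : carrier (characters kG) ==>
  \<chi> \<otimes>\<^bsub>characters kG\<^esub> \<eta> : carrier (characters kG)"
 unfolding characters_mult by (rule char_of_characters) (simp_all add: charactersD)

lemma characters_eqI:
 "\<chi> : carrier (characters kG) ==> \<eta> : carrier (characters kG) ==>
  (!!x. x : carrier G ==> \<chi> (bf x) = \<eta> (bf x)) ==> \<chi> = \<eta>"
 by (rule dual_eqI) (auto dest: charactersD(1) simp del: dual_simps)

lemma characters_mult_bf:
 "\<chi> : carrier (characters kG) ==> \<eta> : carrier (characters kG) ==> x : carrier G ==>
  (\<chi> \<otimes>\<^bsub>characters kG\<^esub> \<eta>) (bf x) = \<chi> (bf x) * \<eta> (bf x)"
 by (simp add: characters_mult char_of_bf)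

lemma characters_one_closed: "\<one>\<^bsub>characters kG\<^esub> : carrier (characters kG)"
 unfolding characters_one by (rule char_of_characters) simp_all

lemma characters_inv_closed:
 "\<chi> : carrier (characters kG) ==> char_of (%x. \<chi> (bf (inv x))) : carrier (characters kG)"
 by (rule char_of_characters) (simp_all add: charactersD)

lemma group_characters: "group (characters kG)"
proof (rule groupI)
 show "\<chi> \<otimes>\<^bsub>characters kG\<^esub> \<eta> : carrier (characters kG)"
  if "\<chi> : carrier (characters kG)" "\<eta> : carrier (characters kG)" for \<chi> \<eta> :: "('g => 'k::field) => 'k"
  using that by (rule characters_mult_closed)
 show "\<one>\<^bsub>characters kG\<^esub> : carrier (characters kG)" by (rule characters_one_closed)
 show "\<chi> \<otimes>\<^bsub>characters kG\<^esub> \<eta> \<otimes>\<^bsub>characters kG\<^esub> \<zeta> = \<chi> \<otimes>\<^bsub>characters kG\<^esub> (\<eta> \<otimes>\<^bsub>characters kG\<^esub> \<zeta>)"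
  if "\<chi> : carrier (characters kG)" "\<eta> : carrier (characters kG)" "\<zeta> : carrier (characters kG)"
  for \<chi> \<eta> \<zeta> :: "('g => 'k::field) => 'k"
  using that by (intro characters_eqI characters_mult_closed) (simp_all add: characters_mult_bf characters_mult_closed)
 show "\<one>\<^bsub>characters kG\<^esub> \<otimes>\<^bsub>characters kG\<^esub> \<chi> = \<chi>" if "\<chi> : carrier (characters kG)"
  for \<chi> :: "('g => 'k::field) => 'k"
 proof (rule characters_eqI[OF characters_mult_closed[OF characters_one_closed that] that])
  fix x assume x: "x : carrier G"
  show "(\<one>\<^bsub>characters kG\<^esub> \<otimes>\<^bsub>characters kG\<^esub> \<chi>) (bf x) = \<chi> (bf x)"
   unfolding characters_mult_bf[OF characters_one_closed that x] by (simp add: characters_one char_of_bf x)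
 qed
 show "\<exists>\<eta>\<in>carrier (characters kG). \<eta> \<otimes>\<^bsub>characters kG\<^esub> \<chi> = \<one>\<^bsub>characters kG\<^esub>"
  if c: "\<chi> : carrier (characters kG)" for \<chi> :: "('g => 'k::field) => 'k"
 proof (rule bexI[OF _ characters_inv_closed[OF c]], rule characters_eqI)
  show "char_of (%x. \<chi> (bf (inv x))) \<otimes>\<^bsub>characters kG\<^esub> \<chi> : carrier (characters kG)"
   by (rule characters_mult_closed[OF characters_inv_closed[OF c] c])
  show "\<one>\<^bsub>characters kG\<^esub> : carrier (characters kG)" by (rule characters_one_closed)
  fix x assume x: "x : carrier G"
  show "(char_of (%x. \<chi> (bf (inv x))) \<otimes>\<^bsub>characters kG\<^esub> \<chi>) (bf x) = \<one>\<^bsub>characters kG\<^esub> (bf x)"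
   unfolding characters_mult_bf[OF characters_inv_closed[OF c] c x] characters_one
   using x charactersD(5,6)[OF c x] by (simp add: char_of_bf)
 qed
qed

lemma characters_inv_bf:
 assumes c: "\<chi> : carrier (characters kG)" and x: "x : carrier G"
 shows "(inv\<^bsub>characters kG\<^esub> \<chi>) (bf x) = inverse (\<chi> (bf x))"
proof -
 note i = group.inv_closed[OF group_characters c] group.l_inv[OF group_characters c]
 have "(inv\<^bsub>characters kG\<^esub> \<chi>) (bf x) * \<chi> (bf x) = 1"
  using characters_mult_bf[OF i(1) c x] i(2) x by (simp add: characters_one char_of_bf)
 then show ?thesis using charactersD(5)[OF c x] by (simp add: field_simps)
qed

lemma characters_pow_bf:
 assumes c: "\<chi> : carrier (characters kG)" and x: "x : carrier G"
 shows "(\<chi> [^]\<^bsub>characters kG\<^esub> (n :: nat)) (bf x) = \<chi> (bf x) ^ n"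
proof -
 interpret c: group "characters kG" by (rule group_characters)
 show ?thesis by (induction n)
   (simp_all add: characters_one char_of_bf x characters_mult_bf[OF c.nat_pow_closed[OF c] c x])
qed

lemma characters_int_pow_bf:
 assumes c: "\<chi> : carrier (characters kG)" and x: "x : carrier G"
 shows "(\<chi> [^]\<^bsub>characters kG\<^esub> (2 :: int)) (bf x) = \<chi> (bf x) ^ 2"
  and "(\<chi> [^]\<^bsub>characters kG\<^esub> (- (2 * int n))) (bf x) = inverse (\<chi> (bf x) ^ (2 * n))"
proof -
 interpret c: group "characters kG" by (rule group_characters)
 have "\<chi> [^]\<^bsub>characters kG\<^esub> (int 2) = \<chi> [^]\<^bsub>characters kG\<^esub> (2 :: nat)" by (rule int_pow_int)
 then show "(\<chi> [^]\<^bsub>characters kG\<^esub> (2 :: int)) (bf x) = \<chi> (bf x) ^ 2"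
  using characters_pow_bf[OF c x, of 2] by simp
 have "\<chi> [^]\<^bsub>characters kG\<^esub> (- int (2 * n)) = inv\<^bsub>characters kG\<^esub> (\<chi> [^]\<^bsub>characters kG\<^esub> (2 * n :: nat))"
  by (rule c.int_pow_neg_int[OF c])
 then show "(\<chi> [^]\<^bsub>characters kG\<^esub> (- (2 * int n))) (bf x) = inverse (\<chi> (bf x) ^ (2 * n))"
  using characters_inv_bf[OF c.nat_pow_closed[OF c] x] characters_pow_bf[OF c x, of "2 * n"] by simp
qed

lemma characters_int_pow_closed:
 "\<chi> : carrier (characters kG) ==> \<chi> [^]\<^bsub>characters kG\<^esub> (n :: int) : carrier (characters kG)"
 by (rule group.int_pow_closed[OF group_characters])

text \<open>On a group element the antipode squares to the identity and the two character values
  cancel, which leaves h = p h p^-1.\<close>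

lemma pair_in_involutionD:
 fixes p :: "'g => 'k::field"
 assumes "pair_in_involution kG p \<chi>"
 shows "\<exists>q. p = bf q \<and> central G q" and "\<chi> : carrier (characters kG)"
proof -
 show c: "\<chi> : carrier (characters kG)" using assms unfolding pair_in_involution_def by blast
 have "p : carrier (grouplikes kG)" using assms unfolding pair_in_involution_def by blast
 then obtain q where q: "q : carrier G" "p = bf q" unfolding carrier_grouplikes by blast
 let ?i = "inv\<^bsub>characters kG\<^esub> \<chi>"
 have i: "?i : carrier (characters kG)" by (rule group.inv_closed[OF group_characters c])
 have "trilin kG kG kG kG (%h1 h2 h3. scl kG (?i h1 * \<chi> h3) (hmul kG (hmul kG p h2) (inv\<^bsub>grouplikes kG\<^esub> p)))"
 proof (rule trilin_outer[where b = "%k. scl kG k" and A = ground and B = kG])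
  show "bilin ground kG kG (scl kG)" by (rule bilin_scl_left[OF _ lin_id vspace_kG]) (rule linI, auto)
  show "bilin kG kG ground (%h1 h3. ?i h1 * \<chi> h3)"
   using bilin_scl_left[OF charactersD(2)[OF i] charactersD(2)[OF c] vspace_ground] by simp
  show "lin kG kG (%h2. hmul kG (hmul kG p h2) (inv\<^bsub>grouplikes kG\<^esub> p))"
   by (rule lin_comp[OF bilinD(2)[OF bilin_hmul] bilinD(1)[OF bilin_hmul]])
    (simp_all add: q grouplikes_inv)
 qed
 note s = sw3_bf[OF this vspace_kG]
 have "q \<otimes> h \<otimes> inv q = h" if h: "h : carrier G" for h
 proof -
  have "hanti kG (hanti kG (bf h)) = scl kG (?i (bf h) * \<chi> (bf h)) (hmul kG (hmul kG p (bf h)) (inv\<^bsub>grouplikes kG\<^esub> p))"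
   using assms s[OF h] bf_kG[OF h] unfolding pair_in_involution_def by metis
  then have "(bf h :: 'g => 'k) = fscl 1 (bf (q \<otimes> h \<otimes> inv q))"
   using h q charactersD(5)[OF c h] by (simp add: characters_inv_bf[OF c h] grouplikes_inv)
  then have "(bf h :: 'g => 'k) = bf (q \<otimes> h \<otimes> inv q)" by (simp add: fscl_def)
  then show ?thesis by (simp add: basis_fun_inject)
 qed
 then have "q \<otimes> h = h \<otimes> q" if "h : carrier G" for h
  using that q(1) by (metis inv_solve_right m_closed)
 then have "central G q" unfolding central_def using q(1) by blast
 then show "\<exists>q. p = bf q \<and> central G q" using q(2) by blast
qed

end

section \<open>The Yetter--Drinfeld module of homomorphisms\<close>

text \<open>Finiteness of \<open>Hom_grp P G\<close> gives \<Omega> a finite basis, so that the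
  calculus of finite bases applies to it.\<close>

locale hom_space = finite_group G for G :: "('g, 'b) monoid_scheme" (structure) +
 fixes P :: "('w, 'y) monoid_scheme" and x0 :: 'w
 assumes P_mult: "!!a b. a : carrier P ==> b : carrier P ==> a \<otimes>\<^bsub>P\<^esub> b : carrier P"
  and x0: "x0 : carrier P" and fin_Hom: "finite (Hom_grp P G)"
begin

abbreviation \<Omega> :: "('k::field, ('w => 'g) => 'k) vspace" where "\<Omega> \<equiv> omega P G"

lemma hom_conj_Hom: "h : carrier G ==> f : Hom_grp P G ==> hom_conj P G h f : Hom_grp P G"
 unfolding Hom_grp_def hom_conj_def by (auto simp: hom_def P_mult group_word_simps Pi_iff)

lemma Hom_value: "f : Hom_grp P G ==> f x0 : carrier G" unfolding Hom_grp_def hom_def using x0 by auto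

lemma hom_conj_mult:
 "h : carrier G ==> k : carrier G ==> f : Hom_grp P G ==>
  hom_conj P G (h \<otimes> k) f = hom_conj P G h (hom_conj P G k f)"
 unfolding Hom_grp_def hom_conj_def hom_def by (auto simp: group_word_simps Pi_def)

lemma hom_conj_one: "f : Hom_grp P G ==> hom_conj P G \<one> f = f"
 unfolding Hom_grp_def hom_conj_def hom_def by (auto simp: fun_eq_iff extensional_def Pi_def)

lemma has_basis_\<Omega>: "has_basis (\<Omega> :: ('k::field, _) vspace) (Hom_grp P G) basis_fun (%f w. w f)"
proof (rule has_basis_cong[OF has_basis_functions[OF fin_Hom]])
 show "carr \<lparr>carr = {w. \<forall>x. x \<notin> Hom_grp P G \<longrightarrow> w x = 0}, scl = fscl\<rparr> = carr (\<Omega> :: ('k, _) vspace)"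
 proof -
  have "finite {f. w f ~= 0}" if "\<forall>x. x \<notin> Hom_grp P G \<longrightarrow> w x = 0" for w :: "_ => 'k"
   by (rule finite_subset[OF _ fin_Hom]) (use that in auto)
  then show ?thesis unfolding omega_def by auto
 qed
qed (simp add: omega_def)

lemmas \<Omega>_basis = has_basisD[OF has_basis_\<Omega>]

lemma vspace_\<Omega> [simp]: "vspace \<Omega>" by (rule \<Omega>_basis)
lemma scl_\<Omega> [simp]: "scl \<Omega> = fscl" by (simp add: omega_def)
lemma basis_\<Omega> [simp]: "f : Hom_grp P G ==> basis_fun f : carr \<Omega>" by (rule \<Omega>_basis)

lemma omega_support: "w : carr \<Omega> ==> {f. w f ~= 0} \<subseteq> Hom_grp P G" by (simp add: omega_def)

lemma omega_act_expand:
 "w : carr \<Omega> ==> omega_act P G a w =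
  (\<Sum>h\<in>carrier G. \<Sum>f\<in>Hom_grp P G. fscl (a h) (fscl (w f) (basis_fun (hom_conj P G h f))))"
 unfolding omega_act_def using omega_support[of w] fin_Hom
 by (intro sum.cong HOL.refl sum.mono_neutral_cong_left) (auto simp: fscl_def fun_eq_iff mult.assoc)

lemma bilin_omega_act: "bilin kG (\<Omega> :: ('k::field, _) vspace) \<Omega> (omega_act P G)"
proof (rule bilin_cong[OF _ vspace_kG vspace_\<Omega>])
 show "(\<Sum>h\<in>carrier G. \<Sum>f\<in>Hom_grp P G. scl \<Omega> (a h) (scl \<Omega> (w f) (basis_fun (hom_conj P G h f)))) = omega_act P G a w"
  if "w : carr \<Omega>" for a and w :: "_ => 'k" using omega_act_expand[OF that] by simp
 show "bilin kG (\<Omega> :: ('k, _) vspace) \<Omega>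
   (%a w. \<Sum>h\<in>carrier G. \<Sum>f\<in>Hom_grp P G. scl \<Omega> (a h) (scl \<Omega> (w f) (basis_fun (hom_conj P G h f))))"
  by (intro bilin_sum vspace_\<Omega> bilin_scl_left kG_basis(4) lin_scl_left \<Omega>_basis(4) basis_\<Omega> hom_conj_Hom)
qed

lemma omega_act_basis:
 assumes "h : carrier G" "f : Hom_grp P G"
 shows "omega_act P G (bf h) (basis_fun f) = (basis_fun (hom_conj P G h f) :: _ => 'k::field)"
proof -
 have "omega_act P G (bf h) (basis_fun f) = (\<Sum>k\<in>carrier G. scl \<Omega> (bf h k)
  (\<Sum>f'\<in>Hom_grp P G. scl \<Omega> (basis_fun f f') (basis_fun (hom_conj P G k f') :: _ => 'k)))"
  by (simp add: omega_act_expand[OF basis_\<Omega>[OF assms(2)]] vspaceD(12)[OF vspace_\<Omega>, unfolded scl_\<Omega>])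
 also have "... = (\<Sum>k\<in>carrier G. scl \<Omega> (bf h k) (basis_fun (hom_conj P G k f)))"
  by (intro sum.cong HOL.refl arg_cong[where f = "scl \<Omega> (bf h k)" for k]
   lin_from_basis(2)[OF has_basis_\<Omega> vspace_\<Omega> _ assms(2)]) (simp add: hom_conj_Hom)
 also have "... = basis_fun (hom_conj P G h f)"
  by (rule lin_from_basis(2)[OF has_basis_kG vspace_\<Omega> _ assms(1)]) (simp add: hom_conj_Hom assms)
 finally show ?thesis .
qed

lemma omega_coact_expand:
 "w : carr \<Omega> ==> omega_coact P G x0 w =
  (\<Sum>f\<in>Hom_grp P G. scl (kG \<boxtimes> \<Omega>) (w f) (tens kG \<Omega> (bf (f x0)) (basis_fun f)))"
 unfolding omega_coact_def using omega_support[of w] fin_Hom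
 by (simp, intro sum.mono_neutral_cong_left) (auto simp: fscl_def fun_eq_iff)

lemma lin_omega_coact: "lin (\<Omega> :: ('k::field, _) vspace) (kG \<boxtimes> \<Omega>) (omega_coact P G x0)"
proof -
 have "lin \<Omega> (kG \<boxtimes> \<Omega>) (%w. \<Sum>f\<in>Hom_grp P G. scl (kG \<boxtimes> \<Omega>) (w f) (tens kG \<Omega> (bf (f x0)) (basis_fun f)))"
  by (rule lin_from_basis(1)[OF has_basis_\<Omega> vspace_tensor]) (simp add: tens_carr Hom_value)
 moreover have eq: "omega_coact P G x0 w = (%w. \<Sum>f\<in>Hom_grp P G. scl (kG \<boxtimes> \<Omega>) (w f)
   (tens kG \<Omega> (bf (f x0)) (basis_fun f))) w" if "w : carr \<Omega>" for w :: "_ => 'k"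
  by (rule omega_coact_expand[OF that])
 ultimately show ?thesis
  using lin_cong[where f = "omega_coact P G x0" and W = "kG \<boxtimes> (\<Omega> :: ('k, _) vspace)", OF eq vspace_\<Omega>] by blast
qed

lemma omega_coact_basis:
 assumes f: "f : Hom_grp P G"
 shows "omega_coact P G x0 (basis_fun f) = tens kG \<Omega> (bf (f x0)) (basis_fun f)"
 unfolding omega_coact_expand[OF basis_\<Omega>[OF f]]
 by (rule lin_from_basis(2)[OF has_basis_\<Omega> vspace_tensor _ f]) (simp add: tens_carr Hom_value)

lemma left_module_\<Omega>: "left_module kG (\<Omega> :: ('k::field, _) vspace) (omega_act P G)"
 unfolding left_module_def
proof (intro conjI ballI)
 show "bilin kG (\<Omega> :: ('k, _) vspace) \<Omega> (omega_act P G)" by (rule bilin_omega_act)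
 fix v assume v: "v : carr (\<Omega> :: ('k, _) vspace)"
 show "omega_act P G (hone kG) v = v"
  by (rule lin_eq_basis[OF has_basis_\<Omega> bilinD(1)[OF bilin_omega_act] lin_id vspace_\<Omega> _ v])
   (simp_all add: omega_act_basis hom_conj_one)
 fix a b assume a: "a : carr (kG :: ('k, 'g => 'k) hopf)" and b: "b : carr (kG :: ('k, 'g => 'k) hopf)"
 show "omega_act P G (hmul kG a b) v = omega_act P G a (omega_act P G b v)"
 proof (rule bilin_eq_basis[OF has_basis_kG has_basis_kG _ _ vspace_\<Omega> _ a b])
  show "bilin kG kG \<Omega> (%a b. omega_act P G (hmul kG a b) v)"
   by (rule bilin_comp[OF bilinD(2)[OF bilin_omega_act v] bilin_hmul])
  show "bilin kG kG \<Omega> (%a b. omega_act P G a (omega_act P G b v))"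
   by (rule bilin_comp2[OF bilin_omega_act lin_id bilinD(2)[OF bilin_omega_act v]])
  fix x y assume xy: "x : carrier G" "y : carrier G"
  show "omega_act P G (hmul kG (bf x) (bf y)) v = omega_act P G (bf x) (omega_act P G (bf y) v)"
  proof (rule lin_eq_basis[OF has_basis_\<Omega> _ _ vspace_\<Omega> _ v])
   show "lin \<Omega> \<Omega> (%v. omega_act P G (hmul kG (bf x) (bf y)) v)"
    by (rule bilinD(1)[OF bilin_omega_act]) (simp add: xy)
   show "lin \<Omega> \<Omega> (%v. omega_act P G (bf x) (omega_act P G (bf y) v))"
    by (rule lin_comp[OF bilinD(1)[OF bilin_omega_act] bilinD(1)[OF bilin_omega_act]]) (simp_all add: xy)
  qed (simp add: xy omega_act_basis hom_conj_mult hom_conj_Hom)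
 qed
qed

lemma left_comodule_\<Omega>: "left_comodule kG (\<Omega> :: ('k::field, _) vspace) (omega_coact P G x0)"
 unfolding left_comodule_def
proof (intro conjI ballI)
 let ?d = "omega_coact P G x0"
 let ?T = "kG \<boxtimes> kG \<boxtimes> (\<Omega> :: ('k, _) vspace)"
 show "lin (\<Omega> :: ('k, _) vspace) (kG \<boxtimes> \<Omega>) ?d" by (rule lin_omega_coact)
 have b1: "bilin kG \<Omega> ?T (%a w. tens kG (kG \<boxtimes> \<Omega>) a (?d w))"
  by (rule bilin_comp2[OF bilin_tens lin_id lin_omega_coact])
 have t3: "trilin kG kG \<Omega> ?T (tens3 kG kG \<Omega>)" unfolding trilin_def tens3_def
  by (auto intro!: bilin_comp[OF bilinD(1)[OF bilin_tens] bilin_tens] bilinD(2)[OF bilin_tens] tens_carr)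
 have b2: "bilin kG \<Omega> ?T (%a w. sw2 kG ?T a (%a1 a2. tens3 kG kG \<Omega> a1 a2 w))"
 proof (rule bilin_cong[OF _ vspace_kG vspace_\<Omega>])
  show "(\<Sum>x\<in>carrier G. scl ?T (a x) (tens3 kG kG \<Omega> (bf x) (bf x) w)) =
    sw2 kG ?T a (%a1 a2. tens3 kG kG \<Omega> a1 a2 w)"
   if "a : carr kG" "w : carr \<Omega>" for a w by (rule sw2_expand[symmetric, OF _ vspace_tensor that(1)])
    (intro bilinI bilinD(2)[OF trilinD(1)[OF t3]] trilinD(2)[OF t3] that(2))
  show "bilin kG \<Omega> ?T (%a w. \<Sum>x\<in>carrier G. scl ?T (a x) (tens3 kG kG \<Omega> (bf x) (bf x) w))"
   by (intro bilin_sum vspace_tensor bilin_scl_left kG_basis(4) bilinD(1)[OF trilinD(1)[OF t3]] bf_kG)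
 qed
 have b3: "bilin kG \<Omega> \<Omega> (%a w. scl \<Omega> (hcounit kG a) w)"
  by (rule bilin_scl_left[OF lin_hcounit lin_id vspace_\<Omega>])
 note l1 = tlift[OF vspace_kG vspace_\<Omega> vspace_tensor b1]
 note l2 = tlift[OF vspace_kG vspace_\<Omega> vspace_tensor b2]
 note l3 = tlift[OF vspace_kG vspace_\<Omega> vspace_\<Omega> b3]
 fix v assume v: "v : carr (\<Omega> :: ('k, _) vspace)"
 show "tlift kG \<Omega> ?T (%a w. tens kG (kG \<boxtimes> \<Omega>) a (?d w)) (?d v) =
   tlift kG \<Omega> ?T (%a w. sw2 kG ?T a (%a1 a2. tens3 kG kG \<Omega> a1 a2 w)) (?d v)"
 proof (rule lin_eq_basis[OF has_basis_\<Omega> lin_comp[OF l1(1) lin_omega_coact]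
    lin_comp[OF l2(1) lin_omega_coact] vspace_tensor _ v])
  fix f assume f: "f : Hom_grp P G"
  have "bilin kG kG ?T (%a1 a2. tens3 kG kG \<Omega> a1 a2 (basis_fun f))"
   by (intro bilinI bilinD(2)[OF trilinD(1)[OF t3]] trilinD(2)[OF t3] basis_\<Omega>[OF f])
  note s = sw2_bf[OF this vspace_tensor Hom_value[OF f]]
  show "tlift kG \<Omega> ?T (%a w. tens kG (kG \<boxtimes> \<Omega>) a (?d w)) (?d (basis_fun f)) =
   tlift kG \<Omega> ?T (%a w. sw2 kG ?T a (%a1 a2. tens3 kG kG \<Omega> a1 a2 w)) (?d (basis_fun f))"
   unfolding omega_coact_basis[OF f] l1(2)[OF bf_kG[OF Hom_value[OF f]] basis_\<Omega>[OF f]]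
    l2(2)[OF bf_kG[OF Hom_value[OF f]] basis_\<Omega>[OF f]] s unfolding tens3_def ..
 qed
 show "tlift kG \<Omega> \<Omega> (%a w. scl \<Omega> (hcounit kG a) w) (?d v) = v"
 proof (rule lin_eq_basis[OF has_basis_\<Omega> lin_comp[OF l3(1) lin_omega_coact] lin_id vspace_\<Omega> _ v])
  fix f assume f: "f : Hom_grp P G"
  show "tlift kG \<Omega> \<Omega> (%a w. scl \<Omega> (hcounit kG a) w) (?d (basis_fun f)) = basis_fun f"
   unfolding omega_coact_basis[OF f] l3(2)[OF bf_kG[OF Hom_value[OF f]] basis_\<Omega>[OF f]]
   using Hom_value[OF f] vspaceD(9)[OF vspace_\<Omega>] by simp
 qed
qed

text \<open>On a group element h and a homomorphism f both sides are (h f(x) h^-1) \<otimes> (h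
  \<bullet> f). The work lies in the multilinearity that reduces the identity to this case.\<close>

lemma left_yetter_drinfeld_\<Omega>:
 "left_yetter_drinfeld kG (\<Omega> :: ('k::field, _) vspace) (omega_act P G) (omega_coact P G x0)"
 unfolding left_yetter_drinfeld_def
proof (intro conjI ballI)
 let ?d = "omega_coact P G x0" and ?act = "omega_act P G"
 let ?T = "kG \<boxtimes> (\<Omega> :: ('k, _) vspace)"
 show "vspace (\<Omega> :: ('k, _) vspace)" "left_module kG (\<Omega> :: ('k, _) vspace) ?act"
  "left_comodule kG (\<Omega> :: ('k, _) vspace) ?d"
  by (rule vspace_\<Omega> left_module_\<Omega> left_comodule_\<Omega>)+
 let ?b = "%t h1 h2 h3. tlift kG \<Omega> ?T (%a w. tens kG \<Omega> (hmul kG (hmul kG h1 a) (hanti kG h3)) (?act h2 w)) t"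
 let ?c = "lcomp kG (\<Omega> :: ('k, _) vspace) (%x a. a x)"
 have bb: "bilin kG \<Omega> ?T (%a w. tens kG \<Omega> (hmul kG (hmul kG h1 a) (hanti kG h3)) (?act h2 w))"
  if h: "h1 : carr kG" "h2 : carr kG" "h3 : carr kG" for h1 h2 h3
  by (rule bilin_comp2[OF bilin_tens lin_comp[OF bilinD(2)[OF bilin_hmul] bilinD(1)[OF bilin_hmul]]
   bilinD(1)[OF bilin_omega_act]]) (use h linD(1)[OF lin_hanti] in auto)
 \<comment> \<open>Trilinearity in the Sweedler legs becomes visible once the tensor
   \<open>t\<close> is expanded in the group basis of its first factor.\<close>
 have tri: "trilin kG kG kG ?T (?b t)" if t: "t : carr ?T" for t
 proof (rule trilin_cong[OF _ vspace_kG vspace_kG vspace_kG])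
  show "(\<Sum>x\<in>carrier G. tens kG \<Omega> (hmul kG (hmul kG h1 (bf x)) (hanti kG h3)) (?act h2 (?c x t))) = ?b t h1 h2 h3"
   if "h1 : carr kG" "h2 : carr kG" "h3 : carr kG" for h1 h2 h3
   by (rule tlift_lcomp[symmetric, OF has_basis_kG vspace_\<Omega> vspace_tensor bb[OF that] t])
  show "trilin kG kG kG ?T (%h1 h2 h3. \<Sum>x\<in>carrier G. tens kG \<Omega> (hmul kG (hmul kG h1 (bf x)) (hanti kG h3)) (?act h2 (?c x t)))"
  proof (rule trilin_sum[OF _ vspace_tensor], rule trilin_outer[OF bilin_tens])
   fix x assume x: "x : carrier G"
   show "bilin kG kG kG (%h1 h3. hmul kG (hmul kG h1 (bf x)) (hanti kG h3))"
    by (rule bilin_comp2[OF bilin_hmul bilinD(2)[OF bilin_hmul] lin_hanti]) (simp add: x)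
   show "lin kG \<Omega> (%h2. ?act h2 (?c x t))"
    by (rule bilinD(2)[OF bilin_omega_act linD(1)[OF lcomp(1)[OF has_basis_kG vspace_\<Omega> x] t]])
  qed
 qed
 have dv: "?d v : carr ?T" if "v : carr \<Omega>" for v :: "_ => 'k" by (rule linD(1)[OF lin_omega_coact that])
 fix h v assume h: "h : carr (kG :: ('k, 'g => 'k) hopf)" and v: "v : carr (\<Omega> :: ('k, _) vspace)"
 show "?d (?act h v) = sw3 kG ?T h (?b (?d v))"
 proof (rule bilin_eq_basis[OF has_basis_kG has_basis_\<Omega> bilin_comp[OF lin_omega_coact bilin_omega_act] _ vspace_tensor _ h v])
  show "bilin kG \<Omega> ?T (%h v. sw3 kG ?T h (?b (?d v)))"
  proof (rule bilin_cong[OF _ vspace_kG vspace_\<Omega>])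
   show "(\<Sum>x\<in>carrier G. scl ?T (h x) (?b (?d v) (bf x) (bf x) (bf x))) = sw3 kG ?T h (?b (?d v))"
    if "h : carr kG" "v : carr \<Omega>" for h and v :: "_ => 'k"
    by (rule sw3_expand[symmetric, OF tri[OF dv[OF that(2)]] vspace_tensor that(1)])
   show "bilin kG \<Omega> ?T (%h v. \<Sum>x\<in>carrier G. scl ?T (h x) (?b (?d v) (bf x) (bf x) (bf x)))"
    by (intro bilin_sum vspace_tensor bilin_scl_left kG_basis(4)
     lin_comp[OF tlift(1)[OF vspace_kG vspace_\<Omega> vspace_tensor bb] lin_omega_coact] bf_kG)
  qed
  fix x f assume x: "x : carrier G" and f: "f : Hom_grp P G"
  have "?b (?d (basis_fun f)) (bf x) (bf x) (bf x) = tens kG \<Omega> (bf (x \<otimes> f x0 \<otimes> inv x)) (basis_fun (hom_conj P G x f))"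
   unfolding omega_coact_basis[OF f]
    tlift(2)[OF vspace_kG vspace_\<Omega> vspace_tensor bb[OF bf_kG[OF x] bf_kG[OF x] bf_kG[OF x]]
     bf_kG[OF Hom_value[OF f]] basis_\<Omega>[OF f]] using x f Hom_value[OF f] by (simp add: omega_act_basis)
  then show "?d (?act (bf x) (basis_fun f)) = sw3 kG ?T (bf x) (?b (?d (basis_fun f)))"
   unfolding sw3_bf[OF tri[OF dv[OF basis_\<Omega>[OF f]]] vspace_tensor x] omega_act_basis[OF x f]
    omega_coact_basis[OF hom_conj_Hom[OF x f]] using x0 by (simp add: hom_conj_def)
 qed
qed

end

section \<open>Hopf bimodules with one-dimensional coinvariants\<close>

lemma trilin_tens3:
 assumes "lin U A f" "lin V B g" "lin W C l"
 shows "trilin U V W (A \<boxtimes> B \<boxtimes> C) (%u v w. tens3 A B C (f u) (g v) (l w))"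
 unfolding trilin_def tens3_def
proof (intro conjI ballI)
 show "bilin V W (A \<boxtimes> B \<boxtimes> C) (%v w. tens A (B \<boxtimes> C) (f u) (tens B C (g v) (l w)))" if "u : carr U" for u
  by (rule bilin_comp[OF bilinD(1)[OF bilin_tens linD(1)[OF assms(1) that]] bilin_comp2[OF bilin_tens assms(2,3)]])
 show "lin U (A \<boxtimes> B \<boxtimes> C) (%u. tens A (B \<boxtimes> C) (f u) (tens B C (g v) (l w)))"
  if "v : carr V" "w : carr W" for v w
  by (rule lin_comp[OF bilinD(2)[OF bilin_tens tens_carr[OF linD(1)[OF assms(2) that(1)] linD(1)[OF assms(3) that(2)]]] assms(1)])
qed

lemma sum_bij_reindex:
 assumes "!!x. x : A ==> f x : B" "!!y. y : B ==> g y : A" "!!x. x : A ==> g (f x) = x" "!!y. y : B ==> f (g y) = y"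
 shows "(\<Sum>x\<in>A. F (f x)) = (\<Sum>y\<in>B. F y)"
 by (rule sum.reindex_bij_witness[where i = g and j = f]) (use assms in auto)

locale hopf_line = finite_group G for G :: "('g, 'b) monoid_scheme" (structure) +
 fixes M :: "('k::field, 'g => 'k, 'm::ab_group_add) bimod" and p :: 'g and \<chi> :: "('g => 'k) => 'k"
 assumes hb: "hopf_bimodule kG M" and p: "central G p" and \<chi>: "\<chi> : carrier (characters kG)"
  and iso: "rmc_isomorphic kG (coinvariants kG M) (line kG (bf p) (inv\<^bsub>characters kG\<^esub> \<chi>))"
begin

section \<open>The two gradings of a Hopf bimodule\<close>

abbreviation co :: "'g => ('g => 'k) => 'k" where "co \<equiv> %x a. a x"
abbreviation (input) T where "T \<equiv> kG \<boxtimes> M \<boxtimes> kG"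

text \<open>Over a group algebra a coaction is a grading. \<open>P x\<close> and \<open>R y\<close>
  are the projections onto the homogeneous components for the left and the right coaction.\<close>

definition P :: "'g => 'm => 'm" where "P x m = lcomp kG M co x (lcoact M m)"
definition R :: "'g => 'm => 'm" where "R y m = rcomp M kG co y (rcoact M m)"
abbreviation ac :: "'g => 'm => 'g => 'm" where "ac h m k \<equiv> ract M (lact M (bf h) m) (bf k)"

lemma p_carrier: "p : carrier G" using p by (simp add: central_def)

lemma vM [simp]: "vspace M" using hb unfolding hopf_bimodule_def by blast

lemma lact: "bilin kG M M (lact M)" "m : carr M ==> lact M (bf \<one>) m = m"
 "x : carrier G ==> y : carrier G ==> m : carr M ==>
  lact M (bf (x \<otimes> y)) m = lact M (bf x) (lact M (bf y) m)"
proof -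
 have l: "left_module kG M (lact M)" using hb unfolding hopf_bimodule_def by blast
 show "bilin kG M M (lact M)" "m : carr M ==> lact M (bf \<one>) m = m" using l unfolding left_module_def by auto
 show "x : carrier G ==> y : carrier G ==> m : carr M ==>
  lact M (bf (x \<otimes> y)) m = lact M (bf x) (lact M (bf y) m)"
  using l bf_kG hmul_bf unfolding left_module_def by metis
qed

lemma ract: "bilin M kG M (ract M)" "m : carr M ==> ract M m (bf \<one>) = m"
 "x : carrier G ==> y : carrier G ==> m : carr M ==>
  ract M m (bf (x \<otimes> y)) = ract M (ract M m (bf x)) (bf y)"
proof -
 have l: "right_module kG M (ract M)" using hb unfolding hopf_bimodule_def by blast
 show "bilin M kG M (ract M)" "m : carr M ==> ract M m (bf \<one>) = m" using l unfolding right_module_def by auto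
 show "x : carrier G ==> y : carrier G ==> m : carr M ==>
  ract M m (bf (x \<otimes> y)) = ract M (ract M m (bf x)) (bf y)"
  using l bf_kG hmul_bf unfolding right_module_def by metis
qed

lemma ract_lact: "x : carrier G ==> y : carrier G ==> m : carr M ==>
  ract M (lact M (bf x) m) (bf y) = lact M (bf x) (ract M m (bf y))"
 using hb bf_kG unfolding hopf_bimodule_def by metis

lemma lin_ac: "h : carrier G ==> k : carrier G ==> lin M M (%m. ac h m k)"
 by (rule lin_comp[OF bilinD(2)[OF ract(1)] bilinD(1)[OF lact(1)]]) simp_all

lemma lin_lcoact: "lin M (kG \<boxtimes> M) (lcoact M)" using hb unfolding hopf_bimodule_def left_comodule_def by blast

lemma lin_rcoact: "lin M (M \<boxtimes> kG) (rcoact M)" using hb unfolding hopf_bimodule_def right_comodule_def by blast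

lemma lin_P: "x : carrier G ==> lin M M (P x)"
 unfolding P_def by (rule lin_comp[OF lcomp(1)[OF has_basis_kG vM] lin_lcoact])

lemma lin_R: "x : carrier G ==> lin M M (R x)"
 unfolding R_def by (rule lin_comp[OF rcomp(1)[OF has_basis_kG vM] lin_rcoact])

lemmas P_carr = linD(1)[OF lin_P] and R_carr = linD(1)[OF lin_R] and ac_carr = linD(1)[OF lin_ac]

lemma lcoact_expand: "m : carr M ==> lcoact M m = (\<Sum>x\<in>carrier G. tens kG M (bf x) (P x m))"
 unfolding P_def by (rule lcomp_expand[OF has_basis_kG vM linD(1)[OF lin_lcoact]])

lemma rcoact_expand: "m : carr M ==> rcoact M m = (\<Sum>x\<in>carrier G. tens M kG (R x m) (bf x))"
 unfolding R_def by (rule rcomp_expand[OF has_basis_kG vM linD(1)[OF lin_rcoact]])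

lemma sum_P: assumes m: "m : carr M" shows "(\<Sum>x\<in>carrier G. P x m) = m"
proof -
 have b: "bilin kG M M (%a w. scl M (hcounit kG a) w)" by (rule bilin_scl_left[OF lin_hcounit lin_id vM])
 have "m = tlift kG M M (%a w. scl M (hcounit kG a) w) (lcoact M m)"
  using hb m unfolding hopf_bimodule_def left_comodule_def by metis
 also have "... = (\<Sum>x\<in>carrier G. scl M (hcounit kG (bf x)) (P x m))"
  unfolding P_def by (rule tlift_lcomp[OF has_basis_kG vM vM b linD(1)[OF lin_lcoact m]])
 also have "... = (\<Sum>x\<in>carrier G. P x m)" by (rule sum.cong) (simp_all add: vspaceD(9)[OF vM])
 finally show ?thesis by simp
qed

lemma sum_R: assumes m: "m : carr M" shows "(\<Sum>x\<in>carrier G. R x m) = m"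
proof -
 have b: "bilin M kG M (%w a. scl M (hcounit kG a) w)" by (rule bilin_scl_right[OF lin_id lin_hcounit vM])
 have "m = tlift M kG M (%w a. scl M (hcounit kG a) w) (rcoact M m)"
  using hb m unfolding hopf_bimodule_def right_comodule_def by metis
 also have "... = (\<Sum>x\<in>carrier G. scl M (hcounit kG (bf x)) (R x m))"
  unfolding R_def by (rule tlift_rcomp[OF has_basis_kG vM vM b linD(1)[OF lin_rcoact m]])
 also have "... = (\<Sum>x\<in>carrier G. R x m)" by (rule sum.cong) (simp_all add: vspaceD(9)[OF vM])
 finally show ?thesis by simp
qed

text \<open>Comparing both sides of coassociativity in the component at \<open>x\<close> shows that
  \<open>P x m\<close> has degree \<open>x\<close>; the projections are therefore orthogonal
  idempotents.\<close>

lemma P_P: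
 assumes m: "m : carr M" and x: "x : carrier G" and y: "y : carrier G"
 shows "P y (P x m) = (if x = y then P x m else 0)"
proof -
 let ?T = "kG \<boxtimes> kG \<boxtimes> M"
 have b1: "bilin kG M ?T (%a w. tens kG (kG \<boxtimes> M) a (lcoact M w))"
  by (rule bilin_comp2[OF bilin_tens lin_id lin_lcoact])
 have t3: "trilin kG kG M ?T (tens3 kG kG M)" by (rule trilin_tens3[OF lin_id lin_id lin_id])
 have s: "sw2 kG ?T (bf z) (%a1 a2. tens3 kG kG M a1 a2 w) = tens3 kG kG M (bf z) (bf z) w"
  if "z : carrier G" "w : carr M" for z w by (rule sw2_bf[OF _ vspace_tensor that(1)])
   (intro bilinI bilinD(2)[OF trilinD(1)[OF t3]] trilinD(2)[OF t3] that(2))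
 have b2: "bilin kG M ?T (%a w. sw2 kG ?T a (%a1 a2. tens3 kG kG M a1 a2 w))"
 proof (rule bilin_cong[OF _ vspace_kG vM])
  show "(\<Sum>x\<in>carrier G. scl ?T (a x) (tens3 kG kG M (bf x) (bf x) w)) =
    sw2 kG ?T a (%a1 a2. tens3 kG kG M a1 a2 w)"
   if "a : carr kG" "w : carr M" for a w by (rule sw2_expand[symmetric, OF _ vspace_tensor that(1)])
    (intro bilinI bilinD(2)[OF trilinD(1)[OF t3]] trilinD(2)[OF t3] that(2))
  show "bilin kG M ?T (%a w. \<Sum>x\<in>carrier G. scl ?T (a x) (tens3 kG kG M (bf x) (bf x) w))"
   by (intro bilin_sum vspace_tensor bilin_scl_left kG_basis(4) bilinD(1)[OF trilinD(1)[OF t3]] bf_kG)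
 qed
 note e = tlift_lcomp[OF has_basis_kG vM vspace_tensor _ linD(1)[OF lin_lcoact m], folded P_def]
 have "tlift kG M ?T (%a w. tens kG (kG \<boxtimes> M) a (lcoact M w)) (lcoact M m) =
   tlift kG M ?T (%a w. sw2 kG ?T a (%a1 a2. tens3 kG kG M a1 a2 w)) (lcoact M m)"
  using hb m unfolding hopf_bimodule_def left_comodule_def by blast
 then have "(\<Sum>z\<in>carrier G. tens kG (kG \<boxtimes> M) (bf z) (lcoact M (P z m))) =
   (\<Sum>z\<in>carrier G. tens kG (kG \<boxtimes> M) (bf z) (tens kG M (bf z) (P z m)))"
  unfolding e[OF b1] e[OF b2] using s P_carr[OF _ m] by (simp add: tens3_def cong: sum.cong)
 then have "lcomp kG (kG \<boxtimes> M) co x (\<Sum>z\<in>carrier G. tens kG (kG \<boxtimes> M) (bf z) (lcoact M (P z m))) =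
   lcomp kG (kG \<boxtimes> M) co x (\<Sum>z\<in>carrier G. tens kG (kG \<boxtimes> M) (bf z) (tens kG M (bf z) (P z m)))"
  by simp
 moreover have "lcomp kG (kG \<boxtimes> M) co x (\<Sum>z\<in>carrier G. tens kG (kG \<boxtimes> M) (bf z) (f z)) = f x"
  if f: "!!z. z : carrier G ==> f z : carr (kG \<boxtimes> M)" for f
 proof -
  have "lcomp kG (kG \<boxtimes> M) co x (\<Sum>z\<in>carrier G. tens kG (kG \<boxtimes> M) (bf z) (f z)) =
    (\<Sum>z\<in>carrier G. lcomp kG (kG \<boxtimes> M) co x (tens kG (kG \<boxtimes> M) (bf z) (f z)))"
   by (rule lin_sum[OF lcomp(1)[OF has_basis_kG vspace_tensor x] vspace_tensor vspace_tensor])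
    (intro tens_carr bf_kG f)
  also have "... = (\<Sum>z\<in>carrier G. if x = z then f z else 0)"
   by (intro sum.cong HOL.refl lcomp_basis[OF has_basis_kG vspace_tensor x] f)
  finally show ?thesis using x fin by simp
 qed
 ultimately have "lcoact M (P x m) = tens kG M (bf x) (P x m)"
  using P_carr[OF _ m] linD(1)[OF lin_lcoact] by (simp add: tens_carr x)
 then have "P y (P x m) = lcomp kG M co y (tens kG M (bf x) (P x m))" unfolding P_def[of y] by simp
 also have "... = (if y = x then P x m else 0)" by (rule lcomp_basis[OF has_basis_kG vM y x P_carr[OF x m]])
 finally show ?thesis by auto
qed

text \<open>The component of a threefold tensor at group elements in its outer legs. It translates
  identities between bicoactions into identities for \<open>R y (P x m)\<close>.\<close>

definition comp :: "'g => 'g => _ => 'm" where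
 "comp x y t = rcomp M kG co y (lcomp kG (M \<boxtimes> kG) co x t)"

lemma comp_carr: "x : carrier G ==> y : carrier G ==> t : carr T ==> comp x y t : carr M"
 unfolding comp_def
 by (rule linD(1)[OF rcomp(1)[OF has_basis_kG vM] linD(1)[OF lcomp(1)[OF has_basis_kG vspace_tensor]]])

lemma lin_comp_xy: "x : carrier G ==> y : carrier G ==> lin T M (comp x y)" unfolding comp_def
 by (rule lin_comp[OF rcomp(1)[OF has_basis_kG vM] lcomp(1)[OF has_basis_kG vspace_tensor]])

lemma comp_tens3:
 assumes "x : carrier G" "y : carrier G" "x' : carrier G" "y' : carrier G" "m : carr M"
 shows "comp x y (tens3 kG M kG (bf x') m (bf y')) = (if x = x' \<and> y = y' then m else 0)"
proof -
 have "lcomp kG (M \<boxtimes> kG) co x (tens3 kG M kG (bf x') m (bf y')) = (if x = x' then tens M kG m (bf y') else 0)"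
  unfolding tens3_def by (rule lcomp_basis[OF has_basis_kG vspace_tensor assms(1,3) tens_carr]) (simp_all add: assms)
 then show ?thesis unfolding comp_def using rcomp_basis[OF has_basis_kG vM assms(2,4,5)]
   lin_0[OF rcomp(1)[OF has_basis_kG vM assms(2)] vspace_tensor vM] by (cases "y = y'") simp_all
qed

lemma tlift3_expand:
 assumes F: "trilin kG M kG Z F" and Z: "vspace Z" and t: "t : carr T"
 shows "tlift3 kG M kG Z F t = (\<Sum>x\<in>carrier G. \<Sum>y\<in>carrier G. F (bf x) (comp x y t) (bf y))"
proof -
 have "tlift3 kG M kG Z F t = (\<Sum>x\<in>carrier G. tlift M kG Z (F (bf x)) (lcomp kG (M \<boxtimes> kG) co x t))"
  unfolding tlift3_def
  by (rule tlift_lcomp[OF has_basis_kG vspace_tensor Z bilin_tlift[OF vM vspace_kG Z has_basis_kG F] t])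
 also have "... = (\<Sum>x\<in>carrier G. \<Sum>y\<in>carrier G. F (bf x) (comp x y t) (bf y))" unfolding comp_def
  by (intro sum.cong HOL.refl tlift_rcomp[OF has_basis_kG vM Z trilinD(1)[OF F]]
    linD(1)[OF lcomp(1)[OF has_basis_kG vspace_tensor] t] bf_kG)
 finally show ?thesis .
qed

lemma comp_double_sum:
 assumes x: "x : carrier G" and y: "y : carrier G"
  and f: "!!x' y'. x' : carrier G ==> y' : carrier G ==> f x' y' : carr M"
 shows "comp x y (\<Sum>x'\<in>carrier G. \<Sum>y'\<in>carrier G. tens3 kG M kG (bf x') (f x' y') (bf y')) = f x y"
proof -
 note l = lin_comp_xy[OF x y]
 have c: "tens3 kG M kG (bf x') (f x' y') (bf y') : carr T" if "x' : carrier G" "y' : carrier G" for x' y'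
  unfolding tens3_def using that f by (intro tens_carr) simp_all
 have "comp x y (\<Sum>x'\<in>carrier G. \<Sum>y'\<in>carrier G. tens3 kG M kG (bf x') (f x' y') (bf y')) =
   (\<Sum>x'\<in>carrier G. comp x y (\<Sum>y'\<in>carrier G. tens3 kG M kG (bf x') (f x' y') (bf y')))"
  by (rule lin_sum[OF l vspace_tensor vM]) (intro vspaceD(5)[OF vspace_tensor] c)
 also have "... = (\<Sum>x'\<in>carrier G. \<Sum>y'\<in>carrier G. comp x y (tens3 kG M kG (bf x') (f x' y') (bf y')))"
  by (intro sum.cong HOL.refl lin_sum[OF l vspace_tensor vM] c)
 also have "... = (\<Sum>x'\<in>carrier G. \<Sum>y'\<in>carrier G. if y' = y then (if x' = x then f x y else 0) else 0)"
  by (intro sum.cong HOL.refl) (use x y f in \<open>auto simp: comp_tens3\<close>)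
 also have "... = (\<Sum>x'\<in>carrier G. if x' = x then f x y else 0)"
  by (intro sum.cong HOL.refl) (use y fin in \<open>simp add: sum.delta\<close>)
 also have "... = f x y" using x fin by (simp add: sum.delta)
 finally show ?thesis .
qed

lemma bicoact_left:
 assumes m: "m : carr M"
 shows "bicoact kG M m : carr T"
  and "x : carrier G ==> y : carrier G ==> comp x y (bicoact kG M m) = R y (P x m)"
proof -
 have b: "bilin kG M T (%a n. tens kG (M \<boxtimes> kG) a (rcoact M n))"
  by (rule bilin_comp2[OF bilin_tens lin_id lin_rcoact])
 show "bicoact kG M m : carr T" unfolding bicoact_def
  by (rule linD(1)[OF tlift(1)[OF vspace_kG vM vspace_tensor b] linD(1)[OF lin_lcoact m]])
 assume x: "x : carrier G" and y: "y : carrier G"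
 have "bicoact kG M m = (\<Sum>x'\<in>carrier G. tens kG (M \<boxtimes> kG) (bf x') (rcoact M (P x' m)))"
  unfolding bicoact_def P_def by (rule tlift_lcomp[OF has_basis_kG vM vspace_tensor b linD(1)[OF lin_lcoact m]])
 also have "... = (\<Sum>x'\<in>carrier G. \<Sum>y'\<in>carrier G. tens3 kG M kG (bf x') (R y' (P x' m)) (bf y'))"
 proof (rule sum.cong[OF HOL.refl])
  fix x' assume x': "x' : carrier G"
  show "tens kG (M \<boxtimes> kG) (bf x') (rcoact M (P x' m)) = (\<Sum>y'\<in>carrier G. tens3 kG M kG (bf x') (R y' (P x' m)) (bf y'))"
   unfolding rcoact_expand[OF P_carr[OF x' m]] tens3_def
   by (rule lin_sum[OF bilinD(1)[OF bilin_tens bf_kG[OF x']] vspace_tensor vspace_tensor])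
    (intro tens_carr R_carr P_carr x' m bf_kG)
 qed
 finally show "comp x y (bicoact kG M m) = R y (P x m)"
  using comp_double_sum[OF x y, of "%x' y'. R y' (P x' m)"] R_carr P_carr m by simp
qed

text \<open>In a bicomodule the two ways of coacting on both sides agree; their components are the
  two sides of the equation.\<close>

lemma R_P:
 assumes m: "m : carr M" and x: "x : carrier G" and y: "y : carrier G"
 shows "R y (P x m) = P x (R y m)"
proof -
 have t3: "bilin kG M T (%a n'. tens3 kG M kG a n' b)" if "b : carr kG" for b
 proof (rule bilinI)
  note tt = trilin_tens3[OF lin_id lin_id lin_id, of kG M kG]
  show "lin M T (%n'. tens3 kG M kG a n' b)" if "a : carr kG" for a
   by (rule bilinD(2)[OF trilinD(1)[OF tt that] \<open>b : carr kG\<close>])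
  show "lin kG T (%a. tens3 kG M kG a n' b)" if "n' : carr M" for n'
   by (rule trilinD(2)[OF tt that \<open>b : carr kG\<close>])
 qed
 have ex: "tlift kG M T (%a n'. tens3 kG M kG a n' b) (lcoact M n) =
   (\<Sum>x\<in>carrier G. tens3 kG M kG (bf x) (P x n) b)" if "n : carr M" "b : carr kG" for n b
  unfolding P_def by (rule tlift_lcomp[OF has_basis_kG vM vspace_tensor t3[OF that(2)] linD(1)[OF lin_lcoact that(1)]])
 have b: "bilin M kG T (%n b. tlift kG M T (%a n'. tens3 kG M kG a n' b) (lcoact M n))"
 proof (rule bilin_cong[OF ex[symmetric] vM vspace_kG], assumption+)
  show "bilin M kG T (%n b. \<Sum>x\<in>carrier G. tens3 kG M kG (bf x) (P x n) b)"
   by (rule bilin_sum[OF trilinD(1)[OF trilin_tens3[OF lin_id lin_P lin_id]] vspace_tensor]) simp_all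
 qed
 have "bicoact kG M m = tlift M kG T (%n b. tlift kG M T (%a n'. tens3 kG M kG a n' b) (lcoact M n)) (rcoact M m)"
  using hb m unfolding hopf_bimodule_def by blast
 also have "... = (\<Sum>y\<in>carrier G. tlift kG M T (%a n'. tens3 kG M kG a n' (bf y)) (lcoact M (R y m)))"
  unfolding R_def by (rule tlift_rcomp[OF has_basis_kG vM vspace_tensor b linD(1)[OF lin_rcoact m]])
 also have "... = (\<Sum>y\<in>carrier G. \<Sum>x\<in>carrier G. tens3 kG M kG (bf x) (P x (R y m)) (bf y))"
  by (intro sum.cong HOL.refl ex R_carr m bf_kG)
 also have "... = (\<Sum>x\<in>carrier G. \<Sum>y\<in>carrier G. tens3 kG M kG (bf x) (P x (R y m)) (bf y))"
  by (rule sum.swap)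
 finally show ?thesis
  using comp_double_sum[OF x y, of "%x' y'. P x' (R y' m)"] bicoact_left(2)[OF m x y] R_carr P_carr m by simp
qed

text \<open>All Sweedler legs of a group element coincide and the antipode is an involution, so the
  compatibility condition merely shifts both degrees by \<open>h\<close> and \<open>k\<close>. Most
  of the proof is the multilinearity that allows the nested Sweedler sums to be evaluated.\<close>

lemma bicoact_act:
 assumes m: "m : carr M" and h: "h : carrier G" and k: "k : carrier G"
 shows "bicoact kG M (ac h m k) = (\<Sum>x\<in>carrier G. \<Sum>y\<in>carrier G.
  tens3 kG M kG (bf (h \<otimes> x \<otimes> k)) (ac h (R y (P x m)) k) (bf (h \<otimes> y \<otimes> k)))"
proof -
 \<comment> \<open>The inverse antipode from the definition of Hopf bimodules. It agrees with the
   antipode on the carrier, so applying it twice gives the identity there.\<close>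
 define Si where "Si = inv_into (carr (kG :: ('k, 'g => 'k) hopf)) (hanti kG)"
 have inj: "inj_on (hanti kG) (carr (kG :: ('k, 'g => 'k) hopf))"
  by (rule inj_on_inverseI[where g = "hanti kG"]) (rule hanti_hanti)
 have Si: "Si a = hanti kG a" if "a : carr kG" for a
  unfolding Si_def by (rule inv_into_f_eq[OF inj]) (rule linD(1)[OF lin_hanti that] hanti_hanti[OF that])+
 have SiSi: "Si (Si a) = a" if "a : carr kG" for a
  using Si[OF that] Si[OF linD(1)[OF lin_hanti that]] hanti_hanti[OF that] by simp
 have lin_SiSi: "lin kG kG (%a. Si (Si a))"
  using lin_cong[where f = "%a. Si (Si a)" and V = kG and W = kG, OF SiSi vspace_kG] lin_id by blast
 define F where "F = (%h1 h2 h3 k1 k2 k3 a n b. tens3 kG M kG (hmul kG (hmul kG h1 a) k1)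
   (ract M (lact M h2 n) k2) (hmul kG (hmul kG h3 b) (Si (Si k3))))"
 have F: "trilin kG M kG T (F h1 h2 h3 k1 k2 k3)"
  if "h1 : carr kG" "h2 : carr kG" "h3 : carr kG" "k1 : carr kG" "k2 : carr kG" "k3 : carr kG"
  for h1 h2 h3 k1 k2 k3 unfolding F_def
  by (intro trilin_tens3 lin_comp[OF bilinD(2)[OF bilin_hmul] bilinD(1)[OF bilin_hmul]]
    lin_comp[OF bilinD(2)[OF ract(1)] bilinD(1)[OF lact(1)]]) (use that linD(1)[OF lin_SiSi] in auto)
 define t where "t = bicoact kG M m"
 have t: "t : carr T" unfolding t_def by (rule bicoact_left[OF m])
 let ?Q = "%h1 h2 h3 k1 k2 k3. tlift3 kG M kG T (F h1 h2 h3 k1 k2 k3) t"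
 have Q: "?Q h1 h2 h3 k1 k2 k3 = (\<Sum>x\<in>carrier G. \<Sum>y\<in>carrier G. F h1 h2 h3 k1 k2 k3 (bf x) (comp x y t) (bf y))"
  if "h1 : carr kG" "h2 : carr kG" "h3 : carr kG" "k1 : carr kG" "k2 : carr kG" "k3 : carr kG"
  for h1 h2 h3 k1 k2 k3 by (rule tlift3_expand[OF F[OF that] vspace_tensor t])
 have tk: "trilin kG kG kG T (?Q h1 h2 h3)"
  if "h1 : carr kG" "h2 : carr kG" "h3 : carr kG" for h1 h2 h3
 proof (rule trilin_cong[OF Q[symmetric, OF that] vspace_kG vspace_kG vspace_kG], assumption+)
  show "trilin kG kG kG T (%k1 k2 k3. \<Sum>x\<in>carrier G. \<Sum>y\<in>carrier G. F h1 h2 h3 k1 k2 k3 (bf x) (comp x y t) (bf y))"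
   unfolding F_def by (intro trilin_sum vspace_tensor trilin_tens3 lin_comp[OF bilinD(1)[OF bilin_hmul] lin_SiSi]
     bilinD(1)[OF bilin_hmul] bilinD(1)[OF ract(1)] bilinD(3)[OF bilin_hmul] bilinD(3)[OF lact(1)]
     that bf_kG comp_carr t)
 qed
 have inner: "sw3 kG T (bf k) (?Q h1 h2 h3) = ?Q h1 h2 h3 (bf k) (bf k) (bf k)"
  if "h1 : carr kG" "h2 : carr kG" "h3 : carr kG" for h1 h2 h3
  by (rule sw3_bf[OF tk[OF that] vspace_tensor k])
 have dk: "bf k : carr kG" using k by simp
 have th: "trilin kG kG kG T (%h1 h2 h3. sw3 kG T (bf k) (?Q h1 h2 h3))"
 proof (rule trilin_cong[OF _ vspace_kG vspace_kG vspace_kG])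
  show "(\<Sum>x\<in>carrier G. \<Sum>y\<in>carrier G. F h1 h2 h3 (bf k) (bf k) (bf k) (bf x) (comp x y t) (bf y)) =
    sw3 kG T (bf k) (?Q h1 h2 h3)" if "h1 : carr kG" "h2 : carr kG" "h3 : carr kG" for h1 h2 h3
   unfolding inner[OF that] Q[OF that dk dk dk] ..
  show "trilin kG kG kG T (%h1 h2 h3. \<Sum>x\<in>carrier G. \<Sum>y\<in>carrier G. F h1 h2 h3 (bf k) (bf k) (bf k) (bf x) (comp x y t) (bf y))"
   unfolding F_def
   by (intro trilin_sum vspace_tensor trilin_tens3 lin_comp[OF bilinD(2)[OF bilin_hmul] bilinD(2)[OF bilin_hmul]]
     lin_comp[OF bilinD(2)[OF ract(1)] bilinD(2)[OF lact(1)]] linD(1)[OF lin_SiSi] dk bf_kG comp_carr t)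
 qed
 have "bicoact kG M (ac h m k) = sw3 kG T (bf h) (%h1 h2 h3. sw3 kG T (bf k) (?Q h1 h2 h3))"
  using hb h k m bf_kG unfolding hopf_bimodule_def Let_def F_def t_def Si_def by blast
 also have "... = ?Q (bf h) (bf h) (bf h) (bf k) (bf k) (bf k)"
  unfolding sw3_bf[OF th vspace_tensor h] by (rule inner) (simp_all add: h)
 also have "... = (\<Sum>x\<in>carrier G. \<Sum>y\<in>carrier G. F (bf h) (bf h) (bf h) (bf k) (bf k) (bf k) (bf x) (comp x y t) (bf y))"
  by (rule Q) (simp_all add: h k)
 also have "... = (\<Sum>x\<in>carrier G. \<Sum>y\<in>carrier G.
   tens3 kG M kG (bf (h \<otimes> x \<otimes> k)) (ac h (R y (P x m)) k) (bf (h \<otimes> y \<otimes> k)))"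
  by (intro sum.cong HOL.refl)
   (simp add: F_def h k SiSi[OF bf_kG[OF k]] t_def bicoact_left(2)[OF m])
 finally show ?thesis .
qed

lemma R_P_act:
 assumes m: "m : carr M" and h: "h : carrier G" and k: "k : carrier G"
  and x: "x : carrier G" and y: "y : carrier G"
 shows "R (h \<otimes> y \<otimes> k) (P (h \<otimes> x \<otimes> k) (ac h m k)) = ac h (R y (P x m)) k"
proof -
 have v: "ac h m k : carr M" by (rule ac_carr[OF h k m])
 let ?i = "%z. inv h \<otimes> z \<otimes> inv k" and ?j = "%z. h \<otimes> z \<otimes> k"
 have i: "?i (?j z) = z" "?j (?i z) = z" "?i z : carrier G" "?j z : carrier G" if "z : carrier G" for z
  using that h k by (simp_all add: group_word_simps)
 \<comment> \<open>Both sums are reindexed so that the outer legs run through the group elements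
   themselves; then components can be compared.\<close>
 have ri: "(\<Sum>z\<in>carrier G. f (?j z)) = (\<Sum>z\<in>carrier G. f z)" for f :: "'g => ('k, 'g => 'k, ('k, 'm, 'g => 'k) ten) ten"
  by (rule sum_bij_reindex[where g = ?i]) (use i in auto)
 have "bicoact kG M (ac h m k) = (\<Sum>x\<in>carrier G. \<Sum>y\<in>carrier G.
   tens3 kG M kG (bf (?j x)) (ac h (R (?i (?j y)) (P (?i (?j x)) m)) k) (bf (?j y)))"
  unfolding bicoact_act[OF m h k] by (intro sum.cong HOL.refl) (simp add: i)
 also have "... = (\<Sum>x\<in>carrier G. \<Sum>y\<in>carrier G.
   tens3 kG M kG (bf (?j x)) (ac h (R (?i y) (P (?i (?j x)) m)) k) (bf y))"
  by (intro sum.cong HOL.refl ri)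
 also have "... = (\<Sum>x\<in>carrier G. \<Sum>y\<in>carrier G.
   tens3 kG M kG (bf x) (ac h (R (?i y) (P (?i x) m)) k) (bf y))"
  by (rule ri)
 finally have "comp (?j x) (?j y) (bicoact kG M (ac h m k)) = ac h (R (?i (?j y)) (P (?i (?j x)) m)) k"
  using comp_double_sum[of "?j x" "?j y" "%x y. ac h (R (?i y) (P (?i x) m)) k"]
   ac_carr[OF h k] R_carr P_carr m i x y by simp
 then show ?thesis using bicoact_left(2)[OF v] i x y by simp
qed

text \<open>Summing the joint statement over all right degrees removes the right projections, since
  they add up to the identity.\<close>

lemma P_act:
 assumes m: "m : carr M" and h: "h : carrier G" and k: "k : carrier G" and x: "x : carrier G"
 shows "P (h \<otimes> x \<otimes> k) (ac h m k) = ac h (P x m) k"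
proof -
 have v: "ac h m k : carr M" by (rule ac_carr[OF h k m])
 have hx: "h \<otimes> x \<otimes> k : carrier G" using h k x by simp
 have "P (h \<otimes> x \<otimes> k) (ac h m k) = (\<Sum>y\<in>carrier G. R y (P (h \<otimes> x \<otimes> k) (ac h m k)))"
  by (rule sum_R[symmetric, OF P_carr[OF hx v]])
 also have "... = (\<Sum>y\<in>carrier G. R (h \<otimes> y \<otimes> k) (P (h \<otimes> x \<otimes> k) (ac h m k)))"
  by (rule sum_bij_reindex[symmetric, where g = "%z. inv h \<otimes> z \<otimes> inv k"])
   (use h k in \<open>auto simp: group_word_simps\<close>)
 also have "... = (\<Sum>y\<in>carrier G. ac h (R y (P x m)) k)" by (intro sum.cong HOL.refl R_P_act[OF m h k x])
 also have "... = ac h (\<Sum>y\<in>carrier G. R y (P x m)) k"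
  by (rule lin_sum[symmetric, OF lin_ac[OF h k] vM vM]) (intro R_carr P_carr x m)
 finally show ?thesis unfolding sum_R[OF P_carr[OF x m]] .
qed

lemma R_act:
 assumes m: "m : carr M" and h: "h : carrier G" and k: "k : carrier G" and y: "y : carrier G"
 shows "R (h \<otimes> y \<otimes> k) (ac h m k) = ac h (R y m) k"
proof -
 have v: "ac h m k : carr M" by (rule ac_carr[OF h k m])
 have hy: "h \<otimes> y \<otimes> k : carrier G" using h k y by simp
 have "R (h \<otimes> y \<otimes> k) (ac h m k) = (\<Sum>x\<in>carrier G. P x (R (h \<otimes> y \<otimes> k) (ac h m k)))"
  by (rule sum_P[symmetric, OF R_carr[OF hy v]])
 also have "... = (\<Sum>x\<in>carrier G. P (h \<otimes> x \<otimes> k) (R (h \<otimes> y \<otimes> k) (ac h m k)))"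
  by (rule sum_bij_reindex[symmetric, where g = "%z. inv h \<otimes> z \<otimes> inv k"])
   (use h k in \<open>auto simp: group_word_simps\<close>)
 also have "... = (\<Sum>x\<in>carrier G. ac h (P x (R y m)) k)"
  using R_P_act[OF m h k _ y] R_P[OF m _ y] R_P[OF v _ hy] h k by (intro sum.cong HOL.refl) simp
 also have "... = ac h (\<Sum>x\<in>carrier G. P x (R y m)) k"
  by (rule lin_sum[symmetric, OF lin_ac[OF h k] vM vM]) (intro R_carr P_carr y m)
 finally show ?thesis unfolding sum_P[OF R_carr[OF y m]] .
qed

end

lemma line_simps [simp]: "carr (line H q \<zeta>) = UNIV" "scl (line H q \<zeta>) = (*)"
 "rmc_act (line H q \<zeta>) l h = \<zeta> h * l" by (simp_all add: line_def)

lemma vspace_line [simp]: "vspace (line H q \<zeta>)" using vspace_ground by (simp add: vspace_def)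

section \<open>The monomial basis generated by a coinvariant vector\<close>

context hopf_line
begin

abbreviation X where "X \<equiv> coinvariants kG M"
abbreviation Y where "Y \<equiv> line kG (bf p) (inv\<^bsub>characters kG\<^esub> \<chi>)"

lemma carr_X: "m : carr X \<longleftrightarrow> m : carr M \<and> P \<one> m = m"
proof -
 have "lcoact M m = tens kG M (bf \<one>) m \<longleftrightarrow> P \<one> m = m" if m: "m : carr M"
 proof
  assume "lcoact M m = tens kG M (bf \<one>) m"
  then show "P \<one> m = m" unfolding P_def using lcomp_basis[OF has_basis_kG vM one_closed one_closed m] by simp
 next
  assume e: "P \<one> m = m"
  have "P x m = (if x = \<one> then m else 0)" if "x : carrier G" for x using P_P[OF m one_closed that] e by auto
  then have "lcoact M m = (\<Sum>x\<in>carrier G. if x = \<one> then tens kG M (bf \<one>) m else 0)"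
   unfolding lcoact_expand[OF m]
   by (intro sum.cong HOL.refl) (auto simp: lin_0[OF bilinD(1)[OF bilin_tens] vM vspace_tensor])
  then show "lcoact M m = tens kG M (bf \<one>) m" using fin by (simp add: sum.delta)
 qed
 then show ?thesis unfolding coinvariants_def by auto
qed

lemma scl_X [simp]: "scl X = scl M" by (simp add: coinvariants_def)

lemma vspace_X: "vspace X"
proof -
 interpret vector_space "scl M" by (rule vspaceD[OF vM])
 note l = linD[OF lin_P[OF one_closed]]
 have "subspace (carr X)" by (rule subspaceI)
   (auto simp: carr_X vspaceD[OF vM] l lin_0[OF lin_P[OF one_closed] vM vM])
 then show ?thesis unfolding vspace_def using vspaceD(14)[OF vM] by simp
qed

lemma lact_act: "h : carrier G ==> m : carr M ==> lact M (bf h) m = ac h m \<one>"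
 using bilinD(3)[OF lact(1)] ract(2) by simp

text \<open>The basis consists of the left translates of one coinvariant vector \<open>m0\<close>.
  Moving the component of degree x back by x^-1 lands in the coinvariants, which form a line; this
  yields spanning and coordinates. The right degree p and the character \<chi>^-1 of that line are
  carried to the translates by the compatibility of actions and coactions.\<close>

theorem basis_of_bimodule:
 "\<exists>e coM. has_basis M (carrier G) e coM \<and> (\<forall>x\<in>carrier G.
  lcoact M (e x) = tens kG M (bf x) (e x) \<and>
  rcoact M (e x) = tens M kG (e x) (bf (x \<otimes> p)) \<and>
  (\<forall>h\<in>carrier G. lact M (bf h) (e x) = e (h \<otimes> x) \<and>
    ract M (e x) (bf h) = scl M (inverse (\<chi> (bf h))) (e (x \<otimes> h))))"
proof -
 obtain \<theta> where \<theta>: "lin X Y \<theta>" "bij_betw \<theta> (carr X) (carr Y)"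
  "\<forall>x\<in>carr X. \<forall>h\<in>carr kG. \<theta> (rmc_act X x h) = rmc_act Y (\<theta> x) h"
  "\<forall>x\<in>carr X. rmc_coact Y (\<theta> x) = tlift X kG (Y \<boxtimes> kG) (%x' h. tens Y kG (\<theta> x') h) (rmc_coact X x)"
  using iso unfolding rmc_isomorphic_def by blast
 have \<theta>g: "lin X ground \<theta>" using \<theta>(1) by (simp add: lin_def)
 have "(1 :: 'k) : \<theta> ` carr X" using \<theta>(2) by (simp add: bij_betw_def)
 then obtain m0 where m0: "m0 : carr X" "\<theta> m0 = 1" by auto
 have m0M: "m0 : carr M" "P \<one> m0 = m0" using m0(1) unfolding carr_X by auto
 have inj: "n = n'" if "n : carr X" "n' : carr X" "\<theta> n = \<theta> n'" for n n'
  using \<theta>(2) that by (auto simp: bij_betw_def inj_on_def)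
 have sX: "scl M c m0 : carr X" for c using vspaceD(4)[OF vspace_X m0(1)] by simp
 have \<theta>s: "\<theta> (scl M c m0) = c" for c using linD(3)[OF \<theta>g m0(1)] m0(2) by simp
 have n_eq: "n = scl M (\<theta> n) m0" if "n : carr X" for n by (rule inj[OF that sX]) (simp add: \<theta>s)
 define e where "e = (%x. lact M (bf x) m0)"
 have eM: "e x : carr M" if "x : carrier G" for x unfolding e_def using bilinD(3)[OF lact(1)] that m0M by simp
 have ea: "e x = ac x m0 \<one>" if "x : carrier G" for x unfolding e_def by (rule lact_act[OF that m0M(1)])
 have Pe: "P x (e x) = e x" if "x : carrier G" for x
  using P_act[OF m0M(1) that one_closed one_closed] that unfolding ea[OF that] m0M(2) by simp
 have Pe': "P y (e x) = (if x = y then e x else 0)" if "x : carrier G" "y : carrier G" for x y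
  using P_P[OF eM[OF that(1)] that] Pe[OF that(1)] by (cases "x = y") simp_all
 have coin: "lact M (bf (inv x)) (P x m) : carr X" if m: "m : carr M" and x: "x : carrier G" for m x
 proof -
  have Pm: "P x m : carr M" "P x (P x m) = P x m" using P_carr[OF x m] P_P[OF m x x] by auto
  have l: "lact M (bf (inv x)) (P x m) : carr M" using bilinD(3)[OF lact(1)] x Pm by simp
  have "P (inv x \<otimes> x \<otimes> \<one>) (ac (inv x) (P x m) \<one>) = ac (inv x) (P x m) \<one>"
   using P_act[OF Pm(1) _ one_closed x, of "inv x"] x Pm(2) by simp
  then show ?thesis unfolding carr_X using l x lact_act[of "inv x" "P x m"] Pm(1) by simp
 qed
 \<comment> \<open>The component of degree \<open>x\<close> is translated back to the coinvariant
   line, on which \<theta> is a coordinate.\<close>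
 define coM where "coM = (%x m. \<theta> (lact M (bf (inv x)) (P x m)))"
 have co_lin: "lin M ground (coM x)" if x: "x : carrier G" for x unfolding coM_def
 proof (rule lin_comp[OF \<theta>g], rule linI)
  have l: "lin M M (%m. lact M (bf (inv x)) (P x m))"
   by (rule lin_comp[OF bilinD(1)[OF lact(1)] lin_P[OF x]]) (simp add: x)
  show "lact M (bf (inv x)) (P x m) : carr X" if "m : carr M" for m by (rule coin[OF that x])
  show "lact M (bf (inv x)) (P x (m + m')) = lact M (bf (inv x)) (P x m) + lact M (bf (inv x)) (P x m')"
   if "m : carr M" "m' : carr M" for m m' using linD(2)[OF l that] .
  show "lact M (bf (inv x)) (P x (scl M c m)) = scl X c (lact M (bf (inv x)) (P x m))"
   if "m : carr M" for c m using linD(3)[OF l that] by simp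
 qed
 have expand: "scl M (coM x m) (e x) = P x m" if m: "m : carr M" and x: "x : carrier G" for m x
 proof -
  have "scl M (coM x m) (e x) = lact M (bf x) (scl M (coM x m) m0)"
   unfolding e_def using linD(3)[OF bilinD(1)[OF lact(1)] m0M(1)] x by simp
  also have "... = lact M (bf x) (lact M (bf (inv x)) (P x m))"
   using n_eq[OF coin[OF m x]] unfolding coM_def by simp
  also have "... = lact M (bf (x \<otimes> inv x)) (P x m)" using lact(3)[of x "inv x"] x P_carr[OF x m] by simp
  also have "... = P x m" using x lact(2) P_carr[OF x m] by simp
  finally show ?thesis .
 qed
 have basis: "has_basis M (carrier G) e coM" unfolding has_basis_def
 proof (intro conjI ballI)
  show "vspace M" "finite (carrier G)" by (simp_all add: fin)
  show "e x : carr M" "lin M ground (coM x)" if "x : carrier G" for x using that eM co_lin by auto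
  show "coM x (e y) = (if x = y then 1 else 0)" if xy: "x : carrier G" "y : carrier G" for x y
  proof (cases "x = y")
   case True
   have "lact M (bf (inv x)) (e x) = m0" using lact(3)[of "inv x" x m0] lact(2) xy m0M unfolding e_def by simp
   then show ?thesis using True Pe[OF xy(1)] m0 unfolding coM_def by simp
  next
   case False
   have l: "lin M M (lact M (bf (inv x)))" by (rule bilinD(1)[OF lact(1)]) (simp add: xy)
   show ?thesis using False Pe'[OF xy(2,1)] lin_0[OF l vM vM] lin_0[OF \<theta>g vspace_X vspace_ground]
    unfolding coM_def by auto
  qed
  show "m = (\<Sum>x\<in>carrier G. scl M (coM x m) (e x))" if m: "m : carr M" for m
   using sum_P[OF m] expand[OF m] by (simp cong: sum.cong)
 qed
 have lco: "lcoact M (e x) = tens kG M (bf x) (e x)" if x: "x : carrier G" for x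
 proof -
  have "lcoact M (e x) = (\<Sum>y\<in>carrier G. if y = x then tens kG M (bf x) (e x) else 0)"
   unfolding lcoact_expand[OF eM[OF x]] by (intro sum.cong HOL.refl)
    (auto simp: Pe'[OF x] lin_0[OF bilinD(1)[OF bilin_tens] vM vspace_tensor])
  then show ?thesis using fin x by (simp add: sum.delta)
 qed
 \<comment> \<open>The map \<theta> intertwines the right coactions, so the right degree of
   \<open>m0\<close> can be read off on the line, where it is \<open>p\<close>.\<close>
 have R0: "R y m0 = (if y = p then m0 else 0)" if y: "y : carrier G" for y
 proof -
  have RX: "R z m0 : carr X" if "z : carrier G" for z
   unfolding carr_X using R_carr[OF that m0M(1)] R_P[OF m0M(1) one_closed that] m0M(2) by simp
  have tX: "tens M kG = tens X kG" by (rule tens_cong) simp_all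
  have tY: "tens ground kG = tens Y kG" by (rule tens_cong) simp_all
  have b: "bilin X kG (Y \<boxtimes> kG) (%x' h. tens Y kG (\<theta> x') h)"
   by (rule bilin_comp2[OF bilin_tens \<theta>(1) lin_id])
  note l = tlift[OF vspace_X vspace_kG vspace_tensor b]
  have "tens Y kG 1 (bf p) = tlift X kG (Y \<boxtimes> kG) (%x' h. tens Y kG (\<theta> x') h) (rcoact M m0)"
  proof -
   have "rmc_coact Y (\<theta> m0) = tlift X kG (Y \<boxtimes> kG) (%x' h. tens Y kG (\<theta> x') h) (rmc_coact X m0)"
    using \<theta>(4) m0(1) by (rule bspec)
   moreover have "rmc_coact X m0 = rcoact M m0" by (simp add: coinvariants_def)
   moreover have "rmc_coact Y (\<theta> m0) = tens ground kG 1 (bf p)" by (simp add: line_def m0(2))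
   ultimately show ?thesis unfolding tY by (simp only:)
  qed
  also have "... = (\<Sum>z\<in>carrier G. tlift X kG (Y \<boxtimes> kG) (%x' h. tens Y kG (\<theta> x') h) (tens X kG (R z m0) (bf z)))"
   unfolding rcoact_expand[OF m0M(1)] tX
   by (rule lin_sum[OF l(1) vspace_tensor vspace_tensor]) (intro tens_carr RX bf_kG)
  also have "... = (\<Sum>z\<in>carrier G. tens Y kG (\<theta> (R z m0)) (bf z))"
   by (intro sum.cong HOL.refl l(2) RX bf_kG)
  finally have e: "tens Y kG 1 (bf p) = (\<Sum>z\<in>carrier G. tens Y kG (\<theta> (R z m0)) (bf z))" .
  note rc = rcomp_basis[OF has_basis_kG vspace_line[of kG "bf p" "inv\<^bsub>characters kG\<^esub> \<chi>"] y, unfolded line_simps]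
  have "rcomp Y kG co y (tens Y kG 1 (bf p)) = (if y = p then 1 else 0)" using rc[OF p_carrier] by simp
  moreover have "rcomp Y kG co y (\<Sum>z\<in>carrier G. tens Y kG (\<theta> (R z m0)) (bf z)) = \<theta> (R y m0)"
  proof -
   have "rcomp Y kG co y (\<Sum>z\<in>carrier G. tens Y kG (\<theta> (R z m0)) (bf z)) =
     (\<Sum>z\<in>carrier G. rcomp Y kG co y (tens Y kG (\<theta> (R z m0)) (bf z)))"
    by (rule lin_sum[OF rcomp(1)[OF has_basis_kG vspace_line y] vspace_tensor vspace_line])
     (intro tens_carr, simp_all)
   also have "... = (\<Sum>z\<in>carrier G. if y = z then \<theta> (R z m0) else 0)"
    by (intro sum.cong HOL.refl rc) auto
   finally show ?thesis using fin y by simp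
  qed
  ultimately have "\<theta> (R y m0) = (if y = p then 1 else 0)" using e by simp
  then have "R y m0 = scl M (if y = p then 1 else 0) m0" using n_eq[OF RX[OF y]] by simp
  then show ?thesis by (simp add: vspaceD[OF vM])
 qed
 have rco: "rcoact M (e x) = tens M kG (e x) (bf (x \<otimes> p))" if x: "x : carrier G" for x
 proof -
  have Re: "R y (e x) = (if y = x \<otimes> p then e x else 0)" if y: "y : carrier G" for y
  proof -
   have z: "inv x \<otimes> y : carrier G" using x y by simp
   have "R (x \<otimes> (inv x \<otimes> y) \<otimes> \<one>) (ac x m0 \<one>) = ac x (R (inv x \<otimes> y) m0) \<one>"
    by (rule R_act[OF m0M(1) x one_closed z])
   moreover have "inv x \<otimes> y = p \<longleftrightarrow> y = x \<otimes> p" using x y p_carrier by (metis inv_cancel_left)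
   ultimately show ?thesis using x y lin_0[OF lin_ac[OF x one_closed] vM vM] unfolding ea[OF x] R0[OF z] by simp
  qed
  have "rcoact M (e x) = (\<Sum>y\<in>carrier G. if y = x \<otimes> p then tens M kG (e x) (bf (x \<otimes> p)) else 0)"
   unfolding rcoact_expand[OF eM[OF x]] by (intro sum.cong HOL.refl)
    (auto simp: Re lin_0[OF bilinD(2)[OF bilin_tens] vM vspace_tensor])
  then show ?thesis using fin x p_carrier by (simp add: sum.delta)
 qed
 have la: "lact M (bf h) (e x) = e (h \<otimes> x)" if "x : carrier G" "h : carrier G" for x h
  unfolding e_def using lact(3)[OF that(2,1) m0M(1)] by simp
 \<comment> \<open>The identity m0 h = h (h^-1 m0 h) reduces the right action to the coinvariant
   action, under which \<open>m0\<close> transforms by \<chi>^-1.\<close>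
 have ra0: "ract M m0 (bf h) = scl M (inverse (\<chi> (bf h))) (e h)" if h: "h : carrier G" for h
 proof -
  let ?n = "ac (inv h) m0 h"
  have n: "?n : carr X"
   unfolding carr_X using ac_carr[of "inv h" h] m0M h P_act[OF m0M(1) _ h one_closed, of "inv h"] by simp
  have b: "bilin kG kG M (%h1 h2. ract M (lact M (hanti kG h1) m0) h2)"
   by (rule bilin_comp2[OF ract(1) lin_comp[OF bilinD(2)[OF lact(1) m0M(1)] lin_hanti] lin_id])
  have "rmc_act X m0 (bf h) = ?n" unfolding coinvariants_def using sw2_bf[OF b vM h] h by simp
  then have "\<theta> ?n = inverse (\<chi> (bf h))"
   using bspec[OF bspec[OF \<theta>(3) m0(1)] bf_kG[OF h]] m0(2) by (simp add: characters_inv_bf[OF \<chi> h])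
  then have "?n = scl M (inverse (\<chi> (bf h))) m0" using n_eq[OF n] by simp
  then have "lact M (bf h) ?n = scl M (inverse (\<chi> (bf h))) (e h)"
   unfolding e_def using linD(3)[OF bilinD(1)[OF lact(1)] m0M(1)] h by simp
  moreover have "lact M (bf h) ?n = ract M m0 (bf h)"
  proof -
   have r: "ract M m0 (bf h) : carr M" using bilinD(3)[OF ract(1)] m0M h by simp
   have "?n = lact M (bf (inv h)) (ract M m0 (bf h))" by (rule ract_lact) (simp_all add: h m0M)
   then have "lact M (bf h) ?n = lact M (bf (h \<otimes> inv h)) (ract M m0 (bf h))"
    using lact(3)[OF h inv_closed[OF h] r] by simp
   then show ?thesis using h lact(2)[OF r] by simp
  qed
  ultimately show ?thesis by simp
 qed
 have ra: "ract M (e x) (bf h) = scl M (inverse (\<chi> (bf h))) (e (x \<otimes> h))"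
  if x: "x : carrier G" and h: "h : carrier G" for x h
 proof -
  have "ract M (e x) (bf h) = lact M (bf x) (ract M m0 (bf h))" unfolding e_def by (rule ract_lact[OF x h m0M(1)])
  also have "... = scl M (inverse (\<chi> (bf h))) (lact M (bf x) (e h))"
   unfolding ra0[OF h] by (rule linD(3)[OF bilinD(1)[OF lact(1)] eM[OF h]]) (simp add: x)
  finally show ?thesis unfolding la[OF h x] .
 qed
 show ?thesis using basis lco rco la ra by blast
qed

end

section \<open>The extended Hilbert space\<close>

lemma has_basis_reindex:
 assumes "has_basis V A e co" "bij_betw f B A"
 shows "has_basis V B (%b. e (f b)) (%b. co (f b))"
proof -
 note b = has_basisD[OF assms(1)]
 have f: "f x : A" if "x : B" for x using assms(2) that by (auto simp: bij_betw_def)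
 have inj: "f x = f y \<longleftrightarrow> x = y" if "x : B" "y : B" for x y
  using assms(2) that by (auto simp: bij_betw_def inj_on_def)
 show ?thesis unfolding has_basis_def
 proof (intro conjI ballI)
  show "finite B" using bij_betw_finite[OF assms(2)] b(2) by simp
  show "v = (\<Sum>x\<in>B. scl V (co (f x) v) (e (f x)))" if "v : carr V" for v
   using b(6)[OF that] sum.reindex_bij_betw[OF assms(2), of "%a. scl V (co a v) (e a)"] by simp
 qed (use b f inj in simp_all)
qed

lemma mtens_scale:
 assumes "finite I"
 shows "mtens I V (%i. scl (V i) (k i) (m i)) = fscl (\<Prod>i\<in>I. k i) (mtens I V m)"
proof
 fix \<phi>
 show "mtens I V (%i. scl (V i) (k i) (m i)) \<phi> = fscl (\<Prod>i\<in>I. k i) (mtens I V m) \<phi>"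
 proof (cases "multilinear_form I V \<phi>")
  case True
  have "J \<subseteq> I ==> \<phi> (\<lambda>i\<in>I. if i : J then scl (V i) (k i) (m i) else m i) = (\<Prod>i\<in>J. k i) * \<phi> (restrict m I)"
   if "finite J" for J using that
  proof (induction J rule: finite_induct)
   case (insert j J)
   let ?m = "\<lambda>i\<in>I. if i : J then scl (V i) (k i) (m i) else m i"
   have j: "j : I" using insert by simp
   have "(\<lambda>i\<in>I. if i : insert j J then scl (V i) (k i) (m i) else m i) = ?m(j := scl (V j) (k j) (m j))"
    using j by (auto simp: fun_eq_iff)
   moreover have "?m(j := m j) = ?m" using insert.hyps j by (auto simp: fun_eq_iff)
   moreover have "\<phi> (?m(j := scl (V j) (k j) (m j))) = k j * \<phi> (?m(j := m j))"
    using True j unfolding multilinear_form_def by blast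
   moreover have "\<phi> ?m = (\<Prod>i\<in>J. k i) * \<phi> (restrict m I)"
    by (rule insert.IH) (use insert.prems in auto)
   moreover have "(\<Prod>i\<in>insert j J. k i) = k j * (\<Prod>i\<in>J. k i)" using insert.hyps by simp
   ultimately show ?case by (simp only: mult.assoc)
  qed simp
  from this[OF assms subset_refl] have "\<phi> (\<lambda>i\<in>I. scl (V i) (k i) (m i)) = (\<Prod>i\<in>I. k i) * \<phi> (restrict m I)"
   by (simp add: restrict_def cong: if_cong)
  then show ?thesis using True by (simp add: mtens_def fscl_def)
 qed (simp add: mtens_def fscl_def)
qed

lemma mtens_restrict [simp]: "mtens I V (restrict m I) = mtens I V m"
proof -
 have "restrict (restrict m I) I = restrict m I" by (auto simp: restrict_def)
 then show ?thesis by (simp only: mtens_def)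
qed

context finite_group
begin

lemma bilin_L_list:
 assumes W: "vspace W" and L: "!!h. h : set hs ==> bilin kG W W (L h)"
 shows "bilin kG W W (L_list kG W L hs)" using L
proof (induction hs)
 case Nil
 have "bilin kG W W (%a w. scl W (hcounit kG a) w)" by (rule bilin_scl_left[OF lin_hcounit lin_id W])
 then show ?case by (rule bilin_cong[OF _ vspace_kG W, rotated]) simp
next
 case (Cons h hs)
 have IH: "bilin kG W W (L_list kG W L hs)" and Lh: "bilin kG W W (L h)" using Cons by auto
 have b: "bilin kG kG W (%a1 a2. L_list kG W L hs a2 (L h a1 w))" if "w : carr W" for w
  using that by (intro bilinI bilinD(1)[OF IH] lin_comp[OF bilinD(1)[OF IH] bilinD(2)[OF Lh]]
    bilinD(2)[OF IH] bilinD(3)[OF Lh])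
 show ?case
 proof (rule bilin_cong[OF _ vspace_kG W])
  show "(\<Sum>x\<in>carrier G. scl W (a x) (L_list kG W L hs (bf x) (L h (bf x) w))) = L_list kG W L (h # hs) a w"
   if "a : carr kG" "w : carr W" for a w using sw2_expand[OF b[OF that(2)] W that(1)] by simp
  show "bilin kG W W (%a w. \<Sum>x\<in>carrier G. scl W (a x) (L_list kG W L hs (bf x) (L h (bf x) w)))"
   by (intro bilin_sum W bilin_scl_left kG_basis(4) lin_comp[OF bilinD(1)[OF IH] bilinD(1)[OF Lh]] bf_kG)
 qed
qed

lemma L_list_bf:
 assumes W: "vspace W" and L: "!!h. h : set hs ==> bilin kG W W (L h)" and x: "x : carrier G" and w: "w : carr W"
 shows "L_list kG W L hs (bf x) w = fold (%h. L h (bf x)) hs w" using L w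
proof (induction hs arbitrary: w)
 case Nil
 then show ?case using x vspaceD(9)[OF W] by simp
next
 case (Cons h hs)
 have IH: "bilin kG W W (L_list kG W L hs)" by (rule bilin_L_list[OF W]) (use Cons.prems in auto)
 have Lh: "bilin kG W W (L h)" using Cons.prems by auto
 have b: "bilin kG kG W (%a1 a2. L_list kG W L hs a2 (L h a1 w))"
  using Cons.prems by (intro bilinI bilinD(1)[OF IH] lin_comp[OF bilinD(1)[OF IH] bilinD(2)[OF Lh]]
    bilinD(2)[OF IH] bilinD(3)[OF Lh])
 have "L_list kG W L (h # hs) (bf x) w = L_list kG W L hs (bf x) (L h (bf x) w)" using sw2_bf[OF b W x] by simp
 also have "... = fold (%h. L h (bf x)) hs (L h (bf x) w)"
  by (rule Cons.IH) (use Cons.prems bilinD(3)[OF Lh] x in auto)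
 finally show ?case by simp
qed

text \<open>Bilinearity and the unfolding of one letter belong together: bilinearity for a longer
  list is read off from the comultiplication expanded in the dual basis.\<close>

lemma bilin_T_list:
 assumes W: "vspace W" and T: "!!h. h : set hs ==> bilin (dual kG) W W (T h)"
 shows "bilin (dual kG) W W (T_list kG W T hs)"
  and "h' # hs' = hs ==> al : carr (dual kG) ==> w : carr W ==>
   T_list kG W T (h' # hs') al w = (\<Sum>x\<in>carrier G. \<Sum>y\<in>carrier G.
    scl W (al (bf (x \<otimes> y))) (T_list kG W T hs' (dual_basis x) (T h' (dual_basis y) w)))"
proof -
 note db = has_basisD(3)[OF has_basis_dual]
 have step: "T_list kG W T (h # hs) al w = (\<Sum>x\<in>carrier G. \<Sum>y\<in>carrier G.
    scl W (al (bf (x \<otimes> y))) (T_list kG W T hs (dual_basis x) (T h (dual_basis y) w)))"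
  if IH: "bilin (dual kG) W W (T_list kG W T hs)" and Th: "bilin (dual kG) W W (T h)"
   and al: "al : carr (dual kG)" and w: "w : carr W" for h hs al w
 proof -
  have b: "bilin (dual kG) (dual kG) W (%\<beta> cf. T_list kG W T hs \<beta> (T h cf w))"
   using w by (intro bilin_comp2[OF IH lin_id bilinD(2)[OF Th]])
  note l = tlift[OF vspace_dual vspace_dual W b]
  have c: "scl (dual kG \<boxtimes> dual kG) (al (bf (x \<otimes> y))) (tens (dual kG) (dual kG) (dual_basis x) (dual_basis y))
    : carr (dual kG \<boxtimes> dual kG)" if "x : carrier G" "y : carrier G" for x y
   by (intro vspaceD(4)[OF vspace_tensor] tens_carr db that)
  have "T_list kG W T (h # hs) al w = tlift (dual kG) (dual kG) W (%\<beta> cf. T_list kG W T hs \<beta> (T h cf w))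
    (\<Sum>x\<in>carrier G. \<Sum>y\<in>carrier G. scl (dual kG \<boxtimes> dual kG) (al (bf (x \<otimes> y)))
     (tens (dual kG) (dual kG) (dual_basis x) (dual_basis y)))"
   using dual_comul_spec(3)[OF al] by simp
  also have "... = (\<Sum>x\<in>carrier G. tlift (dual kG) (dual kG) W (%\<beta> cf. T_list kG W T hs \<beta> (T h cf w))
    (\<Sum>y\<in>carrier G. scl (dual kG \<boxtimes> dual kG) (al (bf (x \<otimes> y)))
     (tens (dual kG) (dual kG) (dual_basis x) (dual_basis y))))"
   by (rule lin_sum[OF l(1) vspace_tensor W]) (intro vspaceD(5)[OF vspace_tensor] c)
  also have "... = (\<Sum>x\<in>carrier G. \<Sum>y\<in>carrier G. tlift (dual kG) (dual kG) W (%\<beta> cf. T_list kG W T hs \<beta> (T h cf w))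
    (scl (dual kG \<boxtimes> dual kG) (al (bf (x \<otimes> y))) (tens (dual kG) (dual kG) (dual_basis x) (dual_basis y))))"
   by (intro sum.cong HOL.refl lin_sum[OF l(1) vspace_tensor W] c)
  also have "... = (\<Sum>x\<in>carrier G. \<Sum>y\<in>carrier G.
    scl W (al (bf (x \<otimes> y))) (T_list kG W T hs (dual_basis x) (T h (dual_basis y) w)))"
  proof (intro sum.cong HOL.refl)
   fix x y assume xy: "x : carrier G" "y : carrier G"
   show "tlift (dual kG) (dual kG) W (%\<beta> cf. T_list kG W T hs \<beta> (T h cf w))
    (scl (dual kG \<boxtimes> dual kG) (al (bf (x \<otimes> y))) (tens (dual kG) (dual kG) (dual_basis x) (dual_basis y))) =
    scl W (al (bf (x \<otimes> y))) (T_list kG W T hs (dual_basis x) (T h (dual_basis y) w))"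
    unfolding linD(3)[OF l(1) tens_carr[OF db[OF xy(1)] db[OF xy(2)]]] l(2)[OF db[OF xy(1)] db[OF xy(2)]] ..
  qed
  finally show ?thesis .
 qed
 have bil: "bilin (dual kG) W W (T_list kG W T hs)"
  if "!!h. h : set hs ==> bilin (dual kG) W W (T h)" for hs using that
 proof (induction hs)
  case Nil
  have "lin (dual kG) ground (%al :: ('g => 'a) => 'a. al (bf \<one>))" by (rule linI) (auto simp: fscl_def)
  then have "bilin (dual kG) W W (%al w. scl W (al (bf \<one>)) w)" by (rule bilin_scl_left[OF _ lin_id W])
  then show ?case by (rule bilin_cong[OF _ vspace_dual W, rotated]) simp
 next
  case (Cons h hs)
  have IH: "bilin (dual kG) W W (T_list kG W T hs)" and Th: "bilin (dual kG) W W (T h)" using Cons by auto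
  show ?case
  proof (rule bilin_cong[OF step[OF IH Th, symmetric] vspace_dual W], assumption+)
   have "lin (dual kG) ground (%al :: ('g => 'a) => 'a. al (bf x))" for x by (rule linI) (auto simp: fscl_def)
   then show "bilin (dual kG) W W (%al w. \<Sum>x\<in>carrier G. \<Sum>y\<in>carrier G.
    scl W (al (bf (x \<otimes> y))) (T_list kG W T hs (dual_basis x) (T h (dual_basis y) w)))"
    by (intro bilin_sum W bilin_scl_left lin_comp[OF bilinD(1)[OF IH] bilinD(1)[OF Th]] db)
  qed
 qed
 show "bilin (dual kG) W W (T_list kG W T hs)" by (rule bil[OF T])
 show "h' # hs' = hs ==> al : carr (dual kG) ==> w : carr W ==>
   T_list kG W T (h' # hs') al w = (\<Sum>x\<in>carrier G. \<Sum>y\<in>carrier G.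
    scl W (al (bf (x \<otimes> y))) (T_list kG W T hs' (dual_basis x) (T h' (dual_basis y) w)))"
  using T by (intro step bil) auto
qed

text \<open>On a joint eigenvector only one term of the expanded comultiplication survives, and the
  degrees multiply. The list is reversed since the operator of the first letter receives the last
  leg.\<close>

lemma T_list_eigen:
 assumes W: "vspace W" and T: "!!h. h : set hs ==> bilin (dual kG) W W (T h)"
  and w: "w : carr W" and d: "!!h. h : set hs ==> d h : carrier G"
  and eig: "!!h al. h : set hs ==> al : carr (dual kG) ==> T h al w = scl W (al (bf (d h))) w"
  and al: "al : carr (dual kG)"
 shows "T_list kG W T hs al w = scl W (al (bf (hol G d (rev hs)))) w" using T d eig al
proof (induction hs arbitrary: al)
 case (Cons h hs)
 note db = has_basisD(3)[OF has_basis_dual]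
 have D: "hol G d (rev hs) : carrier G" using Cons.prems by (intro hol_closed) auto
 have dh: "d h : carrier G" using Cons.prems by auto
 have bT: "bilin (dual kG) W W (T_list kG W T hs)" by (rule bilin_T_list(1)[OF W]) (use Cons.prems in auto)
 have IH: "T_list kG W T hs al w = scl W (al (bf (hol G d (rev hs)))) w" if "al : carr (dual kG)" for al
  using Cons.IH Cons.prems that by simp
 have "T_list kG W T (h # hs) al w = (\<Sum>x\<in>carrier G. \<Sum>y\<in>carrier G.
    scl W (al (bf (x \<otimes> y))) (T_list kG W T hs (dual_basis x) (T h (dual_basis y) w)))"
  using bilin_T_list(2)[OF W, of "h # hs" T h hs] Cons.prems w by blast
 also have "... = (\<Sum>x\<in>carrier G. \<Sum>y\<in>carrier G. if y = d h then
   (if x = hol G d (rev hs) then scl W (al (bf (hol G d (rev hs) \<otimes> d h))) w else 0) else 0)"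
 proof (intro sum.cong HOL.refl)
  fix x y assume xy: "x : carrier G" "y : carrier G"
  have "T h (dual_basis y) w = scl W (if y = d h then 1 else 0) w"
  proof -
   have "dual_basis y (bf (d h)) = (if y = d h then 1 else (0 :: 'a))"
    using has_basisD(5)[OF has_basis_dual dh xy(2)] by auto
   moreover have "T h (dual_basis y) w = scl W (dual_basis y (bf (d h))) w"
    by (rule Cons.prems(3)) (use db[OF xy(2)] in simp_all)
   ultimately show ?thesis by (simp only:)
  qed
  moreover have "T_list kG W T hs (dual_basis x) w = scl W (if x = hol G d (rev hs) then 1 else 0) w"
  proof -
   have "dual_basis x (bf (hol G d (rev hs))) = (if x = hol G d (rev hs) then 1 else (0 :: 'a))"
    using has_basisD(5)[OF has_basis_dual D xy(1)] by auto
   then show ?thesis using IH[OF db[OF xy(1)]] by (simp only:)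
  qed
  moreover have "T_list kG W T hs (dual_basis x) (scl W c w) = scl W c (T_list kG W T hs (dual_basis x) w)" for c
   by (rule linD(3)[OF bilinD(1)[OF bT db[OF xy(1)]] w])
  ultimately show "scl W (al (bf (x \<otimes> y))) (T_list kG W T hs (dual_basis x) (T h (dual_basis y) w)) =
   (if y = d h then (if x = hol G d (rev hs) then scl W (al (bf (hol G d (rev hs) \<otimes> d h))) w else 0) else 0)"
   by (simp add: vspaceD[OF W])
 qed
 also have "... = (\<Sum>x\<in>carrier G. if x = hol G d (rev hs) then scl W (al (bf (hol G d (rev hs) \<otimes> d h))) w else 0)"
  by (intro sum.cong HOL.refl) (use dh fin in \<open>simp add: sum.delta\<close>)
 also have "... = scl W (al (bf (hol G d (rev hs) \<otimes> d h))) w" using D fin by (simp add: sum.delta)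
 also have "hol G d (rev hs) \<otimes> d h = hol G d (rev (h # hs))"
  unfolding rev.simps using Cons.prems(2) by (subst hol_append) auto
 finally show ?case .
qed simp

lemma lin_foldr_family:
 assumes F: "!!c. c : set cs ==> bilin V W W (F c)" and W: "vspace W"
  and a: "!!c. c : set cs ==> a c : carr V"
 shows "lin W W (%w. foldr (%c. F c (a c)) cs w)" using F a
proof (induction cs)
 case (Cons c cs)
 have "lin W W (%w. F c (a c) (foldr (%c. F c (a c)) cs w))"
  by (rule lin_comp[OF bilinD(1)]) (use Cons in auto)
 then show ?case by simp
qed (simp add: lin_id id_def)

lemma lin_foldr_update:
 assumes F: "!!c. c : set cs ==> bilin V W W (F c)" and W: "vspace W" and V: "vspace V"
  and a: "!!c. c : set cs ==> a c : carr V" and w: "w : carr W" and i: "i : set cs" and d: "distinct cs"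
 shows "lin V W (%x. foldr (%c. F c ((a(i := x)) c)) cs w)" using F a i d
proof (induction cs)
 case (Cons c cs)
 show ?case
 proof (cases "i = c")
  case True
  then have "i \<notin> set cs" using Cons.prems by auto
  then have eq: "foldr (%c. F c ((a(i := x)) c)) cs w = foldr (%c. F c (a c)) cs w" for x
   by (intro foldr_cong) auto
  have "foldr (%c. F c (a c)) cs w : carr W"
   by (rule linD(1)[OF lin_foldr_family[OF _ W] w]) (use Cons.prems in auto)
  then have "lin V W (%x. F c x (foldr (%c. F c (a c)) cs w))"
   using Cons.prems(1)[of c] by (intro bilinD(2)) auto
  then show ?thesis unfolding foldr.simps comp_def eq using True by simp
 next
  case False
  then have "lin V W (%x. foldr (%c. F c ((a(i := x)) c)) cs w)" using Cons by auto
  then have "lin V W (%x. F c (a c) (foldr (%c. F c ((a(i := x)) c)) cs w))"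
   by (rule lin_comp[OF bilinD(1), rotated 2]) (use Cons.prems in auto)
  then show ?thesis using False by (simp add: comp_def)
 qed
qed simp

end

section \<open>Vertex and face operators on basis vectors\<close>

text \<open>The bimodule is represented by its monomial basis, on which the structure maps are
  recorded together with their linearity.\<close>

locale kitaev_config = finite_group G for G :: "('g, 'b) monoid_scheme" (structure) +
 fixes M :: "('k::field, 'g => 'k, 'm::ab_group_add) bimod" and p :: 'g and \<chi> :: "('g => 'k) => 'k"
  and e :: "'g => 'm" and coM :: "'g => 'm => 'k" and \<Gamma> :: "('h::linorder) kitaev"
 assumes p: "central G p" and \<chi>: "\<chi> : carrier (characters kG)"
  and lact: "bilin kG M M (lact M)" and ract: "bilin M kG M (ract M)"
  and lin_lcoact: "lin M (kG \<boxtimes> M) (lcoact M)" and lin_rcoact: "lin M (M \<boxtimes> kG) (rcoact M)"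
  and BM: "has_basis M (carrier G) e coM"
  and lco: "!!x. x : carrier G ==> lcoact M (e x) = tens kG M (bf x) (e x)"
  and rco: "!!x. x : carrier G ==> rcoact M (e x) = tens M kG (e x) (bf (x \<otimes> p))"
  and la: "!!x h. x : carrier G ==> h : carrier G ==> lact M (bf h) (e x) = e (h \<otimes> x)"
  and ra: "!!x h. x : carrier G ==> h : carrier G ==>
   ract M (e x) (bf h) = scl M (inverse (\<chi> (bf h))) (e (x \<otimes> h))"
  and K: "kitaev_graph \<Gamma>"
begin

abbreviation Hs where "Hs \<equiv> half_edges \<Gamma>"
abbreviation io where "io \<equiv> iota \<Gamma>"
abbreviation E where "E \<equiv> edges \<Gamma>"
abbreviation W where "W \<equiv> ext_space \<Gamma> M"
abbreviation A where "A \<equiv> cfg G io Hs []"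

lemma ribbon: "finite Hs" "io permutes Hs" "rho \<Gamma> permutes Hs"
 "h : Hs ==> io (io h) = h" "h : Hs ==> io h ~= h" "h : Hs ==> io h : Hs"
 using K permutes_in_image[of io Hs] unfolding kitaev_graph_def ribbon_graph_def by auto

lemma edge_of: "h : Hs ==> edge_of \<Gamma> h = {h, io h}"
proof
 assume h: "h : Hs"
 show "{h, io h} \<subseteq> edge_of \<Gamma> h"
  unfolding edge_of_def using orbit.base[of io h] orbit.step[OF orbit.base[of io h]] ribbon(4)[OF h] by simp
 show "edge_of \<Gamma> h \<subseteq> {h, io h}"
 proof
  fix x assume "x : edge_of \<Gamma> h"
  then show "x : {h, io h}" unfolding edge_of_def by (induction rule: orbit.induct) (use ribbon(4)[OF h] in auto)
 qed
qed

lemma Min_edge: "h : Hs ==> Min (edge_of \<Gamma> h) = min h (io h)" by (simp add: edge_of)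

lemma is_source_iff: "is_source \<Gamma> h \<longleftrightarrow> min h (io h) = h" unfolding is_source_def by auto

lemma not_source: "h : Hs ==> \<not> is_source \<Gamma> h ==> min h (io h) = io h"
 unfolding is_source_def by (auto simp: min_def)

lemma is_source_iota: "h : Hs ==> is_source \<Gamma> (io h) \<longleftrightarrow> \<not> is_source \<Gamma> h"
 using ribbon(4,5)[of h] by (auto simp: is_source_def min_def)

lemma edgesE: assumes "ed : E" shows "Min ed : Hs" "is_source \<Gamma> (Min ed)" "edge_of \<Gamma> (Min ed) = ed"
proof -
 obtain h where h: "h : Hs" "ed = edge_of \<Gamma> h" using assms unfolding edges_def by auto
 show "Min ed : Hs" "is_source \<Gamma> (Min ed)" "edge_of \<Gamma> (Min ed) = ed"
  unfolding h(2) Min_edge[OF h(1)] is_source_iff using h(1) ribbon(4,6)[of h] edge_of[of h] edge_of[of "io h"]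
  by (auto simp: min_def)
qed

lemma edge_in: "h : Hs ==> edge_of \<Gamma> h : E" unfolding edges_def by simp

lemma fin_E: "finite E" unfolding edges_def using ribbon(1) by simp

lemma vM [simp]: "vspace M" by (rule has_basisD[OF BM])
lemma eM: "x : carrier G ==> e x : carr M" by (rule has_basisD[OF BM])
lemma vW [simp]: "vspace W" unfolding ext_space_def by simp

text \<open>The source is the smaller half-edge of an edge, so \<open>Min\<close> selects it. The
  value of a configuration at the source is the index of the basis vector in the factor of that
  edge.\<close>

definition pos :: "('h => 'g) => 'h set => 'g" where "pos cf = (\<lambda>ed\<in>E. cf (Min ed))"
definition bE :: "('h => 'g) => ('k, 'h set, 'm) mten" where
 "bE cf = mtens E (%_. M) (\<lambda>ed\<in>E. e (pos cf ed))"
definition coW :: "('h => 'g) => ('k, 'h set, 'm) mten => 'k" where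
 "coW cf = mlift E (%_. M) ground (%m. \<Prod>ed\<in>E. coM (pos cf ed) (m ed))"

lemma bij_pos: "bij_betw pos A (\<Pi>\<^sub>E ed\<in>E. carrier G)"
proof (rule bij_betw_byWitness[where
   f' = "%g. \<lambda>h\<in>Hs. if is_source \<Gamma> h then g (edge_of \<Gamma> h) else inv g (edge_of \<Gamma> h)"])
 show "\<forall>cf\<in>A. (\<lambda>h\<in>Hs. if is_source \<Gamma> h then pos cf (edge_of \<Gamma> h) else inv pos cf (edge_of \<Gamma> h)) = cf"
 proof (intro ballI ext)
  fix cf h assume cf: "cf : A"
  show "(\<lambda>h\<in>Hs. if is_source \<Gamma> h then pos cf (edge_of \<Gamma> h) else inv pos cf (edge_of \<Gamma> h)) h = cf h"
  proof (cases "h : Hs")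
   case True
   then show ?thesis using cfgD(1,2)[OF cf, of h] edge_in[OF True] not_source[OF True] is_source_iff[of h]
    by (auto simp: pos_def Min_edge)
  next
   case False
   then show ?thesis using cfgD(3)[OF cf] by simp
  qed
 qed
 show "\<forall>g\<in>\<Pi>\<^sub>E ed\<in>E. carrier G.
   pos (\<lambda>h\<in>Hs. if is_source \<Gamma> h then g (edge_of \<Gamma> h) else inv g (edge_of \<Gamma> h)) = g"
 proof (intro ballI ext)
  fix g ed assume g: "g : (\<Pi>\<^sub>E ed\<in>E. carrier G)"
  show "pos (\<lambda>h\<in>Hs. if is_source \<Gamma> h then g (edge_of \<Gamma> h) else inv g (edge_of \<Gamma> h)) ed = g ed"
   using edgesE[of ed] PiE_arb[OF g, of ed] by (cases "ed : E") (simp_all add: pos_def)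
 qed
 show "pos ` A \<subseteq> (\<Pi>\<^sub>E ed\<in>E. carrier G)"
  using cfgD(1)[of _ G io Hs "[]"] edgesE(1) by (auto simp: pos_def)
 show "(%g. \<lambda>h\<in>Hs. if is_source \<Gamma> h then g (edge_of \<Gamma> h) else inv g (edge_of \<Gamma> h)) `
   (\<Pi>\<^sub>E ed\<in>E. carrier G) \<subseteq> A"
 proof clarify
  fix g assume g: "g : (\<Pi>\<^sub>E ed\<in>E. carrier G)"
  let ?cf = "\<lambda>h\<in>Hs. if is_source \<Gamma> h then g (edge_of \<Gamma> h) else inv g (edge_of \<Gamma> h)"
  have gc: "g (edge_of \<Gamma> h) : carrier G" if "h : Hs" for h using g edge_in[OF that] by auto
  have "?cf (io h) = inv ?cf h" if h: "h : Hs" for h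
  proof -
   have "edge_of \<Gamma> (io h) = edge_of \<Gamma> h"
    using edge_of[OF h] edge_of[OF ribbon(6)[OF h]] ribbon(4)[OF h] by auto
   then show ?thesis using h gc[OF h] is_source_iota[OF h] ribbon(6)[OF h] by simp
  qed
  then show "?cf : A" unfolding cfg_def using gc by simp
 qed
qed

lemma BW: "has_basis W A bE coW"
 using has_basis_reindex[OF has_basis_mtensor[where V = "%_. M" and A = "%_. carrier G" and e = "%_. e"
  and co = "%_. coM", OF fin_E BM] bij_pos] unfolding ext_space_def bE_def[abs_def] coW_def[abs_def] by simp

lemma bE_arg: "cf : A ==> (\<lambda>ed\<in>E. e (pos cf ed)) : (\<Pi>\<^sub>E ed\<in>E. carr M)"
 using cfgD(1)[of cf G io Hs "[]"] edgesE(1) eM by (auto simp: pos_def)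

lemma on_factor:
 assumes ed: "ed : E" and T: "lin M M T"
 shows "lin W W (on_factor \<Gamma> M ed T)"
  and "m : (\<Pi>\<^sub>E ed\<in>E. carr M) ==> on_factor \<Gamma> M ed T (mtens E (%_. M) m) = mtens E (%_. M) (m(ed := T (m ed)))"
proof -
 have a: "multilin E (%_. M) W (%m. mtens E (%_. M) (\<lambda>i\<in>E. (if i = ed then T else (%x. x)) (m i)))"
  unfolding ext_space_def by (rule multilin_map[OF multilin_mtens]) (auto simp: T lin_id)
 have b: "(\<lambda>i\<in>E. (if i = ed then T else (%x. x)) (m i)) = m(ed := T (m ed))"
  if "m : (\<Pi>\<^sub>E ed\<in>E. carr M)" for m using PiE_arb[OF that] ed by (auto simp: fun_eq_iff)
 have "multilin E (%_. M) W (%m. mtens E (%_. M) (m(ed := T (m ed))))"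
  by (rule multilin_cong[OF arg_cong[where f = "mtens E (%_. M)", OF b] vM a])
 note l = mlift[OF vM vW this]
 show "lin W W (on_factor \<Gamma> M ed T)" unfolding on_factor_def using l(1) by (simp add: ext_space_def)
 show "m : (\<Pi>\<^sub>E ed\<in>E. carr M) ==> on_factor \<Gamma> M ed T (mtens E (%_. M) m) = mtens E (%_. M) (m(ed := T (m ed)))"
  unfolding on_factor_def by (rule l(2))
qed

lemma lin_mtens_update:
 "m : (\<Pi>\<^sub>E ed\<in>E. carr M) ==> ed : E ==> lin M W (%x. mtens E (%_. M) (m(ed := x)))"
 using multilin_mtens[of E "%_. M"] unfolding multilin_def ext_space_def by blast

text \<open>The operator \<open>on_factor\<close> is a lift chosen for each \<open>a\<close>
  separately; linearity in \<open>a\<close> is recovered by expanding the vector in the basis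
  \<open>bE\<close>.\<close>

lemma bilin_on_factor:
 assumes ed: "ed : E" and b: "bilin V M M b" and V: "vspace V"
 shows "bilin V W W (%a. on_factor \<Gamma> M ed (b a))"
proof (rule bilinI)
 show l: "lin W W (on_factor \<Gamma> M ed (b a))" if "a : carr V" for a
  by (rule on_factor(1)[OF ed bilinD(1)[OF b that]])
 fix w assume w: "w : carr W"
 have bE: "on_factor \<Gamma> M ed (b a) (bE cf) = mtens E (%_. M) ((\<lambda>ed\<in>E. e (pos cf ed))(ed := b a (e (pos cf ed))))"
  if "cf : A" "a : carr V" for cf a
  unfolding bE_def using on_factor(2)[OF ed bilinD(1)[OF b that(2)] bE_arg[OF that(1)]] ed by simp
 have "lin V W (%a. \<Sum>cf\<in>A. scl W (coW cf w) (mtens E (%_. M) ((\<lambda>ed\<in>E. e (pos cf ed))(ed := b a (e (pos cf ed))))))"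
 proof (intro lin_sum_fun lin_scl vW)
  fix cf assume cf: "cf : A"
  have "e (pos cf ed) : carr M" using bE_arg[OF cf] ed by (auto dest: PiE_mem)
  then show "lin V W (%a. mtens E (%_. M) ((\<lambda>ed\<in>E. e (pos cf ed))(ed := b a (e (pos cf ed)))))"
   by (rule lin_comp[OF lin_mtens_update[OF bE_arg[OF cf] ed] bilinD(2)[OF b]])
 qed
 moreover have "on_factor \<Gamma> M ed (b a) w =
   (\<Sum>cf\<in>A. scl W (coW cf w) (mtens E (%_. M) ((\<lambda>ed\<in>E. e (pos cf ed))(ed := b a (e (pos cf ed))))))"
  if "a : carr V" for a using lin_basis_expand[OF BW l[OF that] vW w] bE[OF _ that] by (simp cong: sum.cong)
 ultimately show "lin V W (%a. on_factor \<Gamma> M ed (b a) w)"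
  using lin_cong[OF _ V, of "%a. on_factor \<Gamma> M ed (b a) w" "%a. \<Sum>cf\<in>A. scl W (coW cf w)
   (mtens E (%_. M) ((\<lambda>ed\<in>E. e (pos cf ed))(ed := b a (e (pos cf ed)))))" W] by blast
qed

lemma on_factor_eigen:
 assumes h: "h : Hs" and cf: "cf : A" and cf': "cf' : A" and T: "lin M M T"
  and val: "T (e (cf (min h (io h)))) = scl M c (e (cf' (min h (io h))))"
  and eq: "!!u. u : Hs ==> u ~= h ==> u ~= io h ==> cf' u = cf u"
 shows "on_factor \<Gamma> M (edge_of \<Gamma> h) T (bE cf) = scl W c (bE cf')"
proof -
 let ?ed = "edge_of \<Gamma> h" let ?m = "\<lambda>ed\<in>E. e (pos cf ed)"
 note ed = edge_in[OF h]
 have min_in: "min h (io h) : Hs" using h ribbon(6)[OF h] by (simp add: min_def)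
 have "on_factor \<Gamma> M ?ed T (bE cf) = mtens E (%_. M) (?m(?ed := T (?m ?ed)))"
  unfolding bE_def by (rule on_factor(2)[OF ed T bE_arg[OF cf]])
 also have "T (?m ?ed) = scl M c (e (cf' (min h (io h))))" using val ed Min_edge[OF h] by (simp add: pos_def)
 also have "mtens E (%_. M) (?m(?ed := scl M c (e (cf' (min h (io h)))))) =
   scl W c (mtens E (%_. M) (?m(?ed := e (cf' (min h (io h))))))"
  by (rule linD(3)[OF lin_mtens_update[OF bE_arg[OF cf] ed] eM[OF cfgD(1)[OF cf' min_in]]])
 also have "?m(?ed := e (cf' (min h (io h)))) = (\<lambda>ed\<in>E. e (pos cf' ed))"
 proof
  fix ed'
  show "(?m(?ed := e (cf' (min h (io h))))) ed' = (\<lambda>ed\<in>E. e (pos cf' ed)) ed'"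
  proof (cases "ed' : E \<and> ed' ~= ?ed")
   case True
   have "Min ed' ~= h" "Min ed' ~= io h"
    using True edgesE(3)[of ed'] edge_of[OF h] edge_of[OF ribbon(6)[OF h]] ribbon(4)[OF h] by auto
   then have "cf' (Min ed') = cf (Min ed')" using True edgesE(1)[of ed'] by (intro eq) auto
   then show ?thesis using True by (simp add: pos_def)
  next
   case False
   have "pos cf' ?ed = cf' (min h (io h))" using ed Min_edge[OF h] by (simp add: pos_def)
   then have "(?m(?ed := e (cf' (min h (io h))))) ?ed = (\<lambda>ed\<in>E. e (pos cf' ed)) ?ed" using ed by simp
   then show ?thesis using False by (cases "ed' = ?ed") auto
  qed
 qed
 finally show ?thesis unfolding bE_def .
qed

lemma gauge_cfg:
 assumes "cf : A" "!!u. u : Hs ==> a (t u) : carrier G"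
 shows "gauge G io t Hs a cf : A"
proof -
 have "gauge G io t Hs a cf (io u) = inv gauge G io t Hs a cf u" if u: "u : Hs" for u
  using cfgD(1,2)[OF assms(1) u] assms(2)[OF u] assms(2)[OF ribbon(6)[OF u]] ribbon(4,6)[OF u] u
  by (simp add: gauge_def group_word_simps)
 moreover have "gauge G io t Hs a cf : Hs \<rightarrow>\<^sub>E carrier G"
  using cfgD(1)[OF assms(1)] assms(2) ribbon(6) unfolding gauge_def by simp
 ultimately show ?thesis unfolding cfg_def by simp
qed

lemma bilin_L_op: "h : Hs ==> bilin kG W W (L_op kG M \<Gamma> h)"
proof -
 assume h: "h : Hs"
 have "bilin kG M M (%a m. if is_source \<Gamma> h then ract M m (hanti kG a) else lact M a m)"
 proof (cases "is_source \<Gamma> h")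
  case True
  have "bilin kG M M (%a m. ract M m (hanti kG a))" using linD(1)[OF lin_hanti]
   by (intro bilinI bilinD(2)[OF ract] lin_comp[OF bilinD(1)[OF ract] lin_hanti]) auto
  then show ?thesis using True by simp
 next
  case False
  have "bilin kG M M (%a m. lact M a m)" by (rule lact)
  then show ?thesis using False by simp
 qed
 from bilin_on_factor[OF edge_in[OF h] this vspace_kG] show ?thesis unfolding L_op_def[abs_def] by simp
qed

definition single :: "'h => 'g => 'h => 'g" where "single h k = (%u. if u = h then k else \<one>)"

text \<open>This is the gauge transformation supported at one half-edge, with every half-edge
  regarded as its own vertex. At a target the left action multiplies the source value by k from the
  left. At a source the action is from the right by k^-1, which costs the scalar \<chi>^-1(k^-1) =
  \<chi>(k).\<close>

lemma L_op_bE: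
 assumes h: "h : Hs" and k: "k : carrier G" and cf: "cf : A"
 shows "L_op kG M \<Gamma> h (bf k) (bE cf) =
  scl W (if is_source \<Gamma> h then \<chi> (bf k) else 1) (bE (gauge G io (%u. u) Hs (single h k) cf))"
 unfolding L_op_def
proof (rule on_factor_eigen[OF h cf])
 let ?cf = "gauge G io (%u. u) Hs (single h k) cf"
 note c = cfgD(1)[OF cf]
 have hi: "io h : Hs" "io h ~= h" "h ~= io h" "io (io h) = h" using ribbon(4-6)[OF h] by auto
 show "?cf : A" by (rule gauge_cfg[OF cf]) (simp add: single_def k)
 show "lin M M (%m. if is_source \<Gamma> h then ract M m (hanti kG (bf k)) else lact M (bf k) m)"
  using bilinD(2)[OF ract, of "bf (inv k)"] bilinD(1)[OF lact, of "bf k"] k by (cases "is_source \<Gamma> h") simp_all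
 show "?cf u = cf u" if u: "u : Hs" "u ~= h" "u ~= io h" for u
 proof -
  have "io u ~= h" using u ribbon(4)[of u] hi by metis
  then show ?thesis using u c by (simp add: gauge_def single_def)
 qed
 show "(if is_source \<Gamma> h then ract M (e (cf (min h (io h)))) (hanti kG (bf k)) else lact M (bf k) (e (cf (min h (io h))))) =
  scl M (if is_source \<Gamma> h then \<chi> (bf k) else 1) (e (?cf (min h (io h))))"
 proof (cases "is_source \<Gamma> h")
  case True
  have "?cf h = cf h \<otimes> inv k" using h hi c k by (simp add: gauge_def single_def)
  moreover have "inverse (\<chi> (bf (inv k))) = \<chi> (bf k)" using charactersD(6)[OF \<chi> k] by simp
  ultimately show ?thesis using True ra[OF c[OF h], of "inv k"] k is_source_iff[of h] by simp
 next
  case False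
  have "?cf (io h) = k \<otimes> cf (io h)" using h hi c k by (simp add: gauge_def single_def)
  then show ?thesis using False la[OF c[OF hi(1)] k] not_source[OF h False] vspaceD(9)[OF vM] by simp
 qed
qed

lemma gauge_comp:
 assumes "cf : A" "!!u. u : Hs ==> a (t u) : carrier G" "!!u. u : Hs ==> b (t u) : carrier G"
 shows "gauge G io t Hs a (gauge G io t Hs b cf) = gauge G io t Hs (%v. a v \<otimes> b v) cf"
proof
 fix u
 show "gauge G io t Hs a (gauge G io t Hs b cf) u = gauge G io t Hs (%v. a v \<otimes> b v) cf u"
 proof (cases "u : Hs")
  case True
  then show ?thesis using cfgD(1)[OF assms(1) True] assms(2,3)[OF True] assms(2,3)[OF ribbon(6)[OF True]]
   by (simp add: gauge_def group_word_simps)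
 qed (simp add: gauge_def)
qed

lemma gauge_cong:
 "(!!u. u : Hs ==> a (t u) = b (t' u)) ==> gauge G io t Hs a cf = gauge G io t' Hs b cf"
 unfolding gauge_def using ribbon(6) by (auto simp: fun_eq_iff)

lemma gauge_one: "cf : A ==> gauge G io t Hs (%_. \<one>) cf = cf"
proof
 fix u assume cf: "cf : A"
 show "gauge G io t Hs (%_. \<one>) cf u = cf u"
  using cfgD(1)[OF cf, of u] cfgD(3)[OF cf, of u] by (cases "u : Hs") (simp_all add: gauge_def)
qed

text \<open>As the half-edges are distinct, the supports of the successive gauges are disjoint and
  the gauges combine into one.\<close>

lemma fold_L_op:
 assumes "distinct hs" "set hs \<subseteq> Hs" "!!h. h : set hs ==> k h : carrier G" "cf : A"
 shows "fold (%h. L_op kG M \<Gamma> h (bf (k h))) hs (bE cf) =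
  scl W (\<Prod>h\<in>set hs. if is_source \<Gamma> h then \<chi> (bf (k h)) else 1)
   (bE (gauge G io (%u. u) Hs (%u. if u : set hs then k u else \<one>) cf))"
 using assms
proof (induction hs rule: rev_induct)
 case Nil
 then show ?case using gauge_one[of cf "%u. u"] vspaceD(9)[OF vW] by simp
next
 case (snoc h hs)
 let ?a = "%u. if u : set hs then k u else \<one>"
 have h: "h : Hs" "k h : carrier G" "h \<notin> set hs" using snoc.prems by auto
 have ac: "?a u : carrier G" for u using snoc.prems by auto
 have g: "gauge G io (%u. u) Hs ?a cf : A" by (rule gauge_cfg[where a = ?a and t = "%u. u", OF snoc.prems(4) ac])
 have "fold (%h. L_op kG M \<Gamma> h (bf (k h))) (hs @ [h]) (bE cf) =
   L_op kG M \<Gamma> h (bf (k h)) (scl W (\<Prod>h\<in>set hs. if is_source \<Gamma> h then \<chi> (bf (k h)) else 1)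
    (bE (gauge G io (%u. u) Hs ?a cf)))"
  using snoc by simp
 also have "... = scl W (\<Prod>h\<in>set hs. if is_source \<Gamma> h then \<chi> (bf (k h)) else 1)
   (L_op kG M \<Gamma> h (bf (k h)) (bE (gauge G io (%u. u) Hs ?a cf)))"
  by (rule linD(3)[OF bilinD(1)[OF bilin_L_op[OF h(1)] bf_kG[OF h(2)]] has_basisD(3)[OF BW g]])
 also have "... = scl W ((\<Prod>h\<in>set hs. if is_source \<Gamma> h then \<chi> (bf (k h)) else 1) *
   (if is_source \<Gamma> h then \<chi> (bf (k h)) else 1))
   (bE (gauge G io (%u. u) Hs (single h (k h)) (gauge G io (%u. u) Hs ?a cf)))"
  unfolding L_op_bE[OF h(1,2) g] by (simp only: vspaceD(8)[OF vW])
 also have "gauge G io (%u. u) Hs (single h (k h)) (gauge G io (%u. u) Hs ?a cf) =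
   gauge G io (%u. u) Hs (%u. single h (k h) u \<otimes> ?a u) cf"
  by (rule gauge_comp[where b = ?a and t = "%u. u", OF snoc.prems(4) _ ac]) (simp add: single_def h)
 also have "(%u. single h (k h) u \<otimes> ?a u) = (%u. if u : set (hs @ [h]) then k u else \<one>)"
  using h snoc.prems(3) by (auto simp: fun_eq_iff single_def)
 also have "(\<Prod>h\<in>set hs. if is_source \<Gamma> h then \<chi> (bf (k h)) else 1) * (if is_source \<Gamma> h then \<chi> (bf (k h)) else 1) =
   (\<Prod>h\<in>set (hs @ [h]). if is_source \<Gamma> h then \<chi> (bf (k h)) else 1)"
  using h by (simp add: mult.commute)
 finally show ?case .
qed

lemma bilin_T_op: "h : Hs ==> bilin (dual kG) W W (T_op kG M \<Gamma> h)"
proof -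
 assume h: "h : Hs"
 have ev: "lin (dual kG) ground (%al :: ('g => 'k) => 'k. al x)" for x by (rule linI) (auto simp: fscl_def)
 have b1: "bilin kG M M (%a n. scl M (al a) n)" if "al : carr (dual kG)" for al
  by (rule bilin_scl_left[OF _ lin_id vM]) (use that in simp)
 have b2: "bilin M kG M (%n b. scl M (al (hanti kG b)) n)" if "al : carr (dual kG)" for al
  by (rule bilin_scl_right[OF lin_id lin_comp[OF _ lin_hanti] vM]) (use that in simp)
 have "bilin (dual kG) M M (%al m. tlift kG M M (%a n. scl M (al a) n) (lcoact M m))"
 proof (rule bilin_cong[OF _ vspace_dual vM])
  show "(\<Sum>x\<in>carrier G. scl M (al (bf x)) (lcomp kG M (%x a. a x) x (lcoact M m))) =
    tlift kG M M (%a n. scl M (al a) n) (lcoact M m)"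
   if "al : carr (dual kG)" "m : carr M" for al m
   by (rule tlift_lcomp[symmetric, OF has_basis_kG vM vM b1[OF that(1)] linD(1)[OF lin_lcoact that(2)]])
  show "bilin (dual kG) M M (%al m. \<Sum>x\<in>carrier G. scl M (al (bf x)) (lcomp kG M (%x a. a x) x (lcoact M m)))"
   by (intro bilin_sum vM bilin_scl_left ev lin_comp[OF lcomp(1)[OF has_basis_kG vM] lin_lcoact])
 qed
 moreover have "bilin (dual kG) M M (%al m. tlift M kG M (%n b. scl M (al (hanti kG b)) n) (rcoact M m))"
 proof (rule bilin_cong[OF _ vspace_dual vM])
  show "(\<Sum>x\<in>carrier G. scl M (al (hanti kG (bf x))) (rcomp M kG (%x a. a x) x (rcoact M m))) =
    tlift M kG M (%n b. scl M (al (hanti kG b)) n) (rcoact M m)"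
   if "al : carr (dual kG)" "m : carr M" for al m
   by (rule tlift_rcomp[symmetric, OF has_basis_kG vM vM b2[OF that(1)] linD(1)[OF lin_rcoact that(2)]])
  show "bilin (dual kG) M M (%al m. \<Sum>x\<in>carrier G. scl M (al (hanti kG (bf x))) (rcomp M kG (%x a. a x) x (rcoact M m)))"
   by (intro bilin_sum vM bilin_scl_left ev lin_comp[OF rcomp(1)[OF has_basis_kG vM] lin_rcoact])
 qed
 ultimately have "bilin (dual kG) M M (%al m. if is_source \<Gamma> h
    then tlift kG M M (%a n. scl M (al a) n) (lcoact M m)
    else tlift M kG M (%n b. scl M (al (hanti kG b)) n) (rcoact M m))"
  by (cases "is_source \<Gamma> h") simp_all
 from bilin_on_factor[OF edge_in[OF h] this vspace_dual] show ?thesis unfolding T_op_def[abs_def] by simp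
qed

text \<open>If x is the value at the source, the right degree of the edge is x p. At the target the
  antipode turns this into p^-1 x^-1, and x^-1 is the value at the target.\<close>

definition deg :: "('h => 'g) => 'h => 'g" where
 "deg cf h = (if is_source \<Gamma> h then cf h else inv p \<otimes> cf h)"

lemma p_carrier: "p : carrier G" using p by (simp add: central_def)

lemma T_op_bE:
 assumes h: "h : Hs" and al: "al : carr (dual kG)" and cf: "cf : A"
 shows "T_op kG M \<Gamma> h al (bE cf) = scl W (al (bf (deg cf h))) (bE cf)" unfolding T_op_def
proof (rule on_factor_eigen[OF h cf cf])
 note c = cfgD(1)[OF cf]
 have b1: "bilin kG M M (%a n. scl M (al a) n)"
  by (rule bilin_scl_left[OF _ lin_id vM]) (use al in simp)
 have b2: "bilin M kG M (%n b. scl M (al (hanti kG b)) n)"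
  by (rule bilin_scl_right[OF lin_id lin_comp[OF _ lin_hanti] vM]) (use al in simp)
 note l1 = tlift[OF vspace_kG vM vM b1] and l2 = tlift[OF vM vspace_kG vM b2]
 show "lin M M (%m. if is_source \<Gamma> h then tlift kG M M (%a n. scl M (al a) n) (lcoact M m)
   else tlift M kG M (%n b. scl M (al (hanti kG b)) n) (rcoact M m))"
  using lin_comp[OF l1(1) lin_lcoact] lin_comp[OF l2(1) lin_rcoact] by (cases "is_source \<Gamma> h") simp_all
 show "(if is_source \<Gamma> h then tlift kG M M (%a n. scl M (al a) n) (lcoact M (e (cf (min h (io h)))))
   else tlift M kG M (%n b. scl M (al (hanti kG b)) n) (rcoact M (e (cf (min h (io h)))))) =
  scl M (al (bf (deg cf h))) (e (cf (min h (io h))))"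
 proof (cases "is_source \<Gamma> h")
  case True
  then show ?thesis
   using lco[OF c[OF h]] l1(2)[OF bf_kG[OF c[OF h]] eM[OF c[OF h]]] is_source_iff[of h] by (simp add: deg_def)
 next
  case False
  have hi: "io h : Hs" "cf (io h) = inv cf h" using ribbon(6)[OF h] cfgD(2)[OF cf h] by auto
  have "inv (cf (io h) \<otimes> p) = inv p \<otimes> cf h"
   unfolding hi(2) using c[OF h] p_carrier by (simp add: group_word_simps)
  moreover have "cf (io h) \<otimes> p : carrier G" using c[OF hi(1)] p_carrier by simp
  ultimately show ?thesis
   using False rco[OF c[OF hi(1)]] l2(2)[OF eM[OF c[OF hi(1)]] bf_kG[of "cf (io h) \<otimes> p"]] not_source[OF h False]
   by (simp add: deg_def)
 qed
qed auto

lemma deg_carrier: "cf : A ==> h : Hs ==> deg cf h : carrier G"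
 using cfgD(1)[of cf G io Hs "[]" h] p_carrier by (simp add: deg_def)

end

section \<open>Joint action and coaction of all cilia\<close>

lemma cycle_list:
 assumes "permutation f"
 shows "set (cycle_list f a) = orbit f a" "distinct (cycle_list f a)"
  "length (cycle_list f a) = card (orbit f a)" "(f ^^ card (orbit f a)) a = a"
proof -
 note self = permutation_self_in_orbit[OF assms, of a]
 let ?n = "funpow_dist1 f a a"
 have o: "orbit f a = (%n. (f ^^ n) a) ` {0..<?n}" by (rule orbit_conv_funpow_dist1[OF self])
 have inj: "inj_on (%n. (f ^^ n) a) {0..<?n}" by (rule inj_on_funpow_dist1[OF self])
 have n: "card (orbit f a) = ?n" unfolding o card_image[OF inj] by simp
 show "set (cycle_list f a) = orbit f a" unfolding cycle_list_def n set_map set_upt by (rule o[symmetric])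
 show "distinct (cycle_list f a)" unfolding cycle_list_def n distinct_map set_upt using inj by simp
 show "length (cycle_list f a) = card (orbit f a)" by (simp add: cycle_list_def)
 show "(f ^^ card (orbit f a)) a = a" unfolding n by (rule funpow_dist1_prop[OF self])
qed

lemma orbit_eq_iff:
 assumes "permutation f"
 shows "b : orbit f a \<longleftrightarrow> orbit f b = orbit f a"
proof
 show "b : orbit f a ==> orbit f b = orbit f a" by (rule orbit_cyclic_eq3[OF cyclic_on_orbit'[OF assms]])
 show "orbit f b = orbit f a ==> b : orbit f a" using permutation_self_in_orbit[OF assms, of b] by simp
qed

context kitaev_config
begin

abbreviation C where "C \<equiv> cilia \<Gamma>"
abbreviation cs where "cs \<equiv> sorted_list_of_set C"
abbreviation HG where "HG \<equiv> graph_hopf (kG :: ('k, 'g => 'k) hopf) \<Gamma>"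

lemma C_Hs: "C \<subseteq> Hs" using K unfolding kitaev_graph_def by blast
lemma fin_C: "finite C" using C_Hs ribbon(1) by (rule finite_subset)
lemma cs: "set cs = C" "distinct cs" using fin_C by simp_all

lemma perm_rho: "permutation (rho \<Gamma>)" using ribbon(1,3) unfolding permutation_permutes by blast

lemma rho_inv_permutes: "rho_inv \<Gamma> permutes Hs" unfolding rho_inv_def by (rule permutes_inv[OF ribbon(3)])

lemma face_permutes: "face_perm \<Gamma> permutes Hs"
 unfolding face_perm_def by (rule permutes_compose[OF ribbon(2) rho_inv_permutes])

lemma perm_face: "permutation (face_perm \<Gamma>)"
 using ribbon(1) face_permutes unfolding permutation_permutes by blast

text \<open>Vertices are represented by their cilia. Gauges and based maps are thus indexed by
  cilia, like the tensor factors of the structure algebra.\<close>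

definition vt :: "'h => 'h" where "vt h = inv_into C (vertex_of \<Gamma>) (vertex_of \<Gamma> h)"

lemma bij_C: "bij_betw (vertex_of \<Gamma>) C (vertices \<Gamma>)" using K unfolding kitaev_graph_def by blast

lemma vt: "h : Hs ==> vt h : C" "h : Hs ==> vertex_of \<Gamma> (vt h) = vertex_of \<Gamma> h"
 "c : C ==> h : Hs ==> vt h = c \<longleftrightarrow> h : vertex_of \<Gamma> c"
proof -
 have im: "vertex_of \<Gamma> h : vertex_of \<Gamma> ` C" if "h : Hs" for h
  using bij_C that unfolding bij_betw_def vertices_def by auto
 show 1: "h : Hs ==> vt h : C" and 2: "h : Hs ==> vertex_of \<Gamma> (vt h) = vertex_of \<Gamma> h"
  unfolding vt_def by (rule inv_into_into[OF im] f_inv_into_f[OF im]; assumption)+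
 have inj: "inj_on (vertex_of \<Gamma>) C" using bij_C by (simp add: bij_betw_def)
 show "c : C ==> h : Hs ==> vt h = c \<longleftrightarrow> h : vertex_of \<Gamma> c"
  using 1 2 inj orbit_eq_iff[OF perm_rho, of h c] unfolding vertex_of_def inj_on_def by auto
qed

lemma cyc: assumes "c : C"
 shows "set (cycle_list (rho \<Gamma>) c) = {h : Hs. vt h = c}" "distinct (cycle_list (rho \<Gamma>) c)"
proof -
 have "vertex_of \<Gamma> c \<subseteq> Hs" unfolding vertex_of_def by (rule permutes_orbit_subset[OF ribbon(3)]) (use assms C_Hs in auto)
 then show "set (cycle_list (rho \<Gamma>) c) = {h : Hs. vt h = c}"
  using cycle_list(1)[OF perm_rho, of c] vt(3)[OF assms] unfolding vertex_of_def by auto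
 show "distinct (cycle_list (rho \<Gamma>) c)" by (rule cycle_list(2)[OF perm_rho])
qed

definition fl :: "'h => 'h list" where "fl c = cycle_list (face_perm \<Gamma>) (rho_inv \<Gamma> c)"

lemma fl_Hs: "c : C ==> set (fl c) \<subseteq> Hs" unfolding fl_def cycle_list(1)[OF perm_face]
 by (rule permutes_orbit_subset[OF face_permutes]) (use C_Hs permutes_in_image[OF rho_inv_permutes] in auto)

lemma bilin_cilium_act: "c : C ==> bilin kG W W (cilium_act kG M \<Gamma> c)"
 unfolding cilium_act_def by (rule bilin_L_list[OF vW]) (use cyc in \<open>auto intro: bilin_L_op\<close>)

lemma bilin_cilium_coact: "c : C ==> bilin (dual kG) W W (cilium_coact kG M \<Gamma> c)"
 unfolding cilium_coact_def fl_def[symmetric]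
 by (rule bilin_T_list(1)[OF vW]) (use fl_Hs in \<open>auto intro: bilin_T_op\<close>)

definition D :: "('h => 'g) => 'h => 'g" where "D cf c = hol G (deg cf) (rev (fl c))"
definition Df :: "('h => 'g) => 'h => 'g" where "Df cf = restrict (D cf) C"

lemma D_carrier: "cf : A ==> c : C ==> D cf c : carrier G"
 unfolding D_def by (rule hol_closed) (use fl_Hs deg_carrier in auto)

lemma Df_PiE: "cf : A ==> Df cf : (\<Pi>\<^sub>E c\<in>C. carrier G)" unfolding Df_def using D_carrier by auto

lemma cilium_coact_bE:
 assumes "c : C" "al : carr (dual kG)" "cf : A"
 shows "cilium_coact kG M \<Gamma> c al (bE cf) = scl W (al (bf (D cf c))) (bE cf)"
 unfolding cilium_coact_def fl_def[symmetric] D_def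
 by (rule T_list_eigen[OF vW _ has_basisD(3)[OF BW assms(3)] _ _ assms(2)])
  (use fl_Hs[OF assms(1)] assms in \<open>auto intro!: bilin_T_op deg_carrier T_op_bE simp del: dual_simps\<close>)

definition sc :: "('h => 'g) => 'k" where
 "sc a = (\<Prod>h\<in>Hs. if is_source \<Gamma> h then \<chi> (bf (a (vt h))) else 1)"

text \<open>The vertex cycles at all cilia together list every half-edge once. The gauges at single
  half-edges thus assemble to the gauge \<open>a\<close> at the vertices, and each source
  contributes one character value.\<close>

lemma foldr_cilium_act:
 assumes a: "!!c. c : C ==> a c : carrier G" and cf: "cf : A"
 shows "foldr (%c. cilium_act kG M \<Gamma> c (bf (a c))) cs (bE cf) = scl W (sc a) (bE (gauge G io vt Hs a cf))"
proof -
 let ?l = "%c. cycle_list (rho \<Gamma>) c"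
 let ?hl = "concat (map ?l (rev cs))"
 \<comment> \<open>Membership in the carrier is proved along with the equation, because
   \<open>L_list_bf\<close> applies to vectors of the carrier.\<close>
 have "foldr (%c. cilium_act kG M \<Gamma> c (bf (a c))) xs w = fold (%h. L_op kG M \<Gamma> h (bf (a (vt h)))) (concat (map ?l (rev xs))) w \<and>
   foldr (%c. cilium_act kG M \<Gamma> c (bf (a c))) xs w : carr W"
  if "set xs \<subseteq> C" "w : carr W" for xs w using that(1)
 proof (induction xs)
  case (Cons c xs)
  let ?w = "foldr (%c. cilium_act kG M \<Gamma> c (bf (a c))) xs w"
  have c: "c : C" and w: "?w : carr W" using Cons by auto
  have "cilium_act kG M \<Gamma> c (bf (a c)) ?w = fold (%h. L_op kG M \<Gamma> h (bf (a c))) (?l c) ?w"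
   by (subst cilium_act_def, rule L_list_bf[OF vW _ a[OF c] w]) (use cyc[OF c] in \<open>auto intro: bilin_L_op\<close>)
  also have "... = fold (%h. L_op kG M \<Gamma> h (bf (a (vt h)))) (?l c) ?w"
   by (rule fold_cong) (use cyc(1)[OF c] in auto)
  finally show ?case using Cons bilinD(3)[OF bilin_cilium_act[OF c] bf_kG[OF a[OF c]] w] by simp
 qed (simp add: that)
 then have "foldr (%c. cilium_act kG M \<Gamma> c (bf (a c))) cs (bE cf) = fold (%h. L_op kG M \<Gamma> h (bf (a (vt h)))) ?hl (bE cf)"
  using has_basisD(3)[OF BW cf] cs by simp
 also have "... = scl W (\<Prod>h\<in>set ?hl. if is_source \<Gamma> h then \<chi> (bf (a (vt h))) else 1)
   (bE (gauge G io (%u. u) Hs (%u. if u : set ?hl then a (vt u) else \<one>) cf))"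
 proof (rule fold_L_op[OF _ _ _ cf])
  show "set ?hl \<subseteq> Hs" using cyc(1) cs by auto
  then show "a (vt h) : carrier G" if "h : set ?hl" for h using a vt(1) that by blast
  have "distinct (concat (map ?l xs))" if "distinct xs" "set xs \<subseteq> C" for xs using that
  proof (induction xs)
   case (Cons c xs)
   then show ?case using cyc(1)[of c] cyc(2)[of c] cyc(1) by auto
  qed simp
  then show "distinct ?hl" using cs by simp
 qed
 also have "set ?hl = Hs" using cyc(1) cs vt(1) by auto
 also have "gauge G io (%u. u) Hs (%u. if u : Hs then a (vt u) else \<one>) cf = gauge G io vt Hs a cf"
  by (rule gauge_cong) simp
 finally show ?thesis unfolding sc_def .
qed

definition dC :: "('h => 'g) => ('k, 'h, 'g => 'k) mten" where
 "dC a = mtens C (%_. kG) (\<lambda>c\<in>C. bf (a c))"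
definition coH :: "('h => 'g) => ('k, 'h, 'g => 'k) mten => 'k" where
 "coH a = mlift C (%_. kG) ground (%m. \<Prod>c\<in>C. m c (a c))"

lemma BH: "has_basis HG (\<Pi>\<^sub>E c\<in>C. carrier G) dC coH"
 unfolding graph_hopf_def dC_def[abs_def] coH_def[abs_def]
 by (rule has_basis_mtensor[where V = "%_. kG" and A = "%_. carrier G" and e = "%_. bf"
  and co = "%_ x a. a x", OF fin_C has_basis_kG])

lemma vHG [simp]: "vspace HG" unfolding graph_hopf_def by simp
abbreviation N where "N \<equiv> graph_lmc kG M \<Gamma>"

lemma N_simps [simp]: "carr N = carr W" "scl N = scl W" by (simp_all add: graph_lmc_def Let_def)

lemma vN [simp]: "vspace N" using vW unfolding vspace_def by simp

lemma lmc_act_N: "lmc_act N Y w = mlift C (%_. kG) W (%a. foldr (%c. cilium_act kG M \<Gamma> c (a c)) cs w) Y"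
 by (simp add: graph_lmc_def Let_def)

lemma multilin_act:
 assumes w: "w : carr W"
 shows "multilin C (%_. kG) W (%a. foldr (%c. cilium_act kG M \<Gamma> c (a c)) cs w)"
 unfolding multilin_def
proof (intro ballI conjI)
 fix a :: "'h => 'g => 'k" and c
 assume a: "a : (\<Pi>\<^sub>E c\<in>C. carr kG)"
 have ac: "a c : carr kG" if "c : set cs" for c using a that cs by auto
 show "foldr (%c. cilium_act kG M \<Gamma> c (a c)) cs w : carr W"
  by (rule linD(1)[OF lin_foldr_family[where F = "cilium_act kG M \<Gamma>" and V = kG, OF _ vW ac] w])
   (use cs bilin_cilium_act in auto)
 assume c: "c : C"
 show "lin kG W (%x. foldr (%ca. cilium_act kG M \<Gamma> ca ((a(c := x)) ca)) cs w)"
  by (rule lin_foldr_update[where F = "cilium_act kG M \<Gamma>", OF _ vW vspace_kG ac w _ cs(2)])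
   (use cs c bilin_cilium_act in auto)
qed

lemma dC_arg: "a : (\<Pi>\<^sub>E c\<in>C. carrier G) ==> (\<lambda>c\<in>C. bf (a c)) : (\<Pi>\<^sub>E c\<in>C. carr kG)"
 by (auto dest: PiE_mem)

lemma lmc_act_dC:
 assumes a: "a : (\<Pi>\<^sub>E c\<in>C. carrier G)" and w: "w : carr W"
 shows "lmc_act N (dC a) w = foldr (%c. cilium_act kG M \<Gamma> c (bf (a c))) cs w"
proof -
 have "lmc_act N (dC a) w = foldr (%c. cilium_act kG M \<Gamma> c ((\<lambda>c\<in>C. bf (a c)) c)) cs w"
  unfolding lmc_act_N dC_def by (rule mlift(2)[OF vspace_kG vW multilin_act[OF w] dC_arg[OF a]])
 also have "... = foldr (%c. cilium_act kG M \<Gamma> c (bf (a c))) cs w"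
  by (rule foldr_cong) (use cs in auto)
 finally show ?thesis .
qed

lemma bilin_lmc_act: "bilin HG W W (lmc_act N)"
proof (rule bilinI)
 have l: "lin HG W (%Y. lmc_act N Y w)" if "w : carr W" for w
  unfolding lmc_act_N graph_hopf_def by (rule mlift(1)[OF vspace_kG vW multilin_act[OF that]])
 then show "!!w. w : carr W ==> lin HG W (%Y. lmc_act N Y w)" .
 fix Y assume Y: "Y : carr HG"
 have "lin W W (%w. \<Sum>a\<in>(\<Pi>\<^sub>E c\<in>C. carrier G). scl W (coH a Y) (foldr (%c. cilium_act kG M \<Gamma> c (bf (a c))) cs w))"
 proof (intro lin_sum_fun lin_scl vW)
  fix a assume a: "a : (\<Pi>\<^sub>E c\<in>C. carrier G)"
  show "lin W W (%w. foldr (%c. cilium_act kG M \<Gamma> c (bf (a c))) cs w)"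
   by (rule lin_foldr_family[where F = "cilium_act kG M \<Gamma>" and V = kG, OF _ vW])
    (use cs PiE_mem[OF a] bilin_cilium_act in auto)
 qed
 moreover have "lmc_act N Y w = (\<Sum>a\<in>(\<Pi>\<^sub>E c\<in>C. carrier G). scl W (coH a Y) (foldr (%c. cilium_act kG M \<Gamma> c (bf (a c))) cs w))"
  if "w : carr W" for w
  using lin_basis_expand[OF BH l[OF that] vW Y] lmc_act_dC[OF _ that] by (simp cong: sum.cong)
 ultimately show "lin W W (lmc_act N Y)"
  using lin_cong[OF _ vW, of "lmc_act N Y" "%w. \<Sum>a\<in>(\<Pi>\<^sub>E c\<in>C. carrier G). scl W (coH a Y)
   (foldr (%c. cilium_act kG M \<Gamma> c (bf (a c))) cs w)" W] by blast
qed

lemma lmc_act_bE: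
 assumes a: "a : (\<Pi>\<^sub>E c\<in>C. carrier G)" and cf: "cf : A"
 shows "lmc_act N (dC a) (bE cf) = scl W (sc a) (bE (gauge G io vt Hs a cf))"
 unfolding lmc_act_dC[OF a has_basisD(3)[OF BW cf]] by (rule foldr_cilium_act[OF _ cf]) (use a in auto)

text \<open>The candidate for the joint coaction: a basis configuration is homogeneous, its degree
  being the family of its face degrees.\<close>

definition coN :: "('k, 'h set, 'm) mten => ('k, ('k, 'h, 'g => 'k) mten, ('k, 'h set, 'm) mten) ten" where
 "coN w = (\<Sum>cf\<in>A. scl (HG \<boxtimes> W) (coW cf w) (tens HG W (dC (Df cf)) (bE cf)))"

lemma dC_carr: "a : (\<Pi>\<^sub>E c\<in>C. carrier G) ==> dC a : carr HG" by (rule has_basisD(3)[OF BH])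

lemma bE_carr: "cf : A ==> bE cf : carr W" by (rule has_basisD(3)[OF BW])

lemma lin_coN: "lin W (HG \<boxtimes> W) coN"
 unfolding coN_def[abs_def] by (rule lin_from_basis(1)[OF BW vspace_tensor]) (intro tens_carr dC_carr Df_PiE bE_carr)

lemma coN_bE: "cf : A ==> coN (bE cf) = tens HG W (dC (Df cf)) (bE cf)"
 unfolding coN_def by (rule lin_from_basis(2)[OF BW vspace_tensor]) (intro tens_carr dC_carr Df_PiE bE_carr)

lemma multilin_pairing:
 assumes "al : (\<Pi>\<^sub>E c\<in>C. carr (dual kG))"
 shows "multilin C (%_. kG) ground (%a. \<Prod>c\<in>C. al c (a c))"
 by (rule multilin_prod[OF fin_C]) (use PiE_mem[OF assms] in simp)

text \<open>Basis configurations are joint eigenvectors of the face operators, so \<open>coN\<close>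
  has the prescribed pairings. Uniqueness follows from the pairings with families of dual basis
  elements, which are the components of a tensor.\<close>

lemma lmc_coact_N:
 assumes w: "w : carr W"
 shows "lmc_coact N w = coN w"
proof -
 let ?pair = "%al. tlift HG W W (%Y w'. scl W (mlift C (%_. kG) ground (%a. \<Prod>c\<in>C. al c (a c)) Y) w')"
 let ?P = "%t. t : carr (HG \<boxtimes> W) \<and> (\<forall>al\<in>(\<Pi>\<^sub>E c\<in>C. carr (dual kG)).
   ?pair al t = foldr (%c. cilium_coact kG M \<Gamma> c (al c)) cs w)"
 have lm: "lin HG ground (mlift C (%_. kG) ground (%a. \<Prod>c\<in>C. al c (a c)))"
  if "al : (\<Pi>\<^sub>E c\<in>C. carr (dual kG))" for al
  unfolding graph_hopf_def by (rule mlift(1)[OF vspace_kG vspace_ground multilin_pairing[OF that]])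
 have b: "bilin HG W W (%Y w'. scl W (mlift C (%_. kG) ground (%a. \<Prod>c\<in>C. al c (a c)) Y) w')"
  if "al : (\<Pi>\<^sub>E c\<in>C. carr (dual kG))" for al
  by (rule bilin_scl_left[OF lm[OF that] lin_id vW])
 note l = tlift[OF vHG vW vW b]
 have ex: "?pair al (coN w) = foldr (%c. cilium_coact kG M \<Gamma> c (al c)) cs w"
  if al: "al : (\<Pi>\<^sub>E c\<in>C. carr (dual kG))" for al
 proof (rule lin_eq_basis[OF BW lin_comp[OF l(1)[OF al] lin_coN] _ vW _ w])
  have alc: "al c : carr (dual kG)" if "c : C" for c by (rule PiE_mem[OF al that])
  show "lin W W (%w. foldr (%c. cilium_coact kG M \<Gamma> c (al c)) cs w)"
   by (rule lin_foldr_family[where F = "cilium_coact kG M \<Gamma>" and V = "dual kG", OF _ vW])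
    (use cs alc bilin_cilium_coact in \<open>auto simp del: dual_simps\<close>)
  fix cf assume cf: "cf : A"
  have "foldr (%c. cilium_coact kG M \<Gamma> c (al c)) xs (bE cf) = scl W (\<Prod>c\<in>set xs. al c (bf (D cf c))) (bE cf)"
   if "distinct xs" "set xs \<subseteq> C" for xs using that
  proof (induction xs)
   case Nil
   then show ?case using vspaceD(9)[OF vW] by simp
  next
   case (Cons c xs)
   have c: "c : C" using Cons by auto
   have "foldr (%c. cilium_coact kG M \<Gamma> c (al c)) (c # xs) (bE cf) =
     cilium_coact kG M \<Gamma> c (al c) (scl W (\<Prod>c\<in>set xs. al c (bf (D cf c))) (bE cf))"
    using Cons by simp
   also have "... = scl W (\<Prod>c\<in>set xs. al c (bf (D cf c))) (cilium_coact kG M \<Gamma> c (al c) (bE cf))"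
    by (rule linD(3)[OF bilinD(1)[OF bilin_cilium_coact[OF c] alc[OF c]] bE_carr[OF cf]])
   also have "... = scl W (\<Prod>c\<in>set (c # xs). al c (bf (D cf c))) (bE cf)"
    unfolding cilium_coact_bE[OF c alc[OF c] cf] using Cons.prems by (simp add: vspaceD(8)[OF vW] mult.commute)
   finally show ?case .
  qed
  then have 1: "foldr (%c. cilium_coact kG M \<Gamma> c (al c)) cs (bE cf) = scl W (\<Prod>c\<in>C. al c (bf (D cf c))) (bE cf)"
   using cs by simp
  have "mlift C (%_. kG) ground (%a. \<Prod>c\<in>C. al c (a c)) (dC (Df cf)) = (\<Prod>c\<in>C. al c ((\<lambda>c\<in>C. bf (Df cf c)) c))"
   unfolding dC_def
   by (rule mlift(2)[OF vspace_kG vspace_ground multilin_pairing[OF al] dC_arg[OF Df_PiE[OF cf]]])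
  also have "... = (\<Prod>c\<in>C. al c (bf (D cf c)))" by (rule prod.cong) (simp_all add: Df_def)
  finally show "?pair al (coN (bE cf)) = foldr (%c. cilium_coact kG M \<Gamma> c (al c)) cs (bE cf)"
   unfolding 1 coN_bE[OF cf] l(2)[OF al dC_carr[OF Df_PiE[OF cf]] bE_carr[OF cf]] by simp
 qed
 have uniq: "t = t'" if t: "?P t" "?P t'" for t t'
 proof -
  have "lcomp HG W coH a t = lcomp HG W coH a t'" if a: "a : (\<Pi>\<^sub>E c\<in>C. carrier G)" for a
  proof -
   let ?al = "\<lambda>c\<in>C. dual_basis (a c)"
   have al: "?al : (\<Pi>\<^sub>E c\<in>C. carr (dual kG))"
    using has_basisD(3)[OF has_basis_dual] a by (auto simp del: dual_simps)
   have "mlift C (%_. kG) ground (%m. \<Prod>c\<in>C. ?al c (m c)) = coH a" unfolding coH_def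
   proof (rule mlift_cong)
    fix m :: "'h => 'g => 'k" assume m: "m : (\<Pi>\<^sub>E c\<in>C. carr kG)"
    show "(\<Prod>c\<in>C. ?al c (m c)) = (\<Prod>c\<in>C. m c (a c))"
    proof (rule prod.cong[OF HOL.refl])
     fix c assume c: "c : C"
     show "?al c (m c) = m c (a c)" using PiE_mem[OF m c] c by (simp add: dual_basis_def)
    qed
   qed
   then have "lcomp HG W coH a = ?pair ?al" unfolding lcomp_def by simp
   moreover have "?pair ?al t = ?pair ?al t'"
    using bspec[OF conjunct2[OF t(1)] al] bspec[OF conjunct2[OF t(2)] al] by (rule HOL.trans[OF _ HOL.sym])
   ultimately show ?thesis by simp
  qed
  then have "(\<Sum>a\<in>(\<Pi>\<^sub>E c\<in>C. carrier G). tens HG W (dC a) (lcomp HG W coH a t)) =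
    (\<Sum>a\<in>(\<Pi>\<^sub>E c\<in>C. carrier G). tens HG W (dC a) (lcomp HG W coH a t'))"
   by (intro sum.cong) simp_all
  from HOL.trans[OF HOL.trans[OF lcomp_expand[OF BH vW conjunct1[OF t(1)]] this]
   lcomp_expand[OF BH vW conjunct1[OF t(2)], symmetric]]
  show ?thesis .
 qed
 have "?P (coN w)" using ex linD(1)[OF lin_coN w] by blast
 then have "(THE t. ?P t) = coN w" using uniq by (intro the_equality) blast+
 then show ?thesis by (simp add: graph_lmc_def Let_def)
qed

end

section \<open>Bitensor products of monomial module-comodules\<close>

lemma lin_minus: "lin V W f ==> lin V W g ==> vspace W ==> lin V W (%x. f x - g x)"
proof (rule linI)
 assume f: "lin V W f" and g: "lin V W g" and W: "vspace W"
 interpret module "scl W" using vspaceD(14)[OF W] unfolding vector_space_def module_def .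
 fix x y c assume x: "x : carr V"
 show "f x - g x : carr W" using linD(1)[OF f x] linD(1)[OF g x] by (rule vspaceD(3)[OF W])
 show "f (scl V c x) - g (scl V c x) = scl W c (f x - g x)"
  unfolding linD(3)[OF f x] linD(3)[OF g x] scale_right_diff_distrib ..
 assume y: "y : carr V"
 show "f (x + y) - g (x + y) = f x - g x + (f y - g y)" unfolding linD(2)[OF f x y] linD(2)[OF g x y] by simp
qed

text \<open>Used for two comodules: the extended Hilbert space, where it describes the cotensor
  product, and \<Omega>, where it describes a homogeneous part.\<close>

lemma homogeneous_iff:
 assumes BC: "has_basis C I d co" and BN: "has_basis N A b coN" and lin: "lin N (C \<boxtimes> N) \<Delta>"
  and \<Delta>: "!!cf. cf : A ==> D cf : I \<and> \<Delta> (b cf) = tens C N (d (D cf)) (b cf)"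
  and q: "q : I" and n: "n : carr N"
 shows "\<Delta> n = tens C N (d q) n \<longleftrightarrow> (\<forall>cf\<in>A. D cf ~= q \<longrightarrow> coN cf n = 0)"
proof
 note c = has_basisD[OF BC] and bn = has_basisD[OF BN]
 show "\<forall>cf\<in>A. D cf ~= q \<longrightarrow> coN cf n = 0" if eq: "\<Delta> n = tens C N (d q) n"
 proof (intro ballI impI)
  fix cf assume cf: "cf : A" "D cf ~= q"
  have "coN cf (lcomp C N co q (\<Delta> n)) = 0"
  proof (rule lin_eq_basis[OF BN _ lin_zero[OF vspace_ground] vspace_ground _ n])
   show "lin N ground (%n. coN cf (lcomp C N co q (\<Delta> n)))"
    by (intro lin_comp[OF bn(4)[OF cf(1)]] lin_comp[OF lcomp(1)[OF BC bn(1) q] lin])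
   fix cf' assume cf': "cf' : A"
   show "coN cf (lcomp C N co q (\<Delta> (b cf'))) = 0"
    using \<Delta>[OF cf'] lcomp_basis[OF BC bn(1) q _ bn(3)[OF cf'], of "D cf'"] cf(2) bn(5)[OF cf(1) cf']
     lin_0[OF bn(4)[OF cf(1)] bn(1) vspace_ground] by (cases "q = D cf'"; cases "cf = cf'") simp_all
  qed
  then show "coN cf n = 0" using eq lcomp_basis[OF BC bn(1) q q n] by simp
 qed
 show "\<Delta> n = tens C N (d q) n" if z: "\<forall>cf\<in>A. D cf ~= q \<longrightarrow> coN cf n = 0"
 proof -
  have "\<Delta> n = (\<Sum>cf\<in>A. scl (C \<boxtimes> N) (coN cf n) (\<Delta> (b cf)))"
   by (rule lin_basis_expand[OF BN lin vspace_tensor n])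
  also have "... = (\<Sum>cf\<in>A. scl (C \<boxtimes> N) (coN cf n) (tens C N (d q) (b cf)))"
  proof (rule sum.cong[OF HOL.refl])
   fix cf assume cf: "cf : A"
   show "scl (C \<boxtimes> N) (coN cf n) (\<Delta> (b cf)) = scl (C \<boxtimes> N) (coN cf n) (tens C N (d q) (b cf))"
   proof (cases "D cf = q")
    case False
    then have "coN cf n = 0" using z cf by blast
    then show ?thesis by (simp only: vspaceD(10)[OF vspace_tensor])
   qed (use \<Delta>[OF cf] in simp)
  qed
  also have "... = tens C N (d q) n"
   by (rule lin_basis_expand[OF BN bilinD(1)[OF bilin_tens c(3)[OF q]] vspace_tensor n, symmetric])
  finally show ?thesis .
 qed
qed

text \<open>\<open>X\<close> is a line of degree \<open>q\<close>, so the cotensor condition says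
  that the other tensor leg is homogeneous of degree \<open>q\<close>.\<close>

lemma cotensor_iff:
 fixes X :: "('k::field, 'a::ab_group_add, 'c::ab_group_add, 'x::ab_group_add) rmc"
  and N :: "('k, 'a, 'c, 'n::ab_group_add) lmc"
 assumes BC: "has_basis C I d co" and BN: "has_basis N A b coN"
  and BX: "has_basis X {()} (%_. u) coX"
  and linN: "lin N (C \<boxtimes> N) (lmc_coact N)"
  and \<Delta>: "!!cf. cf : A ==> D cf : I \<and> lmc_coact N (b cf) = tens C N (d (D cf)) (b cf)"
  and linX: "lin X (X \<boxtimes> C) (rmc_coact X)" and q: "q : I" and cX: "rmc_coact X u = tens X C u (d q)"
 shows "t : carr (cotensor C X N) \<longleftrightarrow>
  t : carr (X \<boxtimes> N) \<and> (\<forall>cf\<in>A. D cf ~= q \<longrightarrow> coN cf (lcomp X N coX () t) = 0)"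
proof (cases "t : carr (X \<boxtimes> N)")
 case True
 note c = has_basisD[OF BC] and bn = has_basisD[OF BN] and bx = has_basisD[OF BX]
 note u = bx(3)[OF singletonI]
 let ?n = "lcomp X N coX () t" let ?Z = "X \<boxtimes> C \<boxtimes> N"
 let ?l = "%x n. tlift X C ?Z (%x' c. tens3 X C N x' c n) (rmc_coact X x)"
 let ?r = "%x n. tens X (C \<boxtimes> N) x (lmc_coact N n)"
 have t: "t = tens X N u ?n" using lcomp_expand[OF BX bn(1) True] by simp
 have n: "?n : carr N" by (rule linD(1)[OF lcomp(1)[OF BX bn(1) singletonI] True])
 have bl: "bilin X C ?Z (%x' c. tens3 X C N x' c n)" if "n : carr N" for n
  unfolding tens3_def by (rule bilin_comp2[OF bilin_tens lin_id bilinD(2)[OF bilin_tens that]])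
 have l: "bilin X N ?Z ?l"
 proof (rule bilin_cong[OF _ bx(1) bn(1)])
  show "tens X (C \<boxtimes> N) u (tens C N (lcomp X C coX () (rmc_coact X x)) n) = ?l x n"
   if "x : carr X" "n : carr N" for x n
   using tlift_lcomp[OF BX c(1) vspace_tensor bl[OF that(2)] linD(1)[OF linX that(1)]] by (simp add: tens3_def)
  show "bilin X N ?Z (%x n. tens X (C \<boxtimes> N) u (tens C N (lcomp X C coX () (rmc_coact X x)) n))"
   by (intro bilin_comp[OF bilinD(1)[OF bilin_tens u]] bilin_comp2[OF bilin_tens _ lin_id]
    lin_comp[OF lcomp(1)[OF BX c(1) singletonI] linX])
 qed
 have r: "bilin X N ?Z ?r" by (rule bilin_comp2[OF bilin_tens lin_id linN])
 have 1: "tlift X N ?Z ?l t = tens X (C \<boxtimes> N) u (tens C N (d q) ?n)"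
 proof -
  have "tlift X N ?Z ?l t = ?l u ?n" by (subst t) (rule tlift(2)[OF bx(1) bn(1) vspace_tensor l u n])
  also have "... = tens X (C \<boxtimes> N) u (tens C N (d q) ?n)"
   unfolding cX by (rule HOL.trans[OF tlift(2)[OF bx(1) c(1) vspace_tensor bl[OF n] u c(3)[OF q]]]) (simp only: tens3_def)
  finally show ?thesis .
 qed
 have 2: "tlift X N ?Z ?r t = tens X (C \<boxtimes> N) u (lmc_coact N ?n)"
  by (subst t) (rule tlift(2)[OF bx(1) bn(1) vspace_tensor r u n])
 have "t : carr (cotensor C X N) \<longleftrightarrow>
   tens X (C \<boxtimes> N) u (tens C N (d q) ?n) = tens X (C \<boxtimes> N) u (lmc_coact N ?n)"
  using True unfolding cotensor_def by (simp add: 1 2)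
 also have "... \<longleftrightarrow> lmc_coact N ?n = tens C N (d q) ?n"
 proof -
  have "lcomp X (C \<boxtimes> N) coX () (tens X (C \<boxtimes> N) u w) = w" if "w : carr (C \<boxtimes> N)" for w
   using lcomp_basis[OF BX vspace_tensor singletonI singletonI that] by simp
  then show ?thesis using tens_carr[OF c(3)[OF q] n] linD(1)[OF linN n] by metis
 qed
 also have "... \<longleftrightarrow> (\<forall>cf\<in>A. D cf ~= q \<longrightarrow> coN cf ?n = 0)" by (rule homogeneous_iff[OF BC BN linN \<Delta> q n])
 finally show ?thesis using True by simp
qed (simp add: cotensor_def)

text \<open>The two maps are inverse to each other only modulo \<open>U\<close> and
  \<open>U'\<close>. These lie in the ambient spaces \<open>B\<close> and \<open>B'\<close>, not
  necessarily in \<open>V\<close> and \<open>V'\<close>, since balancing relations may leave the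
  cotensor product.\<close>

lemma lin_isomorphic_quotients:
 fixes B :: "('k::field, 'v::ab_group_add, 'y) vspace_scheme" and B' :: "('k, 'w::ab_group_add, 'z) vspace_scheme"
 assumes B: "vspace B" and B': "vspace B'"
  and V: "carr V \<subseteq> carr B" "scl V = scl B" and V': "carr V' \<subseteq> carr B'" "scl V' = scl B'"
  and U: "module.subspace (scl B) U" "U \<subseteq> carr B" and U': "module.subspace (scl B') U'" "U' \<subseteq> carr B'"
  and vV: "vspace V" and vV': "vspace V'"
  and F: "lin B B' F" "F ` carr V \<subseteq> carr V'" "F ` U \<subseteq> U'"
  and \<Psi>: "lin B' B \<Psi>" "\<Psi> ` carr V' \<subseteq> carr V" "\<Psi> ` U' \<subseteq> U"
  and \<Psi>F: "!!v. v : carr V ==> \<Psi> (F v) - v : U" and F\<Psi>: "!!w. w : carr V' ==> F (\<Psi> w) - w : U'"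
 shows "lin_isomorphic (quotient_image V U) (quotient_image V' U')"
proof -
 define co where "co = (%v. {v + u | u. u : U})"
 define co' where "co' = (%v. {v + u | u. u : U'})"
 \<comment> \<open>The image of a coset under \<open>F\<close> need not be a whole coset; adding
   \<open>U'\<close> completes it, with no choice of representatives.\<close>
 define \<Phi> where "\<Phi> = (%A. {F a + u | a u. a : A \<and> u : U'})"
 interpret m: module "scl B" using vspaceD(14)[OF B] unfolding vector_space_def module_def .
 interpret m': module "scl B'" using vspaceD(14)[OF B'] unfolding vector_space_def module_def .
 note s = m.subspace_0[OF U(1)] m.subspace_add[OF U(1)] m.subspace_diff[OF U(1)] m.subspace_scale[OF U(1)]
 note s' = m'.subspace_0[OF U'(1)] m'.subspace_add[OF U'(1)] m'.subspace_diff[OF U'(1)] m'.subspace_scale[OF U'(1)]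
 have eq: "co v = co w \<longleftrightarrow> v - w : U" for v w
 proof
  show "co v = co w ==> v - w : U"
  proof -
   assume "co v = co w"
   then have "v : co w" using s(1) unfolding co_def by force
   then show "v - w : U" unfolding co_def by auto
  qed
  assume u: "v - w : U"
  have "v + x = w + (v - w + x)" "w + x = v + (x - (v - w))" for x by simp_all
  then show "co v = co w" unfolding co_def using s(2)[OF u] s(3)[OF _ u] by blast
 qed
 have eq': "co' v = co' w \<longleftrightarrow> v - w : U'" for v w
 proof
  show "co' v = co' w ==> v - w : U'"
  proof -
   assume "co' v = co' w"
   then have "v : co' w" using s'(1) unfolding co'_def by force
   then show "v - w : U'" unfolding co'_def by auto
  qed
  assume u: "v - w : U'"
  have "v + x = w + (v - w + x)" "w + x = v + (x - (v - w))" for x by simp_all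
  then show "co' v = co' w" unfolding co'_def using s'(2)[OF u] s'(3)[OF _ u] by blast
 qed
 have \<Phi>: "\<Phi> (co v) = co' (F v)" if v: "v : carr V" for v
 proof
  have vB: "v : carr B" using v V by blast
  show "\<Phi> (co v) \<subseteq> co' (F v)"
  proof
   fix x assume "x : \<Phi> (co v)"
   then obtain u u' where u: "u : U" "u' : U'" and x: "x = F (v + u) + u'" unfolding \<Phi>_def co_def by blast
   have "x = F v + (F u + u')" using x linD(2)[OF F(1) vB, of u] u U by (auto simp: add.assoc)
   moreover have "F u + u' : U'" using F(3) u by (intro s'(2)) auto
   ultimately show "x : co' (F v)" unfolding co'_def by blast
  qed
  have "v : co v" unfolding co_def using s(1) by force
  then show "co' (F v) \<subseteq> \<Phi> (co v)" unfolding \<Phi>_def co'_def by blast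
 qed
 have carr: "ls_carr (quotient_image V U) = co ` carr V" "ls_carr (quotient_image V' U') = co' ` carr V'"
  by (simp_all add: quotient_image_def co_def co'_def)
 have add: "ls_add (quotient_image V U) (co v) (co w) = co (v + w)" for v w
 proof -
  have "(\<exists>a b. x = a + b \<and> (\<exists>u. a = v + u \<and> u : U) \<and> (\<exists>u. b = w + u \<and> u : U)) \<longleftrightarrow>
    (\<exists>u. x = v + w + u \<and> u : U)" (is "?l \<longleftrightarrow> ?r") for x
  proof
   assume ?l
   then obtain u u' where u: "u : U" "u' : U" "x = v + u + (w + u')" by blast
   have "x = v + w + (u + u')" using u(3) by (simp add: add_ac)
   with s(2)[OF u(1,2)] show ?r by blast
  next
   assume ?r
   then obtain u where u: "u : U" "x = v + w + u" by blast
   have "x = v + u + (w + 0)" using u(2) by (simp add: add_ac)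
   with u(1) s(1) show ?l by blast
  qed
  then show ?thesis unfolding quotient_image_def co_def by simp
 qed
 have scl: "ls_scl (quotient_image V U) c (co v) = co (scl B c v)" for c v
 proof -
  have "(\<exists>a u. x = scl B c a + u \<and> (\<exists>u. a = v + u \<and> u : U) \<and> u : U) \<longleftrightarrow>
    (\<exists>u. x = scl B c v + u \<and> u : U)" (is "?l \<longleftrightarrow> ?r") for x
  proof
   assume ?l
   then obtain u u' where u: "u : U" "u' : U" "x = scl B c (v + u) + u'" by blast
   have "x = scl B c v + (scl B c u + u')" using u(3) by (simp add: m.scale_right_distrib add_ac)
   with s(2)[OF s(4)[OF u(1)] u(2)] show ?r by blast
  next
   assume ?r
   then obtain u where u: "u : U" "x = scl B c (v + 0) + u" by auto
   with s(1) show ?l by blast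
  qed
  then show ?thesis unfolding quotient_image_def co_def V(2) by simp
 qed
 have add': "ls_add (quotient_image V' U') (co' v) (co' w) = co' (v + w)" for v w
 proof -
  have "(\<exists>a b. x = a + b \<and> (\<exists>u. a = v + u \<and> u : U') \<and> (\<exists>u. b = w + u \<and> u : U')) \<longleftrightarrow>
    (\<exists>u. x = v + w + u \<and> u : U')" (is "?l \<longleftrightarrow> ?r") for x
  proof
   assume ?l
   then obtain u u' where u: "u : U'" "u' : U'" "x = v + u + (w + u')" by blast
   have "x = v + w + (u + u')" using u(3) by (simp add: add_ac)
   with s'(2)[OF u(1,2)] show ?r by blast
  next
   assume ?r
   then obtain u where u: "u : U'" "x = v + w + u" by blast
   have "x = v + u + (w + 0)" using u(2) by (simp add: add_ac)
   with u(1) s'(1) show ?l by blast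
  qed
  then show ?thesis unfolding quotient_image_def co'_def by simp
 qed
 have scl': "ls_scl (quotient_image V' U') c (co' v) = co' (scl B' c v)" for c v
 proof -
  have "(\<exists>a u. x = scl B' c a + u \<and> (\<exists>u. a = v + u \<and> u : U') \<and> u : U') \<longleftrightarrow>
    (\<exists>u. x = scl B' c v + u \<and> u : U')" (is "?l \<longleftrightarrow> ?r") for x
  proof
   assume ?l
   then obtain u u' where u: "u : U'" "u' : U'" "x = scl B' c (v + u) + u'" by blast
   have "x = scl B' c v + (scl B' c u + u')" using u(3) by (simp add: m'.scale_right_distrib add_ac)
   with s'(2)[OF s'(4)[OF u(1)] u(2)] show ?r by blast
  next
   assume ?r
   then obtain u where u: "u : U'" "x = scl B' c (v + 0) + u" by auto
   with s'(1) show ?l by blast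
  qed
  then show ?thesis unfolding quotient_image_def co'_def V'(2) by simp
 qed
 show ?thesis unfolding lin_isomorphic_def
 proof (intro exI[of _ \<Phi>] conjI ballI allI)
  show "bij_betw \<Phi> (ls_carr (quotient_image V U)) (ls_carr (quotient_image V' U'))" unfolding carr bij_betw_def
  proof
   show "inj_on \<Phi> (co ` carr V)"
   proof (rule inj_onI, elim imageE)
    fix x y v w assume x: "x = co v" and y: "y = co w" and vw: "v : carr V" "w : carr V" and "\<Phi> x = \<Phi> y"
    then have "F v - F w : U'" using \<Phi> eq' by metis
    then have "\<Psi> (F v - F w) : U" using \<Psi>(3) by blast
    moreover have "F v : carr B'" "F w : carr B'" using linD(1)[OF F(1)] vw V by blast+
    ultimately have "\<Psi> (F v) - \<Psi> (F w) : U" using lin_diff[OF \<Psi>(1) B' B] by simp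
    from s(3)[OF s(2)[OF this \<Psi>F[OF vw(2)]] \<Psi>F[OF vw(1)]] have "v - w : U" by simp
    then show "x = y" using x y eq by simp
   qed
   show "\<Phi> ` co ` carr V = co' ` carr V'"
   proof
    show "\<Phi> ` co ` carr V \<subseteq> co' ` carr V'" using \<Phi> F(2) by auto
    show "co' ` carr V' \<subseteq> \<Phi> ` co ` carr V"
    proof
     fix x assume "x : co' ` carr V'"
     then obtain w where w: "w : carr V'" "x = co' w" by blast
     have "\<Psi> w : carr V" using \<Psi>(2) w by blast
     moreover from this have "\<Phi> (co (\<Psi> w)) = x" using \<Phi> eq' F\<Psi>[OF w(1)] w(2) by simp
     ultimately show "x : \<Phi> ` co ` carr V" by blast
    qed
   qed
  qed
  fix x y assume x: "x : ls_carr (quotient_image V U)"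
  then obtain v where v: "v : carr V" "x = co v" unfolding carr by blast
  have vB: "v : carr B" using v V by blast
  show "\<Phi> (ls_scl (quotient_image V U) c x) = ls_scl (quotient_image V' U') c (\<Phi> x)" for c
   using \<Phi>[OF v(1)] \<Phi>[OF vspaceD(4)[OF vV v(1)], of c] linD(3)[OF F(1) vB, of c] v(2) V(2)
   by (simp add: scl scl')
  assume "y : ls_carr (quotient_image V U)"
  then obtain w where w: "w : carr V" "y = co w" unfolding carr by blast
  have wB: "w : carr B" using w V by blast
  show "\<Phi> (ls_add (quotient_image V U) x y) = ls_add (quotient_image V' U') (\<Phi> x) (\<Phi> y)"
   using \<Phi>[OF v(1)] \<Phi>[OF w(1)] \<Phi>[OF vspaceD(2)[OF vV v(1) w(1)]] linD(2)[OF F(1) vB wB] v(2) w(2)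
   by (simp add: add add')
 qed
qed


section \<open>Bitensor products of monomial module-comodules with a line\<close>

locale monomial_bitensor =
 fixes C :: "('k::field, 'c::ab_group_add, 'y) vspace_scheme"
  and X :: "('k, 'c, 'c, 'x::ab_group_add) rmc" and N :: "('k, 'c, 'c, 'n::ab_group_add) lmc"
  and I :: "'i set" and d co and A :: "'a set" and b coN u coX
  and q :: 'i and D :: "'a => 'i" and \<mu> :: "'c => 'k" and \<sigma> :: "'i => 'k" and T :: "'i => 'a => 'a"
 assumes BC: "has_basis C I d co" and BN: "has_basis N A b coN"
  and BX: "has_basis X {()} (%_. u) coX"
  and linN: "lin N (C \<boxtimes> N) (lmc_coact N)"
  and coact_b: "!!cf. cf : A ==> D cf : I \<and> lmc_coact N (b cf) = tens C N (d (D cf)) (b cf)"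
  and linX: "lin X (X \<boxtimes> C) (rmc_coact X)" and q: "q : I" and coact_u: "rmc_coact X u = tens X C u (d q)"
  and \<mu>: "lin C ground \<mu>" "!!x a. x : carr X ==> a : carr C ==> rmc_act X x a = scl X (\<mu> a) x"
  and bilin_act: "bilin C N N (lmc_act N)"
  and act_b: "!!i cf. i : I ==> cf : A ==> lmc_act N (d i) (b cf) = scl N (\<sigma> i) (b (T i cf))"
  and T: "!!i cf. i : I ==> cf : A ==> T i cf : A"
  and DT: "!!i cf. i : I ==> cf : A ==> D (T i cf) = q \<longleftrightarrow> D cf = q"
begin

definition pure :: "'a => ('k, 'x, 'n) ten" where "pure cf = tens X N u (b cf)"
definition coef :: "'a => ('k, 'x, 'n) ten => 'k" where "coef cf t = coN cf (lcomp X N coX () t)"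
text \<open>With \<open>X\<close> a line acted on by the functional \<mu>, balancing amounts to the
  relations \<mu>(a) n = a n, written in \<open>X \<boxtimes> N\<close> by means of the generator
  \<open>u\<close>.\<close>

definition rel :: "'c => 'n => ('k, 'x, 'n) ten" where
 "rel a n = scl (X \<boxtimes> N) (\<mu> a) (tens X N u n) - tens X N u (lmc_act N a n)"

lemmas bC = has_basisD[OF BC] and bN = has_basisD[OF BN] and bX = has_basisD[OF BX]
lemmas u_carr = bX(3)[OF singletonI]

lemma has_basis_pure: "has_basis (X \<boxtimes> N) A pure coef"
proof -
 have "bij_betw (Pair ()) A ({()} \<times> A)" by (auto simp: bij_betw_def inj_on_def)
 from has_basis_reindex[OF has_basis_tensor[OF BX BN] this]
 show ?thesis by (simp add: pure_def[abs_def] coef_def[abs_def])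
qed

lemmas bP = has_basisD[OF has_basis_pure]

lemma cotensor: "t : carr (cotensor C X N) \<longleftrightarrow>
  t : carr (X \<boxtimes> N) \<and> (\<forall>cf\<in>A. D cf ~= q \<longrightarrow> coef cf t = 0)"
 unfolding coef_def by (rule cotensor_iff[OF BC BN BX linN coact_b linX q coact_u])

lemma scl_cotensor: "scl (cotensor C X N) = scl (X \<boxtimes> N)" by (simp add: cotensor_def tensor_def)

lemma vspace_cotensor: "vspace (cotensor C X N)"
proof -
 let ?B = "X \<boxtimes> N"
 interpret module "scl ?B" using vspaceD(14)[OF vspace_tensor, of X N] unfolding vector_space_def module_def .
 note v = vspaceD[OF vspace_tensor[of X N]]
 have eq: "carr (cotensor C X N) = {t : carr ?B. \<forall>cf\<in>A. D cf ~= q \<longrightarrow> coef cf t = 0}"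
  using cotensor by blast
 have "subspace (carr (cotensor C X N))" unfolding subspace_def eq
  using v(1,2,4) linD(2,3)[OF bP(4)] lin_0[OF bP(4) vspace_tensor vspace_ground] by auto
 then show ?thesis unfolding vspace_def scl_cotensor using v(14) by blast
qed

lemma bilin_rel: "bilin C N (X \<boxtimes> N) rel" unfolding rel_def
proof (rule bilinI)
 show "lin N (X \<boxtimes> N) (%n. scl (X \<boxtimes> N) (\<mu> a) (tens X N u n) - tens X N u (lmc_act N a n))" if "a : carr C" for a
  by (intro lin_minus lin_scl lin_comp[OF bilinD(1)[OF bilin_tens u_carr] bilinD(1)[OF bilin_act that]]
   bilinD(1)[OF bilin_tens u_carr] vspace_tensor)
 show "lin C (X \<boxtimes> N) (%a. scl (X \<boxtimes> N) (\<mu> a) (tens X N u n) - tens X N u (lmc_act N a n))" if "n : carr N" for n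
  by (intro lin_minus lin_scl_left \<mu>(1) lin_comp[OF bilinD(1)[OF bilin_tens u_carr] bilinD(2)[OF bilin_act that]]
   tens_carr u_carr that vspace_tensor)
qed

lemma rel_basis: "i : I ==> cf : A ==>
  rel (d i) (b cf) = scl (X \<boxtimes> N) (\<mu> (d i)) (pure cf) - scl (X \<boxtimes> N) (\<sigma> i) (pure (T i cf))"
 unfolding rel_def act_b pure_def by (simp add: linD(3)[OF bilinD(1)[OF bilin_tens u_carr] bN(3)[OF T]])

lemma balancing_generator:
 assumes x: "x : carr X" and a: "a : carr C" and n: "n : carr N"
 shows "tens X N (rmc_act X x a) n - tens X N x (lmc_act N a n) = scl (X \<boxtimes> N) (coX () x) (rel a n)"
proof -
 let ?s = "scl (X \<boxtimes> N)"
 have xu: "x = scl X (coX () x) u" using bX(6)[OF x] by simp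
 have t: "tens X N (scl X k y) n = ?s k (tens X N y n)" if "y : carr X" "n : carr N" for k y n
  by (rule linD(3)[OF bilinD(2)[OF bilin_tens that(2)] that(1)])
 have an: "lmc_act N a n : carr N" by (rule bilinD(3)[OF bilin_act a n])
 have "tens X N (rmc_act X x a) n = ?s (coX () x) (?s (\<mu> a) (tens X N u n))" unfolding \<mu>(2)[OF x a] t[OF x n]
  by (subst xu, subst t[OF u_carr n]) (simp only: vspaceD(8)[OF vspace_tensor] mult.commute)
 moreover have "tens X N x (lmc_act N a n) = ?s (coX () x) (tens X N u (lmc_act N a n))"
  by (subst xu) (rule t[OF u_carr an])
 moreover have "?s k (y - z) = ?s k y - ?s k z" for k y z
  using vspaceD(6)[OF vspace_tensor, of X N k "y - z" z] by (simp add: algebra_simps)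
 ultimately show ?thesis unfolding rel_def by simp
qed

lemma balancing_subspace: "module.subspace (scl (X \<boxtimes> N)) (balancing C X N)"
 "balancing C X N \<subseteq> carr (X \<boxtimes> N)"
proof -
 interpret module "scl (X \<boxtimes> N)" using vspaceD(14)[OF vspace_tensor, of X N] unfolding vector_space_def module_def .
 have s: "fscl = scl (X \<boxtimes> N)" by simp
 show "subspace (balancing C X N)" unfolding balancing_def s by (rule subspace_span)
 show "balancing C X N \<subseteq> carr (X \<boxtimes> N)" unfolding balancing_def s
 proof (rule span_minimal)
  show "subspace (carr (X \<boxtimes> N))" using vspaceD(15)[OF vspace_tensor] .
  show "{tens X N (rmc_act X x a) n - tens X N x (lmc_act N a n) | x a n.
    x : carr X \<and> a : carr C \<and> n : carr N} \<subseteq> carr (X \<boxtimes> N)"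
   using balancing_generator vspaceD(4)[OF vspace_tensor bilinD(3)[OF bilin_rel]] by auto
 qed
qed

lemma rel_balancing: "a : carr C ==> n : carr N ==> rel a n : balancing C X N"
proof -
 assume a: "a : carr C" and n: "n : carr N"
 interpret module "scl (X \<boxtimes> N)" using vspaceD(14)[OF vspace_tensor, of X N] unfolding vector_space_def module_def .
 have s: "fscl = scl (X \<boxtimes> N)" by simp
 have "rel a n = tens X N (rmc_act X u a) n - tens X N u (lmc_act N a n)"
  using balancing_generator[OF u_carr a n] bX(5)[OF singletonI singletonI] by (simp add: fscl_def)
 then show ?thesis unfolding balancing_def s using a n u_carr by (intro span_base) blast
qed

lemma lin_balancing:
 assumes B': "vspace B'" and F: "lin (X \<boxtimes> N) B' F" and U': "module.subspace (scl B') U'"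
  and gen: "!!i cf. i : I ==> cf : A ==> F (rel (d i) (b cf)) : U'"
 shows "F ` balancing C X N \<subseteq> U'"
proof
 interpret module "scl (X \<boxtimes> N)" using vspaceD(14)[OF vspace_tensor, of X N] unfolding vector_space_def module_def .
 interpret m': module "scl B'" using vspaceD(14)[OF B'] unfolding vector_space_def module_def .
 have s: "fscl = scl (X \<boxtimes> N)" by simp
 have U: "F (rel a n) : U'" if a: "a : carr C" and n: "n : carr N" for a n
 proof -
  note bl = bilin_comp[OF F bilin_rel]
  have "F (rel a n) = (\<Sum>i\<in>I. scl B' (co i a) (F (rel (d i) n)))"
   by (rule lin_basis_expand[OF BC bilinD(2)[OF bl n] B' a])
  also have "... = (\<Sum>i\<in>I. scl B' (co i a) (\<Sum>cf\<in>A. scl B' (coN cf n) (F (rel (d i) (b cf)))))"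
   by (intro sum.cong HOL.refl arg_cong[of _ _ "scl B' _"] lin_basis_expand[OF BN bilinD(1)[OF bl bC(3)] B' n])
  also have "... : U'" by (intro m'.subspace_sum[OF U'] m'.subspace_scale[OF U'] gen)
  finally show ?thesis .
 qed
 fix y assume "y : F ` balancing C X N"
 then obtain x where x: "x : balancing C X N" "y = F x" by blast
 have sub: "subspace {x : carr (X \<boxtimes> N). F x : U'}" unfolding subspace_def
  using linD(2,3)[OF F] lin_0[OF F vspace_tensor B'] vspaceD(1,2,4)[OF vspace_tensor[of X N]]
   m'.subspace_0[OF U'] m'.subspace_add[OF U'] m'.subspace_scale[OF U'] by simp
 have "balancing C X N \<subseteq> {x : carr (X \<boxtimes> N). F x : U'}" unfolding balancing_def s
 proof (rule span_minimal[OF _ sub], safe)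
  fix x a n assume xan: "x : carr X" "a : carr C" "n : carr N"
  note r = bilinD(3)[OF bilin_rel xan(2,3)]
  show "tens X N (rmc_act X x a) n - tens X N x (lmc_act N a n) : carr (X \<boxtimes> N)"
   unfolding balancing_generator[OF xan] by (rule vspaceD(4)[OF vspace_tensor r])
  show "F (tens X N (rmc_act X x a) n - tens X N x (lmc_act N a n)) : U'"
   unfolding balancing_generator[OF xan] linD(3)[OF F r] by (rule m'.subspace_scale[OF U' U[OF xan(2,3)]])
 qed
 then show "y : U'" using x by blast
qed

text \<open>\<open>\<phi>\<close> assigns a label to a configuration of degree \<open>q\<close>,
  \<open>g\<close> is a section, and \<open>s cf\<close> is the factor by which \<open>cf\<close>
  differs from the section modulo balancing. The forward map sends \<open>cf\<close> to
  \<open>s cf\<close> times its label, the backward map is the section. \<open>Rel\<close> makes the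
  first map respect balancing; \<open>S\<close> says that the relations between labels come from
  balancing along the section; \<open>retract\<close> moves each configuration to the section by a
  single basis element of the algebra.\<close>

lemma bitensor_isomorphic:
 fixes B' :: "('k, 'w::ab_group_add, 'z) vspace_scheme"
 assumes BB: "has_basis B' H v cov" and H0: "H0 \<subseteq> H"
  and V': "carr V' = {w : carr B'. \<forall>f\<in>H. f \<notin> H0 \<longrightarrow> cov f w = 0}" "scl V' = scl B'" "vspace V'"
  and U': "U' = module.span (scl B') S"
  and S: "!!w. w : S ==> \<exists>f\<in>H0. \<exists>f'\<in>H0. \<exists>i\<in>I. \<exists>c. w = v f' - scl B' c (v f) \<and>
   g f' = T i (g f) \<and> \<mu> (d i) = c * \<sigma> i \<and> \<sigma> i ~= 0"
  and \<phi>: "!!cf. cf : A ==> D cf = q ==> \<phi> cf : H0"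
  and g: "!!f. f : H0 ==> g f : A \<and> D (g f) = q \<and> \<phi> (g f) = f \<and> s (g f) = 1"
  and Rel: "!!i cf. i : I ==> cf : A ==> D cf = q ==>
   scl B' (\<mu> (d i) * s cf) (v (\<phi> cf)) - scl B' (\<sigma> i * s (T i cf)) (v (\<phi> (T i cf))) : U'"
  and retract: "!!cf. cf : A ==> D cf = q ==>
   \<exists>i\<in>I. T i cf = g (\<phi> cf) \<and> \<sigma> i = s cf * \<mu> (d i) \<and> \<mu> (d i) ~= 0"
 shows "lin_isomorphic (bitensor C C X N) (quotient_image V' U')" unfolding bitensor_def
proof (rule lin_isomorphic_quotients[where B = "X \<boxtimes> N" and B' = B'])
 let ?B = "X \<boxtimes> N"
 define F where "F t = (\<Sum>cf\<in>A. scl B' (coef cf t) (if D cf = q then scl B' (s cf) (v (\<phi> cf)) else 0))" for t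
 define \<Psi> where "\<Psi> w = (\<Sum>f\<in>H. scl ?B (cov f w) (if f : H0 then pure (g f) else 0))" for w
 note bB = has_basisD[OF BB]
 interpret m: module "scl ?B" using vspaceD(14)[OF vspace_tensor, of X N] unfolding vector_space_def module_def .
 interpret m': module "scl B'" using vspaceD(14)[OF bB(1)] unfolding vector_space_def module_def .
 have vH0: "v f : carr B'" if "f : H0" for f using bB(3) H0 that by blast
 have vV': "v f : carr V'" if "f : H0" for f unfolding V' using vH0[OF that] bB(5)[of _ f] H0 that by auto
 have Fb: "(if D cf = q then scl B' (s cf) (v (\<phi> cf)) else 0) : carr B'" if "cf : A" for cf
  using vspaceD(1,4)[OF bB(1)] vH0 \<phi>[OF that] by simp
 have \<Psi>b: "(if f : H0 then pure (g f) else 0) : carr ?B" for f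
  using vspaceD(1)[OF vspace_tensor[of X N]] bP(3) g by simp
 show F: "lin ?B B' F" unfolding F_def by (rule lin_from_basis(1)[OF has_basis_pure bB(1) Fb])
 show \<Psi>: "lin B' ?B \<Psi>" unfolding \<Psi>_def by (rule lin_from_basis(1)[OF BB vspace_tensor \<Psi>b])
 have Fp: "F (pure cf) = (if D cf = q then scl B' (s cf) (v (\<phi> cf)) else 0)" if "cf : A" for cf
  unfolding F_def by (rule lin_from_basis(2)[OF has_basis_pure bB(1) Fb that])
 have \<Psi>v: "\<Psi> (v f) = pure (g f)" if "f : H0" for f
  using lin_from_basis(2)[OF BB vspace_tensor \<Psi>b, of f] that H0 unfolding \<Psi>_def by auto
 show "vspace ?B" "vspace B'" "vspace (cotensor C X N)" "vspace V'" "scl V' = scl B'"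
  using bB(1) V' vspace_cotensor by simp_all
 show "carr (cotensor C X N) \<subseteq> carr ?B" "scl (cotensor C X N) = scl ?B" "carr V' \<subseteq> carr B'"
  using cotensor scl_cotensor V' by auto
 show "module.subspace (scl ?B) (balancing C X N)" "balancing C X N \<subseteq> carr ?B" by (rule balancing_subspace)+
 show subU': "module.subspace (scl B') U'" unfolding U' by (rule m'.subspace_span)
 have wS: "w : carr B' \<and> \<Psi> w : balancing C X N" if "w : S" for w
 proof -
  from S[OF that] obtain f f' i c where f: "f : H0" "f' : H0" "i : I" "w = v f' - scl B' c (v f)"
   "g f' = T i (g f)" "\<mu> (d i) = c * \<sigma> i" "\<sigma> i ~= 0" by blast
  have gA: "g f : A" using g f by blast
  note cv = vspaceD(4)[OF bB(1) vH0[OF f(1)], of c]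
  have "\<Psi> w = pure (g f') - scl ?B c (pure (g f))"
   unfolding f(4) using lin_diff[OF \<Psi> bB(1) vspace_tensor vH0[OF f(2)] cv]
    linD(3)[OF \<Psi> vH0[OF f(1)]] \<Psi>v f(1,2) by simp
  \<comment> \<open>The factor arises from solving the balancing relation for the translated vector
    \<open>pure (g f')\<close>.\<close>
  also have "... = scl ?B (- inverse (\<sigma> i)) (rel (d i) (b (g f)))"
   unfolding rel_basis[OF f(3) gA] f(5,6) m.scale_right_diff_distrib m.scale_scale
   using f(7) by (simp add: fscl_def fun_eq_iff)
  also have "... : balancing C X N"
   by (rule m.subspace_scale[OF balancing_subspace(1) rel_balancing[OF bC(3)[OF f(3)] bN(3)[OF gA]]])
  finally show ?thesis using f(4) vspaceD(3)[OF bB(1) vH0[OF f(2)] cv] by simp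
 qed
 show U'B: "U' \<subseteq> carr B'" unfolding U' by (rule m'.span_minimal) (use wS vspaceD(15)[OF bB(1)] in auto)
 show "\<Psi> ` U' \<subseteq> balancing C X N"
 proof -
  have "m'.subspace {w : carr B'. \<Psi> w : balancing C X N}" unfolding m'.subspace_def
   using linD(2,3)[OF \<Psi>] lin_0[OF \<Psi> bB(1) vspace_tensor] vspaceD(1,2,4)[OF bB(1)]
    m.subspace_0[OF balancing_subspace(1)] m.subspace_add[OF balancing_subspace(1)]
    m.subspace_scale[OF balancing_subspace(1)] by simp
  then have "U' \<subseteq> {w : carr B'. \<Psi> w : balancing C X N}"
   unfolding U' by (intro m'.span_minimal) (use wS in auto)
  then show ?thesis by blast
 qed
 show "F ` balancing C X N \<subseteq> U'"
 proof (rule lin_balancing[OF bB(1) F subU'])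
  fix i cf assume i: "i : I" and cf: "cf : A"
  note p = bP(3)[OF cf] bP(3)[OF T[OF i cf]]
  have "F (rel (d i) (b cf)) = scl B' (\<mu> (d i)) (F (pure cf)) - scl B' (\<sigma> i) (F (pure (T i cf)))"
   unfolding rel_basis[OF i cf]
    lin_diff[OF F vspace_tensor bB(1) vspaceD(4)[OF vspace_tensor p(1)] vspaceD(4)[OF vspace_tensor p(2)]]
    linD(3)[OF F p(1)] linD(3)[OF F p(2)] ..
  also have "... : U'" using Rel[OF i cf] DT[OF i cf] m'.subspace_0[OF subU'] Fp[OF cf] Fp[OF T[OF i cf]]
   by (cases "D cf = q") (simp_all add: m'.scale_scale)
  finally show "F (rel (d i) (b cf)) : U'" .
 qed
 show "F ` carr (cotensor C X N) \<subseteq> carr V'"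
 proof (safe)
  fix t
  have "(if D cf = q then scl B' (s cf) (v (\<phi> cf)) else 0) : carr V'" if "cf : A" for cf
   using vspaceD(1,4)[OF V'(3)] vV' \<phi>[OF that] V'(2) by simp
  then show "F t : carr V'" unfolding F_def using vspaceD(4)[OF V'(3)] V'(2) by (intro vspaceD(5)[OF V'(3)]) simp
 qed
 show "\<Psi> ` carr V' \<subseteq> carr (cotensor C X N)"
 proof (safe)
  fix w
  have "(if f : H0 then pure (g f) else 0) : carr (cotensor C X N)" for f
  proof (cases "f : H0")
   case True
   have "coef cf (pure (g f)) = 0" if "cf : A" "D cf ~= q" for cf
    using bP(5)[OF that(1), of "g f"] g[OF True] that by auto
   then show ?thesis using True \<Psi>b[of f] by (simp add: cotensor)
  qed (simp add: vspaceD(1)[OF vspace_cotensor])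
  then show "\<Psi> w : carr (cotensor C X N)"
   unfolding \<Psi>_def scl_cotensor[symmetric] by (intro vspaceD(5)[OF vspace_cotensor] vspaceD(4)[OF vspace_cotensor])
 qed
 show "F (\<Psi> w) - w : U'" if w: "w : carr V'" for w
 proof -
  have wB: "w : carr B'" using w V' by blast
  have "F (\<Psi> w) = (\<Sum>f\<in>H. scl B' (cov f w) (F (\<Psi> (v f))))"
   by (rule lin_basis_expand[OF BB lin_comp[OF F \<Psi>] bB(1) wB])
  also have "... = (\<Sum>f\<in>H. scl B' (cov f w) (v f))"
  proof (rule sum.cong[OF HOL.refl])
   fix f assume f: "f : H"
   show "scl B' (cov f w) (F (\<Psi> (v f))) = scl B' (cov f w) (v f)"
   proof (cases "f : H0")
    case True
    then show ?thesis using \<Psi>v Fp[of "g f"] g[OF True] vspaceD(9)[OF bB(1)] by simp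
   next
    case False
    then have "cov f w = 0" using w f V' by blast
    then show ?thesis by (simp only: vspaceD(10)[OF bB(1)])
   qed
  qed
  also have "... = w" using bB(6)[OF wB] by simp
  finally show ?thesis using m'.subspace_0[OF subU'] by simp
 qed
 show "\<Psi> (F t) - t : balancing C X N" if t: "t : carr (cotensor C X N)" for t
 proof -
  have tB: "t : carr ?B" and z: "!!cf. cf : A ==> D cf ~= q ==> coef cf t = 0" using t cotensor by auto
  have "lin ?B ?B (%t. \<Psi> (F t) - t)" by (intro lin_minus lin_comp[OF \<Psi> F] lin_id vspace_tensor)
  from lin_basis_expand[OF has_basis_pure this vspace_tensor tB]
  have "\<Psi> (F t) - t = (\<Sum>cf\<in>A. scl ?B (coef cf t) (\<Psi> (F (pure cf)) - pure cf))" .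
  also have "... : balancing C X N"
  proof (rule m.subspace_sum[OF balancing_subspace(1)])
   fix cf assume cf: "cf : A"
   show "scl ?B (coef cf t) (\<Psi> (F (pure cf)) - pure cf) : balancing C X N"
   proof (cases "D cf = q")
    case False
    then show ?thesis using m.subspace_0[OF balancing_subspace(1)] by (simp only: z[OF cf False] m.scale_zero_left)
   next
    case True
    from retract[OF cf True] obtain i where i: "i : I" "T i cf = g (\<phi> cf)" "\<sigma> i = s cf * \<mu> (d i)" "\<mu> (d i) ~= 0" by blast
    have "\<Psi> (F (pure cf)) = scl ?B (s cf) (pure (g (\<phi> cf)))"
     using Fp[OF cf] True linD(3)[OF \<Psi> vH0[OF \<phi>[OF cf True]]] \<Psi>v[OF \<phi>[OF cf True]] by simp
    \<comment> \<open>By the choice of \<open>i\<close>, the relation for \<open>cf\<close> is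
      \<mu>(d i) times the difference of \<open>cf\<close> and \<open>s cf\<close> times its section
      point; dividing by -\<mu>(d i) gives the claim.\<close>
    then have "\<Psi> (F (pure cf)) - pure cf = scl ?B (- inverse (\<mu> (d i))) (rel (d i) (b cf))"
     unfolding rel_basis[OF i(1) cf] i(2,3) m.scale_right_diff_distrib m.scale_scale
     using i(4) by (simp add: fscl_def fun_eq_iff)
    then show ?thesis
     using rel_balancing[OF bC(3)[OF i(1)] bN(3)[OF cf]] m.subspace_scale[OF balancing_subspace(1)] by simp
   qed
  qed
  finally show ?thesis .
 qed
qed

end

section \<open>Tensor products of one-dimensional module-comodules\<close>

lemma mlift_unique:
 assumes V: "!!i. i : I ==> vspace (V i)" and U: "vspace U" and b: "multilin I V U b"
  and F: "lin (mtensor I V) U F" "!!m. m : (\<Pi>\<^sub>E i\<in>I. carr (V i)) ==> F (mtens I V m) = b m"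
  and t: "t : carr (mtensor I V)"
 shows "mlift I V U b t = F t"
proof (rule lin_eq_on_span[OF mlift(1)[OF V U b] F(1) vspace_mtensor U _ _ t])
 show "carr (mtensor I V) = module.span (scl (mtensor I V)) (mtens I V ` (\<Pi>\<^sub>E i\<in>I. carr (V i)))"
  by (simp add: mtensor_def)
 show "mlift I V U b x = F x" if "x : mtens I V ` (\<Pi>\<^sub>E i\<in>I. carr (V i))" for x
  using that mlift(2)[OF V U b] F(2) by auto
qed

locale line_family = finite_group G for G :: "('g, 'b) monoid_scheme" (structure) +
 fixes C :: "'i set" and r :: "'i => 'g" and \<zeta> :: "'i => ('g => 'k::field) => 'k"
 assumes fin_I: "finite C" and r: "!!c. c : C ==> r c : carrier G"
  and \<zeta>: "!!c. c : C ==> lin kG ground (\<zeta> c)"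
begin

abbreviation L where "L \<equiv> %c. line (kG :: ('k, 'g => 'k) hopf) (bf (r c)) (\<zeta> c)"
abbreviation HC where "HC \<equiv> mtensor C (%_. kG :: ('k, 'g => 'k) hopf)"
abbreviation RL where "RL \<equiv> rmc_tensor C (kG :: ('k, 'g => 'k) hopf) L"
abbreviation unit_vec where "unit_vec \<equiv> mtens C L (%_. 1)"
definition coL :: "('k, 'i, 'k) mten => 'k" where "coL = mlift C L ground (%m. \<Prod>c\<in>C. m c)"
text \<open>The linear functional by which the tensor product algebra acts on the line
  \<open>RL\<close>.\<close>

definition weight :: "('k, 'i, 'g => 'k) mten => 'k" where
 "weight = mlift C (%_. kG) ground (%a. \<Prod>c\<in>C. \<zeta> c (a c))"

lemma RL_simps: "carr RL = carr (mtensor C L)" "scl RL = fscl" by (simp_all add: rmc_tensor_def mtensor_def)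

lemma scl_mtensor': "scl (mtensor C V) = fscl" by (simp add: mtensor_def)

lemma has_basis_line: "has_basis (L c) {()} (%_. 1) (%_ l. l)"
 unfolding has_basis_def by (auto simp: lin_def)

lemma has_basis_RL: "has_basis RL {()} (%_. unit_vec) (%_. coL)"
proof -
 have "bij_betw (%_. \<lambda>c\<in>C. ()) {()} (\<Pi>\<^sub>E c\<in>C. {()})"
  by (auto simp: bij_betw_def inj_on_def PiE_def extensional_def fun_eq_iff restrict_def)
 from has_basis_reindex[OF has_basis_mtensor[where V = L and A = "%_. {()}" and e = "%_ _. 1" and co = "%_ _ l. l",
   OF fin_I has_basis_line] this]
 have "has_basis (mtensor C L) {()} (%_. unit_vec) (%_. coL)" by (simp add: coL_def[symmetric])
 then show ?thesis by (rule has_basis_cong) (simp_all add: rmc_tensor_def)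
qed

lemma mtens_L: "mtens C L x = fscl (\<Prod>c\<in>C. x c) unit_vec"
 using mtens_scale[OF fin_I, of L x "%_. 1"] by simp

lemma tens_L: "tens (L c) kG = tens ground kG" by (rule tens_cong) simp_all

lemma multilin_weight: "multilin C (%_. kG) ground (%a. \<Prod>c\<in>C. \<zeta> c (a c))"
 by (rule multilin_prod[OF fin_I \<zeta>])

lemma lin_weight: "lin HC ground weight"
 unfolding weight_def by (rule mlift(1)[OF vspace_kG vspace_ground multilin_weight])

lemma weight_basis:
 assumes "a : (\<Pi>\<^sub>E c\<in>C. carrier G)"
 shows "weight (mtens C (%_. kG) (\<lambda>c\<in>C. bf (a c))) = (\<Prod>c\<in>C. \<zeta> c (bf (a c)))"
proof -
 have "(\<lambda>c\<in>C. bf (a c)) : (\<Pi>\<^sub>E c\<in>C. carr (kG :: ('k, 'g => 'k) hopf))" using assms by (auto dest: PiE_mem)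
 from mlift(2)[OF vspace_kG vspace_ground multilin_weight this]
 have "weight (mtens C (%_. kG) (\<lambda>c\<in>C. bf (a c))) = (\<Prod>c\<in>C. \<zeta> c ((\<lambda>c\<in>C. bf (a c)) c))"
  unfolding weight_def .
 also have "... = (\<Prod>c\<in>C. \<zeta> c (bf (a c)))" by (rule prod.cong) simp_all
 finally show ?thesis .
qed

lemma rmc_act_RL:
 assumes t: "t : carr RL" and Y: "Y : carr HC"
 shows "rmc_act RL t Y = scl RL (weight Y) t"
proof -
 let ?X = "mtensor C L"
 have t': "t : carr ?X" using t by (simp add: RL_simps)
 have inner: "mlift C (%_. kG) ?X (%a. mtens C L (%c. \<zeta> c (a c) * x c)) Y = scl ?X (weight Y) (mtens C L x)"
  if x: "x : (\<Pi>\<^sub>E c\<in>C. carr (L c))" for x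
 proof -
  have "mtens C L (%c. \<zeta> c (a c) * x c) = scl ?X (\<Prod>c\<in>C. \<zeta> c (a c)) (mtens C L x)" for a
   using mtens_scale[OF fin_I, of L "%c. \<zeta> c (a c)" x] by (simp add: scl_mtensor')
  then have "mlift C (%_. kG) ?X (%a. mtens C L (%c. \<zeta> c (a c) * x c)) =
    mlift C (%_. kG) ?X (%a. scl ?X (\<Prod>c\<in>C. \<zeta> c (a c)) (mtens C L x))" by simp
  moreover have "mlift C (%_. kG) ?X (%a. scl ?X (\<Prod>c\<in>C. \<zeta> c (a c)) (mtens C L x)) Y =
    scl ?X (weight Y) (mtens C L x)"
  proof (rule mlift_unique[OF vspace_kG vspace_mtensor _ _ _ Y])
   show "multilin C (%_. kG) ?X (%a. scl ?X (\<Prod>c\<in>C. \<zeta> c (a c)) (mtens C L x))"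
    by (rule multilin_lin_comp[OF lin_scl_left[OF lin_id vspace_mtensor mtens_carr[OF x]] multilin_weight])
   show "lin HC ?X (%Y. scl ?X (weight Y) (mtens C L x))"
    by (rule lin_scl_left[OF lin_weight vspace_mtensor mtens_carr[OF x]])
   show "scl ?X (weight (mtens C (%_. kG) m)) (mtens C L x) = scl ?X (\<Prod>c\<in>C. \<zeta> c (m c)) (mtens C L x)"
    if "m : (\<Pi>\<^sub>E c\<in>C. carr kG)" for m
    unfolding weight_def mlift(2)[OF vspace_kG vspace_ground multilin_weight that] ..
  qed
  ultimately show ?thesis by simp
 qed
 have vL: "vspace (L c)" for c by simp
 have "rmc_act RL t Y = mlift C L ?X (%x. mlift C (%_. kG) ?X (%a. mtens C L (%c. \<zeta> c (a c) * x c)) Y) t"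
  by (simp add: rmc_tensor_def)
 also have "... = mlift C L ?X (%x. scl ?X (weight Y) (mtens C L x)) t"
  using mlift_cong[of C L "%x. mlift C (%_. kG) ?X (%a. mtens C L (%c. \<zeta> c (a c) * x c)) Y"
   "%x. scl ?X (weight Y) (mtens C L x)" ?X] inner by simp
 also have "... = scl ?X (weight Y) t"
  by (rule mlift_unique[OF vL vspace_mtensor multilin_lin_comp[OF lin_scl[OF lin_id vspace_mtensor] multilin_mtens]
   lin_scl[OF lin_id vspace_mtensor] HOL.refl t'])
 finally show ?thesis by (simp add: RL_simps scl_mtensor')
qed

text \<open>Since \<open>shuffle\<close> is a choice, a map with its property has to be produced.
  All factors are lines, so their scalars can be moved into the group algebra legs, which leaves the
  unit vector in front.\<close>

lemma shuffle_L:
 shows "lin (mtensor C (%c. L c \<boxtimes> kG)) (mtensor C L \<boxtimes> HC) (shuffle C kG L)"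
  and "!!x h. x : (\<Pi>\<^sub>E c\<in>C. carr (L c)) ==> h : (\<Pi>\<^sub>E c\<in>C. carr kG) ==>
   shuffle C kG L (mtens C (%c. L c \<boxtimes> kG) (%c. tens (L c) kG (x c) (h c))) =
   tens (mtensor C L) HC (mtens C L x) (mtens C (%_. kG) h)"
proof -
 let ?V = "%c. L c \<boxtimes> (kG :: ('k, 'g => 'k) hopf)" let ?Z = "mtensor C L \<boxtimes> HC"
 define val where "val c = tlift (L c) kG kG (%x h. fscl x h)" for c
 have bl: "bilin (L c) (kG :: ('k, 'g => 'k) hopf) kG (%x h. fscl x h)" for c
 proof (rule bilinI)
  show "lin kG (kG :: ('k, 'g => 'k) hopf) (fscl x)" for x using lin_scl[OF lin_id vspace_kG, of x] by simp
  show "lin (L c) (kG :: ('k, 'g => 'k) hopf) (%x. fscl x h)" if "h : carr kG" for h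
  proof -
   have "lin (L c) ground (%x. x)" by (simp add: lin_def)
   from lin_scl_left[OF this vspace_kG that] show ?thesis by simp
  qed
 qed
 note vL = vspace_line[of kG "bf (r c)" "\<zeta> c" for c]
 note val = tlift[OF vL vspace_kG vspace_kG bl, folded val_def]
 have uX: "unit_vec : carr (mtensor C L)" by (rule has_basisD(3)[OF has_basis_RL, unfolded RL_simps]) simp
 let ?b = "%m. tens (mtensor C L) HC unit_vec (mtens C (%_. kG) (\<lambda>c\<in>C. val c (m c)))"
 have ml: "multilin C ?V ?Z ?b"
  by (rule multilin_lin_comp[OF bilinD(1)[OF bilin_tens uX] multilin_map[OF multilin_mtens val(1)]])
 note F = mlift[OF vspace_tensor vspace_tensor ml]
 have "\<exists>F. lin (mtensor C ?V) ?Z F \<and> (\<forall>x\<in>(\<Pi>\<^sub>E c\<in>C. carr (L c)). \<forall>h\<in>(\<Pi>\<^sub>E c\<in>C. carr kG).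
    F (mtens C ?V (%c. tens (L c) kG (x c) (h c))) = tens (mtensor C L) HC (mtens C L x) (mtens C (%_. kG) h))"
 proof (intro exI conjI ballI)
  show "lin (mtensor C ?V) ?Z (mlift C ?V ?Z ?b)" by (rule F(1))
  fix x h assume x: "x : (\<Pi>\<^sub>E c\<in>C. carr (L c))" and h: "h : (\<Pi>\<^sub>E c\<in>C. carr (kG :: ('k, 'g => 'k) hopf))"
  let ?m = "\<lambda>c\<in>C. tens (L c) kG (x c) (h c)"
  have m: "?m : (\<Pi>\<^sub>E c\<in>C. carr (?V c))" using PiE_mem[OF h] by (auto intro!: tens_carr)
  have eq: "(\<lambda>c\<in>C. val c (?m c)) = (\<lambda>c\<in>C. fscl (x c) (h c))"
   using val(2) PiE_mem[OF h] by (auto simp: fun_eq_iff restrict_def)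
  have "mlift C ?V ?Z ?b (mtens C ?V (%c. tens (L c) kG (x c) (h c))) = mlift C ?V ?Z ?b (mtens C ?V ?m)" by simp
  also have "... = tens (mtensor C L) HC unit_vec (mtens C (%_. kG) (%c. fscl (x c) (h c)))"
   unfolding F(2)[OF m] eq by simp
  also have "... = tens (mtensor C L) HC (mtens C L x) (mtens C (%_. kG) h)"
   unfolding mtens_L[of x] using mtens_scale[OF fin_I, of "%_. kG :: ('k, 'g => 'k) hopf" x h]
    tens_scl_left[of "mtensor C L" HC] tens_scl_right[of "mtensor C L" HC] by (simp add: scl_mtensor')
  finally show "mlift C ?V ?Z ?b (mtens C ?V (%c. tens (L c) kG (x c) (h c))) =
    tens (mtensor C L) HC (mtens C L x) (mtens C (%_. kG) h)" .
 qed
 from someI_ex[OF this, folded shuffle_def]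
 show "lin (mtensor C (%c. L c \<boxtimes> kG)) (mtensor C L \<boxtimes> HC) (shuffle C kG L)"
  and "!!x h. x : (\<Pi>\<^sub>E c\<in>C. carr (L c)) ==> h : (\<Pi>\<^sub>E c\<in>C. carr kG) ==>
   shuffle C kG L (mtens C (%c. L c \<boxtimes> kG) (%c. tens (L c) kG (x c) (h c))) =
   tens (mtensor C L) HC (mtens C L x) (mtens C (%_. kG) h)" by blast+
qed

lemma tensor_RL: "RL \<boxtimes> HC = mtensor C L \<boxtimes> HC" "tens RL HC = tens (mtensor C L) HC"
proof -
 show "tens RL HC = tens (mtensor C L) HC" by (rule tens_cong) (simp_all add: RL_simps scl_mtensor')
 then show "RL \<boxtimes> HC = mtensor C L \<boxtimes> HC" by (simp add: tensor_def RL_simps)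
qed

lemma rmc_coact_RL:
 shows "lin RL (RL \<boxtimes> HC) (rmc_coact RL)"
  and "rmc_coact RL unit_vec = tens RL HC unit_vec (mtens C (%_. kG) (\<lambda>c\<in>C. bf (r c)))"
proof -
 let ?V = "%c. L c \<boxtimes> (kG :: ('k, 'g => 'k) hopf)" let ?Z = "mtensor C L \<boxtimes> HC"
 let ?f = "%c l. tens (L c) kG l (bf (r c))"
 let ?b = "%x. shuffle C kG L (mtens C ?V (\<lambda>c\<in>C. ?f c (x c)))"
 have eq: "rmc_coact RL = mlift C L ?Z ?b" by (simp add: rmc_tensor_def line_def tens_L[unfolded line_def])
 have ml: "multilin C L ?Z ?b"
  by (rule multilin_lin_comp[OF shuffle_L(1) multilin_map[OF multilin_mtens bilinD(2)[OF bilin_tens bf_kG[OF r]]]])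
 have vL: "vspace (L c)" for c by simp
 note F = mlift[OF vL vspace_tensor ml]
 show "lin RL (RL \<boxtimes> HC) (rmc_coact RL)"
  unfolding tensor_RL eq using F(1) unfolding lin_def RL_simps by (simp add: scl_mtensor')
 have 1: "(\<lambda>c\<in>C. 1) : (\<Pi>\<^sub>E c\<in>C. carr (L c))" by simp
 have h: "(\<lambda>c\<in>C. bf (r c)) : (\<Pi>\<^sub>E c\<in>C. carr (kG :: ('k, 'g => 'k) hopf))" using r by auto
 have "rmc_coact RL unit_vec = mlift C L ?Z ?b (mtens C L (\<lambda>c\<in>C. 1))" unfolding eq by simp
 also have "... = ?b (\<lambda>c\<in>C. 1)" by (rule F(2)[OF 1])
 also have "(\<lambda>c\<in>C. ?f c ((\<lambda>c\<in>C. 1) c)) = (\<lambda>c\<in>C. tens (L c) kG ((\<lambda>c\<in>C. 1) c) ((\<lambda>c\<in>C. bf (r c)) c))"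
  by (auto simp: fun_eq_iff)
 also have "shuffle C kG L (mtens C ?V (\<lambda>c\<in>C. tens (L c) kG ((\<lambda>c\<in>C. 1) c) ((\<lambda>c\<in>C. bf (r c)) c))) =
   tens RL HC unit_vec (mtens C (%_. kG) (\<lambda>c\<in>C. bf (r c)))"
  unfolding mtens_restrict shuffle_L(2)[OF 1 h, unfolded mtens_restrict] tensor_RL ..
 finally show "rmc_coact RL unit_vec = tens RL HC unit_vec (mtens C (%_. kG) (\<lambda>c\<in>C. bf (r c)))" .
qed

end

section \<open>The face words of a Kitaev graph\<close>

lemma walk_iterates:
 "walk io c a (rev (map (%r. (f ^^ r) x) [0..<Suc n])) b \<longleftrightarrow>
  a = c (io ((f ^^ n) x)) \<and> b = c x \<and> (\<forall>r<n. c (io ((f ^^ r) x)) = c ((f ^^ Suc r) x))"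
proof (induction n arbitrary: a)
 case (Suc n)
 have "walk io c a (rev (map (%r. (f ^^ r) x) [0..<Suc (Suc n)])) b \<longleftrightarrow>
   c (io ((f ^^ Suc n) x)) = a \<and> walk io c (c ((f ^^ Suc n) x)) (rev (map (%r. (f ^^ r) x) [0..<Suc n])) b"
  by simp
 also have "... \<longleftrightarrow> a = c (io ((f ^^ Suc n) x)) \<and> b = c x \<and>
   (\<forall>r<Suc n. c (io ((f ^^ r) x)) = c ((f ^^ Suc r) x))"
  unfolding Suc.IH less_Suc_eq by metis
 finally show ?case .
qed auto

text \<open>In the reversed cycle the letter before \<open>k\<close> is \<open>f k\<close>, so the
  walk condition compares the start of \<open>k\<close> with the end of \<open>f k\<close>.
  Periodicity of the cycle closes the walk.\<close>

lemma walk_cycle_list: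
 assumes f: "permutation f"
 shows "walk io c a (rev (cycle_list f x)) a \<longleftrightarrow> a = c x \<and> (\<forall>k\<in>orbit f x. c (io k) = c (f k))"
proof -
 obtain n where n: "card (orbit f x) = Suc n"
  using finite_orbit[OF permutation_self_in_orbit[OF f]] orbit_nonempty[of f x] by (metis card_eq_0_iff not0_implies_Suc)
 have o: "orbit f x = (%r. (f ^^ r) x) ` {..n}"
  using cycle_list(1)[OF f, of x] unfolding cycle_list_def n by (simp del: upt_Suc add: atLeast0LessThan lessThan_Suc_atMost)
 have per: "(f ^^ Suc n) x = x" using cycle_list(4)[OF f, of x] n by simp
 have "walk io c a (rev (cycle_list f x)) a \<longleftrightarrow>
   a = c x \<and> c (io ((f ^^ n) x)) = c ((f ^^ Suc n) x) \<and> (\<forall>r<n. c (io ((f ^^ r) x)) = c ((f ^^ Suc r) x))"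
  unfolding cycle_list_def n walk_iterates per by auto
 also have "... \<longleftrightarrow> a = c x \<and> (\<forall>k\<in>orbit f x. c (io k) = c (f k))"
  unfolding o by (auto simp: le_less)
 finally show ?thesis .
qed

lemma length_filter_concat_partition:
 assumes "finite S" "distinct xs" "!!x. x : set xs ==> distinct (l x)"
  "!!x. x : set xs ==> set (l x) \<subseteq> S" "!!h. h : S ==> \<exists>!x. x : set xs \<and> h : set (l x)"
 shows "(\<Sum>x\<in>set xs. length (filter P (l x))) = card {h : S. P h}"
proof -
 have "(\<Sum>x\<in>set xs. length (filter P (l x))) = (\<Sum>x\<in>set xs. card {h : set (l x). P h})"
 proof (rule sum.cong[OF HOL.refl])
  fix x assume "x : set xs"
  from distinct_card[OF distinct_filter[OF assms(3)[OF this]], of P]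
  show "length (filter P (l x)) = card {h : set (l x). P h}" by simp
 qed
 also have "... = card (\<Union>x\<in>set xs. {h : set (l x). P h})"
 proof (rule card_UN_disjoint[symmetric])
  show "\<forall>x\<in>set xs. \<forall>y\<in>set xs. x ~= y \<longrightarrow> {h : set (l x). P h} \<inter> {h : set (l y). P h} = {}"
  proof (intro ballI impI)
   fix x y assume xy: "x : set xs" "y : set xs" "x ~= y"
   then have "h \<notin> set (l y)" if "h : set (l x)" for h using assms(4)[OF xy(1)] assms(5)[of h] that by blast
   then show "{h : set (l x). P h} \<inter> {h : set (l y). P h} = {}" by blast
  qed
 qed auto
 also have "(\<Union>x\<in>set xs. {h : set (l x). P h}) = {h : S. P h}"
 proof
  show "(\<Union>x\<in>set xs. {h : set (l x). P h}) \<subseteq> {h : S. P h}" using assms(4) by auto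
  show "{h : S. P h} \<subseteq> (\<Union>x\<in>set xs. {h : set (l x). P h})"
  proof
   fix h assume "h : {h : S. P h}"
   moreover from this obtain x where "x : set xs" "h : set (l x)" using assms(5)[of h] by auto
   ultimately show "h : (\<Union>x\<in>set xs. {h : set (l x). P h})" by auto
  qed
 qed
 finally show ?thesis .
qed

context kitaev_config
begin

lemma fl: "set (fl c) = face_of \<Gamma> (rho_inv \<Gamma> c)" "distinct (fl c)"
 unfolding fl_def face_of_def by (rule cycle_list(1,2)[OF perm_face])+

lemma rho_inv_rho: "rho_inv \<Gamma> (rho \<Gamma> h) = h" "rho \<Gamma> (rho_inv \<Gamma> h) = h"
 unfolding rho_inv_def using permutes_inverses[OF ribbon(3)] by auto

lemma rho_Hs: "h : Hs ==> rho \<Gamma> h : Hs" "h : Hs ==> rho_inv \<Gamma> h : Hs"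
 using permutes_in_image[OF ribbon(3)] permutes_in_image[OF rho_inv_permutes] by auto

lemma ex1_face: assumes h: "h : Hs" shows "\<exists>!c. c : C \<and> h : set (fl c)"
proof -
 have bij: "bij_betw (%c. face_of \<Gamma> (rho_inv \<Gamma> c)) C (faces \<Gamma>)" using K unfolding kitaev_graph_def by blast
 have eq: "h : set (fl c) \<longleftrightarrow> face_of \<Gamma> (rho_inv \<Gamma> c) = face_of \<Gamma> h" for c
  unfolding fl face_of_def using orbit_eq_iff[OF perm_face, of h "rho_inv \<Gamma> c"] by auto
 have "face_of \<Gamma> h : (%c. face_of \<Gamma> (rho_inv \<Gamma> c)) ` C"
  using bij h unfolding bij_betw_def faces_def by blast
 then obtain c where c: "c : C" "face_of \<Gamma> h = face_of \<Gamma> (rho_inv \<Gamma> c)" by (rule imageE) simp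
 show ?thesis
 proof (rule ex1I[of _ c])
  show "c : C \<and> h : set (fl c)" using c eq by simp
  fix c' assume "c' : C \<and> h : set (fl c')"
  then show "c' = c" using inj_onD[OF bij_betw_imp_inj_on[OF bij], of c' c] c eq by simp
 qed
qed

lemma walk_face:
 "walk io c' a (rev (fl c)) a \<longleftrightarrow> a = c' (rho_inv \<Gamma> c) \<and> (\<forall>k\<in>set (fl c). c' (io k) = c' (rho_inv \<Gamma> (io k)))"
 unfolding fl_def walk_cycle_list[OF perm_face] cycle_list(1)[OF perm_face] by (simp add: face_perm_def[THEN fun_cong])

lemma const_vertex:
 assumes "!!h. h : Hs ==> c' (rho_inv \<Gamma> h) = c' h" "h : Hs"
 shows "c' (vt h) = c' h"
proof -
 have "c' k = c' h \<and> k : Hs" if "k : orbit (rho \<Gamma>) h" for k using that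
 proof induction
  case base
  show ?case using assms(1)[OF rho_Hs(1)[OF assms(2)]] rho_Hs(1)[OF assms(2)] by (simp add: rho_inv_rho)
 next
  case (step y)
  then show ?case using assms(1)[OF rho_Hs(1)[of y]] rho_Hs(1)[of y] by (simp add: rho_inv_rho)
 qed
 moreover have "vt h : orbit (rho \<Gamma>) h"
  using vt(2)[OF assms(2)] orbit_eq_iff[OF perm_rho, of "vt h" h] unfolding vertex_of_def by blast
 ultimately show ?thesis by blast
qed

lemma vt_rho_inv: "h : Hs ==> vt (rho_inv \<Gamma> h) = vt h" unfolding vt_def vertex_of_def
 using permutation_orbit_step[OF perm_rho, of "rho_inv \<Gamma> h"] by (simp add: rho_inv_rho)

lemma vt_C: "c : C ==> vt c = c"
 using vt(3)[of c c] C_Hs permutation_self_in_orbit[OF perm_rho, of c] unfolding vertex_of_def by blast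

text \<open>The face permutation goes to the opposite half-edge and then applies the inverse of
  \<open>rho\<close>, which stays at the vertex; so consecutive letters meet there. The reversed
  word ends with \<open>rho_inv \<Gamma> c\<close>, a half-edge at the vertex of
  \<open>c\<close>.\<close>

lemma walk_vt: "c : C ==> walk io vt c (rev (fl c)) c"
 unfolding walk_face using vt_rho_inv vt_C C_Hs ribbon(6) fl_Hs by (metis subsetD)

abbreviation pt0 where "pt0 \<equiv> pt \<Gamma>"
lemma pt_C: "pt0 : C" using K unfolding kitaev_graph_def by blast

definition others where "others = remove1 pt0 cs"
lemma others: "set others = C - {pt0}" "distinct others" "set (pt0 # others) = C" "distinct (pt0 # others)"
 using cs pt_C by (auto simp: others_def set_remove1_eq)

definition target_count where "target_count c = length (filter (%h. \<not> is_source \<Gamma> h) (fl c))"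

text \<open>The holonomy that the cotensor condition prescribes: one factor \<open>p\<close> for
  each target, undoing \<open>deg\<close>, times the degree of the line at \<open>c\<close>, which
  is \<one> at \<open>pt\<close> and p^(-2) elsewhere.\<close>

definition face_value where "face_value c = p [^] target_count c \<otimes> (if c = pt0 then \<one> else inv (p [^] (2::nat)))"

text \<open>The face of the base point is the word to be normalised. Its own holonomy condition is
  added afterwards, as a condition on the product of commutators.\<close>

abbreviation W0 where "W0 \<equiv> rev (fl pt0)"
abbreviation Fs where "Fs \<equiv> map (%c. (rev (fl c), face_value c)) others"

lemma concat_faces: "W0 @ concat (map fst Fs) = concat (map (%c. rev (fl c)) (pt0 # others))"
 by (simp add: comp_def)

lemma letters: "all_letters W0 Fs = Hs"
proof -
 have "all_letters W0 Fs = (\<Union>c\<in>set (pt0 # others). set (fl c))"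
  unfolding all_letters_def concat_faces by simp
 also have "... = Hs"
 proof
  show "(\<Union>c\<in>set (pt0 # others). set (fl c)) \<subseteq> Hs" unfolding others(3) using fl_Hs by auto
  show "Hs \<subseteq> (\<Union>c\<in>set (pt0 # others). set (fl c))"
  proof
   fix h assume "h : Hs"
   from ex1_implies_ex[OF ex1_face[OF this]] show "h : (\<Union>c\<in>set (pt0 # others). set (fl c))"
    unfolding others(3) by (elim exE conjE UN_I)
  qed
 qed
 finally show ?thesis .
qed

text \<open>Every corner of the graph is passed by some face: the corner between
  \<open>rho_inv \<Gamma> h\<close> and \<open>h\<close> is passed in the face that contains
  \<open>io h\<close>.\<close>

lemma walk_faces:
 assumes "walk io c' a W0 a" "\<forall>(F, z)\<in>set Fs. \<exists>b. walk io c' b F b" and h: "h : Hs"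
 shows "c' (rho_inv \<Gamma> h) = c' h"
proof -
 obtain c where c: "c : C" "io h : set (fl c)" using ex1_face[OF ribbon(6)[OF h]] by blast
 have "\<exists>b. walk io c' b (rev (fl c)) b"
 proof (cases "c = pt0")
  case True
  then show ?thesis using assms(1) by blast
 next
  case False
  then have "(rev (fl c), face_value c) : set Fs" using c(1) others(1) by auto
  then show ?thesis using assms(2) by blast
 qed
 then show ?thesis unfolding walk_face using c(2) ribbon(4)[OF h] by metis
qed

lemma connected_const:
 assumes R: "!!u. u : Hs ==> d (io u) = d u" "!!u. u : Hs ==> d (rho \<Gamma> u) = d u" and h: "h : Hs" "k : Hs"
 shows "d h = d k"
proof -
 let ?R = "{(h, io h) | h. h : Hs} \<union> {(h, rho \<Gamma> h) | h. h : Hs}"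
 have "(h, k) : (?R \<union> ?R\<inverse>)\<^sup>*" using K h unfolding kitaev_graph_def connected_ribbon_def Let_def by blast
 then show ?thesis
 proof (induction rule: rtrancl_induct)
  case (step y z)
  then have "d y = d z" using R by auto
  then show ?case using step by simp
 qed simp
qed

text \<open>A function compatible with the corners of all faces is invariant under
  \<open>rho\<close>, hence constant on vertices. A function constant on edges and faces is
  invariant under \<open>iota\<close> and the face permutation, hence under \<open>rho\<close> as
  well, so connectedness of the graph makes it constant.\<close>

lemma surface_words_graph: "surface_words io vt pt0 W0 Fs" unfolding surface_words_def letters
proof (intro conjI allI impI)
 show "distinct (W0 @ concat (map fst Fs))"
 proof -
  have "distinct (concat (map (%c. rev (fl c)) xs))" if "distinct xs" "set xs \<subseteq> C" for xs using that
  proof (induction xs)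
   case (Cons c xs)
   have "set (fl c) \<inter> set (fl c') = {}" if "c' : set xs" for c'
    using that Cons.prems ex1_face fl_Hs[of c] by (auto, metis subsetD)
   then show ?case using Cons fl(2) by auto
  qed simp
  then show ?thesis unfolding concat_faces using others(3,4) by blast
 qed
 show "\<forall>u\<in>Hs. io u : Hs \<and> io (io u) = u \<and> io u ~= u" using ribbon(4-6) by blast
 show "walk io vt pt0 W0 pt0" by (rule walk_vt[OF pt_C])
 have ne: "fl c ~= []" for c using fl(1)[of c] orbit_nonempty[of "face_perm \<Gamma>"] unfolding face_of_def by force
 show "\<forall>(F, z)\<in>set Fs. F ~= [] \<and> (\<exists>a. walk io vt a F a)"
  using ne walk_vt others(1) by auto
 show "W0 = [] ==> Fs = []" using ne by simp
 fix c' :: "'h => bool" and a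
 assume w: "walk io c' a W0 a" "\<forall>(F, z)\<in>set Fs. \<exists>b. walk io c' b F b"
 have "a = c' pt0" using w(1) walk_faces[OF w, of pt0] pt_C C_Hs unfolding walk_face by auto
 moreover have "\<forall>u\<in>Hs. c' u = c' (vt u)" using const_vertex[where c' = c', OF walk_faces[OF w]] by simp
 ultimately show "\<exists>k. k pt0 = a \<and> (\<forall>u\<in>Hs. c' u = k (vt u))" by blast
next
 fix d :: "'h => bool"
 assume d: "\<forall>u\<in>Hs. d (io u) = d u" "\<forall>F\<in>set (W0 # map fst Fs). \<forall>u\<in>set F. \<forall>w\<in>set F. d u = d w"
 have r: "d (rho_inv \<Gamma> h) = d h" if h: "h : Hs" for h
 proof -
  obtain c where c: "c : C" "io h : set (fl c)" using ex1_face[OF ribbon(6)[OF h]] by blast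
  have "face_perm \<Gamma> (io h) : set (fl c)" using c(2) unfolding fl face_of_def by (rule orbit.step)
  then have "rho_inv \<Gamma> h : set (rev (fl c))" "io h : set (rev (fl c))"
   using c(2) ribbon(4)[OF h] by (simp_all add: face_perm_def)
  moreover have "rev (fl c) : set (W0 # map fst Fs)" using c(1) others(1) by (cases "c = pt0") auto
  ultimately have "d (rho_inv \<Gamma> h) = d (io h)" using d(2) by blast
  then show ?thesis using bspec[OF d(1) h] by simp
 qed
 have "d (rho \<Gamma> u) = d u" if "u : Hs" for u using r[OF rho_Hs(1)[OF that]] by (simp add: rho_inv_rho)
 then show "\<forall>u\<in>Hs. \<forall>w\<in>Hs. d u = d w" using connected_const d(1) by blast
qed

lemma central_mult:
 assumes x: "central G x" and y: "central G y"
 shows "central G (x \<otimes> y)" unfolding central_def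
proof (intro conjI ballI)
 have c: "x : carrier G" "y : carrier G" using x y by (simp_all add: central_def)
 then show "x \<otimes> y : carrier G" by simp
 fix h assume h: "h : carrier G"
 have "x \<otimes> y \<otimes> h = x \<otimes> (y \<otimes> h)" by (rule m_assoc[OF c h])
 also have "y \<otimes> h = h \<otimes> y" using y h by (simp add: central_def)
 also have "x \<otimes> (h \<otimes> y) = x \<otimes> h \<otimes> y" by (rule m_assoc[OF c(1) h c(2), symmetric])
 also have "x \<otimes> h = h \<otimes> x" using x h by (simp add: central_def)
 also have "h \<otimes> x \<otimes> y = h \<otimes> (x \<otimes> y)" by (rule m_assoc[OF h c])
 finally show "x \<otimes> y \<otimes> h = h \<otimes> (x \<otimes> y)" .
qed

lemma central_one: "central G \<one>" by (simp add: central_def)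

lemma central_pow: "central G z ==> central G (z [^] (n::nat))"
 by (induction n) (simp_all add: central_one central_mult)

lemma central_face_value: "central G (face_value c)"
 unfolding face_value_def using central_pow[OF p] central_inv central_one by (simp add: central_mult)

lemma card_half_edges: "card Hs = 2 * card E" "card {h : Hs. is_source \<Gamma> h} = card E"
 "card {h : Hs. \<not> is_source \<Gamma> h} = card E"
proof -
 let ?S = "{h : Hs. is_source \<Gamma> h}" let ?T = "{h : Hs. \<not> is_source \<Gamma> h}"
 have "bij_betw Min E ?S"
 proof (rule bij_betw_byWitness[where f' = "edge_of \<Gamma>"])
  show "\<forall>h\<in>?S. Min (edge_of \<Gamma> h) = h" using Min_edge is_source_iff by auto
 qed (use edgesE edge_in in auto)
 from bij_betw_same_card[OF this] show 1: "card ?S = card E" by (rule HOL.sym)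
 have "bij_betw io ?S ?T" by (rule bij_betw_byWitness[where f' = io]) (use ribbon(4,6) is_source_iota in auto)
 from bij_betw_same_card[OF this] 1 show 2: "card ?T = card E" by (rule HOL.trans[OF HOL.sym])
 have "card (?S \<union> ?T) = card ?S + card ?T" using ribbon(1) by (intro card_Un_disjoint) auto
 moreover have "?S \<union> ?T = Hs" by blast
 ultimately have "card Hs = card ?S + card ?T" by simp
 then show "card Hs = 2 * card E" using 1 2 by simp
qed

text \<open>Each half-edge lies on exactly one face and each edge has exactly one target.\<close>

lemma sum_target_count: "(\<Sum>c\<in>C. target_count c) = card E"
proof -
 have "(\<Sum>c\<in>set cs. target_count c) = card {h : Hs. \<not> is_source \<Gamma> h}"
  unfolding target_count_def by (rule length_filter_concat_partition[OF ribbon(1)]) (use cs fl fl_Hs ex1_face in auto)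
 then show ?thesis using cs card_half_edges(3) by simp
qed

lemma insert_vt: "insert pt0 (vt ` Hs) = C" using pt_C vt(1) vt_C C_Hs by (auto simp: image_iff, metis subsetD)

section \<open>Prescribed face holonomies and gauge invariance\<close>

lemma hol_deg:
 assumes "cf : A"
 shows "set l \<subseteq> Hs ==> hol G (deg cf) l = inv (p [^] length (filter (%h. \<not> is_source \<Gamma> h) l)) \<otimes> hol G cf l"
proof (induction l)
 case (Cons h l)
 let ?n = "length (filter (%h. \<not> is_source \<Gamma> h) l)"
 have c: "cf h : carrier G" "hol G cf l : carrier G" "p [^] ?n : carrier G"
  using Cons.prems cfgD(1)[OF assms] p_carrier by (auto intro!: hol_closed)
 have ci: "central G (inv (p [^] ?n))" by (rule central_inv[OF central_pow[OF p]])
 have eq: "cf h \<otimes> (inv (p [^] ?n) \<otimes> hol G cf l) = inv (p [^] ?n) \<otimes> (cf h \<otimes> hol G cf l)"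
  by (rule central_mult_left_commute(1)[OF ci c(1,2)])
 have ip: "inv (p [^] Suc ?n) = inv p \<otimes> inv (p [^] ?n)" using p_carrier by (simp add: inv_mult_group)
 show ?case
 proof (cases "is_source \<Gamma> h")
  case True
  then show ?thesis using Cons eq c by (simp add: deg_def)
 next
  case False
  have IH: "hol G (deg cf) l = inv (p [^] ?n) \<otimes> hol G cf l" using Cons by simp
  have "deg cf h = inv p \<otimes> cf h" using False by (simp add: deg_def)
  then have "hol G (deg cf) (h # l) = inv p \<otimes> (cf h \<otimes> (inv (p [^] ?n) \<otimes> hol G cf l))"
   using IH c p_carrier by (simp add: m_assoc)
  also have "... = inv (p [^] Suc ?n) \<otimes> (cf h \<otimes> hol G cf l)"
   unfolding eq ip using c p_carrier by (simp add: m_assoc)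
  finally show ?thesis using False by simp
 qed
qed simp

definition degree_of where "degree_of c = (if c = pt0 then \<one> else inv (p [^] (2::nat)))"

lemma degree_of: "central G (degree_of c)" "degree_of c : carrier G"
proof -
 show "central G (degree_of c)" unfolding degree_of_def using central_inv[OF central_pow[OF p]] central_one by simp
 then show "degree_of c : carrier G" by (simp add: central_def)
qed

lemma D_eq:
 assumes "cf : A" "c : C"
 shows "D cf c = degree_of c \<longleftrightarrow> hol G cf (rev (fl c)) = face_value c"
proof -
 have pc: "p [^] target_count c : carrier G" using p_carrier by simp
 have hc: "hol G cf (rev (fl c)) : carrier G" using fl_Hs[OF assms(2)] cfgD(1)[OF assms(1)] by (auto intro!: hol_closed)
 have "D cf c = inv (p [^] target_count c) \<otimes> hol G cf (rev (fl c))"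
  unfolding D_def using hol_deg[OF assms(1), of "rev (fl c)"] fl_Hs[OF assms(2)]
  by (simp add: target_count_def rev_filter[symmetric])
 then show ?thesis using inv_solve_left'[OF hc[unfolded HOL.refl] pc degree_of(2)[of c]] pc hc degree_of(2)[of c]
  unfolding face_value_def degree_of_def[symmetric] by (metis inv_cancel_left)
qed

lemma cfg_subset: "cfg G io Hs Fs \<subseteq> A" unfolding cfg_def by auto

lemma Df_iff: "Df cf = restrict degree_of C \<longleftrightarrow> (\<forall>c\<in>C. D cf c = degree_of c)"
proof
 assume eq: "Df cf = restrict degree_of C"
 show "\<forall>c\<in>C. D cf c = degree_of c"
 proof
  fix c assume "c : C"
  then show "D cf c = degree_of c" using fun_cong[OF eq, of c] by (simp add: Df_def)
 qed
next
 assume "\<forall>c\<in>C. D cf c = degree_of c"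
 then show "Df cf = restrict degree_of C" unfolding Df_def by (intro restrict_ext) simp
qed

lemma Df_eq: "{cf : A. Df cf = restrict degree_of C} = {cf : cfg G io Hs Fs. hol G cf W0 = p [^] target_count pt0}"
proof -
 have "Df cf = restrict degree_of C \<longleftrightarrow> cf : cfg G io Hs Fs \<and> hol G cf W0 = p [^] target_count pt0"
  if cf: "cf : A" for cf
 proof -
  have "Df cf = restrict degree_of C \<longleftrightarrow> (\<forall>c\<in>C. D cf c = degree_of c)" by (rule Df_iff)
  also have "... \<longleftrightarrow> (\<forall>c\<in>set (pt0 # others). hol G cf (rev (fl c)) = face_value c)"
   using D_eq[OF cf] others(3) by blast
  also have "... \<longleftrightarrow> cf : cfg G io Hs Fs \<and> hol G cf W0 = p [^] target_count pt0"
   using cf p_carrier unfolding cfg_def by (auto simp: face_value_def)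
  finally show ?thesis .
 qed
 then show ?thesis using cfg_subset by blast
qed

lemma D_gauge:
 assumes "cf : A" "a : (\<Pi>\<^sub>E c\<in>C. carrier G)" and c: "c : C"
 shows "hol G (gauge G io vt Hs a cf) (rev (fl c)) = a c \<otimes> hol G cf (rev (fl c)) \<otimes> inv a c"
 by (rule hol_gauge[OF walk_vt[OF c]]) (use fl_Hs[OF c] cfgD(1)[OF assms(1)] vt(1) assms c in auto)

lemma conj_central_iff:
 assumes "x : carrier G" "h : carrier G" "central G z"
 shows "h \<otimes> x \<otimes> inv h = z \<longleftrightarrow> x = z"
proof -
 have z: "z : carrier G" "z \<otimes> h = h \<otimes> z" using assms by (auto simp: central_def)
 have "h \<otimes> x \<otimes> inv h = z \<longleftrightarrow> h \<otimes> x = z \<otimes> h"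
  using assms(1,2) z(1) inv_solve_right'[of "h \<otimes> x" z h] by (metis inv_solve_right m_closed)
 also have "... \<longleftrightarrow> x = z" unfolding z(2) using assms(1,2) z(1) by simp
 finally show ?thesis .
qed

text \<open>A gauge transformation conjugates each face holonomy by its value at the cilium, and the
  prescribed values are central.\<close>

lemma Df_gauge:
 assumes "cf : A" "a : (\<Pi>\<^sub>E c\<in>C. carrier G)"
 shows "Df (gauge G io vt Hs a cf) = restrict degree_of C \<longleftrightarrow> Df cf = restrict degree_of C"
proof -
 have g: "gauge G io vt Hs a cf : A" by (rule gauge_cfg[OF assms(1)]) (use assms vt(1) in auto)
 have "D (gauge G io vt Hs a cf) c = degree_of c \<longleftrightarrow> D cf c = degree_of c" if c: "c : C" for c
 proof -
  have "hol G cf (rev (fl c)) : carrier G" using fl_Hs[OF c] cfgD(1)[OF assms(1)] by (auto intro!: hol_closed)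
  moreover have "a c : carrier G" using assms c by auto
  ultimately show ?thesis unfolding D_eq[OF g c] D_eq[OF assms(1) c] D_gauge[OF assms c]
   by (rule conj_central_iff[OF _ _ central_face_value])
 qed
 then show ?thesis unfolding Df_iff by simp
qed

end

section \<open>The quotient of the homomorphism space\<close>

text \<open>Extensional homomorphisms are determined by their values on the finitely many
  generators, which lie in a finite group.\<close>

lemma (in group) finite_Hom_grp_presented:
 assumes "finite S" "finite (carrier G)"
 shows "finite (Hom_grp (presented_group S R) G)"
proof (rule finite_imageD)
 let ?r = "%f. \<lambda>s\<in>S. f (word_class S R [(s, True)])"
 have "?r ` Hom_grp (presented_group S R) G \<subseteq> (\<Pi>\<^sub>E s\<in>S. carrier G)"
  using hom_class(2) unfolding Hom_grp_def by fastforce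
 then show "finite (?r ` Hom_grp (presented_group S R) G)" by (rule finite_subset) (intro finite_PiE assms)
 show "inj_on ?r (Hom_grp (presented_group S R) G)"
 proof (rule inj_onI)
  fix f f' assume f: "f : Hom_grp (presented_group S R) G" and f': "f' : Hom_grp (presented_group S R) G"
   and eq: "?r f = ?r f'"
  have h: "f : hom (presented_group S R) G" "f' : hom (presented_group S R) G"
   using f f' unfolding Hom_grp_def by auto
  have gen: "f (word_class S R [(s, True)]) = f' (word_class S R [(s, True)])" if "s : S" for s
   using fun_cong[OF eq, of s] that by simp
  show "f = f'"
  proof (rule extensionalityI)
   show "f : extensional (carrier (presented_group S R))" "f' : extensional (carrier (presented_group S R))"
    using f f' unfolding Hom_grp_def by auto
   fix A assume "A : carrier (presented_group S R)"
   then obtain u where u: "u : words S" "A = word_class S R u" unfolding carrier_presented_group by blast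
   show "f A = f' A" unfolding u(2) hom_class(1)[OF h(1) u(1)] hom_class(1)[OF h(2) u(1)]
   proof (rule hol_cong)
    fix w assume "w : set u"
    then have "fst w : S" using u(1) unfolding words_def by auto
    from gen[OF this] show "letter_val G (%s. f (word_class S R [(s, True)])) w =
      letter_val G (%s. f' (word_class S R [(s, True)])) w"
     by (simp add: letter_val_def case_prod_beta)
   qed
  qed
 qed
qed

lemma hom_space_surface_ext:
 assumes "finite_group G"
 shows "hom_space G (surface_ext g) (surface_ext_central g)"
proof -
 interpret finite_group G by fact
 show ?thesis
 proof
  show "a \<otimes>\<^bsub>surface_ext g\<^esub> b : carrier (surface_ext g)"
   if "a : carrier (surface_ext g)" "b : carrier (surface_ext g)" for a b
   using that unfolding surface_ext_def carrier_presented_group by (auto simp: presented_group_mult words_append)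
  show "surface_ext_central g : carrier (surface_ext g)" by (rule surface_ext_central_carrier)
  show "finite (Hom_grp (surface_ext g) G)"
   unfolding surface_ext_def by (rule finite_Hom_grp_presented[OF _ fin]) (simp add: surface_gens_def)
 qed
qed

context hom_space
begin

definition fiber where "fiber z = {f : Hom_grp P G. f x0 = z}"

lemma carr_homogeneous:
 assumes z: "z : carrier G"
 shows "carr (homogeneous kG (\<Omega> :: ('k::field, _) vspace) (omega_coact P G x0) (bf z)) =
  {w : carr \<Omega>. \<forall>f\<in>Hom_grp P G. f \<notin> fiber z \<longrightarrow> w f = 0}"
proof -
 have "omega_coact P G x0 w = tens kG \<Omega> (bf z) w \<longleftrightarrow> (\<forall>f\<in>Hom_grp P G. f x0 ~= z \<longrightarrow> w f = 0)"
  if "w : carr \<Omega>" for w :: "_ => 'k"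
  by (rule homogeneous_iff[where D = "%f. f x0", OF has_basis_kG has_basis_\<Omega> lin_omega_coact _ z that])
   (use Hom_value omega_coact_basis in auto)
 then show ?thesis unfolding homogeneous_def fiber_def by auto
qed

lemma vspace_homogeneous:
 assumes z: "z : carrier G"
 shows "vspace (homogeneous kG (\<Omega> :: ('k::field, _) vspace) (omega_coact P G x0) (bf z))"
proof -
 interpret module "fscl :: 'k => _ => (_ => 'g) => 'k" using vector_space_fscl unfolding vector_space_def module_def .
 have "subspace {w : carr (\<Omega> :: ('k, _) vspace). \<forall>f\<in>Hom_grp P G. f \<notin> fiber z \<longrightarrow> w f = 0}"
  unfolding subspace_def using vspaceD(1,2,4)[OF vspace_\<Omega>[where 'a = 'k]] by (auto simp: fscl_def)
 then show ?thesis unfolding vspace_def carr_homogeneous[OF z] using vector_space_fscl by (simp add: homogeneous_def)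
qed

text \<open>The kernel of \<eta> is spanned by the elements h - \<eta>(h) 1 with h in the group, so
  the relations reduce to those comparing a single homomorphism with its conjugates.\<close>

lemma span_act:
 assumes z: "z : carrier G" and \<eta>: "lin kG ground \<eta>" "\<eta> (bf \<one>) = (1 :: 'k::field)"
 defines "S \<equiv> {basis_fun (hom_conj P G h f) - fscl (\<eta> (bf h)) (basis_fun f) | h f. h : carrier G \<and> f : fiber z}"
 shows "module.span (scl \<Omega>) {omega_act P G a v | a v. a : carr kG \<and> \<eta> a = 0 \<and>
  v : carr (homogeneous kG \<Omega> (omega_coact P G x0) (bf z))} = module.span (scl \<Omega>) S" (is "module.span _ ?T = _")
proof -
 interpret module "scl (\<Omega> :: ('k, _) vspace)"
  using vspaceD(14)[OF vspace_\<Omega>] unfolding vector_space_def module_def .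
 \<comment> \<open>\<open>B a\<close> is the action of a - \<eta>(a) 1. It agrees with the action of
   \<open>a\<close> on the kernel of \<eta> and is defined bilinearly for all \<open>a\<close>, so
   it can be expanded in group elements.\<close>
 define B where "B a v = omega_act P G a v - scl \<Omega> (\<eta> a) v" for a and v :: "_ => 'k"
 have bB: "bilin kG (\<Omega> :: ('k, _) vspace) \<Omega> B" unfolding B_def
 proof (rule bilinI)
  show "lin \<Omega> \<Omega> (%v. omega_act P G a v - scl \<Omega> (\<eta> a) v)" if "a : carr kG" for a :: "'g => 'k"
   by (intro lin_minus bilinD(1)[OF bilin_omega_act that] lin_scl lin_id vspace_\<Omega>)
  show "lin kG \<Omega> (%a. omega_act P G a v - scl \<Omega> (\<eta> a) v)" if "v : carr \<Omega>" for v :: "_ => 'k"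
   by (intro lin_minus bilinD(2)[OF bilin_omega_act that] lin_scl_left \<eta>(1) vspace_\<Omega> that)
 qed
 have BS: "B a v : span S" if a: "a : carr kG" and v: "v : carr (homogeneous kG \<Omega> (omega_coact P G x0) (bf z))" for a v
 proof -
  have v': "v : carr \<Omega>" "!!f. f : Hom_grp P G ==> f \<notin> fiber z ==> v f = 0"
   using v unfolding carr_homogeneous[OF z] by auto
  have "B a v = (\<Sum>f\<in>Hom_grp P G. scl \<Omega> (v f) (B a (basis_fun f)))"
   by (rule lin_basis_expand[OF has_basis_\<Omega> bilinD(1)[OF bB a] vspace_\<Omega> v'(1)])
  also have "... = (\<Sum>f\<in>Hom_grp P G. scl \<Omega> (v f) (\<Sum>h\<in>carrier G. scl \<Omega> (a h) (B (bf h) (basis_fun f))))"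
   by (intro sum.cong HOL.refl arg_cong[of _ _ "scl \<Omega> _"] lin_basis_expand[OF has_basis_kG bilinD(2)[OF bB basis_\<Omega>] vspace_\<Omega> a])
  also have "... : span S"
  proof (intro span_sum)
   fix f assume f: "f : Hom_grp P G"
   show "scl \<Omega> (v f) (\<Sum>h\<in>carrier G. scl \<Omega> (a h) (B (bf h) (basis_fun f))) : span S"
   proof (cases "f : fiber z")
    case True
    then have "B (bf h) (basis_fun f) : S" if "h : carrier G" for h
     unfolding S_def B_def omega_act_basis[OF that f] using that by auto
    then show ?thesis by (intro span_scale span_sum span_base)
   next
    case False
    show ?thesis unfolding v'(2)[OF f False] scale_zero_left by (rule span_zero)
   qed
  qed
  finally show ?thesis .
 qed
 have "omega_act P G a v : span S" if av: "a : carr kG" "\<eta> a = 0"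
  "v : carr (homogeneous kG \<Omega> (omega_coact P G x0) (bf z))" for a v
  using BS[OF av(1,3)] unfolding B_def av(2) scale_zero_left diff_zero .
 then have 1: "?T \<subseteq> span S" by blast
 have "w : ?T" if w: "w : S" for w
 proof -
  from w[unfolded S_def] obtain h f where hf: "h : carrier G" "f : fiber z"
   "w = basis_fun (hom_conj P G h f) - fscl (\<eta> (bf h)) (basis_fun f)" by (elim CollectE exE conjE)
  have f: "f : Hom_grp P G" using hf(2) by (simp add: fiber_def)
  let ?a = "bf h - scl kG (\<eta> (bf h)) (bf \<one>)"
  note k = bf_kG[OF hf(1)] bf_kG[OF one_closed] vspaceD(4)[OF vspace_kG bf_kG[OF one_closed]]
  have "?a : carr kG" by (rule vspaceD(3)[OF vspace_kG k(1,3)])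
  moreover have "\<eta> ?a = 0"
   unfolding lin_diff[OF \<eta>(1) vspace_kG vspace_ground k(1,3)] linD(3)[OF \<eta>(1) k(2)] \<eta>(2) by simp
  moreover have "omega_act P G ?a (basis_fun f) = w"
   unfolding lin_diff[OF bilinD(2)[OF bilin_omega_act basis_\<Omega>[OF f]] vspace_kG vspace_\<Omega> k(1,3)]
    linD(3)[OF bilinD(2)[OF bilin_omega_act basis_\<Omega>[OF f]] k(2)] omega_act_basis[OF hf(1) f]
    omega_act_basis[OF one_closed f] hom_conj_one[OF f] hf(3) by simp
  moreover have "basis_fun f : carr (homogeneous kG \<Omega> (omega_coact P G x0) (bf z))"
   unfolding carr_homogeneous[OF z] using hf(2) basis_\<Omega>[OF f] by (auto simp: basis_fun_def)
  ultimately show ?thesis by (intro CollectI exI[of _ ?a] exI[of _ "basis_fun f"] conjI HOL.sym[of _ w])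
 qed
 then have 2: "S \<subseteq> span ?T" using span_superset by blast
 show ?thesis using span_minimal[OF 1 subspace_span] span_minimal[OF 2 subspace_span] by blast
qed

end

section \<open>The protected space\<close>

context kitaev_config
begin

lemma fin_group: "finite_group G" by unfold_locales

definition pt_configs where "pt_configs = {cf : A. Df cf = restrict degree_of C}"

text \<open>Cilia, vertices and faces are equally many, which turns the count of the normal form
  into the genus formula.\<close>

lemma card_identity:
 assumes "2 * card C + 2 * length Fs + 4 * n = card Hs + 2"
 shows "n = genus \<Gamma>" "card E + 2 = 2 * card C + 2 * n"
proof -
 have "length Fs + 1 = card C" using others distinct_card[OF others(4)] by simp
 then show e: "card E + 2 = 2 * card C + 2 * n" using assms card_half_edges(1) by simp
 have "card (vertices \<Gamma>) = card C" using bij_betw_same_card[OF bij_C] by simp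
 moreover have "card (faces \<Gamma>) = card C"
  using K bij_betw_same_card[of "%c. face_of \<Gamma> (rho_inv \<Gamma> c)" C "faces \<Gamma>"] unfolding kitaev_graph_def by simp
 ultimately have "int (card (vertices \<Gamma>)) - int (card E) + int (card (faces \<Gamma>)) = 2 * (1 - int n)"
  using e by simp
 then show "n = genus \<Gamma>" unfolding genus_def by simp
qed

text \<open>The normal form says that the holonomy of the base face times all other face values is
  the product of commutators. The exponents of \<open>p\<close> add up to |E| - 2(|V| - 1) = 2g, so
  the condition at the base face holds if and only if that product is p^(2g).\<close>

lemma solution:
 "\<exists>\<Theta> \<tau>. bij_betw (%cf. (\<Theta> cf, \<tau> cf)) pt_configs
   (pairs_with_product G (genus \<Gamma>) (p [^] (2 * genus \<Gamma>)) \<times> based_maps G C pt0) \<and>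
  (\<forall>cf\<in>pt_configs. \<forall>a\<in>(\<Pi>\<^sub>E c\<in>C. carrier G).
   \<Theta> (gauge G io vt Hs a cf) = map (map_prod (conj_by G (a pt0)) (conj_by G (a pt0))) (\<Theta> cf) \<and>
   (\<forall>c\<in>C. \<tau> (gauge G io vt Hs a cf) c = a pt0 \<otimes> \<tau> cf c \<otimes> inv a c)) \<and>
  card E + 2 = 2 * card C + 2 * genus \<Gamma>"
proof -
 have "\<forall>(F, z)\<in>set Fs. central G z" using central_face_value by auto
 from surface_solution[OF surface_words_graph this] obtain n \<Theta> \<tau> where
  s: "solves G io vt pt0 W0 Fs n \<Theta> \<tau>" by blast
 let ?X = "cfg G io Hs Fs"
 note s' = s[unfolded solves_def Let_def letters insert_vt]
 have bij: "bij_betw (%cf. (\<Theta> cf, \<tau> cf)) ?X (pair_lists G n \<times> based_maps G C pt0)"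
  and prod: "!!cf. cf : ?X ==> hol G cf W0 \<otimes> foldr (%q. (\<otimes>) (snd q)) Fs \<one> = comm_prod G (\<Theta> cf)"
  and equi: "!!cf a. cf : ?X ==> a : C \<rightarrow> carrier G ==>
   \<Theta> (gauge G io vt Hs a cf) = map (map_prod (conj_by G (a pt0)) (conj_by G (a pt0))) (\<Theta> cf) \<and>
   (\<forall>c\<in>C. \<tau> (gauge G io vt Hs a cf) c = a pt0 \<otimes> \<tau> cf c \<otimes> inv a c)"
  and cnt: "2 * card C + 2 * length Fs + 4 * n = card Hs + 2" using s' by blast+
 note n = card_identity[OF cnt]
 let ?T = "\<Sum>c\<in>C. target_count c"
 have pc: "p [^] (k :: nat) : carrier G" for k using p_carrier by simp
 \<comment> \<open>The factor with exponent \<open>2 * length xs\<close> clears the inverses of p^2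
   in the face values, so that only natural exponents occur.\<close>
 have fold: "foldr (%q. (\<otimes>) (snd q)) (map (%c. (rev (fl c), face_value c)) xs) \<one> \<otimes> p [^] (2 * length xs) =
   p [^] (\<Sum>c\<in>set xs. target_count c) \<and>
   foldr (%q. (\<otimes>) (snd q)) (map (%c. (rev (fl c), face_value c)) xs) \<one> : carrier G"
  if "distinct xs" "pt0 \<notin> set xs" for xs using that
 proof (induction xs)
  case (Cons c xs)
  let ?f = "foldr (%q. (\<otimes>) (snd q)) (map (%c. (rev (fl c), face_value c)) xs) \<one>"
  have f: "?f : carrier G" "?f \<otimes> p [^] (2 * length xs) = p [^] (\<Sum>c\<in>set xs. target_count c)" using Cons by auto
  have fv: "face_value c = p [^] target_count c \<otimes> inv (p [^] (2::nat))"
   using Cons.prems by (auto simp: face_value_def)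
  have "p [^] (2 * length (c # xs)) = p [^] (2::nat) \<otimes> p [^] (2 * length xs)"
   using nat_pow_mult[OF p_carrier, of 2 "2 * length xs"] by simp
  moreover have "?f \<otimes> (p [^] (2::nat) \<otimes> p [^] (2 * length xs)) = p [^] (2::nat) \<otimes> (?f \<otimes> p [^] (2 * length xs))"
   by (rule central_mult_left_commute(1)[OF central_pow[OF p] f(1) pc])
  ultimately have "face_value c \<otimes> ?f \<otimes> p [^] (2 * length (c # xs)) =
    p [^] target_count c \<otimes> p [^] (\<Sum>c\<in>set xs. target_count c)"
   using f pc fv by (simp add: m_assoc)
  also have "... = p [^] (\<Sum>c\<in>set (c # xs). target_count c)"
   using Cons.prems nat_pow_mult[OF p_carrier] by simp
  finally have "face_value c \<otimes> ?f \<otimes> p [^] (2 * length (c # xs)) = p [^] (\<Sum>c\<in>set (c # xs). target_count c)" .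
  moreover have "face_value c : carrier G" using fv pc by simp
  ultimately show ?case using f(1) by simp
 qed (use p_carrier in simp)
 let ?f = "foldr (%q. (\<otimes>) (snd q)) Fs \<one>"
 let ?m = "p [^] (\<Sum>c\<in>set others. target_count c)" and ?l = "p [^] (2 * length others)"
 have f: "?f : carrier G" "?f \<otimes> ?l = ?m" using fold[OF others(2)] others(1) by auto
 have total: "p [^] target_count pt0 \<otimes> ?m = p [^] (2 * n) \<otimes> ?l"
 proof -
  have "target_count pt0 + (\<Sum>c\<in>set others. target_count c) = ?T"
   unfolding others(1) using sum.remove[OF fin_C pt_C, of target_count] by simp
  moreover have "length others + 1 = card C" using distinct_card[OF others(4)] others(3) by simp
  ultimately have "target_count pt0 + (\<Sum>c\<in>set others. target_count c) = 2 * n + 2 * length others"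
   using sum_target_count n(2) by simp
  then show ?thesis unfolding nat_pow_mult[OF p_carrier] by simp
 qed
 have char: "hol G cf W0 = p [^] target_count pt0 \<longleftrightarrow> comm_prod G (\<Theta> cf) = p [^] (2 * n)" if cf: "cf : ?X" for cf
 proof -
  have h: "hol G cf W0 : carrier G" using fl_Hs[OF pt_C] cfgD(1)[OF cf] by (auto intro!: hol_closed)
  have "comm_prod G (\<Theta> cf) = p [^] (2 * n) \<longleftrightarrow> hol G cf W0 \<otimes> ?f \<otimes> ?l = p [^] (2 * n) \<otimes> ?l"
   unfolding prod[OF cf, symmetric] using h f(1) pc by simp
  also have "... \<longleftrightarrow> hol G cf W0 \<otimes> ?m = p [^] target_count pt0 \<otimes> ?m"
   unfolding total using h f pc by (simp add: m_assoc)
  also have "... \<longleftrightarrow> hol G cf W0 = p [^] target_count pt0" using h pc by simp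
  finally show ?thesis by blast
 qed
 have pX: "pt_configs = {cf : ?X. comm_prod G (\<Theta> cf) = p [^] (2 * n)}"
  unfolding pt_configs_def Df_eq using char by blast
 have "bij_betw (%cf. (\<Theta> cf, \<tau> cf)) pt_configs (pairs_with_product G n (p [^] (2 * n)) \<times> based_maps G C pt0)"
 proof (rule bij_betw_imageI)
  show "inj_on (%cf. (\<Theta> cf, \<tau> cf)) pt_configs"
   using bij_betw_imp_inj_on[OF bij] pX by (auto intro: inj_on_subset)
  show "(%cf. (\<Theta> cf, \<tau> cf)) ` pt_configs = pairs_with_product G n (p [^] (2 * n)) \<times> based_maps G C pt0"
  proof
   show "(%cf. (\<Theta> cf, \<tau> cf)) ` pt_configs \<subseteq> pairs_with_product G n (p [^] (2 * n)) \<times> based_maps G C pt0"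
    using bij_betw_apply[OF bij] unfolding pX pairs_with_product_def by auto
   show "pairs_with_product G n (p [^] (2 * n)) \<times> based_maps G C pt0 \<subseteq> (%cf. (\<Theta> cf, \<tau> cf)) ` pt_configs"
   proof clarify
    fix qs t assume q: "qs : pairs_with_product G n (p [^] (2 * n))" "t : based_maps G C pt0"
    then have "(qs, t) : (%cf. (\<Theta> cf, \<tau> cf)) ` ?X"
     unfolding bij_betw_imp_surj_on[OF bij] by (auto simp: pairs_with_product_def)
    then obtain cf where "cf : ?X" "\<Theta> cf = qs" "\<tau> cf = t" by auto
    moreover from this have "cf : pt_configs" unfolding pX using q(1) by (simp add: pairs_with_product_def)
    ultimately show "(qs, t) : (%cf. (\<Theta> cf, \<tau> cf)) ` pt_configs" by force
   qed
  qed
 qed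
 moreover have "cf : ?X" if "cf : pt_configs" for cf using that unfolding pX by simp
 moreover have "a : C \<rightarrow> carrier G" if "a : (\<Pi>\<^sub>E c\<in>C. carrier G)" for a :: "'h => 'g" using that by auto
 ultimately show ?thesis using equi n by (intro exI[of _ \<Theta>] exI[of _ \<tau>]) simp
qed

end

section \<open>Scalars of gauges and the comparison with \<Omega>\<close>

context kitaev_config
begin

abbreviation \<kappa> where "\<kappa> x \<equiv> \<chi> (bf x)"

definition zeta where
 "zeta c = (if c = pt0 then hcounit kG else \<chi> [^]\<^bsub>characters kG\<^esub> (2 :: int))"

lemma zeta_bf: "x : carrier G ==> zeta c (bf x) = (if c = pt0 then 1 else \<kappa> x ^ 2)"
 unfolding zeta_def using characters_int_pow_bf(1)[OF \<chi>] by simp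

lemma lin_zeta: "lin kG ground (zeta c)"
 unfolding zeta_def by (simp add: lin_hcounit charactersD(2)[OF characters_int_pow_closed[OF \<chi>]])

text \<open>The scalar by which the gauge \<open>b\<close> acts on the tensor product of the lines;
  \<open>sc\<close> is its counterpart on configurations. Both are multiplicative in the
  gauge.\<close>

definition wt where "wt b = (\<Prod>c\<in>C. zeta c (bf (b c)))"

lemma sc_wt_mult:
 assumes "!!c. c : C ==> b c : carrier G" "!!c. c : C ==> b' c : carrier G"
 shows "sc (%c. b c \<otimes> b' c) = sc b * sc b'" "wt (%c. b c \<otimes> b' c) = wt b * wt b'"
proof -
 show "sc (%c. b c \<otimes> b' c) = sc b * sc b'" unfolding sc_def prod.distrib[symmetric]
  by (rule prod.cong) (use assms vt(1) charactersD(4)[OF \<chi>] in auto)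
 show "wt (%c. b c \<otimes> b' c) = wt b * wt b'" unfolding wt_def prod.distrib[symmetric]
 proof (rule prod.cong[OF HOL.refl])
  fix c assume c: "c : C"
  show "zeta c (bf (b c \<otimes> b' c)) = zeta c (bf (b c)) * zeta c (bf (b' c))"
   using assms[OF c] charactersD(4)[OF \<chi> assms[OF c]] by (simp add: zeta_bf power_mult_distrib)
 qed
qed

lemma sc_wt_nonzero:
 assumes "!!c. c : C ==> b c : carrier G"
 shows "sc b ~= 0" "wt b ~= 0"
 unfolding sc_def wt_def using assms vt(1) charactersD(5)[OF \<chi>] ribbon(1) fin_C by (auto simp: zeta_bf)

lemma sc_wt_cong:
 assumes "!!c. c : C ==> b c = b' c"
 shows "sc b = sc b'" "wt b = wt b'" unfolding sc_def wt_def using assms vt(1) by (auto intro!: prod.cong)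

lemma sc_wt_one: "sc (%_. \<one>) = 1" "wt (%_. \<one>) = 1"
 unfolding sc_def wt_def using charactersD(3)[OF \<chi>] by (auto simp: zeta_bf intro!: prod.neutral)

lemma sc_wt_inv:
 assumes b: "!!c. c : C ==> b c : carrier G"
 shows "sc (%c. inv b c) = inverse (sc b)" "wt (%c. inv b c) = inverse (wt b)"
proof -
 have i: "!!c. c : C ==> inv b c : carrier G" using b by simp
 have "sc b * sc (%c. inv b c) = sc (%c. b c \<otimes> inv b c)" "wt b * wt (%c. inv b c) = wt (%c. b c \<otimes> inv b c)"
  using sc_wt_mult[of b "%c. inv b c", OF b i] by simp_all
 moreover have "sc (%c. b c \<otimes> inv b c) = 1" "wt (%c. b c \<otimes> inv b c) = 1"
  using sc_wt_cong[of "%c. b c \<otimes> inv b c" "%_. \<one>"] sc_wt_one b by simp_all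
 ultimately show "sc (%c. inv b c) = inverse (sc b)" "wt (%c. inv b c) = inverse (wt b)"
  using inverse_unique[of "sc b" "sc (%c. inv b c)"] inverse_unique[of "wt b" "wt (%c. inv b c)"] by simp_all
qed

text \<open>The sources contribute \<chi>(h) once per edge, the lines at the cilia other than
  \<open>pt\<close> contribute \<chi>(h)^2 each; by the Euler count the surplus is the exponent
  2n.\<close>

lemma sc_const:
 assumes h: "h : carrier G" and e: "card E + 2 = 2 * card C + 2 * n"
 shows "sc (%_. h) = \<kappa> h ^ (2 * n) * wt (%_. h)"
proof -
 have "sc (%_. h) = (\<Prod>u\<in>{u : Hs. is_source \<Gamma> u}. \<kappa> h)"
  unfolding sc_def by (rule prod.inter_filter[symmetric, OF ribbon(1)])
 then have 1: "sc (%_. h) = \<kappa> h ^ card E" by (simp add: card_half_edges)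
 have "wt (%_. h) = zeta pt0 (bf h) * (\<Prod>c\<in>C - {pt0}. zeta c (bf h))"
  unfolding wt_def by (rule prod.remove[OF fin_C pt_C])
 also have "(\<Prod>c\<in>C - {pt0}. zeta c (bf h)) = (\<Prod>c\<in>C - {pt0}. \<kappa> h ^ 2)"
  by (rule prod.cong) (simp_all add: zeta_bf[OF h])
 finally have 2: "wt (%_. h) = \<kappa> h ^ (2 * card (C - {pt0}))" by (simp add: zeta_bf[OF h] power_mult)
 have "card (C - {pt0}) + 1 = card C" using card.remove[OF fin_C pt_C] by simp
 then have "card E = 2 * n + 2 * card (C - {pt0})" using e by linarith
 then show ?thesis unfolding 1 2 by (simp only: power_add)
qed

text \<open>A configuration is labelled by the homomorphism of its handle holonomies, and the
  section consists of the configurations with trivial transports. The gauge \<open>\<tau> cf\<close>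
  moves \<open>cf\<close> to the section and keeps the label, being trivial at \<open>pt\<close>. A
  constant gauge preserves the section and conjugates labels; these gauges produce the relations
  with \<chi>^(-2g).\<close>

theorem protected_space_isomorphic:
 defines "g \<equiv> genus \<Gamma>"
 shows "lin_isomorphic (protected_space kG M (bf p) \<chi> \<Gamma> (line kG (hone kG) (hcounit kG)))
  (twisted_coinvariants kG (omega (surface_ext g) G) (omega_act (surface_ext g) G)
   (omega_coact (surface_ext g) G (surface_ext_central g))
   (bf p [^]\<^bsub>grouplikes kG\<^esub> (2 * g)) (\<chi> [^]\<^bsub>characters kG\<^esub> (- (2 * int g))))"
proof -
 let ?P = "surface_ext g" and ?x = "surface_ext_central g"
 let ?\<Omega> = "omega ?P G :: ('k, _) vspace"
 let ?I = "\<Pi>\<^sub>E c\<in>C. carrier G"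
 let ?T = "%a. gauge G io vt Hs a"
 define z where "z = p [^] (2 * g)"
 define \<eta> where "\<eta> = \<chi> [^]\<^bsub>characters kG\<^esub> (- (2 * int g))"
 have z: "central G z" "z : carrier G" and z0: "g = 0 ==> z = \<one>"
  using central_pow[OF p, of "2 * g"] p_carrier unfolding z_def by simp_all
 have \<eta>: "\<eta> (bf h) = inverse (\<kappa> h ^ (2 * g))" if "h : carrier G" for h
  unfolding \<eta>_def by (rule characters_int_pow_bf(2)[OF \<chi> that])
 have lin_\<eta>: "lin kG ground \<eta>" "\<eta> (bf \<one>) = 1"
  unfolding \<eta>_def by (rule charactersD(2,3)[OF characters_int_pow_closed[OF \<chi>]])+
 interpret hs: hom_space G ?P ?x by (rule hom_space_surface_ext[OF fin_group])
 interpret ln: line_family G C degree_of zeta by unfold_locales (use fin_C degree_of(2) lin_zeta in auto)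
 have HC: "HG = mtensor C (%_. kG)" by (simp add: graph_hopf_def)
 have wt: "ln.weight (dC a) = wt a" if "a : ?I" for a unfolding dC_def wt_def by (rule ln.weight_basis[OF that])
 have BN: "has_basis N A bE coW" by (rule has_basis_cong[OF BW]) simp_all
 have tN: "HG \<boxtimes> N = HG \<boxtimes> W" "tens HG N = tens HG W"
 proof -
  show "tens HG N = tens HG W" by (rule tens_cong) simp_all
  then show "HG \<boxtimes> N = HG \<boxtimes> W" by (simp add: tensor_def)
 qed
 have q: "restrict degree_of C : ?I" using degree_of(2) by simp
 have gA: "?T a cf : A" if "a : ?I" "cf : A" for a cf
  by (rule gauge_cfg[OF that(2)]) (use that(1) vt(1) in auto)
 interpret mb: monomial_bitensor HG ln.RL N ?I dC coH A bE coW ln.unit_vec "%_. ln.coL" "restrict degree_of C" Df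
  ln.weight sc ?T
 proof
  show "has_basis HG ?I dC coH" by (rule BH)
  show "has_basis N A bE coW" by (rule BN)
  show "has_basis ln.RL {()} (%_. ln.unit_vec) (%_. ln.coL)" by (rule ln.has_basis_RL)
  show "lin N (HG \<boxtimes> N) (lmc_coact N)"
  proof -
   have "lin W (HG \<boxtimes> W) (lmc_coact N)"
    using lin_cong[where f = "lmc_coact N" and g = coN and W = "HG \<boxtimes> W", OF lmc_coact_N vW] lin_coN by simp
   then show ?thesis unfolding tN lin_def by simp
  qed
  show "Df cf : ?I \<and> lmc_coact N (bE cf) = tens HG N (dC (Df cf)) (bE cf)" if "cf : A" for cf
   unfolding tN lmc_coact_N[OF bE_carr[OF that]] using Df_PiE[OF that] coN_bE[OF that] by blast
  show "lin ln.RL (ln.RL \<boxtimes> HG) (rmc_coact ln.RL)" unfolding HC by (rule ln.rmc_coact_RL(1))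
  show "restrict degree_of C : ?I" by (rule q)
  have "(\<lambda>c\<in>C. bf (restrict degree_of C c)) = (\<lambda>c\<in>C. bf (degree_of c) :: 'g => 'k)" by (rule restrict_ext) simp
  then show "rmc_coact ln.RL ln.unit_vec = tens ln.RL HG ln.unit_vec (dC (restrict degree_of C))"
   unfolding HC dC_def using ln.rmc_coact_RL(2) by simp
  show "lin HG ground ln.weight" unfolding HC by (rule ln.lin_weight)
  show "rmc_act ln.RL x a = scl ln.RL (ln.weight a) x" if "x : carr ln.RL" "a : carr HG" for x a
   by (rule ln.rmc_act_RL) (use that HC in simp_all)
  show "bilin HG N N (lmc_act N)" using bilin_lmc_act unfolding bilin_def lin_def by simp
  show "lmc_act N (dC a) (bE cf) = scl N (sc a) (bE (?T a cf))" if "a : ?I" "cf : A" for a cf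
   using lmc_act_bE[OF that] by simp
  show "?T a cf : A" if "a : ?I" "cf : A" for a cf by (rule gA[OF that])
  show "Df (?T a cf) = restrict degree_of C \<longleftrightarrow> Df cf = restrict degree_of C" if "a : ?I" "cf : A" for a cf
   by (rule Df_gauge[OF that(2,1)])
 qed
 obtain \<Theta> \<tau> where bij: "bij_betw (%cf. (\<Theta> cf, \<tau> cf)) pt_configs (pairs_with_product G g z \<times> based_maps G C pt0)"
  and equi: "!!cf a. cf : pt_configs ==> a : ?I ==>
   \<Theta> (?T a cf) = map (map_prod (conj_by G (a pt0)) (conj_by G (a pt0))) (\<Theta> cf) \<and>
   (\<forall>c\<in>C. \<tau> (?T a cf) c = a pt0 \<otimes> \<tau> cf c \<otimes> inv a c)"
  and e: "card E + 2 = 2 * card C + 2 * g" using solution unfolding g_def z_def by blast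
 have mem: "cf : pt_configs \<longleftrightarrow> cf : A \<and> Df cf = restrict degree_of C" for cf by (simp add: pt_configs_def)
 have Tpt: "?T a cf : pt_configs" if "cf : pt_configs" "a : ?I" for a cf
  using that gA Df_gauge unfolding mem by blast
 have \<Theta>: "\<Theta> cf : pairs_with_product G g z" and \<tau>: "\<tau> cf : based_maps G C pt0" if "cf : pt_configs" for cf
  using bij_betw_apply[OF bij that] by auto
 have \<tau>c: "\<tau> cf c : carrier G" if "cf : pt_configs" "c : C" for cf c
  using \<tau>[OF that(1)] that(2) unfolding based_maps_def by auto
 have \<tau>pt: "\<tau> cf pt0 = \<one>" if "cf : pt_configs" for cf using \<tau>[OF that] by (simp add: based_maps_def)
 have uniq: "cf = cf'" if "cf : pt_configs" "cf' : pt_configs" "\<Theta> cf = \<Theta> cf'" "!!c. c : C ==> \<tau> cf c = \<tau> cf' c" for cf cf'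
 proof -
  have "\<tau> cf = \<tau> cf'"
  proof (rule extensionalityI)
   show "\<tau> cf : extensional C" "\<tau> cf' : extensional C"
    using \<tau>[OF that(1)] \<tau>[OF that(2)] unfolding based_maps_def PiE_def by auto
  qed (rule that(4))
  then show ?thesis using inj_onD[OF bij_betw_imp_inj_on[OF bij], of cf cf'] that(1-3) by simp
 qed
 let ?hom = "hom_of_pairs G g z"
 have hb: "bij_betw ?hom (pairs_with_product G g z) (homs_with_value G g z)"
  by (rule bij_betw_hom_of_pairs[OF z(1)]) (rule z0)
 have H0: "homs_with_value G g z = hs.fiber z" unfolding homs_with_value_def hs.fiber_def ..
 define \<phi> where "\<phi> cf = ?hom (\<Theta> cf)" for cf
 \<comment> \<open>Balancing with the gauge \<open>\<tau> cf\<close> identifies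
   \<open>wt (\<tau> cf)\<close> times \<open>cf\<close> with \<open>sc (\<tau> cf)\<close> times
   its representative on the section, whence the quotient.\<close>
 define s where "s cf = sc (\<tau> cf) / wt (\<tau> cf)" for cf
 define sec where "sec f = inv_into pt_configs (%cf. (\<Theta> cf, \<tau> cf))
  (inv_into (pairs_with_product G g z) ?hom f, \<lambda>c\<in>C. \<one>)" for f
 have \<phi>: "\<phi> cf : hs.fiber z" if "cf : pt_configs" for cf
  unfolding \<phi>_def H0[symmetric] by (rule bij_betw_apply[OF hb \<Theta>[OF that]])
 have sec: "sec f : pt_configs" "\<phi> (sec f) = f" "!!c. c : C ==> \<tau> (sec f) c = \<one>" if f: "f : hs.fiber z" for f
 proof -
  let ?qs = "inv_into (pairs_with_product G g z) ?hom f"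
  have f': "f : ?hom ` pairs_with_product G g z" using f bij_betw_imp_surj_on[OF hb] unfolding H0 by simp
  have "(?qs, \<lambda>c\<in>C. \<one>) : pairs_with_product G g z \<times> based_maps G C pt0"
   using inv_into_into[OF f'] pt_C by (auto simp: based_maps_def)
  then have im: "(?qs, \<lambda>c\<in>C. \<one>) : (%cf. (\<Theta> cf, \<tau> cf)) ` pt_configs" using bij by (simp add: bij_betw_def)
  show "sec f : pt_configs" unfolding sec_def by (rule inv_into_into[OF im])
  have eq: "(\<Theta> (sec f), \<tau> (sec f)) = (?qs, \<lambda>c\<in>C. \<one>)"
   unfolding sec_def by (rule f_inv_into_f[OF im])
  then show "\<phi> (sec f) = f" unfolding \<phi>_def using f_inv_into_f[OF f'] by simp
  show "\<tau> (sec f) c = \<one>" if "c : C" for c using eq that by simp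
 qed
 have \<phi>T: "\<phi> (?T a cf) = hom_conj ?P G (a pt0) (\<phi> cf)" if "cf : pt_configs" "a : ?I" for a cf
  unfolding \<phi>_def conjunct1[OF equi[OF that]]
  by (rule hom_of_pairs_conj[OF \<Theta>[OF that(1)] z(1)]) (use that(2) pt_C in auto)
 have inj: "cf = cf'" if "cf : pt_configs" "cf' : pt_configs" "\<phi> cf = \<phi> cf'" "!!c. c : C ==> \<tau> cf c = \<tau> cf' c" for cf cf'
  by (rule uniq[OF that(1,2) inj_onD[OF bij_betw_imp_inj_on[OF hb] that(3)[unfolded \<phi>_def] \<Theta>[OF that(1)] \<Theta>[OF that(2)]] that(4)])
 have conj_fiber: "hom_conj ?P G h f : hs.fiber z" if "h : carrier G" "f : hs.fiber z" for h f
 proof -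
  have "(\<lambda>c\<in>C. h) : ?I" using that by simp
  from \<phi>[OF Tpt[OF sec(1)[OF that(2)] this]] show ?thesis
   using \<phi>T[OF sec(1)[OF that(2)] \<open>(\<lambda>c\<in>C. h) : ?I\<close>] sec(2)[OF that(2)] pt_C by simp
 qed
 let ?S = "{basis_fun (hom_conj ?P G h f) - fscl (\<eta> (bf h)) (basis_fun f) | h f. h : carrier G \<and> f : hs.fiber z}"
 let ?V = "homogeneous kG ?\<Omega> (omega_coact ?P G ?x) (bf z)"
 let ?U = "module.span (scl ?\<Omega>) {omega_act ?P G a v | a v. a : carr kG \<and> \<eta> a = 0 \<and> v : carr ?V}"
 have L: "(%c. if c = pt0 then line kG (hone kG) (hcounit kG)
   else line kG (bf p [^]\<^bsub>grouplikes kG\<^esub> (- 2 :: int)) (\<chi> [^]\<^bsub>characters kG\<^esub> (2 :: int))) = ln.L"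
 proof
  fix c
  have "p [^] (- 2 :: int) = inv (p [^] (2 :: nat))" using int_pow_neg_int[OF p_carrier, of 2] by simp
  then show "(if c = pt0 then line kG (hone kG) (hcounit kG)
    else line kG (bf p [^]\<^bsub>grouplikes kG\<^esub> (- 2 :: int)) (\<chi> [^]\<^bsub>characters kG\<^esub> (2 :: int))) = ln.L c"
   by (simp add: degree_of_def zeta_def grouplikes_int_pow[OF p_carrier])
 qed
 have "lin_isomorphic (bitensor HG HG ln.RL N) (quotient_image ?V ?U)"
 proof (rule mb.bitensor_isomorphic[where B' = ?\<Omega> and v = basis_fun and cov = "%f w. w f" and H = "Hom_grp ?P G"
    and ?H0.0 = "hs.fiber z" and S = ?S and g = sec and \<phi> = \<phi> and s = s])
  show "has_basis ?\<Omega> (Hom_grp ?P G) basis_fun (%f w. w f)" by (rule hs.has_basis_\<Omega>)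
  show "hs.fiber z \<subseteq> Hom_grp ?P G" unfolding hs.fiber_def by blast
  show "carr ?V = {w : carr ?\<Omega>. \<forall>f\<in>Hom_grp ?P G. f \<notin> hs.fiber z \<longrightarrow> w f = 0}"
   by (rule hs.carr_homogeneous[OF z(2)])
  show "scl ?V = scl ?\<Omega>" by (simp add: homogeneous_def)
  show "vspace ?V" by (rule hs.vspace_homogeneous[OF z(2)])
  show U: "?U = module.span (scl ?\<Omega>) ?S" by (rule hs.span_act[OF z(2) lin_\<eta>])
  show "\<exists>f\<in>hs.fiber z. \<exists>f'\<in>hs.fiber z. \<exists>i\<in>?I. \<exists>c. w = basis_fun f' - scl ?\<Omega> c (basis_fun f) \<and>
    sec f' = ?T i (sec f) \<and> ln.weight (dC i) = c * sc i \<and> sc i ~= 0" if w: "w : ?S" for w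
  proof -
   from w obtain h f where hf: "h : carrier G" "f : hs.fiber z"
    "w = basis_fun (hom_conj ?P G h f) - fscl (\<eta> (bf h)) (basis_fun f)" by (elim CollectE exE conjE)
   let ?i = "\<lambda>c\<in>C. h" and ?f' = "hom_conj ?P G h f"
   have i: "?i : ?I" using hf(1) by simp
   have f': "?f' : hs.fiber z" by (rule conj_fiber[OF hf(1,2)])
   note sf = sec[OF hf(2)]
   have "sec ?f' = ?T ?i (sec f)"
   proof (rule inj[OF sec(1)[OF f'] Tpt[OF sf(1) i]])
    show "\<phi> (sec ?f') = \<phi> (?T ?i (sec f))"
     unfolding \<phi>T[OF sf(1) i] sec(2)[OF f'] sf(2) using pt_C by simp
    show "\<tau> (sec ?f') c = \<tau> (?T ?i (sec f)) c" if "c : C" for c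
     using conjunct2[OF equi[OF sf(1) i]] that sf(3)[OF that] sec(3)[OF f' that] pt_C hf(1) by simp
   qed
   moreover have "ln.weight (dC ?i) = \<eta> (bf h) * sc ?i"
   proof -
    have "wt ?i = wt (%_. h)" "sc ?i = sc (%_. h)" using sc_wt_cong[of ?i "%_. h"] by auto
    then show ?thesis
     unfolding wt[OF i] \<eta>[OF hf(1)] using sc_const[OF hf(1) e] charactersD(5)[OF \<chi> hf(1)] by simp
   qed
   moreover have "sc ?i ~= 0" by (rule sc_wt_nonzero(1)) (use hf(1) in simp)
   moreover have "w = basis_fun ?f' - scl ?\<Omega> (\<eta> (bf h)) (basis_fun f)" using hf(3) by simp
   ultimately show ?thesis by (intro bexI[OF _ hf(2)] bexI[OF _ f'] bexI[OF _ i] exI[of _ "\<eta> (bf h)"] conjI)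
  qed
  show "\<phi> cf : hs.fiber z" if "cf : A" "Df cf = restrict degree_of C" for cf
   by (rule \<phi>) (use that mem in simp)
  show "sec f : A \<and> Df (sec f) = restrict degree_of C \<and> \<phi> (sec f) = f \<and> s (sec f) = 1" if f: "f : hs.fiber z" for f
  proof -
   have "s (sec f) = 1"
    unfolding s_def using sc_wt_cong[of "\<tau> (sec f)" "%_. \<one>", OF sec(3)[OF f]] sc_wt_one by simp
   then show ?thesis using sec(1,2)[OF f] mem by blast
  qed
  show "scl ?\<Omega> (ln.weight (dC a) * s cf) (basis_fun (\<phi> cf)) - scl ?\<Omega> (sc a * s (?T a cf)) (basis_fun (\<phi> (?T a cf))) : ?U"
   if a: "a : ?I" and cf: "cf : A" "Df cf = restrict degree_of C" for a cf
  proof -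
   have pc: "cf : pt_configs" using cf mem by simp
   \<comment> \<open>The transport acquires the constant \<open>a pt0\<close> on the left and the
     inverse of \<open>a\<close> on the right. By multiplicativity the right-hand part is absorbed
     by the scalars of the gauge \<open>a\<close> itself, and the constant leaves the factor
     \<chi>(h)^(2g), which matches conjugation of the label by h.\<close>
   let ?h = "a pt0" and ?b = "%c. a pt0 \<otimes> \<tau> cf c"
   have ac: "a c : carrier G" if "c : C" for c using a that by auto
   have h: "?h : carrier G" by (rule ac[OF pt_C])
   note tc = \<tau>c[OF pc]
   have bc: "?b c : carrier G" if "c : C" for c using h tc[OF that] by simp
   have ic: "inv a c : carrier G" if "c : C" for c using ac[OF that] by simp
   have T: "\<tau> (?T a cf) c = ?b c \<otimes> inv a c" if "c : C" for c using conjunct2[OF equi[OF pc a]] that by blast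
   have T': "sc (\<tau> (?T a cf)) = sc (%_. ?h) * sc (\<tau> cf) * inverse (sc a)"
    "wt (\<tau> (?T a cf)) = wt (%_. ?h) * wt (\<tau> cf) * inverse (wt a)"
    using sc_wt_cong[of "\<tau> (?T a cf)" "%c. ?b c \<otimes> inv a c", OF T]
     sc_wt_mult[of ?b "%c. inv a c", OF bc ic] sc_wt_mult[of "%_. ?h" "\<tau> cf", OF h tc]
     sc_wt_inv[of a, OF ac] by simp_all
   have nz: "sc a ~= 0" "wt a ~= 0" "wt (\<tau> cf) ~= 0" "wt (%_. ?h) ~= 0" "\<kappa> ?h ~= 0"
    using sc_wt_nonzero[of a, OF ac] sc_wt_nonzero[of "\<tau> cf", OF tc] sc_wt_nonzero[of "%_. ?h", OF h]
     charactersD(5)[OF \<chi> h] by auto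
   have "x * (k * w * y * inverse x / (w * t * inverse x')) = k * (x' * (y / t))"
    if "x ~= 0" "x' ~= 0" "t ~= 0" "w ~= 0" for x k w y t x' :: 'k
    using that by (simp add: field_simps)
   from this[OF nz(1-4)] have "sc a * s (?T a cf) = \<kappa> ?h ^ (2 * g) * (wt a * s cf)"
    unfolding s_def T' sc_const[OF h e] .
   moreover have "\<kappa> ?h ^ (2 * g) * \<eta> (bf ?h) = 1" using \<eta>[OF h] nz(5) by simp
   ultimately have "scl ?\<Omega> (ln.weight (dC a) * s cf) (basis_fun (\<phi> cf)) -
      scl ?\<Omega> (sc a * s (?T a cf)) (basis_fun (\<phi> (?T a cf))) =
     scl ?\<Omega> (- (\<kappa> ?h ^ (2 * g) * (wt a * s cf)))
      (basis_fun (hom_conj ?P G ?h (\<phi> cf)) - fscl (\<eta> (bf ?h)) (basis_fun (\<phi> cf)))"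
    unfolding wt[OF a] \<phi>T[OF pc a] by (simp add: fscl_def fun_eq_iff algebra_simps)
   moreover interpret module "scl ?\<Omega>"
    using vspaceD(14)[OF hs.vspace_\<Omega>] unfolding vector_space_def module_def .
   have "scl ?\<Omega> c (basis_fun (hom_conj ?P G ?h (\<phi> cf)) - fscl (\<eta> (bf ?h)) (basis_fun (\<phi> cf))) : ?U" for c
    unfolding U using h \<phi>[OF pc]
    by (intro span_scale span_base CollectI exI[of _ ?h] exI[of _ "\<phi> cf"] conjI HOL.refl)
   ultimately show ?thesis by simp
  qed
  show "\<exists>i\<in>?I. ?T i cf = sec (\<phi> cf) \<and> sc i = s cf * ln.weight (dC i) \<and> ln.weight (dC i) ~= 0"
   if cf: "cf : A" "Df cf = restrict degree_of C" for cf
  proof -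
   have pc: "cf : pt_configs" using cf mem by simp
   have i: "\<tau> cf : ?I" using \<tau>[OF pc] unfolding based_maps_def by blast
   note f = \<phi>[OF pc]
   have "?T (\<tau> cf) cf = sec (\<phi> cf)"
   proof (rule inj[OF Tpt[OF pc i] sec(1)[OF f]])
    show "\<phi> (?T (\<tau> cf) cf) = \<phi> (sec (\<phi> cf))"
     unfolding \<phi>T[OF pc i] sec(2)[OF f] \<tau>pt[OF pc]
     by (rule hs.hom_conj_one) (use f in \<open>simp add: hs.fiber_def\<close>)
    show "\<tau> (?T (\<tau> cf) cf) c = \<tau> (sec (\<phi> cf)) c" if "c : C" for c
     using conjunct2[OF equi[OF pc i]] that sec(3)[OF f that] \<tau>pt[OF pc] \<tau>c[OF pc that] by simp
   qed
   moreover have "wt (\<tau> cf) ~= 0" by (rule sc_wt_nonzero(2)[OF \<tau>c[OF pc]])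
   ultimately show ?thesis using wt[OF i] by (intro bexI[OF _ i]) (simp add: s_def)
  qed
 qed
 then show ?thesis
  unfolding protected_space_def twisted_coinvariants_def L \<eta>_def[symmetric] grouplikes_pow[OF p_carrier] z_def[symmetric] .
qed

end

theorem proposition11:
  fixes G :: "('g, 'b) monoid_scheme"
    and \<Gamma> :: "nat kitaev"
    and M :: "('k::field, 'g \<Rightarrow> 'k, 'm::ab_group_add) bimod"
  assumes "group G" and "finite (carrier G)" and "\<Gamma> \<in> RK"
  shows "(let H = (group_algebra G :: ('k, 'g \<Rightarrow> 'k) hopf);
              g = genus \<Gamma>;
              P = surface_ext g;
              x = surface_ext_central g;
              \<Omega> = omega P G;
              act = omega_act P G;
              \<delta> = omega_coact P G x
          in
          (left_yetter_drinfeld H \<Omega> act \<delta> \<and>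
           (\<forall>f\<in>Hom_grp P G.
              \<delta> (basis_fun f) = tens H \<Omega> (basis_fun (f x)) (basis_fun f) \<and>
              (\<forall>h\<in>carrier G. hom_conj P G h f \<in> Hom_grp P G \<and>
                 act (basis_fun h) (basis_fun f) = basis_fun (hom_conj P G h f)))) \<and>
          (\<forall>\<psi> p \<chi>.
             involutive_hopf_bimodule H M \<psi> \<and>
             pair_in_involution H p \<chi> \<and>
             rmc_isomorphic H (coinvariants H M) (line H p (inv\<^bsub>characters H\<^esub> \<chi>)) \<longrightarrow>
             lin_isomorphic
               (protected_space H M p \<chi> \<Gamma> (line H (hone H) (hcounit H)))
               (twisted_coinvariants H \<Omega> act \<delta>
                  (p [^]\<^bsub>grouplikes H\<^esub> (2 * g)) (\<chi> [^]\<^bsub>characters H\<^esub> (- (2 * int g))))))"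
proof -
  interpret finite_group G using assms(1,2) by (simp add: finite_group_def finite_group_axioms_def)
  let ?g = "genus \<Gamma>"
  interpret hs: hom_space G "surface_ext ?g" "surface_ext_central ?g"
    by (rule hom_space_surface_ext) unfold_locales
  show ?thesis
    unfolding Let_def
  proof (intro conjI allI impI ballI)
    show "left_yetter_drinfeld (kG :: ('k, 'g \<Rightarrow> 'k) hopf) (omega (surface_ext ?g) G)
        (omega_act (surface_ext ?g) G) (omega_coact (surface_ext ?g) G (surface_ext_central ?g))"
      by (rule hs.left_yetter_drinfeld_\<Omega>)
    fix f assume f: "f \<in> Hom_grp (surface_ext ?g) G"
    show "omega_coact (surface_ext ?g) G (surface_ext_central ?g) (basis_fun f) =
        tens (kG :: ('k, 'g \<Rightarrow> 'k) hopf) (omega (surface_ext ?g) G) (basis_fun (f (surface_ext_central ?g))) (basis_fun f)"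
      by (rule hs.omega_coact_basis[OF f])
    fix h assume h: "h \<in> carrier G"
    show "hom_conj (surface_ext ?g) G h f \<in> Hom_grp (surface_ext ?g) G" by (rule hs.hom_conj_Hom[OF h f])
    show "omega_act (surface_ext ?g) G (basis_fun h) (basis_fun f) =
        (basis_fun (hom_conj (surface_ext ?g) G h f) :: _ \<Rightarrow> 'k)"
      by (rule hs.omega_act_basis[OF h f])
  next
    fix \<psi> p \<chi>
    assume "involutive_hopf_bimodule (kG :: ('k, 'g \<Rightarrow> 'k) hopf) M \<psi> \<and>
      pair_in_involution (kG :: ('k, 'g \<Rightarrow> 'k) hopf) p \<chi> \<and>
      rmc_isomorphic kG (coinvariants kG M) (line kG p (inv\<^bsub>characters (kG :: ('k, 'g \<Rightarrow> 'k) hopf)\<^esub> \<chi>))"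
    then have M: "hopf_bimodule kG M" and inv: "pair_in_involution (kG :: ('k, 'g \<Rightarrow> 'k) hopf) p \<chi>"
      and iso: "rmc_isomorphic kG (coinvariants kG M) (line kG p (inv\<^bsub>characters (kG :: ('k, 'g \<Rightarrow> 'k) hopf)\<^esub> \<chi>))"
      unfolding involutive_hopf_bimodule_def by blast+
    \<comment> \<open>For a group algebra a pair in involution amounts to a central group element
      and a character; the group element \<open>q\<close> is the degree shift used from here
      on.\<close>
    obtain q where q: "p = basis_fun q" "central G q" using pair_in_involutionD(1)[OF inv] by blast
    interpret hl: hopf_line G M q \<chi>
      by unfold_locales (use M q iso pair_in_involutionD(2)[OF inv] in simp_all)
    obtain e coM where e: "has_basis M (carrier G) e coM" "\<forall>x\<in>carrier G.
        lcoact M (e x) = tens kG M (basis_fun x) (e x) \<and>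
        rcoact M (e x) = tens M kG (e x) (basis_fun (x \<otimes>\<^bsub>G\<^esub> q)) \<and>
        (\<forall>h\<in>carrier G. lact M (basis_fun h) (e x) = e (h \<otimes>\<^bsub>G\<^esub> x) \<and>
          ract M (e x) (basis_fun h) = scl M (inverse (\<chi> (basis_fun h))) (e (x \<otimes>\<^bsub>G\<^esub> h)))"
      using hl.basis_of_bimodule by blast
    interpret kc: kitaev_config G M q \<chi> e coM \<Gamma>
      by unfold_locales (use q pair_in_involutionD(2)[OF inv] hl.lact(1) hl.ract(1) hl.lin_lcoact hl.lin_rcoact
        e assms(3) in \<open>simp_all add: RK_def\<close>)
    show "lin_isomorphic (protected_space kG M p \<chi> \<Gamma> (line kG (hone kG) (hcounit kG)))
      (twisted_coinvariants kG (omega (surface_ext ?g) G) (omega_act (surface_ext ?g) G)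
        (omega_coact (surface_ext ?g) G (surface_ext_central ?g))
        (p [^]\<^bsub>grouplikes kG\<^esub> (2 * ?g)) (\<chi> [^]\<^bsub>characters kG\<^esub> (- (2 * int ?g))))"
      unfolding q(1) by (rule kc.protected_space_isomorphic)
  qed
qed

end
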